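(* Let $\psi\in C^2_x(\bar Q_T)$ and let $\xi\in L_{m+1}(\mathbb T^d)$ satisfy $\xi\ge\psi(0,\cdot)$. Then the entropy solution $(u,\nu)$ to the obstacle problem $$\partial_tu=\Delta(|u|^{m-1}u)+\nu,\qquad u\ge\psi,\qquad u(0,\cdot)=\xi,$$ satisfies the variational inequality $$\langle\!\langle\partial_tu,(|v|^{m-1}v-|u|^{m-1}u)\tilde\phi\rangle\!\rangle+\int_{Q_T}\nabla\big(|u|^{m-1}u\big)\cdot\nabla\big[(|v|^{m-1}v-|u|^{m-1}u)\tilde\phi\big]\,dxdt\ge0$$ for all $v\in K'_\psi$ and all $\tilde\phi\in H^1_\infty([0,T];\mathbb R_+)$ with $\tilde\phi(T)=0$, where $$\begin{aligned}\langle\!\langle\partial_tu,(|v|^{m-1}v-|u|^{m-1}u)\tilde\phi\rangle\!\rangle:=&\int_{Q_T}\Big\{\partial_t\tilde\phi\Big[\tfrac1{m+1}|u|^{m+1}-u|v|^{m-1}v\Big]-\tilde\phi\,u\,\partial_t(|v|^{m-1}v)\Big\}dxdt\\&+\int_{\mathbb T^d}\tilde\phi(0)\Big[\tfrac1{m+1}|\xi|^{m+1}-\xi|v(0)|^{m-1}v(0)\Big]dx.\end{aligned}$$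
   Context: Fix $T>0$, $d\ge1$, $m>1$. $\mathbb T^d$ is the $d$-dimensional torus, $Q_T=[0,T)\times\mathbb T^d$, $\bar Q_T=[0,T]\times\mathbb T^d$. $C^2_x(\bar Q_T)$ is the space of continuous functions $g$ on $\bar Q_T$ such that $g(t,\cdot)\in C^2(\mathbb T^d)$ with $C^2$-norm bounded uniformly in $t\in[0,T]$. $H^1_\infty([0,T];\mathbb R_+)$ is the set of nonnegative functions in the Sobolev space $W^{1,\infty}(0,T)$. $\mathcal E=\{\eta\in C^2(\mathbb R):\eta\text{ convex},\ \eta''\text{ compactly supported}\}$. Everything here is deterministic. $$K'_\psi:=\big\{v\in C([0,T];L_{m+1}(\mathbb T^d)):\ |v|^{m-1}v\in L_2(0,T;H^1(\mathbb T^d)),\ \partial_t(|v|^{m-1}v)\in L_{\frac{m+1}m}(Q_T),\ v\ge\psi\text{ a.e. on }Q_T\big\}.$$ An entropy solution to the obstacle problem $\partial_tu=\Delta(|u|^{m-1}u)+\nu$, $u\ge\psi$, $u(0,\cdot)=\xi$ is a pair $(u,\nu)$ such that: (i) $u\ge\psi$ for almost all $(t,x)\in Q_T$, $u\in L_{m+1}(Q_T)$ and $|u|^{\frac{m-1}2}u\in L_2(0,T;H^1(\mathbb T^d))$; (ii) $\nu$ is a finite (nonnegative) Radon measure on $Q_T$; (iii) for all $(\eta,\varphi,\varrho)\in\mathcal E\times C_c^\infty([0,T))\times C^\infty(\mathbb T^d)$ with $\phi:=\varphi\varrho\ge0$, $$\begin{aligned}&-\int_{Q_T}\eta(u)\partial_t\phi\,dxdt-\int_{Q_T}\eta'(\psi)\phi\,\nu(dxdt)\\&\le\int_{\mathbb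 T^d}\eta(\xi)\phi(0)\,dx+m\int_{Q_T}\Big(\int_0^{u(t,x)}|r|^{m-1}\eta'(r)\,dr\Big)\Delta\phi\,dxdt-\frac{4m}{(m+1)^2}\int_{Q_T}\eta''(u)\big|\nabla(|u|^{\frac{m-1}2}u)\big|^2\phi\,dxdt.\end{aligned}$$ *)

theory Defs
  imports "HOL-Analysis.Analysis"
begin

text \<open>
  The torus \<open>\<T>\<^sup>d\<close> is \<open>\<real>\<^sup>d\<close> modulo \<open>\<int>\<^sup>d\<close>, with \<open>d = CARD('d)\<close>. The half-open unit cell contains exactly
  one point of every class, so integrals over the torus are integrals over the cell, and an
  \<open>L\<^sub>p\<close> class on the torus is represented by a function on \<open>\<real>\<^sup>d\<close> of which only the values on
  the cell matter. Functions with classical regularity on the torus are represented by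
  periodic functions on \<open>\<real>\<^sup>d\<close>. Every Lebesgue class has a Borel representative, so Borel
  measurability is used throughout. Space-time functions are uncurried, with points \<open>(t, x)\<close>.
\<close>

definition cell :: "(real ^ 'd) set" where
  "cell = {x. \<forall>i. 0 \<le> x $ i \<and> x $ i < 1}"

definition QT :: "real \<Rightarrow> (real \<times> (real ^ 'd)) set" where
  "QT T = {0..<T} \<times> cell"

definition torus_measure :: "(real ^ 'd) measure" where
  "torus_measure = restrict_space lborel cell"

definition QT_measure :: "real \<Rightarrow> (real \<times> (real ^ 'd)) measure" where
  "QT_measure T = restrict_space lborel (QT T)"

definition time_measure :: "real \<Rightarrow> real measure" where
  "time_measure T = restrict_space lborel {0<..<T}"

definition periodic :: "(real ^ 'd \<Rightarrow> 'b) \<Rightarrow> bool" where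
  "periodic f \<longleftrightarrow> (\<forall>x i. f (x + axis i 1) = f x)"


subsection \<open>Classical derivatives\<close>

definition dderiv :: "'a::euclidean_space \<Rightarrow> ('a \<Rightarrow> real) \<Rightarrow> 'a \<Rightarrow> real" where
  "dderiv e f x = frechet_derivative f (at x) e"

primrec Ck :: "nat \<Rightarrow> ('a::euclidean_space \<Rightarrow> real) \<Rightarrow> bool" where
  "Ck 0 f \<longleftrightarrow> continuous_on UNIV f"
| "Ck (Suc k) f \<longleftrightarrow> f differentiable_on UNIV \<and> (\<forall>e\<in>Basis. Ck k (dderiv e f))"

definition smooth :: "('a::euclidean_space \<Rightarrow> real) \<Rightarrow> bool" where
  "smooth f \<longleftrightarrow> (\<forall>k. Ck k f)"

definition laplacian :: "(real ^ 'd \<Rightarrow> real) \<Rightarrow> real ^ 'd \<Rightarrow> real" where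
  "laplacian f x = (\<Sum>e\<in>Basis. dderiv e (dderiv e f) x)"

definition C2x :: "real \<Rightarrow> (real \<times> (real ^ 'd) \<Rightarrow> real) set" where
  "C2x T = {g. continuous_on ({0..T} \<times> UNIV) g \<and>
     (\<forall>t\<in>{0..T}. periodic (\<lambda>x. g (t, x)) \<and> Ck 2 (\<lambda>x. g (t, x))) \<and>
     (\<exists>C. \<forall>t\<in>{0..T}. \<forall>x. \<bar>g (t, x)\<bar> \<le> C \<and>
        (\<forall>e\<in>Basis. \<bar>dderiv e (\<lambda>x. g (t, x)) x\<bar> \<le> C \<and>
          (\<forall>e'\<in>Basis. \<bar>dderiv e' (dderiv e (\<lambda>x. g (t, x))) x\<bar> \<le> C)))}"


subsection \<open>Lebesgue and Sobolev spaces\<close>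

definition Lp :: "real \<Rightarrow> 'a measure \<Rightarrow> ('a \<Rightarrow> 'b::real_normed_vector) set" where
  "Lp p M = {f. f \<in> borel_measurable M \<and> integrable M (\<lambda>x. norm (f x) powr p)}"

definition Lp_norm :: "real \<Rightarrow> 'a measure \<Rightarrow> ('a \<Rightarrow> 'b::real_normed_vector) \<Rightarrow> real" where
  "Lp_norm p M f = (\<integral>x. norm (f x) powr p \<partial>M) powr (1 / p)"

text \<open>An element of \<open>C([0,T]; L\<^sub>p(\<T>\<^sup>d))\<close> always has a jointly measurable representative
  that is a representative of the value at \<open>t\<close> for every \<open>t \<in> [0,T]\<close>.\<close>

definition C_Lp :: "real \<Rightarrow> real \<Rightarrow> (real \<times> (real ^ 'd) \<Rightarrow> real) set" where
  "C_Lp T p = {v. v \<in> borel_measurable (QT_measure T) \<and>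
     (\<forall>t\<in>{0..T}. (\<lambda>x. v (t, x)) \<in> Lp p torus_measure) \<and>
     (\<forall>t\<in>{0..T}. ((\<lambda>s. Lp_norm p torus_measure (\<lambda>x. v (s, x) - v (t, x))) \<longlongrightarrow> 0)
        (at t within {0..T}))}"

definition has_torus_wgrad :: "(real ^ 'd \<Rightarrow> real) \<Rightarrow> (real ^ 'd \<Rightarrow> real ^ 'd) \<Rightarrow> bool" where
  "has_torus_wgrad f G \<longleftrightarrow> integrable torus_measure f \<and> integrable torus_measure G \<and>
     (\<forall>\<rho> i. smooth \<rho> \<and> periodic \<rho> \<longrightarrow>
        (\<integral>x. f x * dderiv (axis i 1) \<rho> x \<partial>torus_measure)
          = - (\<integral>x. G x $ i * \<rho> x \<partial>torus_measure))"

definition has_wgrad ::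
    "real \<Rightarrow> (real \<times> (real ^ 'd) \<Rightarrow> real) \<Rightarrow> (real \<times> (real ^ 'd) \<Rightarrow> real ^ 'd) \<Rightarrow> bool" where
  "has_wgrad T f G \<longleftrightarrow> G \<in> borel_measurable (QT_measure T) \<and>
     (AE t in time_measure T. has_torus_wgrad (\<lambda>x. f (t, x)) (\<lambda>x. G (t, x)))"

text \<open>The weak spatial gradient is unique up to null sets of \<open>Q\<^sub>T\<close>; the choice picks a representative.\<close>

definition wgrad :: "real \<Rightarrow> (real \<times> (real ^ 'd) \<Rightarrow> real) \<Rightarrow> real \<times> (real ^ 'd) \<Rightarrow> real ^ 'd" where
  "wgrad T f = (SOME G. has_wgrad T f G)"

text \<open>\<open>L\<^sub>2(0,T; H\<^sup>1(\<T>\<^sup>d))\<close>\<close>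

definition L2H1 :: "real \<Rightarrow> (real \<times> (real ^ 'd) \<Rightarrow> real) set" where
  "L2H1 T = {f. f \<in> Lp 2 (QT_measure T) \<and>
     (\<exists>G. has_wgrad T f G \<and> G \<in> Lp 2 (QT_measure T))}"

text \<open>Weak time derivative of a function on \<open>Q\<^sub>T\<close>, tested against \<open>C\<^sub>c\<^sup>\<infinity>((0,T) \<times> \<T>\<^sup>d)\<close>.\<close>

definition has_wdt ::
    "real \<Rightarrow> (real \<times> (real ^ 'd) \<Rightarrow> real) \<Rightarrow> (real \<times> (real ^ 'd) \<Rightarrow> real) \<Rightarrow> bool" where
  "has_wdt T f g \<longleftrightarrow> integrable (QT_measure T) f \<and> integrable (QT_measure T) g \<and>
     (\<forall>\<phi>. smooth \<phi> \<and> (\<forall>t. periodic (\<lambda>x. \<phi> (t, x))) \<and>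
         (\<exists>a b. 0 < a \<and> b < T \<and> (\<forall>t x. t \<notin> {a..b} \<longrightarrow> \<phi> (t, x) = 0)) \<longrightarrow>
        (\<integral>z. f z * dderiv (1, 0) \<phi> z \<partial>QT_measure T) = - (\<integral>z. g z * \<phi> z \<partial>QT_measure T))"

definition wdt :: "real \<Rightarrow> (real \<times> (real ^ 'd) \<Rightarrow> real) \<Rightarrow> real \<times> (real ^ 'd) \<Rightarrow> real" where
  "wdt T f = (SOME g. has_wdt T f g)"

definition has_wderiv :: "real \<Rightarrow> (real \<Rightarrow> real) \<Rightarrow> (real \<Rightarrow> real) \<Rightarrow> bool" where
  "has_wderiv T f g \<longleftrightarrow> integrable (time_measure T) f \<and> integrable (time_measure T) g \<and>
     (\<forall>\<phi>. smooth \<phi> \<and> (\<exists>a b. 0 < a \<and> b < T \<and> (\<forall>t. t \<notin> {a..b} \<longrightarrow> \<phi> t = 0)) \<longrightarrow>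
        (\<integral>t. f t * deriv \<phi> t \<partial>time_measure T) = - (\<integral>t. g t * \<phi> t \<partial>time_measure T))"

definition wderiv :: "real \<Rightarrow> (real \<Rightarrow> real) \<Rightarrow> real \<Rightarrow> real" where
  "wderiv T f = (SOME g. has_wderiv T f g)"

text \<open>\<open>H\<^sup>1\<^sub>\<infinity>([0,T]; \<real>\<^sub>+)\<close>: elements of \<open>W\<^sup>1\<^sup>,\<^sup>\<infinity>(0,T)\<close> are identified with their continuous
  representative on \<open>[0,T]\<close>, which gives meaning to the values at \<open>0\<close> and \<open>T\<close>.\<close>

definition H1inf_nonneg :: "real \<Rightarrow> (real \<Rightarrow> real) set" where
  "H1inf_nonneg T = {f. continuous_on {0..T} f \<and> (\<forall>t\<in>{0..T}. 0 \<le> f t) \<and>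
     (\<exists>g C. has_wderiv T f g \<and> (AE t in time_measure T. \<bar>g t\<bar> \<le> C))}"


subsection \<open>The obstacle problem\<close>

text \<open>\<open>pw a r\<close> is the signed power \<open>|r|\<^sup>a r\<close>.\<close>

definition pw :: "real \<Rightarrow> real \<Rightarrow> real" where
  "pw a r = \<bar>r\<bar> powr a * r"

definition entropies :: "(real \<Rightarrow> real) set" where
  "entropies = {\<eta>. Ck 2 \<eta> \<and> convex_on UNIV \<eta> \<and> compact (closure {r. deriv (deriv \<eta>) r \<noteq> 0})}"

text \<open>\<open>C\<^sub>c\<^sup>\<infinity>([0,T))\<close>: functions smooth up to the boundary point \<open>0\<close>, represented by a smooth
  extension to the real line; they need not vanish at \<open>0\<close>.\<close>

definition time_tests :: "real \<Rightarrow> (real \<Rightarrow> real) set" where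
  "time_tests T = {\<phi>. smooth \<phi> \<and> (\<exists>s<T. \<forall>t\<ge>s. \<phi> t = 0)}"

text \<open>The measure \<open>\<nu>\<close> lives on the Borel sets of \<open>[0,T) \<times> cell\<close>, which are those of \<open>Q\<^sub>T\<close>.
  A finite Borel measure on this space is automatically Radon.\<close>

definition entropy_solution :: "real \<Rightarrow> real \<Rightarrow> (real \<times> (real ^ 'd) \<Rightarrow> real) \<Rightarrow> (real ^ 'd \<Rightarrow> real) \<Rightarrow>
    (real \<times> (real ^ 'd) \<Rightarrow> real) \<Rightarrow> (real \<times> (real ^ 'd)) measure \<Rightarrow> bool" where
  "entropy_solution T m \<psi> \<xi> u \<nu> \<longleftrightarrow>
     (AE z in QT_measure T. \<psi> z \<le> u z) \<and>
     u \<in> Lp (m + 1) (QT_measure T) \<and>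
     (\<lambda>z. pw ((m - 1) / 2) (u z)) \<in> L2H1 T \<and>
     finite_measure \<nu> \<and> sets \<nu> = sets (restrict_space borel (QT T)) \<and>
     (\<forall>\<eta> \<phi> \<rho>. \<eta> \<in> entropies \<and> \<phi> \<in> time_tests T \<and> smooth \<rho> \<and> periodic \<rho> \<and>
         (\<forall>t\<in>{0..<T}. \<forall>x. 0 \<le> \<phi> t * \<rho> x) \<longrightarrow>
       - (\<integral>(t, x). \<eta> (u (t, x)) * (deriv \<phi> t * \<rho> x) \<partial>QT_measure T)
       - (\<integral>(t, x). deriv \<eta> (\<psi> (t, x)) * (\<phi> t * \<rho> x) \<partial>\<nu>)
       \<le> (\<integral>x. \<eta> (\<xi> x) * (\<phi> 0 * \<rho> x) \<partial>torus_measure)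
         + m * (\<integral>(t, x). (LBINT r=0..u (t, x). \<bar>r\<bar> powr (m - 1) * deriv \<eta> r)
                  * (\<phi> t * laplacian \<rho> x) \<partial>QT_measure T)
         - 4 * m / (m + 1)\<^sup>2 *
             (\<integral>(t, x). deriv (deriv \<eta>) (u (t, x))
                  * (norm (wgrad T (\<lambda>z. pw ((m - 1) / 2) (u z)) (t, x)))\<^sup>2
                  * (\<phi> t * \<rho> x) \<partial>QT_measure T))"

definition K' :: "real \<Rightarrow> real \<Rightarrow> (real \<times> (real ^ 'd) \<Rightarrow> real) \<Rightarrow> (real \<times> (real ^ 'd) \<Rightarrow> real) set" where
  "K' T m \<psi> = {v. v \<in> C_Lp T (m + 1) \<and>
     (\<lambda>z. pw (m - 1) (v z)) \<in> L2H1 T \<and>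
     (\<exists>g. has_wdt T (\<lambda>z. pw (m - 1) (v z)) g \<and> g \<in> Lp ((m + 1) / m) (QT_measure T)) \<and>
     (AE z in QT_measure T. \<psi> z \<le> v z)}"

text \<open>The pairing of \<open>\<partial>\<^sub>t u\<close> with \<open>(|v|\<^sup>m\<^sup>-\<^sup>1 v - |u|\<^sup>m\<^sup>-\<^sup>1 u) \<phi>\<close>.\<close>

definition dt_pairing :: "real \<Rightarrow> real \<Rightarrow> (real ^ 'd \<Rightarrow> real) \<Rightarrow> (real \<times> (real ^ 'd) \<Rightarrow> real) \<Rightarrow>
    (real \<times> (real ^ 'd) \<Rightarrow> real) \<Rightarrow> (real \<Rightarrow> real) \<Rightarrow> real" where
  "dt_pairing T m \<xi> u v \<phi> =
     (\<integral>(t, x). wderiv T \<phi> t * (1 / (m + 1) * \<bar>u (t, x)\<bar> powr (m + 1) - u (t, x) * pw (m - 1) (v (t, x)))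
          - \<phi> t * u (t, x) * wdt T (\<lambda>z. pw (m - 1) (v z)) (t, x) \<partial>QT_measure T)
     + (\<integral>x. \<phi> 0 * (1 / (m + 1) * \<bar>\<xi> x\<bar> powr (m + 1) - \<xi> x * pw (m - 1) (v (0, x))) \<partial>torus_measure)"

end

theory Submission imports Defs begin

text \<open>
  Write \<open>U = |u|\<^sup>m\<^sup>-\<^sup>1 u\<close>, \<open>w = |v|\<^sup>m\<^sup>-\<^sup>1 v\<close>, \<open>\<Psi> = |\<psi>|\<^sup>m\<^sup>-\<^sup>1 \<psi>\<close> and \<open>\<Phi>(r) = |r|\<^sup>m\<^sup>+\<^sup>1 / (m + 1)\<close>.
  Formally the inequality is the equation \<open>\<partial>\<^sub>t u = \<Delta>U + \<nu>\<close> tested with \<open>(w - U) \<phi>\<close>: the obstacle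
  contributes \<open>\<integral> (w - U) \<phi> d\<nu>\<close>, which is nonnegative because \<open>w \<ge> \<Psi>\<close>, with \<open>U = \<Psi>\<close> where \<open>\<nu>\<close> lives.
  Neither \<open>U\<close> nor \<open>w\<close> is an admissible test function, and their values \<open>\<nu>\<close>-almost everywhere have
  no meaning, so the two parts are obtained differently, for smooth \<open>\<phi>(t)\<close> first.

  The part with \<open>U\<close> is nonlinear and comes from the entropy inequality with \<open>\<eta> = \<Phi>\<close>. As \<open>\<Phi>\<close> is not
  an entropy, it is approached by entropies that agree with it on \<open>[-N, N]\<close>. The limit is the energy
  inequality \<open>energy_ineq\<close>; here the obstacle term is \<open>\<integral> \<Psi> \<phi> d\<nu>\<close>, since the entropy formulation
  evaluates \<open>\<eta>'\<close> at \<open>\<psi>\<close>. The same entropies bound the energy \<open>\<integral> \<Phi>(u(t)) dx\<close> and show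
  \<open>H = \<nabla>U \<in> L\<^sub>2\<close>. A Poincare inequality with the \<open>L\<^sub>1\<close> norm on the right then gives \<open>U \<in> L\<^sub>2(0,T; H\<^sup>1)\<close>.

  The part with \<open>w\<close> is linear: the entropies \<open>\<eta>(r) = r\<close> and \<open>\<eta>(r) = -r\<close> turn the inequality into an
  equation, which is tested with \<open>\<phi>\<close> times the mollification of \<open>w\<close> by a nonnegative kernel
  \<open>\<theta>(t - s) \<kappa>(x - y)\<close> (\<open>moll_equation\<close>). The time kernel \<open>\<theta>\<close> looks only forward, so \<open>w\<close> is never
  needed before time zero. Since \<open>w \<ge> \<Psi>\<close> almost everywhere, the mollification of \<open>w\<close> is everywhere at least
  that of \<open>\<Psi>\<close>, which converges pointwise to the continuous function \<open>\<Psi>\<close>; dominated convergence under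
  \<open>\<nu>\<close> then yields \<open>obstacle_inequality\<close>. The initial term converges because \<open>v\<close> is continuous in
  time with values in \<open>L\<^sub>m\<^sub>+\<^sub>1\<close>; the other terms converge by the duality of \<open>L\<^sub>m\<^sub>+\<^sub>1\<close> and \<open>L\<^sub>p\<close>, \<open>p = (m+1)/m\<close>.

  The sum of the two parts is \<open>smooth_inequality\<close>, an inequality between integrals over time. A Lipschitz
  weight is reached by inserting \<open>\<phi> = \<theta>(\<cdot> - s)\<close> and averaging over \<open>s\<close> with that weight
  (\<open>time_extension\<close>). Finally weak derivatives are unique, so the chosen representatives of the
  derivatives in the statement may be replaced by the ones used in the proof.
\<close>

abbreviation (input) TX :: "(real ^ 'd) measure" where "TX \<equiv> torus_measure"

text \<open>Short names for facts on the Bochner integral whose unqualified names denote facts on the gauge integral.\<close>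

lemmas B_integrable_add = Bochner_Integration.integrable_add
lemmas B_integrable_bound = Bochner_Integration.integrable_bound
lemmas B_integrable_cong = Bochner_Integration.integrable_cong
lemmas B_integrable_diff = Bochner_Integration.integrable_diff
lemmas B_integral_add = Bochner_Integration.integral_add
lemmas B_integral_cong = Bochner_Integration.integral_cong
lemmas B_integral_diff = Bochner_Integration.integral_diff
lemmas B_integral_minus = Bochner_Integration.integral_minus
lemmas B_integral_nonneg = Bochner_Integration.integral_nonneg
lemmas B_integral_sum = Bochner_Integration.integral_sum

section \<open>Approximate identities\<close>

text \<open>Integrable functions on a set of finite measure are \<open>L\<^sub>1\<close> limits of bounded continuous functions:
 a clipped function is an almost everywhere limit of continuous functions, which may be clipped at the same level.\<close>

lemma continuous_approx_L1:
 fixes f :: "'a::euclidean_space \<Rightarrow> real"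
 assumes S: "S \<in> sets borel" "emeasure lborel S < \<infinity>"
  and f: "integrable (restrict_space lborel S) f" and e: "e > 0"
 obtains g C where "continuous_on UNIV g" "\<And>x. abs (g x) \<le> C"
  "(LINT x|restrict_space lborel S. \<bar>f x - g x\<bar>) < e"
proof -
 let ?M = "restrict_space lborel S"
 interpret M: finite_measure ?M using S by (intro finite_measureI) (auto simp: emeasure_restrict_space space_restrict_space)
 define clip where "clip N x = max (-N) (min N x)" for N x :: real
 have clip_abs: "abs (clip N x) \<le> N" if "N \<ge> 0" for N x using that by (auto simp: clip_def)
 have [measurable]: "f \<in> borel_measurable ?M" using f by simp
 have "(\<lambda>n. (LINT x|?M. \<bar>f x - clip (real n) (f x)\<bar>)) \<longlonglongrightarrow> (LINT x|?M. 0)"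
 proof (rule integral_dominated_convergence[where w="\<lambda>x. abs (f x)"])
  show "AE x in ?M. (\<lambda>n. \<bar>f x - clip (real n) (f x)\<bar>) \<longlonglongrightarrow> 0"
  proof (intro AE_I2)
   fix x
   obtain N :: nat where N: "abs (f x) \<le> real N" using real_arch_simple by blast
   have "eventually (\<lambda>n. \<bar>f x - clip (real n) (f x)\<bar> = 0) sequentially" using eventually_ge_at_top[of N]
    by eventually_elim (use N in \<open>auto simp: clip_def max_def min_def\<close>)
   then show "(\<lambda>n. \<bar>f x - clip (real n) (f x)\<bar>) \<longlonglongrightarrow> 0" by (rule tendsto_eventually)
  qed
 qed (use f in \<open>auto simp: clip_def max_def min_def\<close>)
 then have "eventually (\<lambda>n. (LINT x|?M. \<bar>f x - clip (real n) (f x)\<bar>) < e/2) sequentially" using e by (intro order_tendstoD) auto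
 then obtain N :: nat where N: "(LINT x|?M. \<bar>f x - clip (real N) (f x)\<bar>) < e/2" by (auto simp: eventually_sequentially)
 define h where "h = (\<lambda>x. indicator S x * clip (real N) (f x))"
 have "(\<lambda>x. clip (real N) (f x)) \<in> borel_measurable ?M" by (auto simp: clip_def)
 then have "h \<in> borel_measurable lborel" unfolding h_def using S by (subst (asm) borel_measurable_restrict_space_iff) auto
 then have "h \<in> borel_measurable lebesgue" by (simp add: measurable_completion)
 then have "h measurable_on UNIV" by (simp add: measurable_on_iff_borel_measurable lebesgue_on_UNIV_eq)
 then obtain Z g where Z: "negligible Z" and g: "\<And>n. continuous_on UNIV (g n)"
  and lim: "\<And>x. x \<notin> Z \<Longrightarrow> (\<lambda>n. g n x) \<longlonglongrightarrow> h x" by (auto simp: measurable_on_def)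
 have gm [measurable]: "g n \<in> borel_measurable borel" for n using g by (simp add: borel_measurable_continuous_onI)
 have [measurable]: "g n \<in> borel_measurable ?M" for n by (rule measurable_restrict_space1) simp
 have AEZ: "AE x in ?M. x \<notin> Z"
 proof -
  have "AE x in lebesgue. x \<notin> Z" using Z by (simp add: negligible_iff_null_sets AE_not_in)
  then have "AE x in lborel. x \<notin> Z" by (simp add: AE_completion_iff)
  then show ?thesis using S by (subst AE_restrict_space_iff) auto
 qed
 have "(\<lambda>n. (LINT x|?M. \<bar>clip (real N) (f x) - clip (real N) (g n x)\<bar>)) \<longlonglongrightarrow> (LINT x|?M. 0)"
 proof (rule integral_dominated_convergence[where w="\<lambda>x. 2 * real N"])
  show "AE x in ?M. (\<lambda>n. \<bar>clip (real N) (f x) - clip (real N) (g n x)\<bar>) \<longlonglongrightarrow> 0" using AEZ AE_space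
  proof eventually_elim
   case (elim x)
   then have "h x = clip (real N) (f x)" by (auto simp: h_def space_restrict_space)
   moreover have "clip (real N) (h x) = h x" by (auto simp: h_def clip_def indicator_def)
   moreover have "(\<lambda>n. clip (real N) (g n x)) \<longlonglongrightarrow> clip (real N) (h x)"
    unfolding clip_def using lim[of x] elim by (intro tendsto_intros) auto
   ultimately have "(\<lambda>n. clip (real N) (f x) - clip (real N) (g n x)) \<longlonglongrightarrow> 0" by (intro tendsto_eq_intros) auto
   then show ?case by (rule tendsto_rabs_zero)
  qed
  show "AE x in ?M. norm \<bar>clip (real N) (f x) - clip (real N) (g n x)\<bar> \<le> 2 * real N" for n
  proof (intro AE_I2)
   fix x show "norm \<bar>clip (real N) (f x) - clip (real N) (g n x)\<bar> \<le> 2 * real N"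
    using clip_abs[of "real N" "f x"] clip_abs[of "real N" "g n x"] by simp
  qed
  show "integrable ?M (\<lambda>x. 2 * real N)" by simp
 qed (auto simp: clip_def)
 then have "eventually (\<lambda>n. (LINT x|?M. \<bar>clip (real N) (f x) - clip (real N) (g n x)\<bar>) < e/2) sequentially"
  using e by (intro order_tendstoD) auto
 then obtain n where n: "(LINT x|?M. \<bar>clip (real N) (f x) - clip (real N) (g n x)\<bar>) < e/2" by (auto simp: eventually_sequentially)
 have clip_int: "integrable ?M (\<lambda>x. clip (real N) (q x))" if [measurable]: "q \<in> borel_measurable ?M" for q
  by (rule M.integrable_const_bound[where B="real N"]) (auto simp: clip_abs, simp add: clip_def)
 have gi: "integrable ?M (\<lambda>x. clip (real N) (g n x))"  by (rule clip_int) simp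
 have fi: "integrable ?M (\<lambda>x. clip (real N) (f x))" by (rule clip_int) simp
 show thesis
 proof
  show "continuous_on UNIV (\<lambda>x. clip (real N) (g n x))" unfolding clip_def using g by (intro continuous_intros)
  show "\<bar>clip (real N) (g n x)\<bar> \<le> real N" for x by (rule clip_abs) simp
  have "(LINT x|?M. \<bar>f x - clip (real N) (g n x)\<bar>) \<le>
   (LINT x|?M. \<bar>f x - clip (real N) (f x)\<bar> + \<bar>clip (real N) (f x) - clip (real N) (g n x)\<bar>)"
   using f fi gi by (intro integral_mono) auto
  also have "\<dots> = (LINT x|?M. \<bar>f x - clip (real N) (f x)\<bar>) + (LINT x|?M. \<bar>clip (real N) (f x) - clip (real N) (g n x)\<bar>)"
   using f fi gi by (intro B_integral_add) auto
  finally show "(LINT x|?M. \<bar>f x - clip (real N) (g n x)\<bar>) < e" using N n by simp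
 qed
qed

lemma integrable_kernel:
 fixes f :: "'a \<Rightarrow> real" and g :: "'b \<Rightarrow> real" and K :: "'a \<Rightarrow> 'b \<Rightarrow> real"
 assumes "sigma_finite_measure A" "sigma_finite_measure B"
  and f: "integrable A f" and g: "integrable B g"
  and K: "(\<lambda>p. K (fst p) (snd p)) \<in> borel_measurable (A \<Otimes>\<^sub>M B)"
  and b: "\<And>a b. \<lbrakk>a \<in> space A; b \<in> space B\<rbrakk> \<Longrightarrow> abs (K a b) \<le> C"
 shows "integrable (A \<Otimes>\<^sub>M B) (\<lambda>(a, b). f a * g b * K a b)"
proof -
 interpret B: sigma_finite_measure B by fact
 interpret A: sigma_finite_measure A by fact
 interpret P: pair_sigma_finite A B ..
 have [measurable]: "f \<in> borel_measurable A" "g \<in> borel_measurable B" using f g by auto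
 note K[measurable]
 have 1: "integrable (A \<Otimes>\<^sub>M B) (\<lambda>p. f (fst p) * g (snd p))"
 proof (rule P.Fubini_integrable)
  show "(\<lambda>p. f (fst p) * g (snd p)) \<in> borel_measurable (A \<Otimes>\<^sub>M B)" by measurable
  show "integrable A (\<lambda>x. (LINT y|B. norm (f (fst (x, y)) * g (snd (x, y)))))" using f g by (simp add: abs_mult)
  show "AE x in A. integrable B (\<lambda>y. f (fst (x, y)) * g (snd (x, y)))" using f g by simp
 qed
 have "integrable (A \<Otimes>\<^sub>M B) (\<lambda>p. C * (f (fst p) * g (snd p)))" using 1 by simp
 then show ?thesis
 proof (rule B_integrable_bound)
  show "(\<lambda>(a, b). f a * g b * K a b) \<in> borel_measurable (A \<Otimes>\<^sub>M B)" unfolding case_prod_beta by measurable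
  show "AE x in A \<Otimes>\<^sub>M B. norm (case x of (a, b) \<Rightarrow> f a * g b * K a b) \<le> norm (C * (f (fst x) * g (snd x)))"
  proof (intro AE_I2)
   fix x assume "x \<in> space (A \<Otimes>\<^sub>M B)"
   then have "\<bar>K (fst x) (snd x)\<bar> \<le> abs C" using b[of "fst x" "snd x"] by (auto simp: space_pair_measure)
   then have "\<bar>f (fst x) * g (snd x)\<bar> * \<bar>K (fst x) (snd x)\<bar> \<le> \<bar>f (fst x) * g (snd x)\<bar> * abs C"
    by (intro mult_left_mono) auto
   then show "norm (case x of (a, b) \<Rightarrow> f a * g b * K a b) \<le> norm (C * (f (fst x) * g (snd x)))"
    by (simp add: case_prod_beta abs_mult mult_ac)
  qed
 qed
qed

text \<open>Fubini in the form in which it moves a bounded kernel from one factor to the other.\<close>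

lemma kernel_swap:
 fixes f :: "'a \<Rightarrow> real" and g :: "'b \<Rightarrow> real" and K :: "'a \<Rightarrow> 'b \<Rightarrow> real"
 assumes "sigma_finite_measure A" "sigma_finite_measure B"
  and f: "integrable A f" and g: "integrable B g"
  and K: "(\<lambda>p. K (fst p) (snd p)) \<in> borel_measurable (A \<Otimes>\<^sub>M B)"
  and b: "\<And>a b. \<lbrakk>a \<in> space A; b \<in> space B\<rbrakk> \<Longrightarrow> abs (K a b) \<le> C"
 shows "(LINT a|A. f a * (LINT b|B. K a b * g b)) = (LINT b|B. g b * (LINT a|A. f a * K a b))"
  and "integrable A (\<lambda>a. f a * (LINT b|B. K a b * g b))"
  and "integrable B (\<lambda>b. g b * (LINT a|A. f a * K a b))"
proof -
 interpret B: sigma_finite_measure B by fact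
 interpret A: sigma_finite_measure A by fact
 interpret P: pair_sigma_finite A B ..
 have i: "integrable (A \<Otimes>\<^sub>M B) (\<lambda>(a, b). f a * g b * K a b)" by (rule integrable_kernel) fact+
 have 1: "f a * (LINT b|B. K a b * g b) = (LINT b|B. f a * g b * K a b)" for a by (simp add: mult.assoc mult.commute[of "K a _"])
 have 2: "g b * (LINT a|A. f a * K a b) = (LINT a|A. f a * g b * K a b)" for b by (subst integral_mult_right_zero[symmetric]) (simp add: mult_ac)
 show "(LINT a|A. f a * (LINT b|B. K a b * g b)) = (LINT b|B. g b * (LINT a|A. f a * K a b))" unfolding 1 2 using P.Fubini_integral[OF i] by simp
 show "integrable A (\<lambda>a. f a * (LINT b|B. K a b * g b))" unfolding 1 using P.integrable_fst[OF i] by simp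
 show "integrable B (\<lambda>b. g b * (LINT a|A. f a * K a b))" unfolding 2 using P.integrable_snd[OF i] by simp
qed

text \<open>Young's inequality with a free parameter takes the place of Hoelder's inequality: it allows one of the two terms
 to be made small at the expense of the other.\<close>

lemma young_scaled:
 fixes x y c p q :: real
 assumes "p > 1" "q > 1" "1/p + 1/q = 1" "x \<ge> 0" "y \<ge> 0" "c > 0"
 shows "x * y \<le> c powr (-q) * x powr q + c powr p * y powr p"
proof -
 have "x * y = (c * y) * (x / c)" using assms by simp
 also have "\<dots> \<le> (c * y) powr p / p + (x / c) powr q / q" using assms by (intro Youngs_inequality) auto
 also have "\<dots> \<le> (c * y) powr p + (x / c) powr q"
 proof -
  have "z / r \<le> z" if "z \<ge> 0" "r > 1" for z r :: real using that by (simp add: divide_le_eq mult_left_mono[of 1 r z, simplified] )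
  then show ?thesis using assms by (intro add_mono) auto
 qed
 also have "\<dots> = c powr (-q) * x powr q + c powr p * y powr p" using assms by (simp add: powr_mult powr_divide powr_minus_divide)
 finally show ?thesis .
qed

lemma exists_small_powr:
 assumes "p > 0" "A \<ge> 0" "r > (0::real)"
 obtains c :: real where "c > 0" "c powr p * A < r"
proof
 let ?c = "(r / (A + 1)) powr (1/p)"
 show "?c > 0" using assms by simp
 have "?c powr p * A = r * A / (A + 1)" using assms by (simp add: powr_powr)
 also have "\<dots> < r" using assms by (simp add: divide_less_eq)
 finally show "?c powr p * A < r" .
qed

lemma le_one_plus_powr: fixes x p :: real assumes "x \<ge> 0" "p \<ge> 1" shows "x \<le> 1 + x powr p"
proof (cases "x \<le> 1")
 case False
 then have "x powr 1 \<le> x powr p" using assms by (intro powr_mono) auto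
 then show ?thesis using False by simp
qed (use powr_ge_zero[of x p] in linarith)

lemma (in finite_measure) integrable_powr_imp_integrable:
 fixes f :: "'a \<Rightarrow> real"
 assumes [measurable]: "f \<in> borel_measurable M" and "p \<ge> 1" and i: "integrable M (\<lambda>x. abs (f x) powr p)"
 shows "integrable M f"
proof (rule B_integrable_bound[of _ "\<lambda>x. 1 + abs (f x) powr p"])
 show "AE x in M. norm (f x) \<le> norm (1 + abs (f x) powr p)" using le_one_plus_powr[OF abs_ge_zero \<open>p \<ge> 1\<close>]
  by (intro AE_I2) (simp add: abs_of_nonneg add_nonneg_nonneg)
qed (use i in auto)

text \<open>Both marginals of the kernel have mass at most one, so that mollification contracts \<open>L\<^sub>1\<close>, and the
 mass of almost every row concentrates at the diagonal. Mass may be lost near the boundary: a forward time kernel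
 loses it near the final time. The conditions are stable under products.\<close>

locale approx_identity =
 fixes S :: "'a::euclidean_space set" and k :: "nat \<Rightarrow> 'a \<Rightarrow> 'a \<Rightarrow> real"
 assumes S_borel: "S \<in> sets borel" and S_fin: "emeasure lborel S < \<infinity>"
  and k_meas: "\<And>n. (\<lambda>p. k n (fst p) (snd p)) \<in> borel_measurable borel"
  and k_nonneg: "\<And>n a b. 0 \<le> k n a b"
  and k_bdd: "\<And>n. \<exists>C. \<forall>a b. k n a b \<le> C"
  and row: "\<And>n a. a \<in> S \<Longrightarrow> (LINT b|restrict_space lborel S. k n a b) \<le> 1"
  and col: "\<And>n b. b \<in> S \<Longrightarrow> (LINT a|restrict_space lborel S. k n a b) \<le> 1"
  and conc: "AE a in restrict_space lborel S. \<forall>d>0.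
    (\<lambda>n. (LINT b|restrict_space lborel S. indicator (ball a d) b * k n a b)) \<longlonglongrightarrow> 1"
begin

abbreviation "M \<equiv> restrict_space lborel S"

definition moll :: "nat \<Rightarrow> ('a \<Rightarrow> real) \<Rightarrow> 'a \<Rightarrow> real" where
 "moll n f a = (LINT b|M. k n a b * f b)"

sublocale finite_measure M using S_borel S_fin by (intro finite_measureI) (auto simp: emeasure_restrict_space space_restrict_space)

lemma space_M [simp]: "space M = S" by (simp add: space_restrict_space)

lemma k_pair [measurable]: "(\<lambda>p. k n (fst p) (snd p)) \<in> borel_measurable (M \<Otimes>\<^sub>M M)"
proof -
 have i: "(\<lambda>x. x) \<in> M \<rightarrow>\<^sub>M borel" by (rule measurable_restrict_space1) simp
 have "(\<lambda>p. (fst p, snd p)) \<in> M \<Otimes>\<^sub>M M \<rightarrow>\<^sub>M borel \<Otimes>\<^sub>M borel"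
  by (intro measurable_Pair measurable_compose[OF measurable_fst i] measurable_compose[OF measurable_snd i])
 moreover have "(\<lambda>p. k n (fst p) (snd p)) \<in> borel_measurable (borel \<Otimes>\<^sub>M borel)" using k_meas by (simp add: borel_prod)
 ultimately show ?thesis by (auto dest: measurable_compose)
qed

lemma k_abs_bdd: "\<exists>C. \<forall>a b. abs (k n a b) \<le> C"
 using k_bdd[of n] k_nonneg[of n] by (auto simp: abs_of_nonneg)

lemma k_row_meas [measurable]: "a \<in> S \<Longrightarrow> (\<lambda>b. k n a b) \<in> borel_measurable M"
 using measurable_compose[OF measurable_Pair1'[of a M M] k_pair] by simp

lemma k_col_meas [measurable]: "b \<in> S \<Longrightarrow> (\<lambda>a. k n a b) \<in> borel_measurable M"
 using measurable_compose[OF measurable_Pair2'[of b M M] k_pair] by simp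

lemma k_row_int_mult: 
 assumes a: "a \<in> S" and f: "integrable M f" shows "integrable M (\<lambda>b. k n a b * f b)"
proof -
 obtain C where C: "\<And>a b. abs (k n a b) \<le> C" using k_abs_bdd by blast
 have [measurable]: "f \<in> borel_measurable M" using f by simp
 show ?thesis
 proof (rule B_integrable_bound[of _ "\<lambda>b. C * f b"])
  show "AE x in M. norm (k n a x * f x) \<le> norm (C * f x)"
  proof (rule AE_I2)
   fix x show "norm (k n a x * f x) \<le> norm (C * f x)"
    using mult_right_mono[OF order_trans[OF C[of a x] abs_ge_self], of "abs (f x)"] by (simp add: abs_mult)
  qed
 qed (use a f in auto)
qed

lemma k_col_int_mult: 
 assumes a: "a \<in> S" and f: "integrable M f" shows "integrable M (\<lambda>b. f b * k n b a)"
proof -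
 obtain C where C: "\<And>a b. abs (k n a b) \<le> C" using k_abs_bdd by blast
 have [measurable]: "f \<in> borel_measurable M" using f by simp
 show ?thesis
 proof (rule B_integrable_bound[of _ "\<lambda>b. C * f b"])
  show "AE x in M. norm (f x * k n x a) \<le> norm (C * f x)"
  proof (rule AE_I2)
   fix x show "norm (f x * k n x a) \<le> norm (C * f x)"
    using mult_right_mono[OF order_trans[OF C[of x a] abs_ge_self], of "abs (f x)"] by (simp add: abs_mult mult.commute)
  qed
 qed (use a f in auto)
qed

lemma k_row_int: "a \<in> S \<Longrightarrow> integrable M (\<lambda>b. k n a b)"
 using k_row_int_mult[of a "\<lambda>_. 1" n] by simp

lemma ind_k_row_int:
 assumes "a \<in> S" shows "integrable M (\<lambda>b. indicator (ball c d) b * k n a b)"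
proof (rule B_integrable_bound[OF k_row_int[OF assms, of n]])
 have [measurable]: "indicat_real (ball c d) \<in> borel_measurable M" by (rule measurable_restrict_space1, rule borel_measurable_indicator) simp
 show "(\<lambda>b. indicator (ball c d) b * k n a b) \<in> borel_measurable M" using assms by measurable
qed (auto simp: indicator_def)

lemma k_row_bound:
 assumes "a \<in> S" and f: "\<And>b. b \<in> S \<Longrightarrow> abs (f b) \<le> C" and "0 \<le> C"
 shows "abs (moll n f a) \<le> C"
proof -
 have "abs (moll n f a) \<le> (LINT b|M. k n a b * C)"
 proof (cases "integrable M (\<lambda>b. k n a b * f b)")
  case True
  then have "integrable M (\<lambda>b. \<bar>k n a b * f b\<bar>)" by simp
  then show ?thesis unfolding moll_def by (intro integral_abs_bound[THEN order_trans] integral_mono)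
    (use k_row_int[OF \<open>a\<in>S\<close>] k_nonneg f in \<open>auto simp: abs_mult intro!: mult_left_mono\<close>)
 next
  case False
  then show ?thesis unfolding moll_def
   using \<open>0 \<le> C\<close> k_nonneg by (auto simp: not_integrable_integral_eq intro!: mult_nonneg_nonneg B_integral_nonneg)
 qed
 also have "\<dots> = C * (LINT b|M. k n a b)" by (simp add: mult.commute)
 also have "\<dots> \<le> C * 1" using row[OF assms(1)] \<open>0 \<le> C\<close> by (intro mult_left_mono)
 finally show ?thesis by simp
qed

lemma kernel_facts:
 assumes f: "integrable M f" and g: "integrable M g"
 shows moll_swap: "(LINT a|M. g a * moll n f a) = (LINT b|M. f b * (LINT a|M. g a * k n a b))"
  and moll_mult_int: "integrable M (\<lambda>a. g a * moll n f a)"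
  and comoll_mult_int: "integrable M (\<lambda>b. f b * (LINT a|M. g a * k n a b))"
proof -
 obtain C where C: "\<And>a b. abs (k n a b) \<le> C" using k_abs_bdd by blast
 note * = kernel_swap[OF sigma_finite_measure_axioms sigma_finite_measure_axioms g f k_pair C]
 show "(LINT a|M. g a * moll n f a) = (LINT b|M. f b * (LINT a|M. g a * k n a b))"
  "integrable M (\<lambda>a. g a * moll n f a)"
  "integrable M (\<lambda>b. f b * (LINT a|M. g a * k n a b))" unfolding moll_def using * by auto
qed

lemma moll_int: "integrable M f \<Longrightarrow> integrable M (moll n f)"
 using moll_mult_int[of f "\<lambda>_. 1" n] by simp

lemma moll_diff: "\<lbrakk>integrable M f; integrable M g; a \<in> S\<rbrakk> \<Longrightarrow> moll n (\<lambda>x. f x - g x) a = moll n f a - moll n g a"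
 unfolding moll_def by (simp add: right_diff_distrib k_row_int_mult)

lemma moll_le_abs: assumes "integrable M f" "a \<in> S" shows "abs (moll n f a) \<le> moll n (\<lambda>x. abs (f x)) a"
proof -
 have "abs (moll n f a) \<le> (LINT b|M. \<bar>k n a b * f b\<bar>)" unfolding moll_def by (rule integral_abs_bound)
 also have "\<dots> = moll n (\<lambda>x. abs (f x)) a" unfolding moll_def using k_nonneg by (simp add: abs_mult abs_of_nonneg)
 finally show ?thesis .
qed

lemma moll_contraction:
 assumes f: "integrable M f" shows "(LINT a|M. abs (moll n f a)) \<le> (LINT a|M. abs (f a))"
proof -
 have "(LINT a|M. abs (moll n f a)) \<le> (LINT a|M. moll n (\<lambda>x. abs (f x)) a)"
  using f moll_le_abs by (intro integral_mono) (auto intro: moll_int)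
 also have "\<dots> = (LINT b|M. abs (f b) * (LINT a|M. k n a b))" using moll_swap[of "\<lambda>x. abs (f x)" "\<lambda>_. 1" n] f by simp
 also have "\<dots> \<le> (LINT b|M. abs (f b) * 1)" using comoll_mult_int[of "\<lambda>x. abs (f x)" "\<lambda>_. 1" n] f col
  by (intro integral_mono mult_left_mono) auto
 finally show ?thesis by simp
qed

lemma mass_tendsto: "AE a in M. (\<lambda>n. (LINT b|M. k n a b)) \<longlonglongrightarrow> 1"
 using conc AE_space
proof eventually_elim
 case (elim a)
 then have a: "a \<in> S" by simp
 have "(\<lambda>n. (LINT b|M. indicator (ball a 1) b * k n a b)) \<longlonglongrightarrow> 1" using elim by simp
 then show ?case
 proof (rule tendsto_sandwich[rotated 2])
  show "\<forall>\<^sub>F n in sequentially. (LINT b|M. indicator (ball a 1) b * k n a b) \<le> (LINT b|M. k n a b)"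
   using a k_nonneg by (intro always_eventually allI integral_mono' k_row_int) (auto simp: indicator_def)
  show "\<forall>\<^sub>F n in sequentially. (LINT b|M. k n a b) \<le> 1" using row a by simp
 qed simp
qed

lemma moll_pointwise:
 assumes g: "continuous_on UNIV g" and C: "\<And>x. abs (g x) \<le> C" and a: "a \<in> S"
  and conc: "\<And>d. d > 0 \<Longrightarrow> (\<lambda>n. (LINT b|M. indicator (ball a d) b * k n a b)) \<longlonglongrightarrow> 1"
  and mass: "(\<lambda>n. (LINT b|M. k n a b)) \<longlonglongrightarrow> 1"
 shows "(\<lambda>n. moll n g a) \<longlonglongrightarrow> g a"
proof -
 have gb [measurable]: "g \<in> borel_measurable borel" using g by (simp add: borel_measurable_continuous_onI)
 have gi: "integrable M g" by (rule integrable_const_bound[where B=C]) (use C in \<open>auto intro: measurable_restrict_space1\<close>)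
 have "(\<lambda>n. moll n (\<lambda>b. g b - g a) a) \<longlonglongrightarrow> 0"
 proof (rule LIMSEQ_I)
  fix r :: real assume r: "r > 0"
  have "isCont g a" using g by (simp add: continuous_on_eq_continuous_at)
  then obtain d where d: "d > 0" "\<And>b. dist b a < d \<Longrightarrow> \<bar>g b - g a\<bar> < r/2"
   using r unfolding continuous_at_eps_delta dist_real_def by (meson half_gt_zero)
  have "(\<lambda>n. 2 * C * ((LINT b|M. k n a b) - (LINT b|M. indicator (ball a d) b * k n a b))) \<longlonglongrightarrow> 2 * C * (1 - 1)"
   using conc[OF d(1)] mass by (intro tendsto_intros)
  then have "eventually (\<lambda>n. 2 * C * ((LINT b|M. k n a b) - (LINT b|M. indicator (ball a d) b * k n a b)) < r/2) sequentially"
   using r by (intro order_tendstoD) auto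
  then obtain N where N: "\<And>n. n \<ge> N \<Longrightarrow> 2 * C * ((LINT b|M. k n a b) - (LINT b|M. indicator (ball a d) b * k n a b)) < r/2"
   by (auto simp: eventually_sequentially)
  show "\<exists>no. \<forall>n\<ge>no. norm (moll n (\<lambda>b. g b - g a) a - 0) < r"
  proof (intro exI allI impI)
   fix n assume "n \<ge> N"
   have i1: "integrable M (\<lambda>b. indicator (ball a d) b * k n a b)" using a by (rule ind_k_row_int)
   have i2: "integrable M (\<lambda>b. k n a b * \<bar>g b - g a\<bar>)" using a gi by (intro k_row_int_mult) auto
   have "\<bar>moll n (\<lambda>b. g b - g a) a\<bar> \<le> moll n (\<lambda>b. \<bar>g b - g a\<bar>) a" using gi a by (intro moll_le_abs) auto
   also have "\<dots> \<le> (LINT b|M. r/2 * k n a b + 2 * C * (k n a b - indicator (ball a d) b * k n a b))" unfolding moll_def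
   proof (intro integral_mono i2)
    fix b 
    have "\<bar>g b - g a\<bar> \<le> r/2 + 2 * C * (1 - indicator (ball a d) b)"
     using d(2)[of b] C[of a] C[of b] r by (auto simp: indicator_def dist_commute)
    then have "k n a b * \<bar>g b - g a\<bar> \<le> k n a b * (r/2 + 2 * C * (1 - indicator (ball a d) b))"
     using k_nonneg by (intro mult_left_mono) auto
    then show "k n a b * \<bar>g b - g a\<bar> \<le> r/2 * k n a b + 2 * C * (k n a b - indicator (ball a d) b * k n a b)"
     by (simp add: algebra_simps)
   qed (use i1 k_row_int[OF a] in auto)
   also have "\<dots> = r/2 * (LINT b|M. k n a b) + 2 * C * ((LINT b|M. k n a b) - (LINT b|M. indicator (ball a d) b * k n a b))"
    using i1 k_row_int[OF a, of n] by simp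
   also have "\<dots> < r/2 * 1 + r/2" using N[OF \<open>n \<ge> N\<close>] row[OF a, of n] r by (intro add_le_less_mono mult_left_mono) auto
   finally show "norm (moll n (\<lambda>b. g b - g a) a - 0) < r" by simp
  qed
 qed
 moreover have "moll n (\<lambda>b. g b - g a) a = moll n g a - g a * (LINT b|M. k n a b)" for n
  using moll_diff[OF gi _ a, of "\<lambda>_. g a" n] by (simp add: moll_def mult.commute)
 ultimately have "(\<lambda>n. (moll n g a - g a * (LINT b|M. k n a b)) + g a * (LINT b|M. k n a b)) \<longlonglongrightarrow> 0 + g a * 1"
  using mass by (intro tendsto_intros) auto
 then show ?thesis by simp
qed

text \<open>For bounded continuous functions this follows from concentration and dominated convergence;
 the contraction property extends it to all integrable functions.\<close>

lemma moll_L1: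
 assumes f: "integrable M f"
 shows "(\<lambda>n. (LINT a|M. \<bar>moll n f a - f a\<bar>)) \<longlonglongrightarrow> 0"
proof (rule LIMSEQ_I)
 fix r :: real assume r: "r > 0"
 then have "r/4 > 0" by simp
 then obtain g C where g: "continuous_on UNIV g" "\<And>x. abs (g x) \<le> C" "(LINT x|M. \<bar>f x - g x\<bar>) < r/4"
  using continuous_approx_L1[OF S_borel S_fin f] by metis
 have gb [measurable]: "g \<in> borel_measurable borel" using g by (simp add: borel_measurable_continuous_onI)
 have gi: "integrable M g" by (rule integrable_const_bound[where B=C]) (use g in \<open>auto intro: measurable_restrict_space1\<close>)
 have [measurable]: "g \<in> borel_measurable M" by (rule measurable_restrict_space1) simp
 have C0: "0 \<le> C" using g(2)[of undefined] by linarith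
 have [measurable]: "moll n g \<in> borel_measurable M" for n using moll_int[OF gi, of n] by simp
 have "(\<lambda>n. (LINT a|M. \<bar>moll n g a - g a\<bar>)) \<longlonglongrightarrow> (LINT a|M. 0)"
 proof (rule integral_dominated_convergence[where w="\<lambda>_. 2 * C"])
  show "AE a in M. (\<lambda>n. \<bar>moll n g a - g a\<bar>) \<longlonglongrightarrow> 0" using conc mass_tendsto AE_space
  proof eventually_elim
   case (elim a)
   have "(\<lambda>n. moll n g a) \<longlonglongrightarrow> g a" using g elim by (intro moll_pointwise) auto
   then have "(\<lambda>n. moll n g a - g a) \<longlonglongrightarrow> 0" by (intro tendsto_eq_intros) auto
   then show ?case by (rule tendsto_rabs_zero)
  qed
  show "AE a in M. norm \<bar>moll n g a - g a\<bar> \<le> 2 * C" for n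
  proof (rule AE_I2)
   fix a assume "a \<in> space M"
   then have "abs (moll n g a) \<le> C" using g C0 by (intro k_row_bound) auto
   then show "norm \<bar>moll n g a - g a\<bar> \<le> 2 * C" using g(2)[of a] by simp
  qed
 qed auto
 then have "eventually (\<lambda>n. (LINT a|M. \<bar>moll n g a - g a\<bar>) < r/4) sequentially" using r by (intro order_tendstoD) auto
 then obtain N where N: "\<And>n. n \<ge> N \<Longrightarrow> (LINT a|M. \<bar>moll n g a - g a\<bar>) < r/4" by (auto simp: eventually_sequentially)
 show "\<exists>no. \<forall>n\<ge>no. norm ((LINT a|M. \<bar>moll n f a - f a\<bar>) - 0) < r"
 proof (intro exI allI impI)
  fix n assume n: "n \<ge> N"
  have dfg: "integrable M (\<lambda>x. f x - g x)" using f gi by auto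
  have "(LINT a|M. \<bar>moll n f a - f a\<bar>) \<le> (LINT a|M. \<bar>moll n (\<lambda>x. f x - g x) a\<bar> + \<bar>moll n g a - g a\<bar> + \<bar>f a - g a\<bar>)"
   using f gi moll_int[OF f] moll_int[OF gi] moll_int[OF dfg] by (intro integral_mono) (auto simp: moll_diff)
  also have "\<dots> = (LINT a|M. \<bar>moll n (\<lambda>x. f x - g x) a\<bar>) + (LINT a|M. \<bar>moll n g a - g a\<bar>) + (LINT a|M. \<bar>f a - g a\<bar>)"
   using f gi moll_int[OF f] moll_int[OF gi] moll_int[OF dfg] by simp
  also have "\<dots> < r" using moll_contraction[OF dfg, of n] N[OF n] g(3) r by linarith
  finally show "norm ((LINT a|M. \<bar>moll n f a - f a\<bar>) - 0) < r" by simp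
 qed
qed

text \<open>The bound is uniform in the kernel and splits the pairing into an \<open>L\<^sub>q\<close> and an \<open>L\<^sub>p\<close> part whose
 sizes can be traded against each other.\<close>

lemma pairing_young:
 assumes pq: "p > 1" "q > 1" "1/p + 1/q = 1" and c: "c > 0"
  and f: "integrable M f" "integrable M (\<lambda>x. abs (f x) powr p)"
  and h: "integrable M h" "integrable M (\<lambda>x. abs (h x) powr q)"
 shows "(LINT a|M. \<bar>h a * moll n f a\<bar>)
  \<le> c powr (-q) * (LINT a|M. abs (h a) powr q) + c powr p * (LINT a|M. abs (f a) powr p)"
proof -
 let ?F = "\<lambda>x. abs (f x) powr p" and ?H = "\<lambda>x. abs (h x) powr q"
 have "(LINT a|M. \<bar>h a * moll n f a\<bar>) \<le> (LINT a|M. c powr (-q) * ?H a + c powr p * moll n ?F a)"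
 proof (intro integral_mono)
  show "integrable M (\<lambda>a. \<bar>h a * moll n f a\<bar>)" using moll_mult_int[OF f(1) h(1), of n] by simp
  show "integrable M (\<lambda>a. c powr (-q) * ?H a + c powr p * moll n ?F a)" using h f moll_int[OF f(2)] by auto
  fix a assume "a \<in> space M" then have a: "a \<in> S" by simp
  have "\<bar>h a * moll n f a\<bar> \<le> abs (h a) * moll n (\<lambda>x. abs (f x)) a"
   using moll_le_abs[OF f(1) a, of n] by (simp add: abs_mult mult_left_mono)
  also have "\<dots> = (LINT b|M. k n a b * (abs (h a) * abs (f b)))"
   unfolding moll_def by (subst integral_mult_right_zero[symmetric]) (simp add: mult_ac)
  also have "\<dots> \<le> (LINT b|M. k n a b * (c powr (-q) * ?H a + c powr p * ?F b))"
   using f a k_nonneg young_scaled[OF pq abs_ge_zero abs_ge_zero c] by (intro integral_mono k_row_int_mult mult_left_mono) auto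
  also have "\<dots> = c powr (-q) * ?H a * (LINT b|M. k n a b) + c powr p * moll n ?F a"
   using k_row_int[OF a] k_row_int_mult[OF a f(2)] by (simp add: moll_def algebra_simps)
  also have "\<dots> \<le> c powr (-q) * ?H a * 1 + c powr p * moll n ?F a" using row[OF a] by (intro add_mono mult_left_mono) auto
  finally show "\<bar>h a * moll n f a\<bar> \<le> c powr (-q) * ?H a + c powr p * moll n ?F a" by simp
 qed
 also have "\<dots> = c powr (-q) * (LINT a|M. ?H a) + c powr p * (LINT a|M. moll n ?F a)" using h f moll_int[OF f(2)] by simp
 also have "(LINT a|M. moll n ?F a) \<le> (LINT a|M. \<bar>moll n ?F a\<bar>)"  using moll_int[OF f(2)] by (intro integral_mono) auto
 also have "\<dots> \<le> (LINT a|M. ?F a)" using moll_contraction[OF f(2), of n] by simp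
 finally show ?thesis by (simp add: mult_left_mono)
qed

text \<open>Convergence of mollifications in \<open>L\<^sub>p\<close>, in the weak form that is enough here: clipping \<open>g\<close> to a bounded
 function costs little by the Young bound, and against a bounded function \<open>L\<^sub>1\<close> convergence suffices.\<close>

lemma moll_pairing:
 assumes pq: "p > 1" "q > 1" "1/p + 1/q = 1"
  and [measurable]: "f \<in> borel_measurable M" "g \<in> borel_measurable M"
  and f: "integrable M (\<lambda>x. abs (f x) powr p)" and g: "integrable M (\<lambda>x. abs (g x) powr q)"
 shows "(\<lambda>n. (LINT a|M. g a * moll n f a)) \<longlonglongrightarrow> (LINT a|M. g a * f a)"
proof (rule LIMSEQ_I)
 fix r :: real assume r: "r > 0"
 have f1: "integrable M f" using pq f by (intro integrable_powr_imp_integrable[of f p]) auto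
 have [measurable]: "moll n f \<in> borel_measurable M" for n using moll_int[OF f1, of n] by simp
 obtain c where c: "c > 0" "c powr p * (LINT a|M. abs (f a) powr p) < r/6"
  using exists_small_powr[of p "(LINT a|M. abs (f a) powr p)" "r/6"] pq r by auto
 define clip where "clip N x = max (-N) (min N x)" for N x :: real
 have clip_abs: "abs (clip N x) \<le> N" if "N \<ge> 0" for N x using that by (auto simp: clip_def)
 have cm [measurable]: "clip N \<in> borel_measurable borel" for N unfolding clip_def by measurable
 define h where "h N x = g x - clip (real N) (g x)" for N x
 have [measurable]: "h N \<in> borel_measurable M" for N unfolding h_def by measurable
 have hle: "abs (h N x) \<le> abs (g x)" for N x by (auto simp: h_def clip_def max_def min_def)
 have hq: "abs (h N x) powr q \<le> abs (g x) powr q" for N x using hle pq by (intro powr_mono2) auto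
 have hqi: "integrable M (\<lambda>x. abs (h N x) powr q)" for N by (rule B_integrable_bound[OF g]) (use hq in auto)
 have hi: "integrable M (h N)" for N using pq hqi[of N] by (intro integrable_powr_imp_integrable[of "h N" q]) auto
 have "(\<lambda>N. c powr (-q) * (LINT x|M. abs (h N x) powr q)) \<longlonglongrightarrow> c powr (-q) * (LINT x|M. 0)"
 proof (intro tendsto_intros integral_dominated_convergence[where w="\<lambda>x. abs (g x) powr q"])
  show "AE x in M. (\<lambda>N. abs (h N x) powr q) \<longlonglongrightarrow> 0"
  proof (intro AE_I2)
   fix x
   obtain N :: nat where N: "abs (g x) \<le> real N" using real_arch_simple by blast
   have "eventually (\<lambda>n. abs (h n x) powr q = 0) sequentially" using eventually_ge_at_top[of N]
    by eventually_elim (use N in \<open>auto simp: h_def clip_def max_def min_def\<close>)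
   then show "(\<lambda>N. abs (h N x) powr q) \<longlonglongrightarrow> 0" by (rule tendsto_eventually)
  qed
 qed (use g hq in auto)
 then have "eventually (\<lambda>N. c powr (-q) * (LINT x|M. abs (h N x) powr q) < r/6) sequentially" using r by (intro order_tendstoD) auto
 then obtain N where N: "c powr (-q) * (LINT x|M. abs (h N x) powr q) < r/6" by (auto simp: eventually_sequentially)
 have "(\<lambda>n. real N * (LINT a|M. \<bar>moll n f a - f a\<bar>)) \<longlonglongrightarrow> real N * 0" by (intro tendsto_intros moll_L1 f1)
 then have "eventually (\<lambda>n. real N * (LINT a|M. \<bar>moll n f a - f a\<bar>) < r/6) sequentially" using r by (intro order_tendstoD) auto
 then obtain n0 where n0: "\<And>n. n \<ge> n0 \<Longrightarrow> real N * (LINT a|M. \<bar>moll n f a - f a\<bar>) < r/6"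
  by (auto simp: eventually_sequentially)
 have Q: "c powr (-q) * (LINT a|M. abs (h N a) powr q) + c powr p * (LINT a|M. abs (f a) powr p) < r/3" using c N by linarith
 have hf: "integrable M (\<lambda>a. h N a * f a)"
 proof (rule B_integrable_bound[of _ "\<lambda>a. c powr (-q) * abs (h N a) powr q + c powr p * abs (f a) powr p"])
  show "AE x in M. norm (h N x * f x) \<le> norm (c powr - q * abs (h N x) powr q + c powr p * abs (f x) powr p)"
   using young_scaled[OF pq abs_ge_zero abs_ge_zero c(1)] by (auto simp: abs_mult)
 qed (use hqi f in auto)
 have "(LINT a|M. \<bar>h N a * f a\<bar>) \<le> (LINT a|M. c powr (-q) * abs (h N a) powr q + c powr p * abs (f a) powr p)"
  using hqi f integrable_abs[OF hf] young_scaled[OF pq abs_ge_zero abs_ge_zero c(1)] by (intro integral_mono) (auto simp: abs_mult)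
 also have "\<dots> = c powr (-q) * (LINT a|M. abs (h N a) powr q) + c powr p * (LINT a|M. abs (f a) powr p)" using hqi f by simp
 finally have R: "(LINT a|M. \<bar>h N a * f a\<bar>) < r/3" using Q by linarith
 show "\<exists>no. \<forall>n\<ge>no. norm ((LINT a|M. g a * moll n f a) - (LINT a|M. g a * f a)) < r"
 proof (intro exI allI impI)
  fix n assume n: "n \<ge> n0"
  have cN: "\<bar>clip (real N) x\<bar> \<le> real N" for x using clip_abs by simp
  have ci: "integrable M (\<lambda>a. clip (real N) (g a))" by (rule integrable_const_bound[where B="real N"]) (auto simp: cN)
  have i1: "integrable M (\<lambda>a. h N a * moll n f a)" by (rule moll_mult_int[OF f1 hi])
  have i2: "integrable M (\<lambda>a. clip (real N) (g a) * moll n f a)" by (rule moll_mult_int[OF f1 ci])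
  have i3: "integrable M (\<lambda>a. clip (real N) (g a) * f a)"
  proof (rule B_integrable_bound[of _ "\<lambda>a. real N * f a"])
   show "AE a in M. norm (clip (real N) (g a) * f a) \<le> norm (real N * f a)" using cN by (auto simp: abs_mult mult_right_mono)
  qed (use f1 in auto)
  have e1: "(LINT a|M. g a * moll n f a) = (LINT a|M. h N a * moll n f a) + (LINT a|M. clip (real N) (g a) * moll n f a)"
   using i1 i2 by (subst B_integral_add[symmetric]) (auto simp: h_def algebra_simps)
  have e2: "(LINT a|M. g a * f a) = (LINT a|M. h N a * f a) + (LINT a|M. clip (real N) (g a) * f a)"
   using hf i3 by (subst B_integral_add[symmetric]) (auto simp: h_def algebra_simps)
  have "\<bar>(LINT a|M. clip (real N) (g a) * moll n f a) - (LINT a|M. clip (real N) (g a) * f a)\<bar>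
    = \<bar>(LINT a|M. clip (real N) (g a) * (moll n f a - f a))\<bar>" using i2 i3 by (simp add: right_diff_distrib)
  also have "\<dots> \<le> (LINT a|M. \<bar>clip (real N) (g a) * (moll n f a - f a)\<bar>)" by (rule integral_abs_bound)
  also have "\<dots> \<le> (LINT a|M. real N * \<bar>moll n f a - f a\<bar>)"
  proof (intro integral_mono)
   show "integrable M (\<lambda>a. \<bar>clip (real N) (g a) * (moll n f a - f a)\<bar>)"
    using i2 i3 by (intro integrable_abs) (simp add: right_diff_distrib)
   show "integrable M (\<lambda>a. real N * \<bar>moll n f a - f a\<bar>)" using moll_int[OF f1, of n] f1 by simp
   show "\<bar>clip (real N) (g a) * (moll n f a - f a)\<bar> \<le> real N * \<bar>moll n f a - f a\<bar>" for a
    using cN by (simp add: abs_mult mult_right_mono)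
  qed
  also have "\<dots> = real N * (LINT a|M. \<bar>moll n f a - f a\<bar>)" by simp
  finally have e3: "\<bar>(LINT a|M. clip (real N) (g a) * moll n f a) - (LINT a|M. clip (real N) (g a) * f a)\<bar> < r/6" using n0[OF n] by linarith
  have e4: "\<bar>(LINT a|M. h N a * moll n f a)\<bar> < r/3"
   using integral_abs_bound[of M "\<lambda>a. h N a * moll n f a"] pairing_young[OF pq c(1) f1 f hi[of N] hqi[of N], where n=n] Q by linarith
  have e5: "\<bar>(LINT a|M. h N a * f a)\<bar> < r/3" using integral_abs_bound[of M "\<lambda>a. h N a * f a"] R by linarith
  show "norm ((LINT a|M. g a * moll n f a) - (LINT a|M. g a * f a)) < r" unfolding e1 e2 real_norm_def using e3 e4 e5 r by linarith
 qed
qed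

end

lemma AE_fst:
 assumes P: "AE x in A. P x" and B: "sigma_finite_measure B"
 shows "AE z in A \<Otimes>\<^sub>M B. P (fst z)"
proof -
 interpret B: sigma_finite_measure B by fact
 from P obtain N where N: "{x \<in> space A. \<not> P x} \<subseteq> N" "emeasure A N = 0" "N \<in> sets A" by (rule AE_E)
 show ?thesis
 proof (rule AE_I)
  show "{z \<in> space (A \<Otimes>\<^sub>M B). \<not> P (fst z)} \<subseteq> N \<times> space B" using N by (auto simp: space_pair_measure)
  show "emeasure (A \<Otimes>\<^sub>M B) (N \<times> space B) = 0" using N by (simp add: B.emeasure_pair_measure_Times)
 qed (use N in auto)
qed

lemma AE_snd:
 assumes P: "AE y in B. P y" and B: "sigma_finite_measure B"
 shows "AE z in A \<Otimes>\<^sub>M B. P (snd z)"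
proof -
 interpret B: sigma_finite_measure B by fact
 from P obtain N where N: "{x \<in> space B. \<not> P x} \<subseteq> N" "emeasure B N = 0" "N \<in> sets B" by (rule AE_E)
 show ?thesis
 proof (rule AE_I)
  show "{z \<in> space (A \<Otimes>\<^sub>M B). \<not> P (snd z)} \<subseteq> space A \<times> N" using N by (auto simp: space_pair_measure)
  show "emeasure (A \<Otimes>\<^sub>M B) (space A \<times> N) = 0" using N by (simp add: B.emeasure_pair_measure_Times)
 qed (use N in auto)
qed

lemma restrict_lborel_Times:
 fixes A :: "'a::euclidean_space set" and B :: "'b::euclidean_space set"
 assumes A: "A \<in> sets borel" and B: "B \<in> sets borel"
  and fin: "emeasure lborel A < \<infinity>" "emeasure lborel B < \<infinity>"
 shows "restrict_space lborel A \<Otimes>\<^sub>M restrict_space lborel B = restrict_space lborel (A \<times> B)"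
proof (rule pair_measure_eqI)
 let ?A = "restrict_space lborel A" and ?B = "restrict_space lborel B"
 interpret A: finite_measure ?A using A fin by (intro finite_measureI) (auto simp: emeasure_restrict_space space_restrict_space)
 interpret B: finite_measure ?B using B fin by (intro finite_measureI) (auto simp: emeasure_restrict_space space_restrict_space)
 show "sigma_finite_measure ?A" "sigma_finite_measure ?B" by unfold_locales
 have AB: "A \<times> B \<in> sets borel" using A B by (simp add: borel_Times)
 have iA: "(\<lambda>x. x) \<in> ?A \<rightarrow>\<^sub>M borel" and iB: "(\<lambda>x. x) \<in> ?B \<rightarrow>\<^sub>M borel"
  by (rule measurable_restrict_space1, simp)+
 have "(\<lambda>p. (fst p, snd p)) \<in> ?A \<Otimes>\<^sub>M ?B \<rightarrow>\<^sub>M borel \<Otimes>\<^sub>M borel"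
  by (intro measurable_Pair measurable_compose[OF measurable_fst iA] measurable_compose[OF measurable_snd iB])
 then have id: "(\<lambda>p. p) \<in> ?A \<Otimes>\<^sub>M ?B \<rightarrow>\<^sub>M borel" by (simp add: borel_prod)
 show "sets (?A \<Otimes>\<^sub>M ?B) = sets (restrict_space lborel (A \<times> B))"
 proof
  show "sets (?A \<Otimes>\<^sub>M ?B) \<subseteq> sets (restrict_space lborel (A \<times> B))"
  proof (rule sets_pair_in_sets)
   fix a b assume "a \<in> sets ?A" "b \<in> sets ?B"
   then have "a \<subseteq> A" "b \<subseteq> B" "a \<in> sets borel" "b \<in> sets borel" using A B by (auto simp: sets_restrict_space_iff)
   then show "a \<times> b \<in> sets (restrict_space lborel (A \<times> B))" using AB by (auto simp: sets_restrict_space_iff borel_Times)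
  qed
  show "sets (restrict_space lborel (A \<times> B)) \<subseteq> sets (?A \<Otimes>\<^sub>M ?B)"
  proof
   fix X assume "X \<in> sets (restrict_space lborel (A \<times> B))"
   then have X: "X \<in> sets borel" "X \<subseteq> A \<times> B" using AB by (auto simp: sets_restrict_space_iff)
   have "(\<lambda>p. p) -` X \<inter> space (?A \<Otimes>\<^sub>M ?B) \<in> sets (?A \<Otimes>\<^sub>M ?B)" using id X(1) by (rule measurable_sets)
   moreover have "(\<lambda>p. p) -` X \<inter> space (?A \<Otimes>\<^sub>M ?B) = X"
    using X(2) by (auto simp: space_pair_measure space_restrict_space)
   ultimately show "X \<in> sets (?A \<Otimes>\<^sub>M ?B)" by simp
  qed
 qed
 fix a b assume "a \<in> sets ?A" "b \<in> sets ?B"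
 then have ab: "a \<subseteq> A" "b \<subseteq> B" "a \<in> sets borel" "b \<in> sets borel" using A B by (auto simp: sets_restrict_space_iff)
 then have "emeasure ?A a * emeasure ?B b = emeasure lborel a * emeasure lborel b" using A B by (simp add: emeasure_restrict_space)
 also have "\<dots> = emeasure (lborel \<Otimes>\<^sub>M lborel) (a \<times> b)" using ab by (simp add: lborel.emeasure_pair_measure_Times)
 also have "\<dots> = emeasure (restrict_space lborel (A \<times> B)) (a \<times> b)"
  using ab AB by (subst emeasure_restrict_space) (auto simp: lborel_prod)
 finally show "emeasure ?A a * emeasure ?B b = emeasure (restrict_space lborel (A \<times> B)) (a \<times> b)" .
qed

text \<open>A ball of the product contains a product of balls, which gives concentration.\<close>

lemma approx_identity_Times:
 assumes "approx_identity A k" "approx_identity B l"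
 shows "approx_identity (A \<times> B) (\<lambda>n a b. k n (fst a) (fst b) * l n (snd a) (snd b))"
proof -
 interpret A: approx_identity A k by fact
 interpret B: approx_identity B l by fact
 interpret P: pair_sigma_finite A.M B.M ..
 have M: "restrict_space lborel (A \<times> B) = A.M \<Otimes>\<^sub>M B.M"
  using A.S_borel B.S_borel A.S_fin B.S_fin by (simp add: restrict_lborel_Times)
 have prod_int: "(\<integral>z. f (fst z) * g (snd z) \<partial>(A.M \<Otimes>\<^sub>M B.M)) = (\<integral>x. f x \<partial>A.M) * (\<integral>y. g y \<partial>B.M)"
   "integrable (A.M \<Otimes>\<^sub>M B.M) (\<lambda>z. f (fst z) * g (snd z))"
  if "integrable A.M f" "integrable B.M g" for f g :: "_ \<Rightarrow> real"
 proof -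
  show i: "integrable (A.M \<Otimes>\<^sub>M B.M) (\<lambda>z. f (fst z) * g (snd z))"
   using integrable_kernel[OF A.sigma_finite_measure_axioms B.sigma_finite_measure_axioms that, of "\<lambda>_ _. 1" 1]
   by (simp add: case_prod_unfold)
  have "(\<integral>z. f (fst z) * g (snd z) \<partial>(A.M \<Otimes>\<^sub>M B.M)) = (\<integral>x. \<integral>y. f x * g y \<partial>B.M \<partial>A.M)"
   using P.integral_fst'[OF i] by simp
  then show "(\<integral>z. f (fst z) * g (snd z) \<partial>(A.M \<Otimes>\<^sub>M B.M)) = (\<integral>x. f x \<partial>A.M) * (\<integral>y. g y \<partial>B.M)" by simp
 qed
 have colA: "integrable A.M (\<lambda>a. k n a b)" if "b \<in> A" for n b using A.k_col_int_mult[OF that, of "\<lambda>_. 1" n] by simp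
 have colB: "integrable B.M (\<lambda>a. l n a b)" if "b \<in> B" for n b using B.k_col_int_mult[OF that, of "\<lambda>_. 1" n] by simp
 have N0: "0 \<le> (\<integral>x. k n a x \<partial>A.M)" "0 \<le> (\<integral>x. k n x a \<partial>A.M)" for n a using A.k_nonneg by simp_all
 show ?thesis
 proof
  show "A \<times> B \<in> sets borel" using A.S_borel B.S_borel by (simp add: borel_Times)
  have "emeasure lborel (A \<times> B) = emeasure lborel A * emeasure lborel B"
   using A.S_borel B.S_borel by (simp add: lborel_prod[symmetric] lborel.emeasure_pair_measure_Times)
  then show "emeasure lborel (A \<times> B) < \<infinity>" using A.S_fin B.S_fin by (simp add: ennreal_mult_less_top)
  fix n
  have m1: "(\<lambda>p::('a \<times> 'b) \<times> ('a \<times> 'b). (fst (fst p), fst (snd p))) \<in> borel \<rightarrow>\<^sub>M borel"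
   and m2: "(\<lambda>p::('a \<times> 'b) \<times> ('a \<times> 'b). (snd (fst p), snd (snd p))) \<in> borel \<rightarrow>\<^sub>M borel"
   by (intro borel_measurable_continuous_onI continuous_intros)+
  show "(\<lambda>p. k n (fst (fst p)) (fst (snd p)) * l n (snd (fst p)) (snd (snd p))) \<in> borel_measurable borel"
   using measurable_compose[OF m1 A.k_meas[of n]] measurable_compose[OF m2 B.k_meas[of n]] by (intro borel_measurable_times) simp_all
  show "0 \<le> k n (fst a) (fst b) * l n (snd a) (snd b)" for a b using A.k_nonneg B.k_nonneg by simp
  obtain C D where CD: "\<forall>a b. k n a b \<le> C" "\<forall>a b. l n a b \<le> D" using A.k_bdd B.k_bdd by blast
  have "0 \<le> C" using A.k_nonneg[of n undefined undefined] CD(1) by (meson order_trans)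
  with CD show "\<exists>C. \<forall>a b. k n (fst a) (fst b) * l n (snd a) (snd b) \<le> C"
   using A.k_nonneg B.k_nonneg by (intro exI[of _ "C * D"] allI mult_mono) (auto intro: order_trans)
  show "(\<integral>b. k n (fst a) (fst b) * l n (snd a) (snd b) \<partial>restrict_space lborel (A \<times> B)) \<le> 1" if "a \<in> A \<times> B" for a
   using that unfolding M by (subst prod_int(1)) (auto intro!: mult_le_one A.row B.row A.k_row_int B.k_row_int B.k_nonneg B_integral_nonneg)
  show "(\<integral>b. k n (fst b) (fst a) * l n (snd b) (snd a) \<partial>restrict_space lborel (A \<times> B)) \<le> 1" if "a \<in> A \<times> B" for a
   using that unfolding M by (subst prod_int(1)) (auto intro!: mult_le_one A.col B.col colA colB B.k_nonneg B_integral_nonneg)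
 next
  have "AE z in A.M \<Otimes>\<^sub>M B.M. \<forall>d>0. (\<lambda>n. \<integral>b. indicator (ball (fst z) d) b * k n (fst z) b \<partial>A.M) \<longlonglongrightarrow> 1"
   using A.conc by (rule AE_fst) unfold_locales
  moreover have "AE z in A.M \<Otimes>\<^sub>M B.M. \<forall>d>0. (\<lambda>n. \<integral>b. indicator (ball (snd z) d) b * l n (snd z) b \<partial>B.M) \<longlonglongrightarrow> 1"
   using B.conc by (rule AE_snd) unfold_locales
  ultimately show "AE a in restrict_space lborel (A \<times> B). \<forall>d>0.
   (\<lambda>n. \<integral>b. indicator (ball a d) b * (k n (fst a) (fst b) * l n (snd a) (snd b)) \<partial>restrict_space lborel (A \<times> B)) \<longlonglongrightarrow> 1"
   unfolding M using AE_space
  proof eventually_elim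
   case (elim a)
   then have a: "fst a \<in> A" "snd a \<in> B" by (auto simp: space_pair_measure)
   show ?case
   proof (intro allI impI)
    fix d :: real assume d: "d > 0"
    have indA: "integrable A.M (\<lambda>b. indicator (ball (fst a) (d/2)) b * k n (fst a) b)" for n using a(1) by (rule A.ind_k_row_int)
    have indB: "integrable B.M (\<lambda>b. indicator (ball (snd a) (d/2)) b * l n (snd a) b)" for n using a(2) by (rule B.ind_k_row_int)
    have "(\<lambda>n. (\<integral>b. indicator (ball (fst a) (d/2)) b * k n (fst a) b \<partial>A.M) *
     (\<integral>b. indicator (ball (snd a) (d/2)) b * l n (snd a) b \<partial>B.M)) \<longlonglongrightarrow> 1 * 1"
     using elim d by (intro tendsto_mult) auto
    then have L: "(\<lambda>n. (\<integral>b. indicator (ball (fst a) (d/2)) b * k n (fst a) b \<partial>A.M) *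
     (\<integral>b. indicator (ball (snd a) (d/2)) b * l n (snd a) b \<partial>B.M)) \<longlonglongrightarrow> 1" by simp
    show "(\<lambda>n. \<integral>b. indicator (ball a d) b * (k n (fst a) (fst b) * l n (snd a) (snd b)) \<partial>(A.M \<Otimes>\<^sub>M B.M)) \<longlonglongrightarrow> 1"
    proof (rule tendsto_sandwich[OF _ _ L tendsto_const])
     have full: "integrable (A.M \<Otimes>\<^sub>M B.M) (\<lambda>b. k n (fst a) (fst b) * l n (snd a) (snd b))" for n
      using prod_int(2)[OF A.k_row_int[OF a(1), of n] B.k_row_int[OF a(2), of n]] .
     have dfull: "integrable (A.M \<Otimes>\<^sub>M B.M) (\<lambda>b. indicator (ball a d) b * (k n (fst a) (fst b) * l n (snd a) (snd b)))" for n
     proof (rule B_integrable_bound[OF full[of n]])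
      have "indicat_real (ball a d) \<in> borel_measurable (A.M \<Otimes>\<^sub>M B.M)"
       unfolding M[symmetric] by (rule measurable_restrict_space1, rule borel_measurable_indicator) simp
      then show "(\<lambda>b. indicator (ball a d) b * (k n (fst a) (fst b) * l n (snd a) (snd b))) \<in> borel_measurable (A.M \<Otimes>\<^sub>M B.M)"
       using borel_measurable_integrable[OF full[of n]] by (rule borel_measurable_times)
     qed (auto simp: indicator_def)
     have "(\<integral>b. indicator (ball (fst a) (d/2)) b * k n (fst a) b \<partial>A.M) *
       (\<integral>b. indicator (ball (snd a) (d/2)) b * l n (snd a) b \<partial>B.M)
       \<le> (\<integral>b. indicator (ball a d) b * (k n (fst a) (fst b) * l n (snd a) (snd b)) \<partial>(A.M \<Otimes>\<^sub>M B.M))" for n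
     proof (subst prod_int(1)[OF indA indB, symmetric], rule integral_mono[OF prod_int(2)[OF indA indB] dfull])
      fix z :: "'a \<times> 'b"
      have "dist a z \<le> dist (fst a) (fst z) + dist (snd a) (snd z)" by (simp add: dist_prod_def sqrt_sum_squares_le_sum)
      then have "indicator (ball (fst a) (d/2)) (fst z) * indicator (ball (snd a) (d/2)) (snd z) \<le> indicat_real (ball a d) z"
       by (auto simp: indicator_def)
      then have "(indicator (ball (fst a) (d/2)) (fst z) * indicator (ball (snd a) (d/2)) (snd z)) * (k n (fst a) (fst z) * l n (snd a) (snd z))
        \<le> indicat_real (ball a d) z * (k n (fst a) (fst z) * l n (snd a) (snd z))" using A.k_nonneg B.k_nonneg by (intro mult_right_mono) auto
      then show "indicator (ball (fst a) (d/2)) (fst z) * k n (fst a) (fst z) * (indicator (ball (snd a) (d/2)) (snd z) * l n (snd a) (snd z))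
        \<le> indicat_real (ball a d) z * (k n (fst a) (fst z) * l n (snd a) (snd z))" by (simp add: mult_ac)
     qed
     then show "\<forall>\<^sub>F n in sequentially. (\<integral>b. indicator (ball (fst a) (d/2)) b * k n (fst a) b \<partial>A.M) *
       (\<integral>b. indicator (ball (snd a) (d/2)) b * l n (snd a) b \<partial>B.M)
       \<le> (\<integral>b. indicator (ball a d) b * (k n (fst a) (fst b) * l n (snd a) (snd b)) \<partial>(A.M \<Otimes>\<^sub>M B.M))" by simp
     have "(\<integral>b. indicator (ball a d) b * (k n (fst a) (fst b) * l n (snd a) (snd b)) \<partial>(A.M \<Otimes>\<^sub>M B.M))
       \<le> (\<integral>b. k n (fst a) (fst b) * l n (snd a) (snd b) \<partial>(A.M \<Otimes>\<^sub>M B.M))" for n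
      by (rule integral_mono[OF dfull full])
       (use A.k_nonneg B.k_nonneg in \<open>auto simp: indicator_def\<close>)
     also have "(\<integral>b. k n (fst a) (fst b) * l n (snd a) (snd b) \<partial>(A.M \<Otimes>\<^sub>M B.M)) \<le> 1" for n
      using a by (subst prod_int(1)) (auto intro!: mult_le_one A.row B.row A.k_row_int B.k_row_int B.k_nonneg B_integral_nonneg)
     finally show "\<forall>\<^sub>F n in sequentially. (\<integral>b. indicator (ball a d) b * (k n (fst a) (fst b) * l n (snd a) (snd b)) \<partial>(A.M \<Otimes>\<^sub>M B.M)) \<le> 1"
      by simp
    qed
   qed
  qed
 qed
qed

section \<open>Smooth functions\<close>

lemma Ck_imp_continuous: "Ck k f \<Longrightarrow> continuous_on UNIV f"
 by (cases k) (auto intro: differentiable_imp_continuous_on)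

lemma Ck_SucD: "Ck (Suc k) f \<Longrightarrow> Ck k f"
 by (induction k arbitrary: f) (auto intro: differentiable_imp_continuous_on)

lemma Ck_has_derivative:
 assumes "Ck (Suc k) f" shows "(f has_derivative frechet_derivative f (at x)) (at x)"
 using assms by (auto simp: differentiable_on_def frechet_derivative_works)

lemma frechet_eq_dderiv:
 fixes f :: "'a::euclidean_space \<Rightarrow> real"
 assumes "f differentiable (at x)"
 shows "frechet_derivative f (at x) h = (\<Sum>b\<in>Basis. (h \<bullet> b) * dderiv b f x)"
proof -
 interpret linear "frechet_derivative f (at x)" using assms by (rule linear_frechet_derivative)
 have "frechet_derivative f (at x) h = frechet_derivative f (at x) (\<Sum>b\<in>Basis. (h \<bullet> b) *\<^sub>R b)"
  by (simp add: euclidean_representation)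
 then show ?thesis by (simp add: sum scale dderiv_def)
qed

lemma Ck_has_derivative_dderiv:
 fixes f :: "'a::euclidean_space \<Rightarrow> real"
 assumes "Ck (Suc k) f" shows "(f has_derivative (\<lambda>h. \<Sum>b\<in>Basis. (h \<bullet> b) * dderiv b f x)) (at x)"
proof -
 have "frechet_derivative f (at x) = (\<lambda>h. \<Sum>b\<in>Basis. (h \<bullet> b) * dderiv b f x)"
  using assms by (intro ext frechet_eq_dderiv) (auto simp: differentiable_on_def)
 then show ?thesis using Ck_has_derivative[OF assms, of x] by simp
qed

lemma dderiv_eqI: "(f has_derivative f') (at x) \<Longrightarrow> dderiv e f x = f' e"
 unfolding dderiv_def by (metis frechet_derivative_at)

lemma Ck_SucI:
 assumes "\<And>x. (f has_derivative f' x) (at x)" "\<And>e. e \<in> Basis \<Longrightarrow> Ck k (\<lambda>x. f' x e)"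
 shows "Ck (Suc k) f"
proof -
 have "dderiv e f = (\<lambda>x. f' x e)" for e using dderiv_eqI[OF assms(1)] by blast
 then show ?thesis using assms by (auto simp: differentiable_on_def differentiable_def)
qed

lemma Ck_const [simp]: "Ck k (\<lambda>_. c)"
proof (induction k arbitrary: c)
 case (Suc k) then show ?case by (intro Ck_SucI[where f'="\<lambda>_ _. 0"]) auto
qed auto

lemma Ck_add: "Ck k f \<Longrightarrow> Ck k g \<Longrightarrow> Ck k (\<lambda>x. f x + g x)"
proof (induction k arbitrary: f g)
 case (Suc k)
 have "Ck k (dderiv e f)" "Ck k (dderiv e g)" if "e \<in> Basis" for e using Suc.prems that by auto
 then show ?case using Suc.IH by (intro Ck_SucI[OF has_derivative_add[OF Suc.prems[THEN Ck_has_derivative]]]) (auto simp: dderiv_def[abs_def])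
qed (auto intro: continuous_intros)

lemma Ck_mult: "Ck k f \<Longrightarrow> Ck k g \<Longrightarrow> Ck k (\<lambda>x. f x * g x)"
proof (induction k arbitrary: f g)
 case (Suc k)
 have *: "Ck k (dderiv e f)" "Ck k (dderiv e g)" if "e \<in> Basis" for e using Suc.prems that by auto
 have "Ck k (\<lambda>x. f x * frechet_derivative g (at x) e + frechet_derivative f (at x) e * g x)" if "e \<in> Basis" for e
  using Suc.IH[of f "dderiv e g"] Suc.IH[of "dderiv e f" g] *[OF that] Suc.prems[THEN Ck_SucD] by (auto simp: dderiv_def[abs_def] intro: Ck_add)
 then show ?case by (intro Ck_SucI[OF has_derivative_mult[OF Suc.prems[THEN Ck_has_derivative]]]) auto
qed (auto intro: continuous_intros)

lemma Ck_sum: "(\<And>i. i \<in> I \<Longrightarrow> Ck k (f i)) \<Longrightarrow> Ck k (\<lambda>x. \<Sum>i\<in>I. f i x)"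
 by (induction I rule: infinite_finite_induct) (auto intro: Ck_add)

lemma Ck_prod: "(\<And>i. i \<in> I \<Longrightarrow> Ck k (f i)) \<Longrightarrow> Ck k (\<lambda>x. \<Prod>i\<in>I. f i x)"
 by (induction I rule: infinite_finite_induct) (auto intro: Ck_mult)

lemma Ck_power: "Ck k f \<Longrightarrow> Ck k (\<lambda>x. f x ^ n)"
 by (induction n) (auto intro: Ck_mult)

lemma Ck_cmult: "Ck k f \<Longrightarrow> Ck k (\<lambda>x. c * f x)" by (intro Ck_mult) auto

lemma Ck_minus: "Ck k f \<Longrightarrow> Ck k (\<lambda>x. - f x)" using Ck_cmult[of k f "-1"] by simp

lemma dderiv_affine:
 fixes f :: "'b::euclidean_space \<Rightarrow> real" and L :: "'a::euclidean_space \<Rightarrow> 'b"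
 assumes L: "bounded_linear L" and f: "Ck (Suc k) f"
 shows "((\<lambda>x. f (L x + c)) has_derivative (\<lambda>h. \<Sum>b\<in>Basis. (L h \<bullet> b) * dderiv b f (L x + c))) (at x)"
proof -
 have "((\<lambda>x. L x + c) has_derivative L) (at x)" using L by (auto intro!: derivative_eq_intros simp: bounded_linear_imp_has_derivative)
 from has_derivative_compose[OF this Ck_has_derivative_dderiv[OF f]] show ?thesis by simp
qed

lemma Ck_affine:
 fixes f :: "'b::euclidean_space \<Rightarrow> real" and L :: "'a::euclidean_space \<Rightarrow> 'b"
 assumes L: "bounded_linear L" 
 shows "Ck k f \<Longrightarrow> Ck k (\<lambda>x. f (L x + c))"
proof (induction k arbitrary: f)
 case 0
 have "continuous_on UNIV (\<lambda>x. L x + c)" by (intro continuous_intros linear_continuous_on L)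
 with 0 show ?case using continuous_on_compose2[of UNIV f UNIV "\<lambda>x. L x + c"] by auto
next
 case (Suc k)
 show ?case by (rule Ck_SucI[OF dderiv_affine[OF L Suc.prems]]) (use Suc in \<open>auto intro!: Ck_sum Ck_cmult\<close>)
qed

lemma Ck_realI:
 fixes f :: "real \<Rightarrow> real"
 assumes "\<And>x. (f has_real_derivative f' x) (at x)" "Ck k f'"
 shows "Ck (Suc k) f" using assms by (intro Ck_SucI[where f'="\<lambda>x h. f' x * h"]) (auto simp: has_field_derivative_def)

lemma Ck_real_deriv:
 fixes f :: "real \<Rightarrow> real"
 assumes "Ck (Suc k) f" shows "(f has_real_derivative deriv f x) (at x)" "Ck k (deriv f)"
proof -
 have *: "(f has_real_derivative dderiv 1 f x) (at x)" for x
  using Ck_has_derivative_dderiv[OF assms, of x] by (simp add: has_field_derivative_def mult_commute_abs)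
 then have "deriv f = dderiv 1 f" by (auto intro: DERIV_imp_deriv)
 then show "(f has_real_derivative deriv f x) (at x)" "Ck k (deriv f)" using * assms by auto
qed

lemma smooth_const [simp]: "smooth (\<lambda>_. c)" by (simp add: smooth_def)
lemma smooth_mult: "smooth f \<Longrightarrow> smooth g \<Longrightarrow> smooth (\<lambda>x. f x * g x)" by (simp add: smooth_def Ck_mult)
lemma smooth_cmult: "smooth f \<Longrightarrow> smooth (\<lambda>x. c * f x)" by (simp add: smooth_def Ck_cmult)
lemma smooth_affine: "bounded_linear L \<Longrightarrow> smooth f \<Longrightarrow> smooth (\<lambda>x. f (L x + c))" by (simp add: smooth_def Ck_affine)
lemma smooth_dderiv: "smooth f \<Longrightarrow> e \<in> Basis \<Longrightarrow> smooth (dderiv e f)"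
 by (metis Ck.simps(2) smooth_def)
lemma smooth_realI: "(\<And>x. (f has_real_derivative f' x) (at x)) \<Longrightarrow> smooth f' \<Longrightarrow> smooth f"
 unfolding smooth_def by (metis Ck_SucD Ck_realI)
lemma smooth_deriv: "smooth (f :: real \<Rightarrow> real) \<Longrightarrow> smooth (deriv f)"
 unfolding smooth_def using Ck_real_deriv(2) by blast
lemma smooth_DERIV: "smooth (f :: real \<Rightarrow> real) \<Longrightarrow> (f has_real_derivative deriv f x) (at x)"
 unfolding smooth_def using Ck_real_deriv(1) by blast
lemma smooth_has_derivative: "smooth f \<Longrightarrow> (f has_derivative (\<lambda>h. \<Sum>b\<in>Basis. (h \<bullet> b) * dderiv b f x)) (at x)"
 unfolding smooth_def using Ck_has_derivative_dderiv by blast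
lemma smooth_continuous: "smooth f \<Longrightarrow> continuous_on S f"
 unfolding smooth_def using Ck_imp_continuous continuous_on_subset by blast

lemma smooth_cos_sin: "smooth (\<lambda>x::real. cos x)" "smooth (\<lambda>x::real. sin x)"
proof -
 have "Ck k (\<lambda>x::real. cos x) \<and> Ck k (\<lambda>x::real. sin x)" for k
 proof (induction k)
  case (Suc k)
  show ?case
  proof
   show "Ck (Suc k) (\<lambda>x::real. cos x)" using Suc by (intro Ck_realI[where f'="\<lambda>x. - sin x"] DERIV_cos Ck_minus) auto
   show "Ck (Suc k) (\<lambda>x::real. sin x)" using Suc by (intro Ck_realI[where f'=cos] DERIV_sin) auto
  qed
 qed (auto intro!: continuous_intros)
 then show "smooth (\<lambda>x::real. cos x)" "smooth (\<lambda>x::real. sin x)" by (auto simp: smooth_def)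
qed

section \<open>The forward time kernel\<close>

text \<open>The powers of \<open>1 / t\<close> make the family closed under differentiation, so smoothness of
 \<open>exp (- 1 / t)\<close> at the origin follows from continuity of all members.\<close>

definition flat :: "nat \<Rightarrow> real \<Rightarrow> real" where
 "flat j t = (if t > 0 then exp (- (1 / t)) / t ^ j else 0)"

lemma flat_tendsto: "(flat j \<longlongrightarrow> 0) (at 0)"
proof -
 have "((\<lambda>s::real. s ^ j / exp s) \<longlongrightarrow> 0) at_top" by (rule tendsto_power_div_exp_0)
 then have "((\<lambda>t::real. inverse t ^ j / exp (inverse t)) \<longlongrightarrow> 0) (at_right 0)"
  by (rule filterlim_compose) (rule filterlim_inverse_at_top_right)
 then have "(flat j \<longlongrightarrow> 0) (at_right 0)" by (rule Lim_transform_eventually)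
   (auto simp: eventually_at_filter flat_def exp_minus field_simps power_inverse inverse_eq_divide power_one_over)
 moreover have "(flat j \<longlongrightarrow> 0) (at_left 0)" by (rule tendsto_eventually) (auto simp: eventually_at_filter flat_def)
 ultimately show ?thesis by (rule filterlim_split_at[rotated])
qed

lemma flat_deriv: "(flat j has_real_derivative (flat (j + 2) t - real j * flat (j + 1) t)) (at t)"
proof -
 consider "t > 0" | "t < 0" | "t = 0" by linarith
 then show ?thesis
 proof cases
  case 1
  have d1: "((\<lambda>t. exp (- (1 / t))) has_real_derivative exp (- (1 / t)) / t\<^sup>2) (at t)"
   using 1 by (auto intro!: derivative_eq_intros simp: power2_eq_square)
  have d2: "((\<lambda>t. t ^ j) has_real_derivative real j * t ^ (j - 1)) (at t)" using DERIV_pow[of j t UNIV] by simp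
  have "(exp (- (1 / t)) / t\<^sup>2 * t ^ j - exp (- (1 / t)) * (real j * t ^ (j - 1))) / (t ^ j * t ^ j)
   = flat (j + 2) t - real j * flat (j + 1) t" using 1 by (cases j) (simp_all add: flat_def field_simps power2_eq_square)
  then have "((\<lambda>t. exp (- (1 / t)) / t ^ j) has_real_derivative (flat (j + 2) t - real j * flat (j + 1) t)) (at t)"
   using DERIV_divide[OF d1 d2] 1 by simp
  then show ?thesis by (rule has_field_derivative_transform_within_open[where S="{0<..}"]) (use 1 in \<open>auto simp: flat_def\<close>)
 next
  case 2
  have "((\<lambda>t. 0) has_real_derivative (flat (j + 2) t - real j * flat (j + 1) t)) (at t)" using 2 by (auto simp: flat_def)
  then show ?thesis by (rule has_field_derivative_transform_within_open[where S="{..<0}"]) (use 2 in \<open>auto simp: flat_def\<close>)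
 next
  case 3
  have "((\<lambda>h. (flat j (0 + h) - flat j 0) / h) \<longlongrightarrow> 0) (at 0)" using flat_tendsto[of "Suc j"]
   by (rule Lim_transform_eventually) (auto simp: eventually_at_filter flat_def)
  then show ?thesis using 3 by (simp add: DERIV_def flat_def)
 qed
qed

lemma smooth_flat: "smooth (flat j)"
proof -
 have "Ck k (flat j)" for k
 proof (induction k arbitrary: j)
  case 0
  have "isCont (flat j) x" for x using flat_deriv by (rule DERIV_isCont)
  then show ?case by (simp add: continuous_on_eq_continuous_at)
 next
  case (Suc k)
  show ?case by (rule Ck_realI[OF flat_deriv])
    (use Ck_add[OF Suc Ck_minus[OF Ck_cmult[OF Suc]]] in auto)
 qed
 then show ?thesis by (simp add: smooth_def)
qed

definition bump :: "real \<Rightarrow> real" where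
 "bump t = flat 0 (t + 2) * flat 0 (- t - 1)"

lemma smooth_bump: "smooth bump"
proof -
 have "smooth (\<lambda>t. flat 0 (1 * t + 2) * flat 0 ((-1) * t + (-1)))"
  by (intro smooth_mult smooth_affine[where L="(*) _"] smooth_flat bounded_linear_mult_right)
 then show ?thesis by (simp add: bump_def[abs_def])
qed

lemma bump_nonneg: "0 \<le> bump t" by (simp add: bump_def flat_def)
lemma bump_pos: "-2 < t \<Longrightarrow> t < -1 \<Longrightarrow> 0 < bump t" by (simp add: bump_def flat_def)
lemma bump_zero: "t \<notin> {-2<..< -1} \<Longrightarrow> bump t = 0" by (auto simp: bump_def flat_def)

lemma integrable_smooth_support:
 fixes f :: "real \<Rightarrow> real"
 assumes "continuous_on UNIV f" "\<And>t. t \<notin> {a..b} \<Longrightarrow> f t = 0"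
 shows "integrable lborel f"
proof -
 have i: "integrable lborel (\<lambda>x. indicator {a..b} x *\<^sub>R f x)"
  using borel_integrable_compact[of "{a..b}" f] assms(1) by (auto intro: continuous_on_subset simp: set_integrable_def)
 have "indicator {a..b} x *\<^sub>R f x = f x" for x using assms(2)[of x] by (cases "x \<in> {a..b}") auto
 then have "(\<lambda>x. indicator {a..b} x *\<^sub>R f x) = f" by blast
 with i show ?thesis by simp
qed

lemma integrable_bump: "integrable lborel bump"
 by (rule integrable_smooth_support[where a="-2" and b="-1"]) (auto intro: smooth_continuous smooth_bump bump_zero)

lemma integral_bump_pos: "0 < (LINT t|lborel. bump t)"
proof -
 have "(LINT t|lborel. bump t) \<noteq> 0"
 proof
  assume "(LINT t|lborel. bump t) = 0"
  then have "AE t in lborel. bump t = 0" using integral_nonneg_eq_0_iff_AE[OF integrable_bump] bump_nonneg by auto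
  then have "AE t in lborel. t \<notin> {-2<..< -1::real}" using bump_pos by (rule_tac AE_mp[OF \<open>AE t in lborel. bump t = 0\<close>]) (force intro!: AE_I2)
  then have "emeasure lborel {-2<..< -1::real} = 0"
   by (subst (asm) AE_iff_measurable[OF _ refl]) (auto simp: greaterThanLessThan_def greaterThan_def lessThan_def Collect_conj_eq[symmetric])
  then show False by simp
 qed
 moreover have "(LINT t|lborel. bump t) \<ge> 0" using bump_nonneg by simp
 ultimately show ?thesis by simp
qed

text \<open>The support lies in negative times: \<open>\<theta>(t - s)\<close> averages over times \<open>s\<close> after \<open>t\<close>. As a function of \<open>t\<close>
 it vanishes near and after \<open>s\<close>, hence it is a test function on \<open>[0,T)\<close>.\<close>

definition theta :: "nat \<Rightarrow> real \<Rightarrow> real" where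
 "theta n t = real (Suc n) * bump (real (Suc n) * t) / (LINT t|lborel. bump t)"

lemma theta_nonneg: "0 \<le> theta n t"
 using bump_nonneg integral_bump_pos by (simp add: theta_def)

lemma theta_zero: assumes "t \<notin> {-2 / real (Suc n)<..< -1 / real (Suc n)}" shows "theta n t = 0"
proof -
 have "real (Suc n) * t \<notin> {-2<..< -1}" using assms by (auto simp: field_simps simp del: of_nat_Suc)
 then show ?thesis by (simp add: theta_def bump_zero del: of_nat_Suc)
qed

lemma smooth_theta: "smooth (theta n)"
proof -
 have "smooth (\<lambda>t. (real (Suc n) / (LINT t|lborel. bump t)) * bump (real (Suc n) * t + 0))"
  by (intro smooth_cmult smooth_affine[where L="(*) _"] smooth_bump bounded_linear_mult_right)
 then show ?thesis by (simp add: theta_def[abs_def])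
qed

lemma integrable_theta: "integrable lborel (theta n)"
proof (rule integrable_smooth_support)
 show "continuous_on UNIV (theta n)" by (intro smooth_continuous smooth_theta)
 show "theta n t = 0" if "t \<notin> {-2 / real (Suc n).. -1 / real (Suc n)}" for t using that by (intro theta_zero) auto
qed

lemma integral_theta: "(LINT t|lborel. theta n t) = 1"
proof -
 have "(LINT t|lborel. bump t) = abs (real (Suc n)) *\<^sub>R (LINT t|lborel. bump (0 + real (Suc n) * t))"
  by (rule lborel_integral_real_affine) simp
 then have "(LINT t|lborel. bump t) = real (Suc n) * (LINT t|lborel. bump (real (Suc n) * t))" by simp
 moreover have "(LINT t|lborel. theta n t) = real (Suc n) * (LINT t|lborel. bump (real (Suc n) * t)) / (LINT t|lborel. bump t)"
  by (simp add: theta_def[abs_def] del: of_nat_Suc)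
 ultimately show ?thesis using integral_bump_pos by (metis divide_self less_irrefl)
qed

section \<open>Integration over the torus\<close>

definition unit_cell_at :: "real ^ 'd \<Rightarrow> (real ^ 'd) set" where
 "unit_cell_at a = {x. \<forall>i. a $ i \<le> x $ i \<and> x $ i < a $ i + 1}"

lemma cell_eq: "cell = unit_cell_at 0" by (simp add: cell_def unit_cell_at_def)

lemma unit_cell_borel [measurable]: "unit_cell_at (a :: real ^ 'd) \<in> sets borel"
proof -
 have "unit_cell_at a = (\<Inter>i. {x. x $ i \<ge> a $ i} \<inter> {x. x $ i < a $ i + 1})" by (auto simp: unit_cell_at_def)
 also have "\<dots> \<in> sets borel"
  by (intro sets.finite_INT sets.Int borel_closed borel_open closed_halfspace_component_ge_cart open_halfspace_component_lt_cart) auto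
 finally show ?thesis .
qed

lemma cell_borel [measurable]: "cell \<in> sets borel" by (simp add: cell_eq)

lemma nn_integral_lborel_shift:
 fixes f :: "'a::euclidean_space \<Rightarrow> ennreal"
 assumes "f \<in> borel_measurable borel"
 shows "(\<integral>\<^sup>+x. f (c + x) \<partial>lborel) = (\<integral>\<^sup>+x. f x \<partial>lborel)"
proof -
 have "(\<integral>\<^sup>+x. f x \<partial>lborel) = (\<integral>\<^sup>+x. f x \<partial>distr lborel borel ((+) c))" by (simp add: lborel_distr_plus)
 also have "\<dots> = (\<integral>\<^sup>+x. f (c + x) \<partial>lborel)" using assms by (subst nn_integral_distr) auto
 finally show ?thesis by simp
qed

text \<open>The part of the cell that leaves on one side is the translate by a period of the part that enters on the other.\<close>

lemma unit_cell_step: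
 fixes f :: "real ^ 'd \<Rightarrow> ennreal"
 assumes f [measurable]: "f \<in> borel_measurable borel" and per: "periodic f" and s: "0 \<le> s" "s \<le> 1"
 shows "(\<integral>\<^sup>+x. indicator (unit_cell_at (a + axis i s)) x * f x \<partial>lborel) = (\<integral>\<^sup>+x. indicator (unit_cell_at a) x * f x \<partial>lborel)"
proof -
 define A where "A = unit_cell_at a \<inter> {x. x $ i < a $ i + s}"
 define B where "B = unit_cell_at a \<inter> {x. x $ i \<ge> a $ i + s}"
 have [measurable]: "A \<in> sets borel" "B \<in> sets borel"
  unfolding A_def B_def by (intro sets.Int unit_cell_borel borel_closed borel_open closed_halfspace_component_ge_cart open_halfspace_component_lt_cart)+
 have 1: "indicator (unit_cell_at a) x = (indicator A x + indicator B x :: ennreal)" for x by (auto simp: A_def B_def indicator_def)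
 have shift: "x \<in> unit_cell_at (a + axis i s) \<longleftrightarrow> x \<in> B \<or> x - axis i 1 \<in> A" for x
 proof
  assume x: "x \<in> unit_cell_at (a + axis i s)"
  then have **: "(a + axis i s) $ j \<le> x $ j \<and> x $ j < (a + axis i s) $ j + 1" for j by (simp add: unit_cell_at_def)
  have *: "a $ i + s \<le> x $ i" "x $ i < a $ i + s + 1" "\<And>j. j \<noteq> i \<Longrightarrow> a $ j \<le> x $ j \<and> x $ j < a $ j + 1"
   using **[of i] apply (simp_all add: axis_def)
   subgoal for j using **[of j] by (simp add: axis_def)
   done
  show "x \<in> B \<or> x - axis i 1 \<in> A"
  proof (cases "x $ i < a $ i + 1")
   case True
   then have "a $ j \<le> x $ j \<and> x $ j < a $ j + 1" for j using * s by (cases "j = i") auto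
   then show ?thesis using * by (auto simp: B_def unit_cell_at_def)
  next
   case False
   then have "a $ j \<le> (x - axis i 1) $ j \<and> (x - axis i 1) $ j < a $ j + 1" for j using * s by (cases "j = i") (auto simp: axis_def)
   then show ?thesis using * by (auto simp: A_def unit_cell_at_def axis_def)
  qed
 next
  assume "x \<in> B \<or> x - axis i 1 \<in> A"
  then show "x \<in> unit_cell_at (a + axis i s)"
  proof
   assume "x \<in> B"
   then have "(a + axis i s) $ j \<le> x $ j \<and> x $ j < (a + axis i s) $ j + 1" for j
    using s by (cases "j = i") (auto simp: B_def unit_cell_at_def axis_def intro: order_less_le_trans)
   then show ?thesis by (simp add: unit_cell_at_def)
  next
   assume x: "x - axis i 1 \<in> A"
   then have *: "a $ j \<le> (x - axis i 1) $ j \<and> (x - axis i 1) $ j < a $ j + 1" "(x - axis i 1) $ i < a $ i + s" for j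
    by (auto simp: A_def unit_cell_at_def)
   have "(a + axis i s) $ j \<le> x $ j \<and> x $ j < (a + axis i s) $ j + 1" for j using s *(1)[of j] *(2) by (cases "j = i") (auto simp: axis_def)
   then show ?thesis by (simp add: unit_cell_at_def)
  qed
 qed
 have disj: "\<not> (x \<in> B \<and> x - axis i 1 \<in> A)" for x
 proof
  assume "x \<in> B \<and> x - axis i 1 \<in> A"
  then have "x \<in> unit_cell_at a" "x - axis i 1 \<in> unit_cell_at a" by (simp_all add: A_def B_def)
  then have "x $ i < a $ i + 1" "a $ i \<le> (x - axis i 1) $ i" unfolding unit_cell_at_def by blast+
  then show False by (simp add: axis_def)
 qed
 have 2: "indicator (unit_cell_at (a + axis i s)) x = (indicator B x + indicator A (x - axis i 1) :: ennreal)" for x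
  using shift[of x] disj[of x] by (auto simp: indicator_def)
 have 3: "(\<integral>\<^sup>+x. indicator A (x - axis i 1) * f x \<partial>lborel) = (\<integral>\<^sup>+x. indicator A x * f x \<partial>lborel)"
 proof -
  have "(\<integral>\<^sup>+x. indicator A (x - axis i 1) * f x \<partial>lborel) = (\<integral>\<^sup>+x. indicator A ((axis i 1 + x) - axis i 1) * f (axis i 1 + x) \<partial>lborel)"
   by (rule nn_integral_lborel_shift[symmetric]) measurable
  also have "\<dots> = (\<integral>\<^sup>+x. indicator A x * f x \<partial>lborel)" using per by (simp add: periodic_def add.commute)
  finally show ?thesis .
 qed
 show ?thesis unfolding 1 2 distrib_right by (subst (1 2) nn_integral_add) (auto simp: 3 add.commute)
qed

lemma unit_cell_axis:
 fixes f :: "real ^ 'd \<Rightarrow> ennreal"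
 assumes f [measurable]: "f \<in> borel_measurable borel" and per: "periodic f"
 shows "(\<integral>\<^sup>+x. indicator (unit_cell_at (a + axis i s)) x * f x \<partial>lborel) = (\<integral>\<^sup>+x. indicator (unit_cell_at a) x * f x \<partial>lborel)"
proof -
 have *: "(\<integral>\<^sup>+x. indicator (unit_cell_at (a + axis i s)) x * f x \<partial>lborel) = (\<integral>\<^sup>+x. indicator (unit_cell_at a) x * f x \<partial>lborel)"
  if "0 \<le> s" "s \<le> real n" for n s a using that
 proof (induction n arbitrary: s a)
  case 0
  then have "s = 0" by simp
  moreover have "axis i (0::real) = 0" by (simp add: vec_eq_iff axis_def)
  ultimately show ?case by (simp only: add_0_right)
 next
  case (Suc n)
  show ?case
  proof (cases "s \<le> 1")
   case True then show ?thesis using Suc.prems by (intro unit_cell_step f per)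
  next
   case False
   then have "(\<integral>\<^sup>+x. indicator (unit_cell_at (a + axis i 1 + axis i (s - 1))) x * f x \<partial>lborel)
    = (\<integral>\<^sup>+x. indicator (unit_cell_at (a + axis i 1)) x * f x \<partial>lborel)" using Suc.prems by (intro Suc.IH) auto
   also have "\<dots> = (\<integral>\<^sup>+x. indicator (unit_cell_at a) x * f x \<partial>lborel)" by (intro unit_cell_step f per) auto
   moreover have "a + axis i 1 + axis i (s - 1) = a + axis i s" by (simp add: vec_eq_iff axis_def)
   ultimately show ?thesis by simp
  qed
 qed
 show ?thesis
 proof (cases "s \<ge> 0")
  case True
  obtain n :: nat where "s \<le> real n" using real_arch_simple by blast
  then show ?thesis using True by (intro *)
 next
  case False
  obtain n :: nat where "- s \<le> real n" using real_arch_simple by blast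
  then have "(\<integral>\<^sup>+x. indicator (unit_cell_at ((a + axis i s) + axis i (- s))) x * f x \<partial>lborel)
   = (\<integral>\<^sup>+x. indicator (unit_cell_at (a + axis i s)) x * f x \<partial>lborel)" using False by (intro *) auto
  moreover have "(a + axis i s) + axis i (- s) = a" by (simp add: vec_eq_iff axis_def)
  ultimately show ?thesis by simp
 qed
qed

lemma unit_cell_shift:
 fixes f :: "real ^ 'd \<Rightarrow> ennreal"
 assumes f [measurable]: "f \<in> borel_measurable borel" and per: "periodic f"
 shows "(\<integral>\<^sup>+x. indicator (unit_cell_at a) x * f x \<partial>lborel) = (\<integral>\<^sup>+x. indicator (unit_cell_at b) x * f x \<partial>lborel)"
proof -
 have "(\<integral>\<^sup>+x. indicator (unit_cell_at (b + (\<Sum>i\<in>I. axis i (h i)))) x * f x \<partial>lborel) = (\<integral>\<^sup>+x. indicator (unit_cell_at b) x * f x \<partial>lborel)"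
  if "finite I" for I and h :: "'d \<Rightarrow> real" using that
 proof induction
  case (insert i I)
  then show ?case using unit_cell_axis[OF f per, of "b + (\<Sum>i\<in>I. axis i (h i))" i "h i"] by (simp add: add_ac)
 qed simp
 from this[of UNIV "\<lambda>i. (a - b) $ i"]
 have "(\<integral>\<^sup>+x. indicator (unit_cell_at (b + (\<Sum>i\<in>UNIV. axis i ((a - b) $ i)))) x * f x \<partial>lborel) = (\<integral>\<^sup>+x. indicator (unit_cell_at b) x * f x \<partial>lborel)"
  by simp
 moreover have "(\<Sum>i\<in>UNIV. axis i ((a - b) $ i)) = a - b" by (simp add: vec_eq_iff axis_def if_distrib cong: if_cong)
 ultimately show ?thesis by simp
qed

lemma nn_integral_torus: 
 fixes f :: "real ^ 'd \<Rightarrow> ennreal"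
 shows "(\<integral>\<^sup>+x. f x \<partial>TX) = (\<integral>\<^sup>+x. indicator cell x * f x \<partial>lborel)"
 unfolding torus_measure_def by (subst nn_integral_restrict_space) (auto simp: mult.commute)

lemma integral_torus: 
 fixes f :: "real ^ 'd \<Rightarrow> real"
 shows "(LINT x|TX. f x) = (LINT x|lborel. indicator cell x * f x)" unfolding torus_measure_def by (subst integral_restrict_space) auto

lemma space_torus [simp]: "space TX = cell"
 by (simp add: torus_measure_def space_restrict_space)

lemma measurable_torus: "f \<in> borel_measurable borel \<Longrightarrow> f \<in> borel_measurable TX"
 unfolding torus_measure_def by (rule measurable_restrict_space1) simp

lemma torus_nn_shift:
 fixes f :: "real ^ 'd \<Rightarrow> ennreal"
 assumes f [measurable]: "f \<in> borel_measurable borel" and per: "periodic f"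
 shows "(\<integral>\<^sup>+x. f (x + h) \<partial>TX) = (\<integral>\<^sup>+x. f x \<partial>TX)"
proof -
 have "(\<integral>\<^sup>+x. f (x + h) \<partial>TX) = (\<integral>\<^sup>+x. indicator (unit_cell_at h) (h + x) * f (h + x) \<partial>lborel)"
  unfolding nn_integral_torus by (intro nn_integral_cong) (auto simp: cell_eq unit_cell_at_def indicator_def add_ac)
 also have "\<dots> = (\<integral>\<^sup>+x. indicator (unit_cell_at h) x * f x \<partial>lborel)" by (rule nn_integral_lborel_shift) measurable
 also have "\<dots> = (\<integral>\<^sup>+x. f x \<partial>TX)" unfolding nn_integral_torus cell_eq by (rule unit_cell_shift[OF f per])
 finally show ?thesis .
qed

lemma torus_shift:
 fixes f :: "real ^ 'd \<Rightarrow> real"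
 assumes f [measurable]: "f \<in> borel_measurable borel" and per: "periodic f" and i: "integrable TX f"
 shows "integrable TX (\<lambda>x. f (x + h))" "(LINT x|TX. f (x + h)) = (LINT x|TX. f x)"
proof -
 have m: "(\<lambda>x. f (x + h)) \<in> borel_measurable TX" by (intro measurable_torus) measurable
 have p: "periodic (\<lambda>x. ennreal (g (f x)))" for g using per by (simp add: periodic_def)
 show i2: "integrable TX (\<lambda>x. f (x + h))"
 proof (rule integrableI_bounded[OF m])
  have "(\<integral>\<^sup>+x. ennreal (norm (f (x + h))) \<partial>TX) = (\<integral>\<^sup>+x. ennreal (norm (f x)) \<partial>TX)"
   by (rule torus_nn_shift[of "\<lambda>x. ennreal (norm (f x))" h]) (use p[of norm] in auto)
  also have "\<dots> < \<infinity>" using i by (simp add: integrable_iff_bounded)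
  finally show "(\<integral>\<^sup>+x. ennreal (norm (f (x + h))) \<partial>TX) < \<infinity>" .
 qed
 show "(LINT x|TX. f (x + h)) = (LINT x|TX. f x)" unfolding real_lebesgue_integral_def[OF i] real_lebesgue_integral_def[OF i2]
  using torus_nn_shift[of "\<lambda>x. ennreal (f x)" h] torus_nn_shift[of "\<lambda>x. ennreal (- f x)" h] p[of "\<lambda>x. x"] p[of uminus] by simp
qed

lemma torus_center:
 fixes f :: "real ^ 'd \<Rightarrow> real"
 assumes f [measurable]: "f \<in> borel_measurable borel" and per: "periodic f" and i: "integrable TX f"
 shows "integrable lborel (\<lambda>x. indicator (unit_cell_at a) x * f x)"
  "(LINT x|lborel. indicator (unit_cell_at a) x * f x) = (LINT x|TX. f x)"
proof -
 have *: "indicator cell x * f (x + a) = indicator (unit_cell_at a) (x + a) * f (x + a)" for x by (auto simp: cell_eq unit_cell_at_def indicator_def)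
 have "integrable TX (\<lambda>x. f (x + a))" by (rule torus_shift(1)[OF assms])
 then have "integrable lborel (\<lambda>x. indicator cell x * f (x + a))" unfolding torus_measure_def by (subst (asm) integrable_restrict_space) auto
 then have i2: "integrable lborel (\<lambda>x. indicator (unit_cell_at a) (a + x) * f (a + x))" unfolding * by (simp add: add.commute)
 have m: "(\<lambda>x. indicator (unit_cell_at a) x * f x) \<in> borel_measurable borel" by measurable
 have "integrable (distr lborel borel ((+) a)) (\<lambda>x. indicator (unit_cell_at a) x * f x)" using i2 by (subst integrable_distr_eq) auto
 then show "integrable lborel (\<lambda>x. indicator (unit_cell_at a) x * f x)" by (simp add: lborel_distr_plus)
 have "(LINT x|lborel. indicator (unit_cell_at a) x * f x) = (\<integral>x. indicator (unit_cell_at a) x * f x \<partial>distr lborel borel ((+) a))"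
  by (simp add: lborel_distr_plus)
 also have "\<dots> = (LINT x|lborel. indicator (unit_cell_at a) (a + x) * f (a + x))" by (subst integral_distr) auto
 also have "\<dots> = (LINT x|TX. f (x + a))" unfolding integral_torus * by (simp add: add.commute)
 also have "\<dots> = (LINT x|TX. f x)" by (rule torus_shift(2)[OF assms])
 finally show "(LINT x|lborel. indicator (unit_cell_at a) x * f x) = (LINT x|TX. f x)" .
qed

lemma cell_box: "box 0 One \<subseteq> (cell :: (real ^ 'd) set)" "(cell :: (real ^ 'd) set) \<subseteq> cbox 0 One"
proof -
 have "One \<bullet> axis i (1::real) = 1" for i :: 'd
 proof -
  have "axis i (1::real) \<in> Basis" by (simp add: axis_in_Basis_iff)
  then have "One \<bullet> axis i (1::real) = (\<Sum>b\<in>Basis. if b = axis i (1::real) then 1 else 0)"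
   unfolding inner_sum_left by (intro sum.cong) (auto simp: inner_Basis)
  then show ?thesis using \<open>axis i (1::real) \<in> Basis\<close> by simp
 qed
 then have "One $ i = (1::real)" for i :: 'd by (simp add: inner_axis)
 then show "box 0 One \<subseteq> (cell :: (real ^ 'd) set)" "(cell :: (real ^ 'd) set) \<subseteq> cbox 0 One"
  by (auto simp: cell_def mem_box_cart less_imp_le)
qed

lemma emeasure_cell [simp]: "emeasure lborel (cell :: (real ^ 'd) set) = 1"
proof (rule antisym)
 have "emeasure lborel (cell :: (real ^ 'd) set) \<le> emeasure lborel (cbox 0 (One::real^'d))" by (intro emeasure_mono cell_box) auto
 also have "\<dots> = 1" by (subst emeasure_lborel_cbox) auto
 finally show "emeasure lborel (cell :: (real ^ 'd) set) \<le> 1" .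
 have "1 = emeasure lborel (box 0 (One::real^'d))" by (subst emeasure_lborel_box) auto
 also have "\<dots> \<le> emeasure lborel (cell :: (real ^ 'd) set)" by (intro emeasure_mono cell_box) auto
 finally show "1 \<le> emeasure lborel (cell :: (real ^ 'd) set)" .
qed

lemma emeasure_torus: "emeasure TX (space TX) = 1"
 unfolding space_torus unfolding torus_measure_def by (subst emeasure_restrict_space) auto

interpretation torus: finite_measure TX by (rule finite_measureI) (simp only: emeasure_torus, simp)

lemma measure_torus [simp]: "measure TX cell = 1"
 using emeasure_torus by (simp add: measure_def)

text \<open>Near interior points the distance of the torus is the Euclidean one.\<close>

lemma AE_torus_interior: "AE x in TX. x \<in> box 0 (One :: real ^ 'd)"
proof -
 have "emeasure lborel (cell - box 0 (One :: real ^ 'd)) = emeasure lborel (cell :: (real^'d) set) - emeasure lborel (box 0 (One :: real ^ 'd))"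
  by (rule emeasure_Diff) (use cell_box in auto)
 then have "cell - box 0 (One :: real ^ 'd) \<in> null_sets lborel" by (subst null_sets_def) (auto simp: emeasure_lborel_box)
 then have "AE x in lborel. x \<notin> cell - box 0 (One :: real ^ 'd)" by (rule AE_not_in)
 then show ?thesis unfolding torus_measure_def by (subst AE_restrict_space_iff) auto
qed

lemma torus_integrable_bounded:
 fixes f :: "real ^ 'd \<Rightarrow> real"
 assumes "f \<in> borel_measurable borel" "\<And>x. abs (f x) \<le> C"
 shows "integrable TX f" by (rule torus.integrable_const_bound[where B=C]) (use assms in \<open>auto intro: measurable_torus\<close>)

text \<open>The integral does not change under translation, so its derivative along translations is zero.\<close>

lemma torus_integral_deriv:
 fixes f g :: "real ^ 'd \<Rightarrow> real"
 assumes d: "\<And>x r. ((\<lambda>r. f (x + r *\<^sub>R e)) has_real_derivative g (x + r *\<^sub>R e)) (at r)"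
  and f: "f \<in> borel_measurable borel" and per: "periodic f" and fC: "\<And>x. abs (f x) \<le> C"
  and g: "g \<in> borel_measurable borel" and gC: "\<And>x. abs (g x) \<le> C"
 shows "(LINT x|TX. g x) = 0"
proof -
 note f[measurable] g[measurable]
 let ?q = "\<lambda>n x. (f (x + (1 / real (Suc n)) *\<^sub>R e) - f x) / (1 / real (Suc n))"
 have fi: "integrable TX f" using f fC by (rule torus_integrable_bounded)
 have "(\<lambda>n. (LINT x|TX. ?q n x)) \<longlonglongrightarrow> (LINT x|TX. g x)"
 proof (rule integral_dominated_convergence[where w="\<lambda>_. C"])
  show "g \<in> borel_measurable TX" using g by (rule measurable_torus)
  show "?q n \<in> borel_measurable TX" for n by (rule measurable_torus) measurable
  show "AE x in TX. (\<lambda>n. ?q n x) \<longlonglongrightarrow> g x"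
  proof (rule AE_I2)
   fix x
   have "((\<lambda>r. (f (x + r *\<^sub>R e) - f x) / r) \<longlongrightarrow> g x) (at 0)" using d[of x 0] by (simp add: DERIV_def)
   moreover have "filterlim (\<lambda>n. 1 / real (Suc n)) (at 0) sequentially"
    using LIMSEQ_inverse_real_of_nat by (auto simp: filterlim_at inverse_eq_divide)
   ultimately show "(\<lambda>n. ?q n x) \<longlonglongrightarrow> g x" by (rule filterlim_compose)
  qed
  show "AE x in TX. norm (?q n x) \<le> C" for n
  proof (rule AE_I2)
   fix x
   have "\<exists>z. 0 < z \<and> z < 1 / real (Suc n) \<and> f (x + (1 / real (Suc n)) *\<^sub>R e) - f (x + 0 *\<^sub>R e) = (1 / real (Suc n) - 0) * g (x + z *\<^sub>R e)"
    using d by (intro MVT2) auto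
   then obtain z where "f (x + (1 / real (Suc n)) *\<^sub>R e) - f x = (1 / real (Suc n)) * g (x + z *\<^sub>R e)" by (auto simp del: of_nat_Suc)
   then have "?q n x = g (x + z *\<^sub>R e)" by simp
   then show "norm (?q n x) \<le> C" using gC by simp
  qed
 qed simp
 moreover have "(LINT x|TX. ?q n x) = 0" for n using torus_shift[OF f per fi, of "(1 / real (Suc n)) *\<^sub>R e"] fi by (simp del: of_nat_Suc)
 ultimately show ?thesis by (simp add: LIMSEQ_const_iff)
qed

section \<open>The space kernel\<close>

text \<open>Equal to one exactly on the lattice of periods; high powers of it concentrate there. This gives smooth periodic
 kernels without any periodisation.\<close>

definition trig :: "real ^ 'd \<Rightarrow> real" where
 "trig x = (\<Prod>i\<in>UNIV. (1 + cos (2 * pi * x $ i)) / 2)"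

lemma cos_half_range: "0 \<le> (1 + cos t) / 2" "(1 + cos t) / 2 \<le> 1" for t :: real
proof -
 have "0 \<le> 1 + cos t" using add_left_mono[OF cos_ge_minus_one[of t], of 1] by simp
 then show "0 \<le> (1 + cos t) / 2" by (rule divide_nonneg_pos) simp
 have "1 + cos t \<le> 2" using add_left_mono[OF cos_le_one[of t], of 1] by simp
 then show "(1 + cos t) / 2 \<le> 1" by simp
qed

lemma trig_range: fixes x :: "real ^ 'd" shows "0 \<le> trig x" "trig x \<le> 1"
proof -
 show "0 \<le> trig x" "trig x \<le> 1" unfolding trig_def by (intro prod_nonneg prod_le_1 conjI cos_half_range)+
qed

lemma trig_0 [simp]: "trig 0 = 1" by (simp add: trig_def)

lemma trig_minus: "trig (- x) = trig x" by (simp add: trig_def)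

lemma periodic_trig: "periodic trig"
proof -
 have *: "cos (2 * pi * (x + axis i 1) $ j) = cos (2 * pi * x $ j)" for x :: "real ^ 'd" and i j by (cases "i = j") (auto simp: axis_def distrib_left)
 then show ?thesis unfolding periodic_def trig_def by (simp only: * simp_thms)
qed

lemma smooth_trig: "smooth (trig :: real ^ 'd \<Rightarrow> real)"
proof -
 have "Ck k (\<lambda>x :: real ^ 'd. cos (2 * pi * x $ i + 0))" for k i by (rule Ck_affine[where L="\<lambda>x :: real ^ 'd. 2 * pi * x $ i"])
   (use smooth_cos_sin in \<open>auto simp: smooth_def intro!: bounded_linear_intros\<close>)
 then have "Ck k (\<lambda>x :: real ^ 'd. (1 / 2) * (1 + cos (2 * pi * x $ i)))" for k i by (intro Ck_cmult Ck_add) auto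
 then show ?thesis unfolding smooth_def trig_def[abs_def] by (intro allI Ck_prod) simp
qed

lemma continuous_trig: "continuous_on S (trig :: real ^ 'd \<Rightarrow> real)"
 by (intro smooth_continuous smooth_trig)

lemma trig_borel [measurable]: "(trig :: real ^ 'd \<Rightarrow> real) \<in> borel_measurable borel"
 by (intro borel_measurable_continuous_onI continuous_trig)

definition kappa :: "nat \<Rightarrow> real ^ 'd \<Rightarrow> real" where
 "kappa n x = trig x ^ n / (LINT x|(TX :: (real ^ 'd) measure). trig x ^ n)"

lemma trig_power_integrable: "integrable TX (\<lambda>x :: real ^ 'd. trig x ^ n)"
 by (rule torus_integrable_bounded[where C=1]) (auto simp: trig_range power_le_one)

text \<open>The mass of \<open>trig\<^sup>n\<close> decays more slowly than any \<open>r\<^sup>n\<close> with \<open>r < 1\<close>, while away from the lattice \<open>trig\<^sup>n\<close> itself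
 decays like such a power.\<close>

lemma trig_mass_lower:
 fixes r :: real
 assumes "0 \<le> r" "r < 1"
 obtains m where "m > 0" "\<And>n. r ^ n * m \<le> (LINT x|(TX :: (real ^ 'd) measure). trig x ^ n)"
proof -
 have "continuous_on UNIV (trig :: real^'d \<Rightarrow> real)" by (rule continuous_trig)
 then have "isCont (trig :: real^'d \<Rightarrow> real) 0" by (simp add: continuous_on_eq_continuous_at)
 then have "((trig :: real^'d \<Rightarrow> real) \<longlongrightarrow> trig (0 :: real ^ 'd)) (nhds 0)"
  by (simp only: isCont_def tendsto_at_iff_tendsto_nhds)
 then have "eventually (\<lambda>x::real^'d. trig x > r) (nhds 0)" by (rule order_tendstoD) (use assms in simp)
 then obtain d where d: "d > 0" "\<And>x::real^'d. dist x 0 < d \<Longrightarrow> trig x > r" by (auto simp: eventually_nhds_metric)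
 define V :: "(real^'d) set" where "V = box 0 One \<inter> ball 0 d"
 define e where "e = min (1/2) (d / (2 * (1 + norm (One :: real ^ 'd))))"
 have e: "0 < e" "e < 1" using d by (auto simp: e_def add_pos_nonneg)
 have eOne: "e *\<^sub>R One \<in> V"
 proof -
  have "e * norm (One :: real ^ 'd) \<le> e * (1 + norm (One :: real^'d))" using e by simp
  also have "\<dots> \<le> d / (2 * (1 + norm (One :: real ^ 'd))) * (1 + norm (One :: real^'d))" by (intro mult_right_mono) (auto simp: e_def)
  also have "\<dots> = d / 2"
  proof -
   have "1 + norm (One :: real ^ 'd) \<noteq> 0" using norm_ge_zero[of "One :: real ^ 'd"] by linarith
   then show ?thesis by (simp add: field_simps)
  qed
  also have "\<dots> < d" using d by simp
  finally show ?thesis using e by (simp add: V_def mem_box dist_norm)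
 qed
 have oV: "open V" by (auto simp: V_def open_box)
 define m where "m = measure lborel V"
 have Vfin: "emeasure lborel V < \<infinity>"
 proof -
  have "emeasure lborel V \<le> emeasure lborel (ball 0 d :: (real^'d) set)" by (intro emeasure_mono) (auto simp: V_def)
  then show ?thesis using emeasure_bounded_finite[of "ball 0 d :: (real^'d) set"] by (auto simp: top.not_eq_extremum intro: le_less_trans)
 qed
 have "emeasure lborel V \<noteq> 0"
 proof
  assume "emeasure lborel V = 0"
  then have "negligible V" using oV by (simp add: negligible_iff_null_sets null_sets_def null_sets_completionI)
  then show False using open_not_negligible[OF oV] eOne by auto
 qed
 then have m: "m > 0" using Vfin by (simp add: m_def measure_def enn2real_positive_iff zero_less_iff_neq_zero)
 show thesis
 proof
  show "m > 0" by fact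
  fix n
  have "r ^ n * m = (LINT x|lborel. indicator V x * r ^ n)" using oV Vfin by (simp add: m_def)
  also have "\<dots> \<le> (LINT x|(lborel :: (real ^ 'd) measure). indicator cell x * trig x ^ n)"
  proof (intro integral_mono)
   show "integrable lborel (\<lambda>x. indicator V x * r ^ n)" using oV Vfin by (intro integrable_mult_left) auto
   show "integrable lborel (\<lambda>x::real^'d. indicator cell x * trig x ^ n)"
    using trig_power_integrable[of n] unfolding torus_measure_def by (subst (asm) integrable_restrict_space) auto
   show "indicator V x * r ^ n \<le> indicator cell x * trig x ^ n" for x :: "real ^ 'd"
   proof (cases "x \<in> V")
    case True
    then have "x \<in> cell" "r \<le> trig x" using cell_box d(2)[of x] by (auto simp: V_def)
    then show ?thesis using True assms by (simp add: power_mono)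
   qed (simp add: trig_range)
  qed
  also have "\<dots> = (LINT x|(TX :: (real ^ 'd) measure). trig x ^ n)" by (simp add: integral_torus)
  finally show "r ^ n * m \<le> (LINT x|(TX :: (real ^ 'd) measure). trig x ^ n)" .
 qed
qed

lemma trig_mass_pos: "0 < (LINT x|(TX :: (real ^ 'd) measure). trig x ^ n)"
proof -
 obtain m where "m > 0" "\<And>n. (1/2) ^ n * m \<le> (LINT x|(TX :: (real ^ 'd) measure). trig x ^ n)" using trig_mass_lower[of "1/2"] by auto
 then show ?thesis by (meson less_le_trans mult_pos_pos zero_less_power half_gt_zero zero_less_one)
qed

lemma kappa_nonneg: "0 \<le> kappa n (x :: real ^ 'd)"
 using trig_mass_pos[of n, where 'd='d] by (simp add: kappa_def trig_range less_imp_le)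

lemma kappa_minus: "kappa n (- x) = kappa n x" by (simp add: kappa_def trig_minus)

lemma kappa_minus_commute: "kappa n (x - y) = kappa n (y - x)" using kappa_minus[of n "x - y"] by simp

lemma periodic_kappa: "periodic (kappa n :: real ^ 'd \<Rightarrow> real)"
 using periodic_trig[where 'a='d] by (simp add: periodic_def kappa_def)

lemma smooth_kappa: "smooth (kappa n :: real ^ 'd \<Rightarrow> real)"
proof -
 have "smooth (\<lambda>x :: real^'d. (1 / (LINT x|(TX :: (real ^ 'd) measure). trig x ^ n)) * trig x ^ n)"
  using smooth_trig[where 'd='d] unfolding smooth_def by (intro allI Ck_cmult Ck_power) auto
 then show ?thesis by (simp add: kappa_def[abs_def])
qed

lemma kappa_borel [measurable]: "(kappa n :: real ^ 'd \<Rightarrow> real) \<in> borel_measurable borel"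
 by (intro borel_measurable_continuous_onI smooth_continuous smooth_kappa)

lemma kappa_bounded: "\<exists>C. \<forall>x :: real ^ 'd. abs (kappa n x) \<le> C"
proof (intro exI allI)
 fix x :: "real ^ 'd" show "abs (kappa n x) \<le> 1 / (LINT x|(TX :: (real ^ 'd) measure). trig x ^ n)"
  using trig_mass_pos[of n, where 'd='d] kappa_nonneg[of n x] by (simp add: kappa_def divide_right_mono power_le_one trig_range)
qed

lemma kappa_integrable: "integrable TX (kappa n)"
 unfolding kappa_def[abs_def] by (intro integrable_divide_zero trig_power_integrable)

lemma kappa_integral: "(LINT x|(TX :: (real ^ 'd) measure). kappa n x) = 1"
 using trig_mass_pos[of n, where 'd='d] unfolding kappa_def[abs_def] by simp

text \<open>The period cell centred at the origin, in which the kernel concentrates at a single point.\<close>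

abbreviation ccell :: "(real ^ 'd) set" where "ccell \<equiv> unit_cell_at (\<chi> i. - 1 / 2)"

lemma trig_away:
 assumes "d > 0"
 obtains r where "0 \<le> r" "r < 1" "\<And>x::real^'d. x \<in> ccell \<Longrightarrow> norm x \<ge> d \<Longrightarrow> trig x \<le> r"
proof
 define c where "c = min (1/2) (d / real CARD('d))"
 have c: "0 < c" "c \<le> 1/2" unfolding c_def using assms by - (simp, rule min.cobounded1)
 let ?r = "(1 + cos (2 * pi * c)) / 2"
 show "0 \<le> ?r" by (rule cos_half_range)
 have "cos (2 * pi * c) < cos 0" 
 proof (rule cos_monotone_0_pi)
  show "0 < 2 * pi * c" using c by simp
  have "2 * pi * c \<le> 2 * pi * (1/2)" using c by (intro mult_left_mono) auto
  then show "2 * pi * c \<le> pi" by simp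
 qed simp
 then show "?r < 1" by simp
 fix x :: "real ^ 'd" assume x: "x \<in> ccell" "norm x \<ge> d"
 obtain i where i: "\<bar>x $ i\<bar> \<ge> c"
 proof (rule ccontr)
  assume "\<not> thesis"
  then have "\<bar>x $ i\<bar> < c" for i using that[of i] by (metis not_le)
  then have "\<And>i. \<bar>x $ i\<bar> < d / real CARD('d)" by (auto simp: c_def)
  then have "(\<Sum>i\<in>UNIV. \<bar>x $ i\<bar>) < (\<Sum>i\<in>(UNIV::'d set). d / real CARD('d))" by (intro sum_strict_mono) auto
  then have "norm x < d" using norm_le_l1_cart[of x] by simp
  then show False using x by simp
 qed
 have "- 1 / 2 \<le> x $ i \<and> x $ i < - 1 / 2 + 1" using x(1) by (simp add: unit_cell_at_def)
 then have xi: "\<bar>x $ i\<bar> \<le> 1/2" by linarith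
 have "cos (2 * pi * x $ i) = cos (2 * pi * \<bar>x $ i\<bar>)" by (cases "x $ i \<ge> 0") auto
 also have "\<dots> \<le> cos (2 * pi * c)" 
 proof (rule cos_monotone_0_pi_le)
  show "0 \<le> 2 * pi * c" using c by simp
  show "2 * pi * c \<le> 2 * pi * \<bar>x $ i\<bar>" using i by simp
  have "2 * pi * \<bar>x $ i\<bar> \<le> 2 * pi * (1/2)" using xi by (intro mult_left_mono) auto
  then show "2 * pi * \<bar>x $ i\<bar> \<le> pi" by simp
 qed
 finally have 1: "(1 + cos (2 * pi * x $ i)) / 2 \<le> ?r" by simp
 have "trig x = (1 + cos (2 * pi * x $ i)) / 2 * (\<Prod>j\<in>UNIV - {i}. (1 + cos (2 * pi * x $ j)) / 2)"
  unfolding trig_def by (rule prod.remove) auto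
 also have "\<dots> \<le> ?r * 1"
 proof (intro mult_mono 1)
  show "(\<Prod>j\<in>UNIV - {i}. (1 + cos (2 * pi * x $ j)) / 2) \<le> 1" "0 \<le> (\<Prod>j\<in>UNIV - {i}. (1 + cos (2 * pi * x $ j)) / 2)"
   by (intro prod_nonneg prod_le_1 conjI cos_half_range)+
  show "0 \<le> ?r" by (rule cos_half_range)
 qed
 finally show "trig x \<le> ?r" by simp
qed

lemma ccell_integrable:
 fixes f :: "real ^ 'd \<Rightarrow> real"
 assumes [measurable]: "A \<in> sets borel" "f \<in> borel_measurable borel" and "A \<subseteq> ccell" and C: "\<And>x. abs (f x) \<le> C"
 shows "integrable lborel (\<lambda>x. indicator A x * f x)"
proof -
 have "integrable lborel (\<lambda>x. indicator (ccell :: (real ^ 'd) set) x * (1::real))"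
  by (rule torus_center(1)) (auto simp: periodic_def intro!: torus_integrable_bounded[where C=1])
 then have "integrable lborel (\<lambda>x. C * indicator (ccell :: (real ^ 'd) set) x)" by simp
 then show ?thesis
 proof (rule B_integrable_bound)
  show "AE x in lborel. norm (indicator A x * f x) \<le> norm (C * indicator (ccell :: (real ^ 'd) set) x)"
  proof (rule AE_I2)
   fix x
   show "norm (indicator A x * f x) \<le> norm (C * indicator (ccell :: (real ^ 'd) set) x)"
    using assms(3) order_trans[OF C[of x] abs_ge_self] by (auto simp: indicator_def)
  qed
 qed measurable
qed

lemma kappa_tail_tendsto:
 assumes "d > 0"
 shows "(\<lambda>n. (LINT x|(lborel :: (real ^ 'd) measure). indicator (ccell - ball 0 d) x * kappa n x)) \<longlonglongrightarrow> 0"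
proof -
 obtain r where r: "0 \<le> r" "r < 1" "\<And>x::real^'d. x \<in> ccell \<Longrightarrow> norm x \<ge> d \<Longrightarrow> trig x \<le> r"
  using trig_away[OF assms] by blast
 define R where "R = (1 + r) / 2"
 have R: "0 < R" "R < 1" "r < R" using r by (auto simp: R_def)
 obtain m where m: "m > 0" "\<And>n. R ^ n * m \<le> (LINT x|(TX :: (real ^ 'd) measure). trig x ^ n)" using trig_mass_lower[of R] R by auto
 have le: "(LINT x|(lborel :: (real ^ 'd) measure). indicator (ccell - ball 0 d) x * kappa n x) \<le> (r / R) ^ n / m" for n
 proof -
  have b: "indicator (ccell - ball 0 d) x * kappa n x \<le> indicator ccell x * ((r / R) ^ n / m)" for x :: "real ^ 'd"
  proof (cases "x \<in> ccell - ball 0 d")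
   case True
   then have "trig x ^ n \<le> r ^ n" using r(3)[of x] trig_range by (intro power_mono) (auto simp: dist_norm)
   then have "kappa n x \<le> r ^ n / (R ^ n * m)" unfolding kappa_def using m R r by (intro frac_le) auto
   then show ?thesis using True by (simp add: power_divide)
  next
   case False
   have "0 \<le> indicator ccell x * ((r / R) ^ n / m)" using r R m by (intro mult_nonneg_nonneg) auto
   then show ?thesis using False by (simp only: indicator_simps mult_zero_left not_False_eq_True)
  qed
  have one: "(\<lambda>_. 1 :: real) \<in> borel_measurable borel" "periodic (\<lambda>_ :: real ^ 'd. 1 :: real)"
    "integrable TX (\<lambda>_ :: real ^ 'd. 1 :: real)" by (auto simp: periodic_def intro!: torus_integrable_bounded[where C=1])
  have "(LINT x|(lborel :: (real ^ 'd) measure). indicator ccell x * (1::real)) = (LINT x|(TX :: (real ^ 'd) measure). 1)"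
   by (rule torus_center(2)[OF one])
  then have c: "integrable lborel (\<lambda>x. indicator (ccell :: (real ^ 'd) set) x * (1::real))"
    "(LINT x|(lborel :: (real ^ 'd) measure). indicator ccell x) = (1 :: real)"
   using torus_center(1)[OF one] by (simp_all only: mult_1_right lebesgue_integral_const measure_torus space_torus, simp)
  obtain C where C: "\<And>x::real^'d. abs (kappa n x) \<le> C" using kappa_bounded by blast
  have "(LINT x|(lborel :: (real ^ 'd) measure). indicator (ccell - ball 0 d) x * kappa n x) \<le> (LINT x|(lborel :: (real ^ 'd) measure). indicator ccell x * ((r / R) ^ n / m))"
  proof (rule integral_mono[OF _ _ b])
   show "integrable lborel (\<lambda>x :: real ^ 'd. indicator ccell x * ((r / R) ^ n / m))" using c(1) by (intro integrable_mult_left) simp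
   show "integrable lborel (\<lambda>x :: real ^ 'd. indicator (ccell - ball 0 d) x * kappa n x)"
    by (rule ccell_integrable[where C=C]) (use C in auto)
  qed
  also have "\<dots> = (r / R) ^ n / m" using c(2) by (simp only: integral_mult_left_zero mult_1_left)
  finally show ?thesis .
 qed
 have "(\<lambda>n. (r / R) ^ n / m) \<longlonglongrightarrow> 0 / m" using r R m by (intro tendsto_intros LIMSEQ_power_zero) auto
 then have "(\<lambda>n. (r / R) ^ n / m) \<longlonglongrightarrow> 0" by simp
 then show ?thesis by (rule tendsto_sandwich[rotated 2, OF tendsto_const])
   (use le kappa_nonneg in \<open>auto intro!: always_eventually B_integral_nonneg mult_nonneg_nonneg\<close>)
qed

lemma kappa_shift_integral:
 fixes f :: "real ^ 'd \<Rightarrow> real"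
 assumes [measurable]: "f \<in> borel_measurable borel" and per: "periodic f" and C: "\<And>x. abs (f x) \<le> C"
 shows "(LINT y|TX. kappa n (x - y) * f y) = (LINT z|lborel. indicator ccell z * (kappa n z * f (x + z)))"
proof -
 obtain D where D: "\<And>x::real^'d. abs (kappa n x) \<le> D" using kappa_bounded by blast
 have D0: "0 \<le> D" using D[of 0] by linarith
 have p: "periodic (\<lambda>y. kappa n y * f (x + y))" using periodic_kappa per unfolding periodic_def by (metis add.assoc)
 have i: "integrable TX (\<lambda>y. kappa n y * f (x + y))"
  by (rule torus_integrable_bounded[where C="D * C"]) (auto simp: abs_mult intro!: mult_mono D C D0)
 have "(LINT y|TX. kappa n (x - y) * f y) = (LINT y|TX. kappa n (y + (- x)) * f (x + (y + (- x))))" by (simp add: kappa_minus_commute[of n x])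
 also have "\<dots> = (LINT y|TX. kappa n y * f (x + y))" by (rule torus_shift(2)[OF _ p i]) measurable
 also have "\<dots> = (LINT z|lborel. indicator ccell z * (kappa n z * f (x + z)))" by (rule torus_center(2)[symmetric, OF _ p i]) measurable
 finally show ?thesis .
qed

lemma kappa_row: "(LINT y|TX. kappa n (x - y)) = 1" "(LINT x|TX. kappa n (x - y)) = 1"
 "(LINT z|lborel. indicator ccell z * kappa n z) = 1"
proof -
 show 1: "(LINT x|TX. kappa n (x - y)) = 1" for y :: "real ^ 'd"
  using torus_shift(2)[OF kappa_borel periodic_kappa kappa_integrable, of n "- y"] by (simp add: kappa_integral)
 show "(LINT y|TX. kappa n (x - y)) = 1" using 1[of x] by (simp add: kappa_minus_commute[of n x])
 show "(LINT z|lborel. indicator (ccell :: (real^'d) set) z * kappa n z) = 1"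
  using torus_center(2)[OF kappa_borel periodic_kappa kappa_integrable] by (simp add: kappa_integral)
qed

lemma approx_identity_kappa: "approx_identity (cell :: (real ^ 'd) set) (\<lambda>n x y. kappa n (x - y))"
proof
 fix n
 show "(cell :: (real ^ 'd) set) \<in> sets borel" by simp
 show "emeasure lborel (cell :: (real ^ 'd) set) < \<infinity>" by simp
 show "(\<lambda>p :: (real ^ 'd) \<times> (real ^ 'd). kappa n (fst p - snd p)) \<in> borel_measurable borel"
  by (rule borel_measurable_continuous_onI, rule continuous_on_compose2[OF smooth_continuous[OF smooth_kappa] _ subset_UNIV])
   (intro continuous_intros)
 show "0 \<le> kappa n (a - b)" for a b :: "real ^ 'd" by (rule kappa_nonneg)
 show "\<exists>C. \<forall>a b :: real ^ 'd. kappa n (a - b) \<le> C" 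
 proof -
  obtain C where "\<forall>x :: real ^ 'd. abs (kappa n x) \<le> C" using kappa_bounded by blast
  then show ?thesis by (intro exI[of _ C]) (auto simp: abs_le_iff)
 qed
 show "(\<integral>b. kappa n (a - b) \<partial>restrict_space lborel cell) \<le> 1" for a :: "real ^ 'd"
  unfolding torus_measure_def[symmetric] by (simp only: kappa_row)
 show "(\<integral>b. kappa n (b - a) \<partial>restrict_space lborel cell) \<le> 1" for a :: "real ^ 'd"
  unfolding torus_measure_def[symmetric] by (simp only: kappa_row)
next
 have "AE a :: real ^ 'd in TX. \<forall>d>0. (\<lambda>n. (LINT b|TX. indicator (ball a d) b * kappa n (a - b))) \<longlonglongrightarrow> (1::real)"
  using AE_torus_interior
 proof eventually_elim
  case (elim a)
  show ?case
  proof (intro allI impI)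
   fix d :: real assume "d > 0"
   obtain d' where d': "d' > 0" "ball a d' \<subseteq> box 0 (One :: real ^ 'd)" by (rule openE[OF open_box elim])
   define e where "e = min (min d d') (1/2)"
   have "ball a e \<subseteq> ball a d'" by (rule subset_ball) (simp add: e_def)
   then have e: "e > 0" "e \<le> d" "ball a e \<subseteq> cell" "e \<le> 1/2"
    using d'(1) \<open>d > 0\<close> order_trans[OF order_trans[OF _ d'(2)] cell_box(1)] by (simp_all add: e_def)
   have sub: "ball 0 e \<subseteq> (ccell :: (real ^ 'd) set)"
   proof
    fix x :: "real ^ 'd" assume "x \<in> ball 0 e"
    then have "norm x < 1/2" using e by (simp add: dist_norm)
    then have "\<bar>x $ i\<bar> < 1/2" for i using component_le_norm_cart[of x i] by simp
    then have "- 1 / 2 \<le> x $ i \<and> x $ i < - 1 / 2 + 1" for i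
    proof -
     show ?thesis using \<open>\<And>i. \<bar>x $ i\<bar> < 1 / 2\<close>[of i] by linarith
    qed
    then show "x \<in> ccell" by (simp add: unit_cell_at_def)
   qed
   define tail where "tail n = (LINT x|(lborel :: (real ^ 'd) measure). indicator (ccell - ball 0 e) x * kappa n x)" for n
   have i1: "integrable TX (\<lambda>b. indicator S b * kappa n (a - b))" if [measurable]: "S \<in> sets borel" for S n
   proof -
    obtain D where D: "\<And>x::real^'d. abs (kappa n x) \<le> D" using kappa_bounded by blast
    show ?thesis by (rule torus_integrable_bounded[where C=D]) (use D order_trans[OF abs_ge_zero D] in \<open>auto simp: indicator_def\<close>)
   qed
   have low: "1 - tail n \<le> (LINT b|TX. indicator (ball a d) b * kappa n (a - b))" for n
   proof -
    obtain D where D: "\<And>x::real^'d. abs (kappa n x) \<le> D" using kappa_bounded by blast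
    have "1 - tail n = (LINT z|(lborel :: (real ^ 'd) measure). indicator ccell z * kappa n z) - (LINT z|(lborel :: (real ^ 'd) measure). indicator (ccell - ball 0 e) z * kappa n z)"
     by (simp only: kappa_row tail_def)
    also have "\<dots> = (LINT z|(lborel :: (real ^ 'd) measure). indicator ccell z * kappa n z - indicator (ccell - ball 0 e) z * kappa n z)"
    proof -
     have "integrable lborel (\<lambda>z. indicator A z * kappa n z)" if "A \<in> sets borel" "A \<subseteq> ccell" for A :: "(real ^ 'd) set"
      by (rule ccell_integrable[where C=D]) (use that D in auto)
     from this[of ccell] this[of "ccell - ball 0 e"] show ?thesis by (intro B_integral_diff[symmetric]) auto
    qed
    also have "\<dots> = (LINT z|(lborel :: (real ^ 'd) measure). indicator (ball 0 e) z * kappa n z)"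
     using sub by (intro B_integral_cong) (auto simp: indicator_def)
    also have "\<dots> = (\<integral>z. indicator (ball 0 e) z * kappa n z \<partial>distr (lborel :: (real ^ 'd) measure) borel ((+) (- a)))"
     by (simp add: lborel_distr_plus)
    also have "\<dots> = (LINT b|(lborel :: (real ^ 'd) measure). indicator (ball 0 e) (- a + b) * kappa n (- a + b))"
    proof (rule integral_distr)
     have [measurable]: "ball 0 e \<in> sets (borel :: (real ^ 'd) measure)" by simp
     show "(\<lambda>z :: real ^ 'd. indicator (ball 0 e) z * kappa n z) \<in> borel_measurable borel" by measurable
    qed simp
    also have "\<dots> = (LINT b|(lborel :: (real ^ 'd) measure). indicator cell b * (indicator (ball a e) b * kappa n (a - b)))"
    proof (intro B_integral_cong refl)
     fix b
     have "b \<in> ball a e \<longleftrightarrow> - a + b \<in> ball 0 e" by (simp add: dist_norm norm_minus_commute)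
     moreover have "kappa n (a - b) = kappa n (- a + b)" using kappa_minus_commute[of n a b] by simp
     ultimately show "indicator (ball 0 e) (- a + b) * kappa n (- a + b) = indicator cell b * (indicator (ball a e) b * kappa n (a - b))"
      using e(3) by (cases "b \<in> ball a e") auto
    qed
    also have "\<dots> = (LINT b|TX. indicator (ball a e) b * kappa n (a - b))" by (simp add: integral_torus)
    also have "\<dots> \<le> (LINT b|TX. indicator (ball a d) b * kappa n (a - b))"
     using e(2) kappa_nonneg by (intro integral_mono i1) (auto simp: indicator_def)
    finally show ?thesis .
   qed
   have up: "(LINT b|TX. indicator (ball a d) b * kappa n (a - b)) \<le> 1" for n
   proof -
    have "(LINT b|TX. indicator (ball a d) b * kappa n (a - b)) \<le> (LINT b|TX. indicator UNIV b * kappa n (a - b))"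
     using kappa_nonneg by (intro integral_mono i1) (auto simp: indicator_def)
    then show ?thesis by (simp add: kappa_row)
   qed
   have "(\<lambda>n. 1 - tail n) \<longlonglongrightarrow> 1 - 0" using e unfolding tail_def by (intro tendsto_intros kappa_tail_tendsto)
   then have lim: "(\<lambda>n. 1 - tail n) \<longlonglongrightarrow> 1" by simp
   show "(\<lambda>n. (LINT b|TX. indicator (ball a d) b * kappa n (a - b))) \<longlonglongrightarrow> 1"
    by (rule tendsto_sandwich[OF _ _ lim tendsto_const]) (simp_all only: low up eventually_True)
  qed
 qed
 then show "AE a in restrict_space lborel (cell :: (real^'d) set). \<forall>d>0. (\<lambda>n. \<integral>b. indicator (ball a d) b * kappa n (a - b) \<partial>restrict_space lborel cell) \<longlonglongrightarrow> (1::real)"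
  unfolding torus_measure_def .
qed

text \<open>For \<open>t < T\<close> the window \<open>(t, t + 2 / (n + 1))\<close> is eventually contained in \<open>[0,T)\<close>, so the row has full mass.\<close>

lemma approx_identity_theta:
 assumes T: "0 < T"
 shows "approx_identity {0..<T} (\<lambda>n t s. theta n (t - s))"
proof
 fix n
 show "{0..<T} \<in> sets borel" "emeasure lborel {0..<T} < \<infinity>" using T by auto
 have c: "continuous_on UNIV (theta n)" by (intro smooth_continuous smooth_theta)
 then have m [measurable]: "theta n \<in> borel_measurable borel" for n by (intro borel_measurable_continuous_onI smooth_continuous smooth_theta)
 show "(\<lambda>p. theta n (fst p - snd p)) \<in> borel_measurable borel"
  by (rule borel_measurable_continuous_onI, rule continuous_on_compose2[OF c _ subset_UNIV])
   (intro continuous_intros)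
 show "0 \<le> theta n (a - b)" for a b by (rule theta_nonneg)
 have "compact (theta n ` {-2 / real (Suc n).. -1 / real (Suc n)})" by (intro compact_continuous_image continuous_on_subset[OF c]) auto
 then have "bounded (theta n ` {-2 / real (Suc n).. -1 / real (Suc n)})" by (rule compact_imp_bounded)
 then obtain C where "\<forall>x \<in> theta n ` {-2 / real (Suc n).. -1 / real (Suc n)}. norm x \<le> C" unfolding bounded_iff by blast
 then have C: "\<And>t. t \<in> {-2 / real (Suc n).. -1 / real (Suc n)} \<Longrightarrow> theta n t \<le> C" by (force simp: abs_le_iff)
 have "theta n t \<le> max C 0" for t
  by (cases "t \<in> {-2 / real (Suc n).. -1 / real (Suc n)}") (use C[of t] theta_zero[of t n] in \<open>auto simp del: of_nat_Suc\<close>)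
 then show "\<exists>C. \<forall>a b. theta n (a - b) \<le> C" by blast
 have i1: "integrable lborel (\<lambda>b. theta n (a - b))" and e1: "(LINT b|lborel. theta n (a - b)) = 1" for a n
  using lborel_integrable_real_affine[OF integrable_theta[of n], of "-1" a]
   lborel_integral_real_affine[of "-1" "theta n" a] by (auto simp: integral_theta)
 have i2: "integrable lborel (\<lambda>b. theta n (b - a))" and e2: "(LINT b|lborel. theta n (b - a)) = 1" for a n
  using lborel_integrable_real_affine[OF integrable_theta[of n], of 1 "- a"]
   lborel_integral_real_affine[of 1 "theta n" "- a"] by (auto simp: integral_theta)
 have le: "(\<integral>b. f b \<partial>restrict_space lborel {0..<T}) \<le> (LINT b|lborel. f b)" if "integrable lborel f" "\<And>b. 0 \<le> f b" for f :: "real \<Rightarrow> real"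
  using that by (subst integral_restrict_space) (auto intro!: integral_mono' simp: indicator_def)
 show "(\<integral>b. theta n (a - b) \<partial>restrict_space lborel {0..<T}) \<le> 1" for a using le[OF i1[of n a] theta_nonneg] by (simp add: e1)
 show "(\<integral>b. theta n (b - a) \<partial>restrict_space lborel {0..<T}) \<le> 1" for a using le[OF i2[of n a] theta_nonneg] by (simp add: e2)
next
 have "(\<lambda>n. \<integral>b. indicator (ball a d) b * theta n (a - b) \<partial>restrict_space lborel {0..<T}) \<longlonglongrightarrow> (1::real)"
  if a: "a \<in> {0..<T}" and d: "d > 0" for a d
 proof (rule tendsto_eventually)
  have "(\<lambda>n. 2 / real (Suc n)) \<longlonglongrightarrow> 0" by (rule LIMSEQ_Suc) (rule lim_const_over_n)
  then have "eventually (\<lambda>n. 2 / real (Suc n) < min d (T - a)) sequentially" using a d by (intro order_tendstoD) auto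
  then show "eventually (\<lambda>n. (\<integral>b. indicator (ball a d) b * theta n (a - b) \<partial>restrict_space lborel {0..<T}) = 1) sequentially"
  proof eventually_elim
   case (elim n)
   have "(\<integral>b. indicator (ball a d) b * theta n (a - b) \<partial>restrict_space lborel {0..<T}) = (LINT b|lborel. theta n (a - b))"
   proof (subst integral_restrict_space, simp, intro B_integral_cong refl)
    fix b
    show "indicator {0..<T} b *\<^sub>R (indicator (ball a d) b * theta n (a - b)) = theta n (a - b)"
    proof (cases "a - b \<in> {-2 / real (Suc n)<..< -1 / real (Suc n)}")
     case True
     moreover have "0 < 1 / real (Suc n)" by simp
     ultimately have "0 < b - a" "b - a < 2 / real (Suc n)" unfolding greaterThanLessThan_iff minus_divide_left[symmetric] by linarith+
     then have "b \<in> {0..<T}" "b \<in> ball a d" using elim a by (auto simp: dist_real_def)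
     then show ?thesis by simp
    qed (simp add: theta_zero del: of_nat_Suc)
   qed
   also have "\<dots> = 1" using lborel_integral_real_affine[of "-1" "theta n" a] by (auto simp: integral_theta)
   finally show ?case .
  qed
 qed
 then show "AE a in restrict_space lborel {0..<T}. \<forall>d>0. (\<lambda>n. \<integral>b. indicator (ball a d) b * theta n (a - b) \<partial>restrict_space lborel {0..<T}) \<longlonglongrightarrow> (1::real)"
  by (intro AE_I2) (auto simp: space_restrict_space)
qed

section \<open>Almost everywhere convergence and differentiation of mollifications\<close>

lemma (in approx_identity) moll_AE_subseq:
 assumes f: "integrable M f"
 obtains r where "strict_mono r" "AE a in M. (\<lambda>n. moll (r n) f a) \<longlonglongrightarrow> f a"
proof -
 have "(\<lambda>n. (LINT a|M. norm (moll n f a - f a))) \<longlonglongrightarrow> 0" using moll_L1[OF f] by simp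
 then obtain r where r: "strict_mono r" "AE a in M. (\<lambda>n. moll (r n) f a - f a) \<longlonglongrightarrow> 0"
  using tendsto_L1_AE_subseq[of M "\<lambda>n a. moll n f a - f a", OF B_integrable_diff[OF moll_int[OF f] f]]
  by (auto simp: strict_mono_def)
 from r(2) have "AE a in M. (\<lambda>n. moll (r n) f a) \<longlonglongrightarrow> f a" by eventually_elim (simp add: LIM_zero_iff)
 with r(1) show thesis by (rule that)
qed

text \<open>A closed constraint that holds for the mollifications passes to the function. With the constraint
 \<open>{0}\<close> this proves uniqueness of weak derivatives.\<close>

lemma (in approx_identity) moll_AE_eventually_closed:
 assumes f: "integrable M f" and "closed X" and ev: "AE a in M. eventually (\<lambda>n. moll n f a \<in> X) sequentially"
 shows "AE a in M. f a \<in> X"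
proof -
 obtain r where r: "strict_mono r" "AE a in M. (\<lambda>n. moll (r n) f a) \<longlonglongrightarrow> f a" by (rule moll_AE_subseq[OF f])
 from r(2) ev show ?thesis
 proof eventually_elim
  case (elim a)
  have "eventually (\<lambda>n. moll (r n) f a \<in> X) sequentially" using eventually_subseq[OF r(1) elim(2)] .
  then show ?case using elim(1) \<open>closed X\<close> by (intro Lim_in_closed_set[of X _ sequentially]) auto
 qed
qed

text \<open>Differentiation under the integral; the derivative of the kernel is uniformly bounded.\<close>

lemma param_deriv:
 fixes k k' :: "real \<Rightarrow> 'b \<Rightarrow> real" and f :: "'b \<Rightarrow> real"
 assumes f: "integrable M f"
  and m: "\<And>r. k r \<in> borel_measurable M" "\<And>r. k' r \<in> borel_measurable M"
  and d: "\<And>r y. y \<in> space M \<Longrightarrow> ((\<lambda>r. k r y) has_real_derivative k' r y) (at r)"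
  and b: "\<And>r y. y \<in> space M \<Longrightarrow> abs (k r y) \<le> C" "\<And>r y. y \<in> space M \<Longrightarrow> abs (k' r y) \<le> C"
 shows "((\<lambda>r. (LINT y|M. k r y * f y)) has_real_derivative (LINT y|M. k' r y * f y)) (at r)" unfolding DERIV_def
proof (subst tendsto_at_iff_sequentially, intro allI impI)
 fix X :: "nat \<Rightarrow> real" assume X: "\<forall>i. X i \<in> UNIV - {0}" "X \<longlonglongrightarrow> 0"
 have [measurable]: "f \<in> borel_measurable M" using f by simp
 note m[measurable]
 have ki: "integrable M (\<lambda>y. k r y * f y)" for r
 proof (rule B_integrable_bound[of _ "\<lambda>y. C * f y"])
  show "AE y in M. norm (k r y * f y) \<le> norm (C * f y)"
  proof (rule AE_I2)
   fix y assume "y \<in> space M"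
   then show "norm (k r y * f y) \<le> norm (C * f y)"
    using mult_right_mono[OF order_trans[OF b(1)[of y r] abs_ge_self], of "abs (f y)"] by (simp add: abs_mult)
  qed
 qed (use f in auto)
 have "(\<lambda>n. (LINT y|M. (k (r + X n) y - k r y) / X n * f y)) \<longlonglongrightarrow> (LINT y|M. k' r y * f y)"
 proof (rule integral_dominated_convergence[where w="\<lambda>y. C * abs (f y)"])
  show "AE y in M. (\<lambda>n. (k (r + X n) y - k r y) / X n * f y) \<longlonglongrightarrow> k' r y * f y"
  proof (rule AE_I2)
   fix y assume "y \<in> space M"
   then have "((\<lambda>h. (k (r + h) y - k r y) / h) \<longlongrightarrow> k' r y) (at 0)" using d[of y r] by (simp add: DERIV_def)
   moreover have "filterlim X (at 0) sequentially" using X by (auto simp: filterlim_at)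
   ultimately have "(\<lambda>n. (k (r + X n) y - k r y) / X n) \<longlonglongrightarrow> k' r y" by (rule filterlim_compose)
   then show "(\<lambda>n. (k (r + X n) y - k r y) / X n * f y) \<longlonglongrightarrow> k' r y * f y" by (intro tendsto_intros)
  qed
  show "AE y in M. norm ((k (r + X n) y - k r y) / X n * f y) \<le> C * abs (f y)" for n
  proof (rule AE_I2)
   fix y assume y: "y \<in> space M"
   have "X n \<noteq> 0" using X by auto
   obtain z where z: "k (r + X n) y - k r y = X n * k' z y"
   proof (cases "X n > 0")
    case True
    have "\<exists>z>r. z < r + X n \<and> k (r + X n) y - k r y = (r + X n - r) * k' z y" using True d[OF y] by (intro MVT2) auto
    then show ?thesis using that by auto
   next
    case False
    have "\<exists>z>r + X n. z < r \<and> k r y - k (r + X n) y = (r - (r + X n)) * k' z y"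
     using False \<open>X n \<noteq> 0\<close> d[OF y] by (intro MVT2) auto
    then obtain z where "k r y - k (r + X n) y = - (X n * k' z y)" by auto
    then have "k (r + X n) y - k r y = X n * k' z y" by linarith
    then show ?thesis by (rule that)
   qed
   then have "(k (r + X n) y - k r y) / X n = k' z y" using \<open>X n \<noteq> 0\<close> by simp
   then show "norm ((k (r + X n) y - k r y) / X n * f y) \<le> C * abs (f y)" using b(2)[OF y, of z] by (simp add: abs_mult mult_right_mono)
  qed
 qed (use f in auto)
 moreover have "(LINT y|M. (k (r + X n) y - k r y) / X n * f y) = ((LINT y|M. k (r + X n) y * f y) - (LINT y|M. k r y * f y)) / X n" for n
 proof -
  have "(LINT y|M. (k (r + X n) y - k r y) / X n * f y) = (LINT y|M. (k (r + X n) y * f y - k r y * f y) / X n)"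
   by (intro B_integral_cong) (auto simp: algebra_simps diff_divide_distrib)
  then show ?thesis using ki by simp
 qed
 ultimately show "((\<lambda>h. ((LINT y|M. k (r + h) y * f y) - (LINT y|M. k r y * f y)) / h) \<circ> X) \<longlonglongrightarrow> (LINT y|M. k' r y * f y)"
  by (simp only: o_def)
qed

section \<open>Periodic smooth functions\<close>

lemma periodic_int:
 assumes "periodic f" shows "f (x + (\<Sum>i\<in>UNIV. axis i (of_int (k i)))) = f (x :: real ^ 'd)"
proof -
 have nat: "f (x + axis i (real n)) = f x" for x :: "real ^ 'd" and i n
 proof (induction n)
  case 0
  have "axis i (0::real) = 0" by (simp add: vec_eq_iff axis_def)
  then show ?case by (simp only: of_nat_0 add_0_right)
 next
  case (Suc n)
  have "x + axis i (real (Suc n)) = (x + axis i (real n)) + axis i 1" by (simp add: vec_eq_iff axis_def)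
  then show ?case using Suc assms unfolding periodic_def by metis
 qed
 have int: "f (x + axis i (of_int k)) = f x" for x :: "real ^ 'd" and i and k :: int
 proof (cases "k \<ge> 0")
  case True
  then show ?thesis using nat[of x i "nat k"] by simp
 next
  case False
  have "(x + axis i (of_int k)) + axis i (real (nat (- k))) = x" using False by (simp add: vec_eq_iff axis_def)
  then show ?thesis using nat[of "x + axis i (of_int k)" i "nat (- k)"] by metis
 qed
 have "f (x + (\<Sum>i\<in>I. axis i (of_int (k i)))) = f x" if "finite I" for I using that
 proof induction
  case (insert i I)
  then show ?case using int[of "x + (\<Sum>i\<in>I. axis i (of_int (k i)))" i "k i"] by (simp add: add_ac)
 qed simp
 then show ?thesis by simp
qed

lemma periodic_continuous_bounded:
 fixes f :: "real ^ 'd \<Rightarrow> real"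
 assumes c: "continuous_on UNIV f" and p: "periodic f"
 obtains C where "\<And>x. abs (f x) \<le> C"
proof -
 have "compact (f ` cbox 0 One)" by (intro compact_continuous_image continuous_on_subset[OF c]) auto
 then obtain C where C: "\<forall>y \<in> f ` cbox 0 One. norm y \<le> C" using compact_imp_bounded bounded_iff by blast
 have "abs (f x) \<le> C" for x
 proof -
  let ?y = "x + (\<Sum>i\<in>UNIV. axis i (of_int (- \<lfloor>x $ i\<rfloor>)))"
  have "(\<Sum>i\<in>UNIV. axis i (of_int (- \<lfloor>x $ i\<rfloor>))) $ j = - of_int \<lfloor>x $ j\<rfloor>" for j
   by (simp add: axis_def if_distrib cong: if_cong)
  then have "?y $ j = frac (x $ j)" for j by (simp add: frac_def)
  then have "?y \<in> cell" by (simp add: cell_def frac_ge_0 frac_lt_1)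
  then have "?y \<in> cbox 0 One" using cell_box(2) by blast
  then have "norm (f ?y) \<le> C" using C by blast
  then show ?thesis using periodic_int[OF p, of x "\<lambda>i. - \<lfloor>x $ i\<rfloor>"] by simp
 qed
 then show thesis by (rule that)
qed

lemma smooth_affine_dderiv:
 fixes f :: "'b::euclidean_space \<Rightarrow> real" and L :: "'a::euclidean_space \<Rightarrow> 'b"
 assumes "bounded_linear L" "smooth f"
 shows "dderiv e (\<lambda>x. f (L x + c)) x = (\<Sum>b\<in>Basis. (L e \<bullet> b) * dderiv b f (L x + c))"
 using dderiv_eqI[OF dderiv_affine[OF assms(1), of 0 f c x]] assms(2) unfolding smooth_def by blast

lemma smooth_reflect:
 fixes f :: "'b::euclidean_space \<Rightarrow> real"
 assumes f: "smooth f"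
 shows "smooth (\<lambda>y. f (x - y))" and "e \<in> Basis \<Longrightarrow> dderiv e (\<lambda>y. f (x - y)) y = - dderiv e f (x - y)"
proof -
 have L: "bounded_linear (\<lambda>y::'b. - y)" by (rule bounded_linear_minus) (rule bounded_linear_ident)
 show "smooth (\<lambda>y. f (x - y))" using smooth_affine[OF L f, of x] by simp
 assume e: "e \<in> Basis"
 have "dderiv e (\<lambda>y. f (x - y)) y = (\<Sum>b\<in>Basis. (- e \<bullet> b) * dderiv b f (x - y))"
  using smooth_affine_dderiv[OF L f, of e x y] by simp
 also have "\<dots> = (\<Sum>b\<in>Basis. if b = e then - dderiv b f (x - y) else 0)" using e by (intro sum.cong) (auto simp: inner_Basis)
 finally show "dderiv e (\<lambda>y. f (x - y)) y = - dderiv e f (x - y)" using e by simp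
qed

lemma smooth_translate:
 fixes f :: "'b::euclidean_space \<Rightarrow> real"
 assumes f: "smooth f"
 shows "smooth (\<lambda>y. f (y + c))" and "e \<in> Basis \<Longrightarrow> dderiv e (\<lambda>y. f (y + c)) y = dderiv e f (y + c)"
proof -
 have L: "bounded_linear (\<lambda>y::'b. y)" by (rule bounded_linear_ident)
 show "smooth (\<lambda>y. f (y + c))" using smooth_affine[OF L f, of c] by simp
 assume e: "e \<in> Basis"
 have "dderiv e (\<lambda>y. f (y + c)) y = (\<Sum>b\<in>Basis. (e \<bullet> b) * dderiv b f (y + c))"
  using smooth_affine_dderiv[OF L f, of e c y] by simp
 also have "\<dots> = (\<Sum>b\<in>Basis. if b = e then dderiv b f (y + c) else 0)" using e by (intro sum.cong) (auto simp: inner_Basis)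
 finally show "dderiv e (\<lambda>y. f (y + c)) y = dderiv e f (y + c)" using e by simp
qed

lemma periodic_dderiv:
 assumes f: "smooth f" and p: "periodic f" and e: "e \<in> Basis" shows "periodic (dderiv e f)" unfolding periodic_def
proof (intro allI)
 fix x i
 have "(\<lambda>y. f (y + axis i 1)) = f" using p by (simp add: periodic_def)
 then show "dderiv e f (x + axis i 1) = dderiv e f x" using smooth_translate(2)[OF f e, of "axis i 1" x] by simp
qed

lemma periodic_reflect: 
 assumes p: "periodic f" shows "periodic (\<lambda>y. f (x - y))" unfolding periodic_def
proof (intro allI)
 fix y i
 have "f (x - (y + axis i 1)) = f (x - (y + axis i 1) + axis i 1)" using p unfolding periodic_def by metis
 then show "f (x - (y + axis i 1)) = f (x - y)" by simp
qed

lemma smooth_periodic_bounded: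
 fixes f :: "real ^ 'd \<Rightarrow> real"
 assumes f: "smooth f" and p: "periodic f" and e: "e \<in> Basis"
 obtains C where "\<And>x. abs (f x) \<le> C" "\<And>x. abs (dderiv e f x) \<le> C"
proof -
 obtain A where A: "\<And>x. abs (f x) \<le> A" using periodic_continuous_bounded[OF smooth_continuous[OF f] p] by blast
 obtain B where B: "\<And>x. abs (dderiv e f x) \<le> B"
  using periodic_continuous_bounded[OF smooth_continuous[OF smooth_dderiv[OF f e]] periodic_dderiv[OF f p e]] by blast
 show thesis by (rule that[of "max A B"]) (use A B in \<open>auto simp: le_max_iff_disj\<close>)
qed

lemma sum_Basis_vec: "(\<Sum>b\<in>(Basis :: (real ^ 'd) set). g b) = (\<Sum>i\<in>UNIV. g (axis i 1))"
proof -
 have B: "(Basis :: (real ^ 'd) set) = range (\<lambda>i. axis i 1)" by (auto simp: Basis_vec_def)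
 have i: "inj (\<lambda>i::'d. axis i (1::real))" by (auto simp: inj_on_def axis_eq_axis)
 show ?thesis unfolding B by (subst sum.reindex[OF i]) (simp add: o_def)
qed

lemma axis_Basis [simp]: "axis i (1::real) \<in> (Basis :: (real ^ 'd) set)" by (simp add: axis_in_Basis_iff)

lemma smooth_directional:
 assumes "smooth f"
 shows "((\<lambda>r. f (x + r *\<^sub>R h)) has_real_derivative (\<Sum>b\<in>Basis. (h \<bullet> b) * dderiv b f (x + r *\<^sub>R h))) (at r)"
proof -
 have "((\<lambda>r. x + r *\<^sub>R h) has_derivative (\<lambda>s. s *\<^sub>R h)) (at r)" by (auto intro!: derivative_eq_intros)
 from has_derivative_compose[OF this smooth_has_derivative[OF assms]]
 have "((\<lambda>r. f (x + r *\<^sub>R h)) has_derivative (\<lambda>s. \<Sum>b\<in>Basis. (s *\<^sub>R h \<bullet> b) * dderiv b f (x + r *\<^sub>R h))) (at r)" .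
 moreover have "(\<lambda>s. \<Sum>b\<in>Basis. (s *\<^sub>R h \<bullet> b) * dderiv b f (x + r *\<^sub>R h)) = (*) (\<Sum>b\<in>Basis. (h \<bullet> b) * dderiv b f (x + r *\<^sub>R h))"
  by (auto simp: fun_eq_iff sum_distrib_left mult_ac)
 ultimately show ?thesis by (simp add: has_field_derivative_def)
qed

lemma smooth_directional_Basis:
 assumes f: "smooth f" and e: "e \<in> Basis"
 shows "((\<lambda>r. f (x + r *\<^sub>R e)) has_real_derivative dderiv e f (x + r *\<^sub>R e)) (at r)"
proof -
 have "(\<Sum>b\<in>Basis. (e \<bullet> b) * dderiv b f (x + r *\<^sub>R e)) = (\<Sum>b\<in>Basis. if b = e then dderiv b f (x + r *\<^sub>R e) else 0)"
  using e by (intro sum.cong) (auto simp: inner_Basis)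
 also have "\<dots> = dderiv e f (x + r *\<^sub>R e)" using e by simp
 finally show ?thesis using smooth_directional[OF f, of x e r] by simp
qed

lemma sum_axis: "(\<Sum>j\<in>UNIV. axis i (1::real) $ j * X j) = X (i :: 'd::finite)"
 by (simp add: axis_def if_distrib[of "\<lambda>z. z * _"] cong: if_cong)

section \<open>Mollification on the torus\<close>

interpretation K: approx_identity "cell :: (real ^ 'd) set" "\<lambda>n x y. kappa n (x - y)" by (rule approx_identity_kappa)

definition tmoll :: "nat \<Rightarrow> (real ^ 'd \<Rightarrow> real) \<Rightarrow> real ^ 'd \<Rightarrow> real" where
 "tmoll n f x = (LINT y|TX. kappa n (x - y) * f y)"

lemma K_moll: "K.moll n f x = tmoll n f x"
 by (simp add: K.moll_def tmoll_def torus_measure_def)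

lemmas torus_fold = torus_measure_def[symmetric]

lemma kappa_shift_meas [measurable]: "(\<lambda>y. kappa n (x - y)) \<in> borel_measurable TX"
 by (rule measurable_torus, rule borel_measurable_continuous_onI, rule continuous_on_compose2[OF smooth_continuous[OF smooth_kappa] _ subset_UNIV])
  (intro continuous_intros)

lemma kappa_shift_int:
 fixes f :: "real ^ 'd \<Rightarrow> real"
 assumes f: "integrable TX f" shows "integrable TX (\<lambda>y. kappa n (x - y) * f y)"
proof -
 obtain C where C: "\<And>x :: real ^ 'd. abs (kappa n x) \<le> C" using kappa_bounded by blast
 have [measurable]: "f \<in> borel_measurable TX" using f by simp
 show ?thesis
 proof (rule B_integrable_bound[of _ "\<lambda>y. C * f y"])
  show "AE y in TX. norm (kappa n (x - y) * f y) \<le> norm (C * f y)"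
   using mult_right_mono[OF order_trans[OF C abs_ge_self] abs_ge_zero] by (auto simp: abs_mult)
 qed (use f in auto)
qed

lemma tmoll_bounded:
 fixes f :: "real ^ 'd \<Rightarrow> real"
 assumes f: "integrable TX f"
 obtains C where "\<And>x. abs (tmoll n f x) \<le> C"
proof -
 obtain C where C: "\<And>x :: real ^ 'd. abs (kappa n x) \<le> C" using kappa_bounded by blast
 show thesis
 proof (rule that)
  fix x
  have "abs (tmoll n f x) \<le> (LINT y|TX. \<bar>kappa n (x - y) * f y\<bar>)" unfolding tmoll_def by (rule integral_abs_bound)
  also have "\<dots> \<le> (LINT y|TX. C * abs (f y))"
   using f kappa_shift_int[OF f, of n x] C by (intro integral_mono integrable_abs) (auto simp: abs_mult mult_right_mono)
  finally show "abs (tmoll n f x) \<le> (LINT y|TX. C * abs (f y))" .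
 qed
qed

lemma tmoll_borel [measurable]:
 fixes f :: "real ^ 'd \<Rightarrow> real"
 assumes [measurable]: "f \<in> borel_measurable TX"
 shows "tmoll n f \<in> borel_measurable borel"
proof -
 have i: "(\<lambda>x. x) \<in> (TX :: (real ^ 'd) measure) \<rightarrow>\<^sub>M borel" by (rule measurable_torus) simp
 have "(\<lambda>p. fst p - snd p) \<in> borel \<Otimes>\<^sub>M TX \<rightarrow>\<^sub>M (borel :: (real ^ 'd) measure)"
  by (intro borel_measurable_diff measurable_fst measurable_compose[OF measurable_snd i])
 then have "(\<lambda>p. kappa n (fst p - snd p)) \<in> borel_measurable ((borel :: (real ^ 'd) measure) \<Otimes>\<^sub>M TX)"
  by (rule measurable_compose) simp
 then have "(\<lambda>(x, y). kappa n (x - y) * f y) \<in> borel_measurable ((borel :: (real ^ 'd) measure) \<Otimes>\<^sub>M TX)"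
  unfolding case_prod_beta by measurable
 then show ?thesis unfolding tmoll_def[abs_def] by (rule torus.borel_measurable_lebesgue_integral)
qed

lemma tmoll_periodic: "periodic (tmoll n f :: real ^ 'd \<Rightarrow> real)"
proof -
 have "kappa n (x + axis i 1 - y) = kappa n (x - y)" for x y :: "real ^ 'd" and i
  using periodic_kappa[of n] unfolding periodic_def by (metis add_diff_eq diff_add_eq)
 then show ?thesis unfolding periodic_def tmoll_def by simp
qed

lemma tmoll_torus_int: "integrable TX f \<Longrightarrow> integrable TX (tmoll n f)"
 using K.moll_int[of f n] unfolding K_moll torus_fold .

lemma tmoll_L1: "integrable TX f \<Longrightarrow> (\<lambda>n. (LINT x|TX. \<bar>tmoll n f x - f x\<bar>)) \<longlonglongrightarrow> 0"
 using K.moll_L1[of f] unfolding K_moll torus_fold .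

lemma integrable_vec_nth:
 fixes G :: "'b \<Rightarrow> real ^ 'd"
 assumes "integrable M G" shows "integrable M (\<lambda>y. G y $ i)"
proof -
 have "integrable M (\<lambda>y. G y \<bullet> axis i 1)" using assms by simp
 then show ?thesis by (simp add: inner_axis)
qed

text \<open>Mollification turns the weak gradient into the classical derivative: the reflected kernel is a test function.\<close>

lemma tmoll_deriv:
 fixes f :: "real ^ 'd \<Rightarrow> real"
 assumes w: "has_torus_wgrad f G"
 shows "((\<lambda>r. tmoll n f (x + r *\<^sub>R h)) has_real_derivative (\<Sum>i\<in>UNIV. h $ i * tmoll n (\<lambda>y. G y $ i) (x + r *\<^sub>R h))) (at r)"
proof -
 have f: "integrable TX f" and G: "integrable TX G" using w by (auto simp: has_torus_wgrad_def)
 have Gi: "integrable TX (\<lambda>y. G y $ i)" for i using G by (rule integrable_vec_nth)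
 let ?D = "\<lambda>b. dderiv b (kappa n :: real ^ 'd \<Rightarrow> real)"
 have "\<exists>C. \<forall>x. \<bar>kappa n (x :: real ^ 'd)\<bar> \<le> C \<and> \<bar>?D (axis i 1) x\<bar> \<le> C" for i
  using smooth_periodic_bounded[OF smooth_kappa periodic_kappa axis_Basis, of n i] by metis
 then obtain C where C: "\<And>i x. \<bar>kappa n (x :: real ^ 'd)\<bar> \<le> C i \<and> \<bar>?D (axis i 1) x\<bar> \<le> C i" by metis
 define B where "B = (\<Sum>i\<in>UNIV. (1 + \<bar>h $ i\<bar>) * C i)"
 have C0: "0 \<le> C i" for i using C[of 0 i] by linarith
 have Db [measurable]: "?D (axis i 1) \<in> borel_measurable borel" for i
  by (intro borel_measurable_continuous_onI smooth_continuous smooth_dderiv smooth_kappa) simp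
 let ?k' = "\<lambda>r y. \<Sum>i\<in>UNIV. h $ i * ?D (axis i 1) (x + r *\<^sub>R h - y)"
 have "((\<lambda>r. (LINT y|TX. kappa n (x + r *\<^sub>R h - y) * f y)) has_real_derivative (LINT y|TX. ?k' r y * f y)) (at r)"
 proof (rule param_deriv[OF f, where C=B])
  show "(\<lambda>y. kappa n (x + r *\<^sub>R h - y)) \<in> borel_measurable TX" for r by measurable
  show "?k' r \<in> borel_measurable TX" for r by (intro measurable_torus) measurable
  show "((\<lambda>r. kappa n (x + r *\<^sub>R h - y)) has_real_derivative ?k' r y) (at r)" for r y
   using smooth_directional[OF smooth_kappa[of n], of "x - y" h r] by (simp add: sum_Basis_vec inner_axis algebra_simps)
  show "\<bar>kappa n (x + r *\<^sub>R h - y)\<bar> \<le> B" for r y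
  proof -
   obtain i0 :: 'd where True by simp
   have "C i0 \<le> (1 + \<bar>h $ i0\<bar>) * C i0" using C0[of i0] by (simp add: distrib_right)
   also have "\<dots> \<le> B" unfolding B_def using C0 by (intro member_le_sum) auto
   finally show ?thesis using C[of "x + r *\<^sub>R h - y" i0] by linarith
  qed
  show "\<bar>?k' r y\<bar> \<le> B" for r y unfolding B_def
  proof (rule sum_abs[THEN order_trans], rule sum_mono)
   fix i
   have "\<bar>h $ i * ?D (axis i 1) (x + r *\<^sub>R h - y)\<bar> \<le> \<bar>h $ i\<bar> * C i" using C by (simp add: abs_mult mult_left_mono)
   also have "\<dots> \<le> (1 + \<bar>h $ i\<bar>) * C i" using C0[of i] by (simp add: distrib_right)
   finally show "\<bar>h $ i * ?D (axis i 1) (x + r *\<^sub>R h - y)\<bar> \<le> (1 + \<bar>h $ i\<bar>) * C i" .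
  qed
 qed
 moreover have "(LINT y|TX. ?k' r y * f y) = (\<Sum>i\<in>UNIV. h $ i * tmoll n (\<lambda>y. G y $ i) (x + r *\<^sub>R h))"
 proof -
  let ?z = "x + r *\<^sub>R h"
  have Di: "integrable TX (\<lambda>y. ?D (axis i 1) (?z - y) * f y)" for i
  proof (rule B_integrable_bound[of _ "\<lambda>y. C i * f y"])
   show "AE y in TX. norm (?D (axis i 1) (?z - y) * f y) \<le> norm (C i * f y)"
    using mult_right_mono[OF conjunct2[OF C] abs_ge_zero] C0 by (auto simp: abs_mult)
   have "(\<lambda>y. ?D (axis i 1) (?z - y)) \<in> borel_measurable TX" by (intro measurable_torus) measurable
   then show "(\<lambda>y. ?D (axis i 1) (?z - y) * f y) \<in> borel_measurable TX" using f by (intro borel_measurable_times) auto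
  qed (use f in auto)
  have e: "(LINT y|TX. ?D (axis i 1) (?z - y) * f y) = tmoll n (\<lambda>y. G y $ i) ?z" for i
  proof -
   have "(LINT y|TX. f y * dderiv (axis i 1) (\<lambda>y. kappa n (?z - y)) y) = - (LINT y|TX. G y $ i * kappa n (?z - y))"
    using w smooth_reflect(1)[OF smooth_kappa] periodic_reflect[OF periodic_kappa] unfolding has_torus_wgrad_def by blast
   then show ?thesis by (simp add: smooth_reflect(2)[OF smooth_kappa] tmoll_def mult.commute)
  qed
  have "(LINT y|TX. ?k' r y * f y) = (LINT y|TX. (\<Sum>i\<in>UNIV. h $ i * (?D (axis i 1) (?z - y) * f y)))"
   by (simp add: sum_distrib_right mult.assoc)
  also have "\<dots> = (\<Sum>i\<in>UNIV. h $ i * (LINT y|TX. ?D (axis i 1) (?z - y) * f y))"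
   using Di by (subst B_integral_sum) auto
  finally show ?thesis by (simp add: e)
 qed
 ultimately show ?thesis unfolding tmoll_def[abs_def] by simp
qed

lemma has_torus_wgrad_unique:
 fixes f :: "real ^ 'd \<Rightarrow> real"
 assumes 1: "has_torus_wgrad f G" and 2: "has_torus_wgrad f H"
 shows "AE x in TX. G x = H x"
proof -
 have GH: "integrable TX G" "integrable TX H" using assms by (auto simp: has_torus_wgrad_def)
 have Gi: "integrable TX (\<lambda>y. G y $ i)" "integrable TX (\<lambda>y. H y $ i)" for i using GH by (auto intro: integrable_vec_nth)
 have z: "K.moll n (\<lambda>y. G y $ i - H y $ i) x \<in> {0}" for n i x
 proof -
  have "tmoll n (\<lambda>y. G y $ i) x = tmoll n (\<lambda>y. H y $ i) x"
   using DERIV_unique[OF tmoll_deriv[OF 1, of n x "axis i 1" 0] tmoll_deriv[OF 2, of n x "axis i 1" 0]] unfolding sum_axis by simp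
  then show ?thesis unfolding K_moll tmoll_def using kappa_shift_int[OF Gi(1)] kappa_shift_int[OF Gi(2)] by (simp add: right_diff_distrib)
 qed
 have "AE x in TX. G x $ i - H x $ i \<in> {0}" for i unfolding torus_measure_def
  by (rule K.moll_AE_eventually_closed) (use Gi in \<open>auto simp: torus_fold intro!: always_eventually z[simplified]\<close>)
 then have "AE x in TX. \<forall>i. G x $ i - H x $ i \<in> {0}" by (simp add: AE_all_countable)
 then show ?thesis by eventually_elim (auto simp: vec_eq_iff)
qed

section \<open>Chain rules for the weak gradient\<close>

lemma tmoll_AE_subseq:
 fixes f :: "real ^ 'd \<Rightarrow> real"
 assumes f: "integrable TX f"
 shows "\<exists>r. strict_mono r \<and> (AE x in TX. (\<lambda>n. tmoll (r n) f x) \<longlonglongrightarrow> f x)"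
 using K.moll_AE_subseq[of f, unfolded K_moll torus_fold, OF f] by blast

text \<open>The classical chain rule for the mollified function, integrated by parts over the torus, passes to the limit along
 an almost everywhere convergent subsequence.\<close>

lemma chain_rule_C1:
 fixes f :: "real ^ 'd \<Rightarrow> real"
 assumes w: "has_torus_wgrad f G"
  and d: "\<And>s. (F has_real_derivative F' s) (at s)" and c: "continuous_on UNIV F'" and b: "\<And>s. abs (F' s) \<le> C"
 shows "has_torus_wgrad (\<lambda>x. F (f x)) (\<lambda>x. F' (f x) *\<^sub>R G x)"
proof -
 have f: "integrable TX f" and G: "integrable TX G" using w by (auto simp: has_torus_wgrad_def)
 have Gi: "integrable TX (\<lambda>y. G y $ i)" for i using G by (rule integrable_vec_nth)
 have [measurable]: "f \<in> borel_measurable TX" "G \<in> borel_measurable TX" using f G by auto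
 have "continuous_on UNIV F" using d by (intro DERIV_continuous_on) (auto intro: has_field_derivative_at_within)
 then have Fm [measurable]: "F \<in> borel_measurable borel" and F'm [measurable]: "F' \<in> borel_measurable borel"
  using c by (auto intro: borel_measurable_continuous_onI)
 have C0: "0 \<le> C" using b[of 0] by linarith
 have lip: "\<bar>F s - F t\<bar> \<le> C * \<bar>s - t\<bar>" for s t
 proof -
  have "norm (F s - F t) \<le> C * norm (s - t)"
   by (rule field_differentiable_bound[of UNIV F F']) (use d b in \<open>auto intro: has_field_derivative_at_within\<close>)
  then show ?thesis by simp
 qed
 have Fi: "integrable TX (\<lambda>x. F (f x))"
 proof (rule B_integrable_bound[of _ "\<lambda>x. abs (F 0) + C * abs (f x)"])
  show "AE x in TX. norm (F (f x)) \<le> norm (abs (F 0) + C * abs (f x))"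
  proof (rule AE_I2)
   fix x show "norm (F (f x)) \<le> norm (abs (F 0) + C * abs (f x))" using lip[of "f x" 0] C0 by (simp add: abs_of_nonneg)
  qed
 qed (use f in auto)
 have F'G: "integrable TX (\<lambda>x. F' (f x) *\<^sub>R G x)"
 proof (rule B_integrable_bound[of _ "\<lambda>x. C *\<^sub>R G x"])
  show "AE x in TX. norm (F' (f x) *\<^sub>R G x) \<le> norm (C *\<^sub>R G x)" using b C0 by (auto simp: mult_right_mono)
 qed (use G in auto)
 show ?thesis unfolding has_torus_wgrad_def
 proof (intro conjI Fi F'G allI impI)
  fix \<rho> :: "real ^ 'd \<Rightarrow> real" and i assume \<rho>: "smooth \<rho> \<and> periodic \<rho>"
  let ?e = "axis i 1 :: real ^ 'd" and ?g = "\<lambda>y. G y $ i"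
  obtain B where B: "\<And>x. \<bar>\<rho> x\<bar> \<le> B" "\<And>x. \<bar>dderiv ?e \<rho> x\<bar> \<le> B"
   using smooth_periodic_bounded[of \<rho> ?e] \<rho> by (metis axis_Basis)
  have B0: "0 \<le> B" using B(1)[of 0] by linarith
  have [measurable]: "\<rho> \<in> borel_measurable borel" "dderiv ?e \<rho> \<in> borel_measurable borel"
   using \<rho> by (auto intro!: borel_measurable_continuous_onI smooth_continuous smooth_dderiv)
  have \<rho>t [measurable]: "\<rho> \<in> borel_measurable TX" "dderiv ?e \<rho> \<in> borel_measurable TX" by (auto intro: measurable_torus)
  have [measurable]: "?g \<in> borel_measurable TX" using Gi by simp
  have tm [measurable]: "tmoll n f \<in> borel_measurable TX" "tmoll n ?g \<in> borel_measurable TX" for n by (auto intro!: measurable_torus)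
  have eq: "(LINT x|TX. F (tmoll n f x) * dderiv ?e \<rho> x) = - (LINT x|TX. F' (tmoll n f x) * tmoll n ?g x * \<rho> x)" for n
  proof -
   obtain A where A: "\<And>x. abs (tmoll n f x) \<le> A" using tmoll_bounded[OF f, of n] by blast
   obtain A' where A': "\<And>x. \<bar>tmoll n ?g x\<bar> \<le> A'" using tmoll_bounded[OF Gi[of i], of n] by blast
   have A0: "0 \<le> A" "0 \<le> A'" using A[of 0] A'[of 0] by linarith+
   let ?a = "\<lambda>x. F (tmoll n f x) * dderiv ?e \<rho> x" and ?b = "\<lambda>x. F' (tmoll n f x) * tmoll n ?g x * \<rho> x"
   have FA: "abs (F (tmoll n f x)) \<le> abs (F 0) + C * A" for x
    using order_trans[OF lip[of "tmoll n f x" 0, unfolded diff_0_right] mult_left_mono[OF A[of x] C0]] by linarith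
   have ab: "\<bar>?a x\<bar> \<le> (abs (F 0) + C * A) * B" for x unfolding abs_mult using FA B(2) B0 C0 A0 by (intro mult_mono) auto
   have bb: "\<bar>?b x\<bar> \<le> C * A' * B" for x unfolding abs_mult using b A' B(1) B0 C0 A0 by (intro mult_mono) auto
   have ai: "integrable TX ?a" by (rule torus_integrable_bounded[OF _ ab]) measurable
   have bi: "integrable TX ?b" by (rule torus_integrable_bounded[OF _ bb]) measurable
   have "(LINT x|TX. ?a x + ?b x) = 0"
   proof (rule torus_integral_deriv[where f="\<lambda>x. F (tmoll n f x) * \<rho> x" and e="?e" and C="max ((abs (F 0) + C * A) * B) ((abs (F 0) + C * A) * B + C * A' * B)"])
    show "((\<lambda>r. F (tmoll n f (x + r *\<^sub>R ?e)) * \<rho> (x + r *\<^sub>R ?e)) has_real_derivative ?a (x + r *\<^sub>R ?e) + ?b (x + r *\<^sub>R ?e)) (at r)" for x r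
    proof -
     have 1: "((\<lambda>r. tmoll n f (x + r *\<^sub>R ?e)) has_real_derivative tmoll n ?g (x + r *\<^sub>R ?e)) (at r)"
      using tmoll_deriv[OF w, of n x ?e r] unfolding sum_axis .
     have 2: "((\<lambda>r. \<rho> (x + r *\<^sub>R ?e)) has_real_derivative dderiv ?e \<rho> (x + r *\<^sub>R ?e)) (at r)"
      using \<rho> by (intro smooth_directional_Basis) auto
     show ?thesis using DERIV_mult[OF DERIV_chain2[OF d 1] 2] by (simp add: algebra_simps)
    qed
    show "periodic (\<lambda>x. F (tmoll n f x) * \<rho> x)" using tmoll_periodic[of n f] \<rho> by (simp add: periodic_def)
    show "\<bar>F (tmoll n f x) * \<rho> x\<bar> \<le> max ((abs (F 0) + C * A) * B) ((abs (F 0) + C * A) * B + C * A' * B)" for x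
    proof -
     have "\<bar>F (tmoll n f x) * \<rho> x\<bar> \<le> (abs (F 0) + C * A) * B"
      unfolding abs_mult using FA B(1) B0 C0 A0 by (intro mult_mono) auto
     then show ?thesis by simp
    qed
    show "\<bar>?a x + ?b x\<bar> \<le> max ((abs (F 0) + C * A) * B) ((abs (F 0) + C * A) * B + C * A' * B)" for x
     using ab[of x] bb[of x] by linarith
   qed measurable
   then show ?thesis using ai bi by simp
  qed
  obtain r where r: "strict_mono r" "AE x in TX. (\<lambda>n. tmoll (r n) f x) \<longlonglongrightarrow> f x" using tmoll_AE_subseq[OF f] by blast
  have L1: "(\<lambda>n. (LINT x|TX. F (tmoll n f x) * dderiv ?e \<rho> x)) \<longlonglongrightarrow> (LINT x|TX. F (f x) * dderiv ?e \<rho> x)"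
  proof (rule LIM_zero_cancel, rule Lim_null_comparison)
   have "(\<lambda>n. C * B * (LINT x|TX. \<bar>tmoll n f x - f x\<bar>)) \<longlonglongrightarrow> C * B * 0" by (intro tendsto_intros tmoll_L1 f)
   then show "(\<lambda>n. C * B * (LINT x|TX. \<bar>tmoll n f x - f x\<bar>)) \<longlonglongrightarrow> 0" by simp
   show "\<forall>\<^sub>F n in sequentially. norm ((LINT x|TX. F (tmoll n f x) * dderiv ?e \<rho> x) - (LINT x|TX. F (f x) * dderiv ?e \<rho> x))
    \<le> C * B * (LINT x|TX. \<bar>tmoll n f x - f x\<bar>)"
   proof (intro always_eventually allI)
    fix n
    have di: "integrable TX (\<lambda>x. \<bar>tmoll n f x - f x\<bar>)" using tmoll_torus_int[OF f, of n] f by auto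
    have pt: "\<bar>F (tmoll n f x) * dderiv ?e \<rho> x - F (f x) * dderiv ?e \<rho> x\<bar> \<le> C * B * \<bar>tmoll n f x - f x\<bar>" for x
    proof -
     have "\<bar>F (tmoll n f x) - F (f x)\<bar> * \<bar>dderiv ?e \<rho> x\<bar> \<le> (C * \<bar>tmoll n f x - f x\<bar>) * B"
      using lip B(2) C0 by (intro mult_mono) auto
     then show ?thesis by (simp add: left_diff_distrib[symmetric] abs_mult mult_ac)
    qed
    have i2: "integrable TX (\<lambda>x. F (f x) * dderiv ?e \<rho> x)"
    proof (rule B_integrable_bound[of _ "\<lambda>x. B * F (f x)"])
     show "AE x in TX. norm (F (f x) * dderiv ?e \<rho> x) \<le> norm (B * F (f x))"
     proof (rule AE_I2)
      fix x show "norm (F (f x) * dderiv ?e \<rho> x) \<le> norm (B * F (f x))"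
       using mult_right_mono[OF B(2)[of x], of "abs (F (f x))"] B0 by (simp add: abs_mult mult.commute)
     qed
    qed (use Fi in auto)
    have i3: "integrable TX (\<lambda>x. F (tmoll n f x) * dderiv ?e \<rho> x - F (f x) * dderiv ?e \<rho> x)"
    proof (rule B_integrable_bound[of _ "\<lambda>x. C * B * \<bar>tmoll n f x - f x\<bar>"])
     show "AE x in TX. norm (F (tmoll n f x) * dderiv ?e \<rho> x - F (f x) * dderiv ?e \<rho> x) \<le> norm (C * B * \<bar>tmoll n f x - f x\<bar>)"
      using pt C0 B0 by (simp add: abs_mult)
    qed (use di in auto)
    have i1: "integrable TX (\<lambda>x. F (tmoll n f x) * dderiv ?e \<rho> x)" using B_integrable_add[OF i3 i2] by simp
    have "norm ((LINT x|TX. F (tmoll n f x) * dderiv ?e \<rho> x) - (LINT x|TX. F (f x) * dderiv ?e \<rho> x))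
     = \<bar>(LINT x|TX. F (tmoll n f x) * dderiv ?e \<rho> x - F (f x) * dderiv ?e \<rho> x)\<bar>" using i1 i2 by simp
    also have "\<dots> \<le> (LINT x|TX. \<bar>F (tmoll n f x) * dderiv ?e \<rho> x - F (f x) * dderiv ?e \<rho> x\<bar>)" by (rule integral_abs_bound)
    also have "\<dots> \<le> (LINT x|TX. C * B * \<bar>tmoll n f x - f x\<bar>)" using pt i3 di by (intro integral_mono) auto
    finally show "norm ((LINT x|TX. F (tmoll n f x) * dderiv ?e \<rho> x) - (LINT x|TX. F (f x) * dderiv ?e \<rho> x))
    \<le> C * B * (LINT x|TX. \<bar>tmoll n f x - f x\<bar>)" by simp
   qed
  qed
  have L2: "(\<lambda>n. (LINT x|TX. F' (tmoll (r n) f x) * ?g x * \<rho> x)) \<longlonglongrightarrow> (LINT x|TX. F' (f x) * ?g x * \<rho> x)"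
  proof (rule integral_dominated_convergence[where w="\<lambda>x. C * B * \<bar>?g x\<bar>"])
   show "AE x in TX. (\<lambda>n. F' (tmoll (r n) f x) * ?g x * \<rho> x) \<longlonglongrightarrow> F' (f x) * ?g x * \<rho> x" using r(2)
   proof eventually_elim
    case (elim x)
    have "isCont F' (f x)" using c by (simp add: continuous_on_eq_continuous_at)
    then have "(\<lambda>n. F' (tmoll (r n) f x)) \<longlonglongrightarrow> F' (f x)" using elim by (rule isCont_tendsto_compose)
    then show ?case by (intro tendsto_mult tendsto_const)
   qed
   show "AE x in TX. norm (F' (tmoll (r n) f x) * ?g x * \<rho> x) \<le> C * B * \<bar>?g x\<bar>" for n
   proof (rule AE_I2)
    fix x
    have "\<bar>F' (tmoll (r n) f x)\<bar> * \<bar>\<rho> x\<bar> * \<bar>?g x\<bar> \<le> C * B * \<bar>?g x\<bar>"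
     using b B(1) C0 B0 by (intro mult_mono) auto
    then show "norm (F' (tmoll (r n) f x) * ?g x * \<rho> x) \<le> C * B * \<bar>?g x\<bar>" by (simp add: abs_mult mult_ac)
   qed
  qed (use Gi in auto)
  have L3: "(\<lambda>n. (LINT x|TX. F' (tmoll (r n) f x) * (tmoll (r n) ?g x - ?g x) * \<rho> x)) \<longlonglongrightarrow> 0"
  proof (rule Lim_null_comparison)
   have "(\<lambda>n. (LINT x|TX. \<bar>tmoll (r n) ?g x - ?g x\<bar>)) \<longlonglongrightarrow> 0"
    using LIMSEQ_subseq_LIMSEQ[OF tmoll_L1[OF Gi, of i] r(1)] by (simp add: o_def)
   then have "(\<lambda>n. C * B * (LINT x|TX. \<bar>tmoll (r n) ?g x - ?g x\<bar>)) \<longlonglongrightarrow> C * B * 0" by (intro tendsto_intros)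
   then show "(\<lambda>n. C * B * (LINT x|TX. \<bar>tmoll (r n) ?g x - ?g x\<bar>)) \<longlonglongrightarrow> 0" by simp
   show "\<forall>\<^sub>F n in sequentially. norm (LINT x|TX. F' (tmoll (r n) f x) * (tmoll (r n) ?g x - ?g x) * \<rho> x)
    \<le> C * B * (LINT x|TX. \<bar>tmoll (r n) ?g x - ?g x\<bar>)"
   proof (intro always_eventually allI)
    fix n
    have di: "integrable TX (\<lambda>x. \<bar>tmoll (r n) ?g x - ?g x\<bar>)" using tmoll_torus_int[OF Gi, of "r n" i] Gi[of i] by auto
    have pt: "\<bar>F' (tmoll (r n) f x) * (tmoll (r n) ?g x - ?g x) * \<rho> x\<bar> \<le> C * B * \<bar>tmoll (r n) ?g x - ?g x\<bar>" for x
    proof -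
     have "\<bar>F' (tmoll (r n) f x)\<bar> * \<bar>\<rho> x\<bar> * \<bar>tmoll (r n) ?g x - ?g x\<bar> \<le> C * B * \<bar>tmoll (r n) ?g x - ?g x\<bar>"
      using b B(1) C0 B0 by (intro mult_mono) auto
     then show ?thesis by (simp add: abs_mult mult_ac)
    qed
    have i3: "integrable TX (\<lambda>x. F' (tmoll (r n) f x) * (tmoll (r n) ?g x - ?g x) * \<rho> x)"
    proof (rule B_integrable_bound[of _ "\<lambda>x. C * B * \<bar>tmoll (r n) ?g x - ?g x\<bar>"])
     show "AE x in TX. norm (F' (tmoll (r n) f x) * (tmoll (r n) ?g x - ?g x) * \<rho> x) \<le> norm (C * B * \<bar>tmoll (r n) ?g x - ?g x\<bar>)"
      using pt C0 B0 by (simp add: abs_mult[of "C * B"] abs_mult[of C])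
    qed (use di in auto)
    have "\<bar>(LINT x|TX. F' (tmoll (r n) f x) * (tmoll (r n) ?g x - ?g x) * \<rho> x)\<bar>
     \<le> (LINT x|TX. \<bar>F' (tmoll (r n) f x) * (tmoll (r n) ?g x - ?g x) * \<rho> x\<bar>)" by (rule integral_abs_bound)
    also have "\<dots> \<le> (LINT x|TX. C * B * \<bar>tmoll (r n) ?g x - ?g x\<bar>)" using pt i3 di by (intro integral_mono) auto
    finally show "norm (LINT x|TX. F' (tmoll (r n) f x) * (tmoll (r n) ?g x - ?g x) * \<rho> x)
    \<le> C * B * (LINT x|TX. \<bar>tmoll (r n) ?g x - ?g x\<bar>)" by simp
   qed
  qed
  have split: "(LINT x|TX. F' (tmoll n f x) * (tmoll n ?g x - ?g x) * \<rho> x) + (LINT x|TX. F' (tmoll n f x) * ?g x * \<rho> x)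
   = (LINT x|TX. F' (tmoll n f x) * tmoll n ?g x * \<rho> x)" for n
  proof -
   have ii: "integrable TX (\<lambda>x. F' (tmoll n f x) * q x * \<rho> x)" if q: "integrable TX q" for q
   proof (rule B_integrable_bound[of _ "\<lambda>x. C * B * abs (q x)"])
    have [measurable]: "q \<in> borel_measurable TX" using q by simp
    show "(\<lambda>x. F' (tmoll n f x) * q x * \<rho> x) \<in> borel_measurable TX" by measurable
    show "AE x in TX. norm (F' (tmoll n f x) * q x * \<rho> x) \<le> norm (C * B * abs (q x))"
    proof (rule AE_I2)
     fix x
     have "abs (F' (tmoll n f x)) * \<bar>\<rho> x\<bar> * abs (q x) \<le> C * B * abs (q x)"
      using b B(1) C0 B0 by (intro mult_mono) auto
     then show "norm (F' (tmoll n f x) * q x * \<rho> x) \<le> norm (C * B * abs (q x))" using C0 B0 by (simp add: abs_mult mult_ac)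
    qed
   qed (use q in auto)
   have "F' (tmoll n f x) * (tmoll n ?g x - ?g x) * \<rho> x + F' (tmoll n f x) * ?g x * \<rho> x = F' (tmoll n f x) * tmoll n ?g x * \<rho> x" for x
    by (simp add: algebra_simps)
   then show ?thesis
    using B_integral_add[OF ii[OF B_integrable_diff[OF tmoll_torus_int[OF Gi, of n i] Gi[of i]]] ii[OF Gi[of i]]]
    by simp
  qed
  have "(\<lambda>n. (LINT x|TX. F' (tmoll (r n) f x) * tmoll (r n) ?g x * \<rho> x)) \<longlonglongrightarrow> (LINT x|TX. F' (f x) * ?g x * \<rho> x)"
   using tendsto_add[OF L3 L2] unfolding split by simp
  then have "(\<lambda>n. (LINT x|TX. F (tmoll (r n) f x) * dderiv ?e \<rho> x)) \<longlonglongrightarrow> - (LINT x|TX. F' (f x) * ?g x * \<rho> x)"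
   unfolding eq by (rule tendsto_minus)
  moreover have "(\<lambda>n. (LINT x|TX. F (tmoll (r n) f x) * dderiv ?e \<rho> x)) \<longlonglongrightarrow> (LINT x|TX. F (f x) * dderiv ?e \<rho> x)"
   using LIMSEQ_subseq_LIMSEQ[OF L1 r(1)] by (simp add: o_def)
  ultimately have "- (LINT x|TX. F' (f x) * ?g x * \<rho> x) = (LINT x|TX. F (f x) * dderiv ?e \<rho> x)" by (rule LIMSEQ_unique)
  from this[symmetric] show "(LINT x|TX. F (f x) * dderiv ?e \<rho> x) = - (LINT x|TX. (F' (f x) *\<^sub>R G x) $ i * \<rho> x)"
   by (simp only: vector_scaleR_component real_scaleR_def)
 qed
qed

lemma continuous_abs_powr: "a > 0 \<Longrightarrow> continuous_on S (\<lambda>r::real. abs r powr a)"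
 by (rule continuous_on_powr') (auto intro: continuous_intros)

lemma pw_abs: "abs (pw a r) = abs r powr (a + 1)"
 by (simp add: pw_def abs_mult powr_add)

lemma pw_deriv:
 assumes a: "a > 0" shows "(pw a has_real_derivative (a + 1) * abs r powr a) (at r)"
proof -
 consider "r > 0" | "r < 0" | "r = 0" by linarith
 then show ?thesis
 proof cases
  case 1
  have "((\<lambda>r. r powr (a + 1)) has_real_derivative (a + 1) * abs r powr a) (at r)" using 1 by (auto intro!: derivative_eq_intros)
  then show ?thesis by (rule has_field_derivative_transform_within_open[where S="{0<..}"]) (use 1 in \<open>auto simp: pw_def powr_add\<close>)
 next
  case 2
  have "((\<lambda>r. - ((- r) powr (a + 1))) has_real_derivative (a + 1) * abs r powr a) (at r)"
   using 2 by (auto intro!: derivative_eq_intros)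
  then show ?thesis by (rule has_field_derivative_transform_within_open[where S="{..<0}"]) (use 2 in \<open>auto simp: pw_def powr_add\<close>)
 next
  case 3
  have "isCont (\<lambda>h::real. abs h powr a) 0" using continuous_abs_powr[OF a, of UNIV] by (simp add: continuous_on_eq_continuous_at)
  then have "((\<lambda>h::real. abs h powr a) \<longlongrightarrow> \<bar>0\<bar> powr a) (at 0)" unfolding isCont_def .
  then have "((\<lambda>h::real. abs h powr a) \<longlongrightarrow> 0) (at 0)" by simp
  then have "((\<lambda>h. (pw a (0 + h) - pw a 0) / h) \<longlongrightarrow> 0) (at 0)"
   by (rule Lim_transform_eventually) (auto simp: eventually_at_filter pw_def)
  then show ?thesis using 3 by (simp add: DERIV_def)
 qed
qed

lemma continuous_pw: "a > 0 \<Longrightarrow> continuous_on S (pw a)"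
 unfolding pw_def[abs_def] by (intro continuous_intros continuous_abs_powr)

lemma pw_borel [measurable]: "pw a \<in> borel_measurable borel"
 unfolding pw_def[abs_def] by measurable

lemma pw_pw: 
 assumes m: "m > 1"
 shows "pw ((m - 1) / (m + 1)) (pw ((m - 1) / 2) r) = pw (m - 1) r"
  and "\<bar>pw ((m - 1) / 2) r\<bar> powr ((m - 1) / (m + 1)) = abs r powr ((m - 1) / 2)"
proof -
 have e: "((m - 1) / 2 + 1) * ((m - 1) / (m + 1)) = (m - 1) / 2" using m by (simp add: field_simps)
 show *: "\<bar>pw ((m - 1) / 2) r\<bar> powr ((m - 1) / (m + 1)) = abs r powr ((m - 1) / 2)" by (simp only: pw_abs powr_powr e)
 show "pw ((m - 1) / (m + 1)) (pw ((m - 1) / 2) r) = pw (m - 1) r"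
  unfolding pw_def[of "(m - 1) / (m + 1)"] * by (simp add: pw_def powr_add[symmetric] flip: mult.assoc)
qed

lemma pw_mono: assumes "a \<ge> 0" "r \<le> s" shows "pw a r \<le> pw a s"
proof -
 consider "0 \<le> r" | "r < 0" "0 \<le> s" | "s < 0" by linarith
 then show ?thesis
 proof cases
  case 1
  then show ?thesis using assms unfolding pw_def by (intro mult_mono powr_mono2) auto
 next
  case 2
  then have "pw a r \<le> 0" "0 \<le> pw a s" unfolding pw_def by (auto simp: mult_nonneg_nonpos)
  then show ?thesis by linarith
 next
  case 3
  then have "abs s powr a * (- s) \<le> abs r powr a * (- r)" using assms by (intro mult_mono powr_mono2) auto
  then show ?thesis unfolding pw_def by simp
 qed
qed

text \<open>For \<open>c > 0\<close> a diffeomorphism onto a bounded interval with derivative between zero and one; it tends to the identity as \<open>c\<close> tends to zero.\<close>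

definition squash :: "real \<Rightarrow> real \<Rightarrow> real" where
 "squash c r = r / sqrt (1 + (c * r)\<^sup>2)"

lemma squash_pos: "0 < 1 + (c * r)\<^sup>2" for c r :: real
 using zero_le_power2[of "c * r"] by linarith

lemma squash_deriv: "(squash c has_real_derivative 1 / ((1 + (c * r)\<^sup>2) * sqrt (1 + (c * r)\<^sup>2))) (at r)"
proof -
 let ?q = "1 + (c * r)\<^sup>2"
 have q: "?q > 0" by (rule squash_pos)
 have 1: "((\<lambda>r. sqrt (1 + (c * r)\<^sup>2)) has_real_derivative (c * (c * r)) / sqrt ?q) (at r)"
  using q by (auto intro!: derivative_eq_intros simp: field_simps power2_eq_square)
 have "((\<lambda>r. r / sqrt (1 + (c * r)\<^sup>2)) has_real_derivative (1 * sqrt ?q - r * ((c * (c * r)) / sqrt ?q)) / (sqrt ?q * sqrt ?q)) (at r)"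
  using q by (intro DERIV_divide DERIV_ident 1) auto
 moreover have "(1 * sqrt ?q - r * ((c * (c * r)) / sqrt ?q)) / (sqrt ?q * sqrt ?q) = 1 / (?q * sqrt ?q)"
 proof -
  have s: "sqrt ?q > 0" "sqrt ?q * sqrt ?q = ?q" using q by simp_all
  have "1 * sqrt ?q - r * ((c * (c * r)) / sqrt ?q) = (sqrt ?q * sqrt ?q - (c * r)\<^sup>2) / sqrt ?q"
   using s(1) by (simp add: field_simps power2_eq_square)
  also have "\<dots> = 1 / sqrt ?q" unfolding s(2) by simp
  finally show ?thesis unfolding s(2) by (simp add: mult.commute)
 qed
 ultimately show ?thesis by (simp add: squash_def[abs_def])
qed

lemma squash_le: "abs (squash c r) \<le> abs r"
proof -
 have "1 \<le> sqrt (1 + (c * r)\<^sup>2)" by simp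
 then have "abs r / sqrt (1 + (c * r)\<^sup>2) \<le> abs r / 1" using squash_pos[of c r] by (intro divide_left_mono) auto
 then show ?thesis by (simp add: squash_def abs_divide)
qed

lemma squash_bound: assumes "c > 0" shows "abs (squash c r) \<le> 1 / c"
proof -
 have "\<bar>c * r\<bar> \<le> sqrt (1 + (c * r)\<^sup>2)" by (rule real_le_rsqrt) simp
 then have "c * abs r \<le> sqrt (1 + (c * r)\<^sup>2)" using assms by (simp add: abs_mult)
 then show ?thesis using assms squash_pos[of c r] by (simp add: squash_def abs_divide divide_le_eq le_divide_eq mult.commute)
qed

lemma squash_deriv_bounds: "0 \<le> 1 / ((1 + (c * r)\<^sup>2) * sqrt (1 + (c * r)\<^sup>2))" "1 / ((1 + (c * r)\<^sup>2) * sqrt (1 + (c * r)\<^sup>2)) \<le> 1" for c r :: real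
proof -
 have "1 * 1 \<le> (1 + (c * r)\<^sup>2) * sqrt (1 + (c * r)\<^sup>2)" by (intro mult_mono) auto
 then show "0 \<le> 1 / ((1 + (c * r)\<^sup>2) * sqrt (1 + (c * r)\<^sup>2))" "1 / ((1 + (c * r)\<^sup>2) * sqrt (1 + (c * r)\<^sup>2)) \<le> 1"
  by (auto simp: divide_le_eq)
qed

text \<open>The signed power has an unbounded derivative, so it is composed with \<open>squash\<close>, whose decay makes the derivative of the composition
 bounded. Dominated convergence removes the truncation.\<close>

lemma chain_rule_pw:
 fixes w :: "real ^ 'd \<Rightarrow> real"
 assumes w: "has_torus_wgrad w G" and a: "a > 0"
  and i1: "integrable TX (\<lambda>x. pw a (w x))"
  and i2: "integrable TX (\<lambda>x. ((a + 1) * abs (w x) powr a) *\<^sub>R G x)"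
 shows "has_torus_wgrad (\<lambda>x. pw a (w x)) (\<lambda>x. ((a + 1) * abs (w x) powr a) *\<^sub>R G x)" unfolding has_torus_wgrad_def
proof (intro conjI i1 i2 allI impI)
 fix \<rho> :: "real ^ 'd \<Rightarrow> real" and i assume \<rho>: "smooth \<rho> \<and> periodic \<rho>"
 let ?e = "axis i 1 :: real ^ 'd"
 obtain B where B: "\<And>x. \<bar>\<rho> x\<bar> \<le> B" "\<And>x. \<bar>dderiv ?e \<rho> x\<bar> \<le> B"
  using smooth_periodic_bounded[of \<rho> ?e] \<rho> by (metis axis_Basis)
 have B0: "0 \<le> B" using B(1)[of 0] by linarith
 have [measurable]: "\<rho> \<in> borel_measurable TX" "dderiv ?e \<rho> \<in> borel_measurable TX"
  using \<rho> by (auto intro!: measurable_torus borel_measurable_continuous_onI smooth_continuous smooth_dderiv)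
 have wG [measurable]: "w \<in> borel_measurable TX" "G \<in> borel_measurable TX" using w by (auto simp: has_torus_wgrad_def)
 have [measurable]: "(\<lambda>x. G x $ i) \<in> borel_measurable TX" using integrable_vec_nth[of TX G i] w by (auto simp: has_torus_wgrad_def)
 have i2': "integrable TX (\<lambda>x. (a + 1) * abs (w x) powr a * G x $ i)" using integrable_vec_nth[OF i2, of i] by simp
 define c where "c n = 1 / real (Suc n)" for n
 have c: "c n > 0" for n by (simp add: c_def)
 have c_lim: "c \<longlonglongrightarrow> 0" unfolding c_def[abs_def] by (rule LIMSEQ_Suc) (rule lim_const_over_n)
 define D where "D n r = 1 / ((1 + (c n * r)\<^sup>2) * sqrt (1 + (c n * r)\<^sup>2))" for n r
 define F' where "F' n r = (a + 1) * \<bar>squash (c n) r\<bar> powr a * D n r" for n r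
 have sq_cont: "continuous_on UNIV (squash k)" for k using squash_deriv by (intro DERIV_continuous_on) (auto intro: has_field_derivative_at_within)
 have D01: "0 \<le> D n r" "D n r \<le> 1" for n r unfolding D_def by (rule squash_deriv_bounds)+
 have D_cont: "continuous_on UNIV (D n)" for n
  unfolding D_def[abs_def] using squash_pos[of "c n"] by (intro continuous_intros) (auto simp: less_imp_neq[symmetric])
 have F'_cont: "continuous_on UNIV (F' n)" for n unfolding F'_def[abs_def]
  by (intro continuous_intros D_cont continuous_on_compose2[OF continuous_abs_powr[OF a, of UNIV] sq_cont subset_UNIV])
 have F'_le: "abs (F' n r) \<le> (a + 1) * abs r powr a" for n r
 proof -
  have "\<bar>squash (c n) r\<bar> powr a \<le> abs r powr a" using a squash_le by (intro powr_mono2) auto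
  then have "(a + 1) * \<bar>squash (c n) r\<bar> powr a * D n r \<le> (a + 1) * abs r powr a * 1" using a D01 by (intro mult_mono) auto
  then show ?thesis unfolding F'_def using a D01[of n r] by (simp add: abs_mult)
 qed
 have F'_b: "abs (F' n r) \<le> (a + 1) * (1 / c n) powr a" for n r
 proof -
  have "\<bar>squash (c n) r\<bar> powr a \<le> (1 / c n) powr a" using a squash_bound[OF c] by (intro powr_mono2) auto
  then have "(a + 1) * \<bar>squash (c n) r\<bar> powr a * D n r \<le> (a + 1) * (1 / c n) powr a * 1" using a D01 by (intro mult_mono) auto
  then show ?thesis unfolding F'_def using a D01[of n r] by (simp add: abs_mult)
 qed
 have F_d: "((\<lambda>r. pw a (squash (c n) r)) has_real_derivative F' n r) (at r)" for n r
  unfolding F'_def D_def by (rule DERIV_chain2[OF pw_deriv[OF a] squash_deriv])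
 have F_le: "\<bar>pw a (squash (c n) r)\<bar> \<le> abs (pw a r)" for n r unfolding pw_abs using a squash_le by (intro powr_mono2) auto
 have sq_lim: "(\<lambda>n. squash (c n) r) \<longlonglongrightarrow> r" for r
 proof -
  have "(\<lambda>n. r / sqrt (1 + (c n * r)\<^sup>2)) \<longlonglongrightarrow> r / sqrt (1 + (0 * r)\<^sup>2)" by (intro tendsto_intros c_lim) simp
  then show ?thesis by (simp add: squash_def)
 qed
 have D_lim: "(\<lambda>n. D n r) \<longlonglongrightarrow> 1" for r
 proof -
  have "(\<lambda>n. D n r) \<longlonglongrightarrow> 1 / ((1 + (0 * r)\<^sup>2) * sqrt (1 + (0 * r)\<^sup>2))"
   unfolding D_def by (intro tendsto_intros c_lim) simp
  then show ?thesis by simp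
 qed
 have eq: "(LINT x|TX. pw a (squash (c n) (w x)) * dderiv ?e \<rho> x) = - (LINT x|TX. F' n (w x) * G x $ i * \<rho> x)" for n
  using chain_rule_C1[OF w F_d[of n] F'_cont[of n] F'_b[of n]] \<rho> unfolding has_torus_wgrad_def by (simp add: mult_ac)
 have [measurable]: "squash (c n) \<in> borel_measurable borel" "F' n \<in> borel_measurable borel" for n
  using sq_cont F'_cont by (auto intro: borel_measurable_continuous_onI)
 have L1: "(\<lambda>n. (LINT x|TX. pw a (squash (c n) (w x)) * dderiv ?e \<rho> x)) \<longlonglongrightarrow> (LINT x|TX. pw a (w x) * dderiv ?e \<rho> x)"
 proof (rule integral_dominated_convergence[where w="\<lambda>x. abs (pw a (w x)) * B"])
  show "AE x in TX. (\<lambda>n. pw a (squash (c n) (w x)) * dderiv ?e \<rho> x) \<longlonglongrightarrow> pw a (w x) * dderiv ?e \<rho> x"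
  proof (rule AE_I2)
   fix x
   have "isCont (pw a) (w x)" using continuous_pw[OF a, of UNIV] by (simp add: continuous_on_eq_continuous_at)
   then have "(\<lambda>n. pw a (squash (c n) (w x))) \<longlonglongrightarrow> pw a (w x)" using sq_lim by (rule isCont_tendsto_compose)
   then show "(\<lambda>n. pw a (squash (c n) (w x)) * dderiv ?e \<rho> x) \<longlonglongrightarrow> pw a (w x) * dderiv ?e \<rho> x"
    by (intro tendsto_mult tendsto_const)
  qed
  show "AE x in TX. norm (pw a (squash (c n) (w x)) * dderiv ?e \<rho> x) \<le> abs (pw a (w x)) * B" for n
   using F_le B(2) by (intro AE_I2) (auto simp: abs_mult intro!: mult_mono)
 qed (use i1 in auto)
 have L2: "(\<lambda>n. (LINT x|TX. F' n (w x) * G x $ i * \<rho> x)) \<longlonglongrightarrow> (LINT x|TX. ((a + 1) * abs (w x) powr a) * G x $ i * \<rho> x)"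
 proof (rule integral_dominated_convergence[where w="\<lambda>x. \<bar>(a + 1) * abs (w x) powr a * G x $ i\<bar> * B"])
  show "AE x in TX. (\<lambda>n. F' n (w x) * G x $ i * \<rho> x) \<longlonglongrightarrow> ((a + 1) * abs (w x) powr a) * G x $ i * \<rho> x"
  proof (rule AE_I2)
   fix x
   have "isCont (\<lambda>r. abs r powr a) (w x)" using continuous_abs_powr[OF a, of UNIV] by (simp add: continuous_on_eq_continuous_at)
   then have "(\<lambda>n. \<bar>squash (c n) (w x)\<bar> powr a) \<longlonglongrightarrow> \<bar>w x\<bar> powr a"
    using sq_lim by (rule isCont_tendsto_compose)
   then have "(\<lambda>n. F' n (w x)) \<longlonglongrightarrow> (a + 1) * abs (w x) powr a * 1"
    unfolding F'_def using D_lim by (intro tendsto_mult tendsto_const)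
   then have "(\<lambda>n. F' n (w x)) \<longlonglongrightarrow> (a + 1) * abs (w x) powr a" by simp
   then show "(\<lambda>n. F' n (w x) * G x $ i * \<rho> x) \<longlonglongrightarrow> ((a + 1) * abs (w x) powr a) * G x $ i * \<rho> x"
    by (intro tendsto_mult tendsto_const)
  qed
  show "AE x in TX. norm (F' n (w x) * G x $ i * \<rho> x) \<le> \<bar>(a + 1) * abs (w x) powr a * G x $ i\<bar> * B" for n
  proof (rule AE_I2)
   fix x
   have "abs (F' n (w x)) * \<bar>G x $ i\<bar> * \<bar>\<rho> x\<bar> \<le> ((a + 1) * abs (w x) powr a) * \<bar>G x $ i\<bar> * B"
    using F'_le B(1) a by (intro mult_mono) auto
   then show "norm (F' n (w x) * G x $ i * \<rho> x) \<le> \<bar>(a + 1) * abs (w x) powr a * G x $ i\<bar> * B" using a by (simp add: abs_mult)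
  qed
 qed (use i2' in auto)
 show "(LINT x|TX. pw a (w x) * dderiv ?e \<rho> x) = - (LINT x|TX. (((a + 1) * abs (w x) powr a) *\<^sub>R G x) $ i * \<rho> x)"
  using LIMSEQ_unique[OF L1 tendsto_minus[OF L2, folded eq]] by simp
qed

section \<open>A Poincare inequality\<close>

lemma (in finite_measure) square_integrable_imp_integrable_real:
 fixes f :: "'a \<Rightarrow> real"
 assumes [measurable]: "f \<in> borel_measurable M" and i: "integrable M (\<lambda>x. (f x)\<^sup>2)"
 shows "integrable M f"
proof (rule B_integrable_bound[of _ "\<lambda>x. 1 + (f x)\<^sup>2"])
 have "abs t \<le> 1 + t\<^sup>2" for t :: real
 proof -
  have "0 \<le> (abs t - 1)\<^sup>2" by simp
  then have "2 * abs t \<le> 1 + t\<^sup>2" by (simp add: power2_eq_square algebra_simps)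
  then show ?thesis using abs_ge_zero[of t] by linarith
 qed
 then show "AE x in M. norm (f x) \<le> norm (1 + (f x)\<^sup>2)" by (auto simp: abs_of_nonneg)
qed (use i in auto)

text \<open>The variance with respect to the weight is nonnegative.\<close>

lemma weighted_jensen_square:
 fixes k f :: "'b \<Rightarrow> real"
 assumes k: "\<And>x. x \<in> space M \<Longrightarrow> 0 \<le> k x" "integrable M k" "(LINT x|M. k x) = 1"
  and f: "integrable M (\<lambda>x. k x * f x)" "integrable M (\<lambda>x. k x * (f x)\<^sup>2)"
 shows "(LINT x|M. k x * f x)\<^sup>2 \<le> (LINT x|M. k x * (f x)\<^sup>2)"
proof -
 let ?m = "(LINT x|M. k x * f x)"
 have "0 \<le> (LINT x|M. k x * (f x - ?m)\<^sup>2)" using k by (intro B_integral_nonneg) auto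
 also have "\<dots> = (LINT x|M. k x * (f x)\<^sup>2 - 2 * ?m * (k x * f x) + ?m\<^sup>2 * k x)"
  by (intro B_integral_cong) (auto simp: power2_eq_square algebra_simps)
 also have "\<dots> = (LINT x|M. k x * (f x)\<^sup>2) - 2 * ?m * ?m + ?m\<^sup>2 * 1" using k f by simp
 finally show ?thesis by (simp add: power2_eq_square)
qed

lemma abs_square_le: "abs x \<le> C \<Longrightarrow> \<bar>x\<^sup>2\<bar> \<le> C * C" for x C :: real
 unfolding power2_eq_square abs_mult by (intro mult_mono) auto

text \<open>The mean value theorem for \<open>r \<mapsto> \<integral> f (x + r h) g(x) dx\<close>, with \<open>g\<close> the increment itself, bounds \<open>\<integral> g\<^sup>2\<close> by a pairing of a translate of \<open>D\<close>
 with \<open>g\<close>, and translations preserve the integral.\<close>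

lemma translation_L2:
 fixes f D :: "real ^ 'd \<Rightarrow> real"
 assumes d: "\<And>x r. ((\<lambda>r. f (x + r *\<^sub>R h)) has_real_derivative D (x + r *\<^sub>R h)) (at r)"
  and f [measurable]: "f \<in> borel_measurable borel" and fp: "periodic f" and fC: "\<And>x. abs (f x) \<le> C"
  and D [measurable]: "D \<in> borel_measurable borel" and Dp: "periodic D" and DC: "\<And>x. abs (D x) \<le> C"
 shows "(LINT x|TX. (f (x + h) - f x)\<^sup>2) \<le> (LINT x|TX. (D x)\<^sup>2)"
proof -
 have C0: "0 \<le> C" using fC[of 0] by linarith
 define g where "g x = f (x + h) - f x" for x
 have gm [measurable]: "g \<in> borel_measurable borel" unfolding g_def by measurable
 have gC: "abs (g x) \<le> 2 * C" for x using fC[of x] fC[of "x + h"] unfolding g_def by linarith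
 have gi: "integrable TX g" by (rule torus_integrable_bounded[OF gm gC])
 define P where "P r = (LINT x|TX. f (x + r *\<^sub>R h) * g x)" for r
 have "(P has_real_derivative (LINT x|TX. D (x + r *\<^sub>R h) * g x)) (at r)" for r unfolding P_def[abs_def]
  by (rule param_deriv[OF gi, where C=C]) (auto intro!: measurable_torus d fC DC)
 then have "\<exists>z>0. z < 1 \<and> P 1 - P 0 = (1 - 0) * (LINT x|TX. D (x + z *\<^sub>R h) * g x)" by (intro MVT2) auto
 then obtain z where z: "P 1 - P 0 = (LINT x|TX. D (x + z *\<^sub>R h) * g x)" by auto
 have fg: "integrable TX (\<lambda>x. f (x + r *\<^sub>R h) * g x)" for r
  by (rule torus_integrable_bounded[where C="C * (2 * C)"]) (auto simp: abs_mult intro!: mult_mono fC gC C0)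
 have Dg: "integrable TX (\<lambda>x. D (x + r *\<^sub>R h) * g x)" for r
  by (rule torus_integrable_bounded[where C="C * (2 * C)"]) (auto simp: abs_mult intro!: mult_mono DC gC C0)
 have g2: "integrable TX (\<lambda>x. (g x)\<^sup>2)"
  by (rule torus_integrable_bounded[where C="(2 * C) * (2 * C)"]) (measurable, rule abs_square_le, rule gC)
 have D2: "integrable TX (\<lambda>x. (D x)\<^sup>2)" by (rule torus_integrable_bounded[where C="C * C"]) (measurable, rule abs_square_le, rule DC)
 have D2p: "periodic (\<lambda>x. (D x)\<^sup>2)" using Dp by (simp add: periodic_def)
 note D2s = torus_shift[OF _ D2p D2, of "z *\<^sub>R h"]
 have "(LINT x|TX. (g x)\<^sup>2) = P 1 - P 0"
 proof -
  have "P 1 - P 0 = (LINT x|TX. f (x + 1 *\<^sub>R h) * g x - f (x + 0 *\<^sub>R h) * g x)"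
   unfolding P_def using fg by (intro B_integral_diff[symmetric])
  also have "\<dots> = (LINT x|TX. (g x)\<^sup>2)" by (intro B_integral_cong) (auto simp: g_def power2_eq_square algebra_simps)
  finally show ?thesis by simp
 qed
 also have "\<dots> \<le> (LINT x|TX. ((D (x + z *\<^sub>R h))\<^sup>2 + (g x)\<^sup>2) / 2)" unfolding z
 proof (intro integral_mono Dg)
  show "integrable TX (\<lambda>x. ((D (x + z *\<^sub>R h))\<^sup>2 + (g x)\<^sup>2) / 2)" using g2 D2s(1) by auto
  show "D (x + z *\<^sub>R h) * g x \<le> ((D (x + z *\<^sub>R h))\<^sup>2 + (g x)\<^sup>2) / 2" for x
   using sum_squares_bound[of "D (x + z *\<^sub>R h)" "g x"] by simp
 qed
 also have "\<dots> = ((LINT x|TX. (D x)\<^sup>2) + (LINT x|TX. (g x)\<^sup>2)) / 2" using g2 D2s by simp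
 finally show ?thesis unfolding g_def by simp
qed

text \<open>The mean is controlled by the \<open>L\<^sub>1\<close> norm, so square integrability of \<open>f\<close> is part of the conclusion; hence the
 integral on the left is an extended one. The translation estimate is applied to mollifications.\<close>

lemma poincare:
 fixes f :: "real ^ 'd \<Rightarrow> real"
 assumes w: "has_torus_wgrad f G" and G2: "integrable TX (\<lambda>x. (norm (G x))\<^sup>2)"
 shows "(\<integral>\<^sup>+x. ennreal ((f x)\<^sup>2) \<partial>TX)
  \<le> ennreal (2 * (real CARD('d))\<^sup>2 * (LINT x|TX. (norm (G x))\<^sup>2) + 2 * (LINT x|TX. abs (f x))\<^sup>2)"
proof -
 have f: "integrable TX f" and G: "integrable TX G" using w by (auto simp: has_torus_wgrad_def)
 have Gi: "integrable TX (\<lambda>y. G y $ i)" for i using G by (rule integrable_vec_nth)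
 have [measurable]: "f \<in> borel_measurable TX" "G \<in> borel_measurable TX" using f G by auto
 have [measurable]: "(\<lambda>y. G y $ i) \<in> borel_measurable TX" for i using Gi by simp
 have Gle: "(G x $ i)\<^sup>2 \<le> (norm (G x))\<^sup>2" for x i
  using component_le_norm_cart[of "G x" i] by (metis abs_le_square_iff abs_norm_cancel)
 have Gi2: "integrable TX (\<lambda>x. (G x $ i)\<^sup>2)" for i by (rule B_integrable_bound[OF G2]) (use Gle in auto)
 define g where "g n i = tmoll n (\<lambda>y. G y $ i)" for n i
 define E where "E = (LINT x|TX. (norm (G x))\<^sup>2)"
 have "\<exists>C. \<forall>x. abs (g n i x) \<le> C" for n i using tmoll_bounded[OF Gi[of i], of n] unfolding g_def by metis
 then obtain A where A: "\<And>n i x. abs (g n i x) \<le> A n i" by metis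
 have A0: "0 \<le> A n i" for n i using A[of n i 0] by linarith
 have gm [measurable]: "g n i \<in> borel_measurable borel" for n i unfolding g_def by measurable
 have gp: "periodic (g n i)" for n i unfolding g_def by (rule tmoll_periodic)
 have g2i: "integrable TX (\<lambda>x. (g n i x)\<^sup>2)" for n i
  by (rule torus_integrable_bounded[where C="A n i * A n i"]) (measurable, rule abs_square_le, rule A)
 have g2: "(LINT x|TX. (g n i x)\<^sup>2) \<le> (LINT x|TX. (G x $ i)\<^sup>2)" for n i
 proof -
  have "(g n i x)\<^sup>2 \<le> tmoll n (\<lambda>y. (G y $ i)\<^sup>2) x" for x unfolding g_def tmoll_def by (rule weighted_jensen_square)
    (use kappa_nonneg kappa_row(1)[of n x] kappa_shift_int[OF Gi[of i]] kappa_shift_int[OF Gi2[of i]] kappa_shift_int[of "\<lambda>_. 1" n x] in auto)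
  then have "(LINT x|TX. (g n i x)\<^sup>2) \<le> (LINT x|TX. tmoll n (\<lambda>y. (G y $ i)\<^sup>2) x)"
   by (intro integral_mono g2i tmoll_torus_int Gi2)
  also have "\<dots> \<le> (LINT x|TX. \<bar>tmoll n (\<lambda>y. (G y $ i)\<^sup>2) x\<bar>)"
   by (intro integral_mono integrable_abs tmoll_torus_int Gi2) simp
  also have "\<dots> \<le> (LINT x|TX. (G x $ i)\<^sup>2)"
   using K.moll_contraction[of "\<lambda>y. (G y $ i)\<^sup>2" n, unfolded K_moll torus_fold, OF Gi2] by simp
  finally show ?thesis .
 qed
 have bound: "(LINT x|TX. (tmoll n f x)\<^sup>2) \<le> 2 * (real CARD('d))\<^sup>2 * E + 2 * (LINT x|TX. abs (f x))\<^sup>2" for n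
 proof -
  let ?f = "tmoll n f"
  obtain B where B: "\<And>x. \<bar>?f x\<bar> \<le> B" using tmoll_bounded[OF f, of n] by blast
  have B0: "0 \<le> B" using B[of 0] by linarith
  have fm [measurable]: "?f \<in> borel_measurable borel" by measurable
  have fp: "periodic ?f" by (rule tmoll_periodic)
  have fi: "integrable TX ?f" by (rule tmoll_torus_int[OF f])
  define mean where "mean = (LINT x|TX. ?f x)"
  have mean: "(LINT h|TX. ?f (x + h)) = mean" "integrable TX (\<lambda>h. ?f (x + h))" for x
   using torus_shift[OF fm fp fi, of x] by (simp_all add: mean_def add.commute)
  have mean_le: "mean\<^sup>2 \<le> (LINT x|TX. abs (f x))\<^sup>2"
  proof -
   have "abs mean \<le> (LINT x|TX. \<bar>?f x\<bar>)" unfolding mean_def by (rule integral_abs_bound)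
   also have "\<dots> \<le> (LINT x|TX. abs (f x))" using K.moll_contraction[of f n, unfolded K_moll torus_fold, OF f] by simp
   finally show ?thesis using abs_le_square_iff by (metis abs_ge_self abs_of_nonneg B_integral_nonneg abs_ge_zero)
  qed
  define Q where "Q h = (LINT x|TX. (?f (x + h) - ?f x)\<^sup>2)" for h
  have Q: "Q h \<le> (real CARD('d))\<^sup>2 * E" if h: "h \<in> cell" for h
  proof -
   let ?D = "\<lambda>x. \<Sum>i\<in>UNIV. h $ i * g n i x"
   have h1: "(h $ i)\<^sup>2 \<le> 1" for i using h by (auto simp: cell_def intro: power_le_one less_imp_le)
   have habs: "\<bar>h $ i\<bar> \<le> 1" for i using h by (auto simp: cell_def less_imp_le)
   have DA: "\<bar>?D x\<bar> \<le> (\<Sum>i\<in>UNIV. A n i)" for x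
   proof (rule sum_abs[THEN order_trans], rule sum_mono)
    fix i
    have "\<bar>h $ i\<bar> * abs (g n i x) \<le> 1 * A n i" using habs A by (intro mult_mono) auto
    then show "\<bar>h $ i * g n i x\<bar> \<le> A n i" by (simp add: abs_mult)
   qed
   have "Q h \<le> (LINT x|TX. (?D x)\<^sup>2)" unfolding Q_def
   proof (rule translation_L2[where C="max B (\<Sum>i\<in>UNIV. A n i)"])
    show "((\<lambda>r. ?f (x + r *\<^sub>R h)) has_real_derivative ?D (x + r *\<^sub>R h)) (at r)" for x r
     using tmoll_deriv[OF w, of n x h r] by (simp add: g_def)
    show "periodic ?D" using gp[of n] by (simp add: periodic_def)
    show "\<bar>?f x\<bar> \<le> max B (\<Sum>i\<in>UNIV. A n i)" for x using B[of x] by simp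
    show "\<bar>?D x\<bar> \<le> max B (\<Sum>i\<in>UNIV. A n i)" for x using DA[of x] by simp
   qed (auto intro: fp)
   also have "\<dots> \<le> (LINT x|TX. real CARD('d) * (\<Sum>i\<in>UNIV. (g n i x)\<^sup>2))"
   proof (intro integral_mono)
    show "integrable TX (\<lambda>x. (?D x)\<^sup>2)"
     by (rule torus_integrable_bounded[where C="(\<Sum>i\<in>UNIV. A n i) * (\<Sum>i\<in>UNIV. A n i)"])
      (measurable, rule abs_square_le, rule DA)
    show "integrable TX (\<lambda>x. real CARD('d) * (\<Sum>i\<in>UNIV. (g n i x)\<^sup>2))" using g2i by auto
    fix x
    have "(?D x)\<^sup>2 \<le> (\<Sum>i\<in>(UNIV::'d set). (h $ i)\<^sup>2) * (\<Sum>i\<in>UNIV. (g n i x)\<^sup>2)" by (rule Cauchy_Schwarz_ineq_sum)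
    also have "\<dots> \<le> (\<Sum>i\<in>(UNIV::'d set). 1) * (\<Sum>i\<in>UNIV. (g n i x)\<^sup>2)"
     using h1 by (intro mult_right_mono sum_mono) (auto intro: sum_nonneg)
    finally show "(?D x)\<^sup>2 \<le> real CARD('d) * (\<Sum>i\<in>UNIV. (g n i x)\<^sup>2)" by simp
   qed
   also have "\<dots> = real CARD('d) * (\<Sum>i\<in>UNIV. (LINT x|TX. (g n i x)\<^sup>2))" using g2i by simp
   also have "\<dots> \<le> real CARD('d) * (\<Sum>i\<in>(UNIV::'d set). E)"
   proof (intro mult_left_mono sum_mono)
    fix i
    have "(LINT x|TX. (G x $ i)\<^sup>2) \<le> E" unfolding E_def by (intro integral_mono Gi2 G2 Gle)
    then show "(LINT x|TX. (g n i x)\<^sup>2) \<le> E" using g2[of n i] by linarith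
   qed simp
   finally show ?thesis by (simp add: power2_eq_square)
  qed
  have Fub: "(LINT x|TX. (LINT h|TX. (?f (x + h) - ?f x)\<^sup>2)) = (LINT h|TX. Q h)"
   and Fubi: "integrable TX (\<lambda>x. (LINT h|TX. (?f (x + h) - ?f x)\<^sup>2))" "integrable TX Q"
  proof -
   have m: "(\<lambda>p. (?f (fst p + snd p) - ?f (fst p))\<^sup>2) \<in> borel_measurable (TX \<Otimes>\<^sub>M TX)"
   proof -
    have i: "(\<lambda>x. x) \<in> (TX :: (real ^ 'd) measure) \<rightarrow>\<^sub>M borel" by (rule measurable_torus) simp
    have [measurable]: "(\<lambda>p. fst p + snd p) \<in> TX \<Otimes>\<^sub>M TX \<rightarrow>\<^sub>M (borel :: (real ^ 'd) measure)"
     by (intro borel_measurable_add measurable_compose[OF measurable_fst i] measurable_compose[OF measurable_snd i])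
    have [measurable]: "fst \<in> TX \<Otimes>\<^sub>M TX \<rightarrow>\<^sub>M (borel :: (real ^ 'd) measure)"
     by (rule measurable_compose[OF measurable_fst i])
    show ?thesis by measurable
   qed
   have b: "\<bar>(?f (x + h) - ?f x)\<^sup>2\<bar> \<le> (2 * B) * (2 * B)" for x h
   proof -
    have "\<bar>?f (x + h) - ?f x\<bar> \<le> 2 * B" using B[of x] B[of "x + h"] by linarith
    then show ?thesis by (rule abs_square_le)
   qed
   have one: "integrable (TX :: (real ^ 'd) measure) (\<lambda>_. 1::real)" by simp
   note ks = kernel_swap[OF torus.sigma_finite_measure_axioms torus.sigma_finite_measure_axioms one one m b]
   show "(LINT x|TX. (LINT h|TX. (?f (x + h) - ?f x)\<^sup>2)) = (LINT h|TX. Q h)"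
    "integrable TX (\<lambda>x. (LINT h|TX. (?f (x + h) - ?f x)\<^sup>2))" "integrable TX Q" using ks unfolding Q_def[abs_def] by simp_all
  qed
  have pt: "(?f x)\<^sup>2 \<le> 2 * (LINT h|TX. (?f (x + h) - ?f x)\<^sup>2) + 2 * mean\<^sup>2" for x
  proof -
   have sqi: "integrable TX (\<lambda>h. (?f (x + h) - ?f x)\<^sup>2)"
   proof (rule torus_integrable_bounded)
    show "\<bar>(?f (x + h) - ?f x)\<^sup>2\<bar> \<le> (2 * B) * (2 * B)" for h
    proof -
     have "\<bar>?f (x + h) - ?f x\<bar> \<le> 2 * B" using B[of x] B[of "x + h"] by linarith
     then show ?thesis by (rule abs_square_le)
    qed
   qed measurable
   have "(LINT h|TX. 1 * (?f (x + h) - ?f x))\<^sup>2 \<le> (LINT h|TX. 1 * (?f (x + h) - ?f x)\<^sup>2)"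
    by (rule weighted_jensen_square) (use sqi mean(2)[of x] in auto)
   moreover have "(LINT h|TX. 1 * (?f (x + h) - ?f x)) = mean - ?f x" using mean[of x] by simp
   ultimately have 1: "(mean - ?f x)\<^sup>2 \<le> (LINT h|TX. (?f (x + h) - ?f x)\<^sup>2)" by simp
   have "(?f x)\<^sup>2 \<le> 2 * (mean - ?f x)\<^sup>2 + 2 * mean\<^sup>2"
   proof -
    have "0 \<le> (2 * mean - ?f x)\<^sup>2" by simp
    then show ?thesis by (simp add: power2_eq_square algebra_simps)
   qed
   then show ?thesis using 1 by linarith
  qed
  have f2i: "integrable TX (\<lambda>x. (?f x)\<^sup>2)" by (rule torus_integrable_bounded[where C="B * B"]) (measurable, rule abs_square_le, rule B)
  have "(LINT x|TX. (?f x)\<^sup>2) \<le> (LINT x|TX. 2 * (LINT h|TX. (?f (x + h) - ?f x)\<^sup>2) + 2 * mean\<^sup>2)"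
   using Fubi by (intro integral_mono f2i pt) auto
  also have "\<dots> = 2 * (LINT h|TX. Q h) + 2 * mean\<^sup>2" using Fubi by (simp add: Fub)
  also have "(LINT h|TX. Q h) \<le> (LINT h|(TX :: (real ^ 'd) measure). (real CARD('d))\<^sup>2 * E)" using Fubi(2) Q by (intro integral_mono) auto
  finally show ?thesis using mean_le by simp
 qed
 obtain r where r: "strict_mono r" "AE x in TX. (\<lambda>n. tmoll (r n) f x) \<longlonglongrightarrow> f x" using tmoll_AE_subseq[OF f] by blast
 have "(\<integral>\<^sup>+x. ennreal ((f x)\<^sup>2) \<partial>TX) = (\<integral>\<^sup>+x. liminf (\<lambda>n. ennreal ((tmoll (r n) f x)\<^sup>2)) \<partial>TX)"
 proof (rule nn_integral_cong_AE)
  show "AE x in TX. ennreal ((f x)\<^sup>2) = liminf (\<lambda>n. ennreal ((tmoll (r n) f x)\<^sup>2))" using r(2)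
  proof eventually_elim
   case (elim x)
   have "(\<lambda>n. ennreal ((tmoll (r n) f x)\<^sup>2)) \<longlonglongrightarrow> ennreal ((f x)\<^sup>2)"
    using elim by (intro tendsto_intros tendsto_ennrealI)
   then show ?case by (metis lim_imp_Liminf trivial_limit_sequentially)
  qed
 qed
 also have "\<dots> \<le> liminf (\<lambda>n. \<integral>\<^sup>+x. ennreal ((tmoll (r n) f x)\<^sup>2) \<partial>TX)"
  by (rule nn_integral_liminf) (auto intro!: measurable_torus)
 also have "\<dots> \<le> liminf (\<lambda>n. ennreal (2 * (real CARD('d))\<^sup>2 * E + 2 * (LINT x|TX. abs (f x))\<^sup>2))"
 proof (intro Liminf_mono always_eventually allI)
  fix n
  obtain B where B: "\<And>x. \<bar>tmoll (r n) f x\<bar> \<le> B" using tmoll_bounded[OF f, of "r n"] by blast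
  have B0: "0 \<le> B" using B[of 0] by linarith
  have "integrable TX (\<lambda>x. (tmoll (r n) f x)\<^sup>2)"
   by (rule torus_integrable_bounded[where C="B * B"]) (measurable, rule abs_square_le, rule B)
  then have "(\<integral>\<^sup>+x. ennreal ((tmoll (r n) f x)\<^sup>2) \<partial>TX) = ennreal (LINT x|TX. (tmoll (r n) f x)\<^sup>2)"
   by (intro nn_integral_eq_integral) auto
  also have "\<dots> \<le> ennreal (2 * (real CARD('d))\<^sup>2 * E + 2 * (LINT x|TX. abs (f x))\<^sup>2)" by (intro ennreal_leI bound)
  finally show "(\<integral>\<^sup>+x. ennreal ((tmoll (r n) f x)\<^sup>2) \<partial>TX) \<le> ennreal (2 * (real CARD('d))\<^sup>2 * E + 2 * (LINT x|TX. abs (f x))\<^sup>2)" .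
 qed
 finally show ?thesis unfolding E_def by (simp add: Liminf_const)
qed

section \<open>Space-time\<close>

abbreviation TM :: "real \<Rightarrow> real measure" where "TM T \<equiv> restrict_space lborel {0..<T}"

lemma QT_pair: "0 \<le> T \<Longrightarrow> QT_measure T = TM T \<Otimes>\<^sub>M (TX :: (real ^ 'd) measure)"
 unfolding QT_measure_def QT_def torus_measure_def by (subst restrict_lborel_Times) auto

lemma TM_finite: "0 \<le> T \<Longrightarrow> finite_measure (TM T)"
 by (intro finite_measureI) (auto simp: emeasure_restrict_space space_restrict_space)

lemma pair_TM: "0 \<le> T \<Longrightarrow> pair_sigma_finite (TM T) (TX :: (real ^ 'd) measure)"
 using TM_finite[of T] torus.sigma_finite_measure_axioms by (intro pair_sigma_finite.intro) (auto simp: finite_measure_def)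

lemma QT_finite: assumes "0 \<le> T" shows "finite_measure (QT_measure T :: (real \<times> (real ^ 'd)) measure)"
proof -
 have "emeasure (lborel \<Otimes>\<^sub>M lborel) ({0..<T} \<times> (cell :: (real ^ 'd) set)) = emeasure lborel {0..<T} * emeasure lborel (cell :: (real ^ 'd) set)"
  by (intro lborel.emeasure_pair_measure_Times) auto
 then have "emeasure lborel ({0..<T} \<times> (cell :: (real ^ 'd) set)) = ennreal T" using assms by (simp add: lborel_prod)
 moreover have "{0..<T} \<times> (cell :: (real ^ 'd) set) \<in> sets borel" by (simp add: borel_Times)
 ultimately show ?thesis unfolding QT_measure_def QT_def by (intro finite_measureI) (auto simp: emeasure_restrict_space space_restrict_space)
qed

lemma AE_TM_time: "(AE t in time_measure T. P t) \<longleftrightarrow> (AE t in TM T. P t)"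
proof -
 have "AE t in lborel. t \<noteq> (0::real)" by (rule AE_lborel_singleton)
 then have "(AE t in lborel. t \<in> {0<..<T} \<longrightarrow> P t) \<longleftrightarrow> (AE t in lborel. t \<in> {0..<T} \<longrightarrow> P t)"
 proof (intro iffI)
  assume "AE t in lborel. t \<in> {0<..<T} \<longrightarrow> P t"
  with \<open>AE t in lborel. t \<noteq> (0::real)\<close> show "AE t in lborel. t \<in> {0..<T} \<longrightarrow> P t" by eventually_elim auto
 next
  assume "AE t in lborel. t \<in> {0..<T} \<longrightarrow> P t"
  then show "AE t in lborel. t \<in> {0<..<T} \<longrightarrow> P t" by eventually_elim auto
 qed
 then show ?thesis unfolding time_measure_def by (subst (1 2) AE_restrict_space_iff) auto
qed

text \<open>Time intervals with and without the initial point differ by a null set.\<close>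

lemma TM_time_integrable: "integrable (time_measure T) f \<longleftrightarrow> integrable (TM T) (f :: real \<Rightarrow> real)"
 and TM_time_integral: "(LINT t|time_measure T. f t) = (LINT t|TM T. f t)"
proof -
 have "AE t in lborel. t \<noteq> (0::real)" by (rule AE_lborel_singleton)
 then have ae: "AE t in lborel. indicator {0<..<T} t *\<^sub>R f t = indicator {0..<T} t *\<^sub>R f t" by eventually_elim (auto simp: indicator_def)
 have meas: "(\<lambda>t. indicator {0<..<T} t *\<^sub>R f t) \<in> borel_measurable lborel \<longleftrightarrow> (\<lambda>t. indicator {0..<T} t *\<^sub>R f t) \<in> borel_measurable lborel"
 proof
  assume "(\<lambda>t. indicator {0<..<T} t *\<^sub>R f t) \<in> borel_measurable lborel"
  then have "(\<lambda>t. indicator {0<..<T} t *\<^sub>R f t + indicator ({0} \<inter> {0..<T}) t *\<^sub>R f 0) \<in> borel_measurable lborel" by measurable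
  moreover have "(\<lambda>t. indicator {0<..<T} t *\<^sub>R f t + indicator ({0} \<inter> {0..<T}) t *\<^sub>R f 0) = (\<lambda>t. indicator {0..<T} t *\<^sub>R f t)"
   by (auto simp: indicator_def fun_eq_iff)
  ultimately show "(\<lambda>t. indicator {0..<T} t *\<^sub>R f t) \<in> borel_measurable lborel" by simp
 next
  assume "(\<lambda>t. indicator {0..<T} t *\<^sub>R f t) \<in> borel_measurable lborel"
  then have "(\<lambda>t. indicator {0..<T} t *\<^sub>R f t - indicator ({0} \<inter> {0..<T}) t *\<^sub>R f 0) \<in> borel_measurable lborel" by measurable
  moreover have "(\<lambda>t. indicator {0..<T} t *\<^sub>R f t - indicator ({0} \<inter> {0..<T}) t *\<^sub>R f 0) = (\<lambda>t. indicator {0<..<T} t *\<^sub>R f t)"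
   by (auto simp: indicator_def fun_eq_iff)
  ultimately show "(\<lambda>t. indicator {0<..<T} t *\<^sub>R f t) \<in> borel_measurable lborel" by simp
 qed
 show "integrable (time_measure T) f \<longleftrightarrow> integrable (TM T) f"
 proof -
  have "integrable lborel (\<lambda>t. indicator {0<..<T} t *\<^sub>R f t) \<longleftrightarrow> integrable lborel (\<lambda>t. indicator {0..<T} t *\<^sub>R f t)"
  proof (cases "(\<lambda>t. indicator {0<..<T} t *\<^sub>R f t) \<in> borel_measurable lborel")
   case True
   then show ?thesis using meas ae by (intro integrable_cong_AE) auto
  next
   case False
   then have "\<not> integrable lborel (\<lambda>t. indicator {0<..<T} t *\<^sub>R f t)" "\<not> integrable lborel (\<lambda>t. indicator {0..<T} t *\<^sub>R f t)"
    using meas by (blast dest: borel_measurable_integrable)+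
   then show ?thesis by simp
  qed
  then show ?thesis unfolding time_measure_def by (subst (1 2) integrable_restrict_space) auto
 qed
 show "(LINT t|time_measure T. f t) = (LINT t|TM T. f t)"
 proof -
  have "(LINT t|lborel. indicator {0<..<T} t *\<^sub>R f t) = (LINT t|lborel. indicator {0..<T} t *\<^sub>R f t)"
  proof (cases "(\<lambda>t. indicator {0<..<T} t *\<^sub>R f t) \<in> borel_measurable lborel")
   case True
   then show ?thesis using meas ae by (intro integral_cong_AE) auto
  next
   case False
   then have "\<not> integrable lborel (\<lambda>t. indicator {0<..<T} t *\<^sub>R f t)" "\<not> integrable lborel (\<lambda>t. indicator {0..<T} t *\<^sub>R f t)"
    using meas by (blast dest: borel_measurable_integrable)+
   then show ?thesis using not_integrable_integral_eq by metis
  qed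
  then show ?thesis unfolding time_measure_def by (subst (1 2) integral_restrict_space) auto
 qed
qed

lemma has_wgrad_unique:
 fixes f :: "real \<times> (real ^ 'd) \<Rightarrow> real"
 assumes T: "0 \<le> T" and 1: "has_wgrad T f G" and 2: "has_wgrad T f H"
 shows "AE z in QT_measure T. G z = H z"
proof -
 interpret P: pair_sigma_finite "TM T" "TX :: (real ^ 'd) measure" by (rule pair_TM[OF T])
 note Q = QT_pair[OF T, where 'd='d]
 have [measurable]: "G \<in> borel_measurable (TM T \<Otimes>\<^sub>M TX)" "H \<in> borel_measurable (TM T \<Otimes>\<^sub>M TX)"
  using 1 2 unfolding has_wgrad_def Q by auto
 have g: "AE t in TM T. has_torus_wgrad (\<lambda>x. f (t, x)) (\<lambda>x. G (t, x))" "AE t in TM T. has_torus_wgrad (\<lambda>x. f (t, x)) (\<lambda>x. H (t, x))"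
  using 1 2 unfolding has_wgrad_def AE_TM_time by auto
 have "AE t in TM T. AE x in TX. G (t, x) = H (t, x)" using g by eventually_elim (rule has_torus_wgrad_unique)
 then show ?thesis unfolding Q by (intro P.AE_pair_measure) auto
qed

lemma has_wgrad_wgrad:
 assumes "has_wgrad T f G" shows "has_wgrad T f (wgrad T f)" unfolding wgrad_def by (rule someI[of "has_wgrad T f", OF assms])

lemma wgrad_AE:
 fixes f :: "real \<times> (real ^ 'd) \<Rightarrow> real"
 assumes "0 \<le> T" "has_wgrad T f G" shows "AE z in QT_measure T. wgrad T f z = G z"
 using has_wgrad_unique[OF assms(1) has_wgrad_wgrad[OF assms(2)] assms(2)] .

lemma antiderivative_exists:
 fixes f :: "real \<Rightarrow> real"
 assumes "continuous_on UNIV f"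
 obtains F where "\<And>x. (F has_real_derivative f x) (at x)" "F a = 0"
proof -
 have "\<exists>F. \<forall>x. -\<infinity> < ereal x \<longrightarrow> ereal x < \<infinity> \<longrightarrow> (F has_vector_derivative f x) (at x)"
  using assms by (intro einterval_antiderivative) (auto simp: continuous_on_eq_continuous_at)
 then obtain F where F: "\<And>x. (F has_vector_derivative f x) (at x)" by auto
 show thesis
 proof (rule that[of "\<lambda>x. F x - F a"])
  show "((\<lambda>x. F x - F a) has_real_derivative f x) (at x)" for x
   using F[of x] by (auto simp: has_real_derivative_iff_has_vector_derivative[symmetric] intro!: derivative_eq_intros)
 qed simp
qed

section \<open>Smooth cutoffs in time\<close>

text \<open>The primitive of the time kernel is a smooth step from zero to one; reflected in time it is a cutoff.\<close>

definition theta_prim :: "nat \<Rightarrow> real \<Rightarrow> real" where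
 "theta_prim n = (SOME F. (\<forall>t. (F has_real_derivative theta n t) (at t)) \<and> F (- 2 / real (Suc n)) = 0)"

lemma theta_prim_deriv: "(theta_prim n has_real_derivative theta n t) (at t)"
 and theta_prim_base: "theta_prim n (- 2 / real (Suc n)) = 0"
proof -
 have "\<exists>F. (\<forall>t. (F has_real_derivative theta n t) (at t)) \<and> F (- 2 / real (Suc n)) = 0"
  using antiderivative_exists[OF smooth_continuous[OF smooth_theta[of n]], of "- 2 / real (Suc n)"] by metis
 from someI_ex[OF this]
 show "(theta_prim n has_real_derivative theta n t) (at t)" "theta_prim n (- 2 / real (Suc n)) = 0" unfolding theta_prim_def by auto
qed

lemma smooth_theta_prim: "smooth (theta_prim n)"
 using theta_prim_deriv smooth_theta by (rule smooth_realI)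

lemma theta_prim_mono: "s \<le> t \<Longrightarrow> theta_prim n s \<le> theta_prim n t"
 by (rule DERIV_nonneg_imp_nondecreasing[of s t]) (use theta_prim_deriv theta_nonneg in blast)+

lemma theta_prim_0: assumes "t \<le> - 2 / real (Suc n)" shows "theta_prim n t = 0"
proof -
 have "(theta_prim n has_real_derivative 0) (at s)" if "s \<le> - 2 / real (Suc n)" for s
  using theta_prim_deriv[of n s] theta_zero[of s n] that by simp
 then have "theta_prim n (- 2 / real (Suc n)) \<le> theta_prim n t" using DERIV_nonpos_imp_nonincreasing[OF assms, of "theta_prim n"] by blast
 moreover have "theta_prim n t \<le> theta_prim n (- 2 / real (Suc n))" using assms by (rule theta_prim_mono)
 ultimately show ?thesis using theta_prim_base[of n] by simp
qed

lemma theta_prim_1: assumes "t \<ge> - 1 / real (Suc n)" shows "theta_prim n t = 1"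
proof -
 let ?a = "- 2 / real (Suc n)"
 have a: "?a \<le> t"
 proof -
  have "?a \<le> - 1 / real (Suc n)" by (intro divide_right_mono) auto
  then show ?thesis using assms by linarith
 qed
 have "theta_prim n t - theta_prim n ?a = (LBINT x=?a..t. theta n x)" by (rule interval_integral_FTC_finite[symmetric])
   (auto intro!: smooth_continuous smooth_theta has_field_derivative_at_within theta_prim_deriv
    simp: has_real_derivative_iff_has_vector_derivative[symmetric])
 also have "\<dots> = (LBINT x:{?a..t}. theta n x)" using a by (rule interval_integral_Icc)
 also have "\<dots> = (LINT x|lborel. theta n x)" unfolding set_lebesgue_integral_def
 proof (intro B_integral_cong refl)
  fix x
  show "indicator {?a..t} x *\<^sub>R theta n x = theta n x"
  proof (cases "x \<in> {?a..t}")
   case False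
   then have "x \<notin> {?a<..< - 1 / real (Suc n)}" using assms by (auto simp del: of_nat_Suc)
   then show ?thesis by (simp add: theta_zero del: of_nat_Suc)
  qed simp
 qed
 finally show ?thesis using theta_prim_base integral_theta by simp
qed

lemma theta_prim_range: "0 \<le> theta_prim n t" "theta_prim n t \<le> 1"
proof -
 show "0 \<le> theta_prim n t" using theta_prim_0[of "min t (- 2 / real (Suc n))" n] theta_prim_mono[of "min t (- 2 / real (Suc n))" t n] by simp
 show "theta_prim n t \<le> 1" using theta_prim_1[of n "max t (- 1 / real (Suc n))"] theta_prim_mono[of t "max t (- 1 / real (Suc n))" n] by simp
qed

lemma theta_prim_reflect_deriv: "((\<lambda>t. theta_prim n (c - t)) has_real_derivative - theta n (c - t)) (at t)"
proof -
 have "((\<lambda>t. c - t) has_real_derivative - 1) (at t)" by (auto intro!: derivative_eq_intros)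
 from DERIV_chain2[where f="theta_prim n" and g="\<lambda>t. c - t", OF theta_prim_deriv this] show ?thesis by simp
qed

lemma theta_prim_time_test:
 assumes "c + 2 / real (Suc n) < T"
 shows "(\<lambda>t. theta_prim n (c - t)) \<in> time_tests T" unfolding time_tests_def
proof (intro CollectI conjI exI allI impI)
 show "smooth (\<lambda>t. theta_prim n (c - t))" by (rule smooth_reflect(1)[OF smooth_theta_prim])
 show "c + 2 / real (Suc n) < T" by fact
 show "theta_prim n (c - t) = 0" if "t \<ge> c + 2 / real (Suc n)" for t using that by (intro theta_prim_0) (simp del: of_nat_Suc)
qed

section \<open>Entropies approaching the energy\<close>

lemma entropy_of_second_derivative:
 fixes h :: "real \<Rightarrow> real"
 assumes c: "continuous_on UNIV h" and nn: "\<And>r. 0 \<le> h r" and supp: "\<And>r. abs r > R \<Longrightarrow> h r = 0"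
  and d1: "\<And>r. (\<eta> has_real_derivative \<eta>' r) (at r)" and d2: "\<And>r. (\<eta>' has_real_derivative h r) (at r)"
 shows "\<eta> \<in> entropies" "deriv \<eta> = \<eta>'" "deriv (deriv \<eta>) = h"
proof -
 show e1: "deriv \<eta> = \<eta>'" using d1 by (auto intro: DERIV_imp_deriv)
 then show e2: "deriv (deriv \<eta>) = h" using d2 by (auto intro: DERIV_imp_deriv)
 have "Ck (Suc (Suc 0)) \<eta>" using c by (intro Ck_realI[OF d1] Ck_realI[OF d2]) simp
 then have "Ck 2 \<eta>" by (simp only: numeral_2_eq_2)
 moreover have "convex_on UNIV \<eta>" by (rule f''_ge0_imp_convex[OF convex_UNIV]) (use d1 d2 nn in auto)
 moreover have "compact (closure {r. deriv (deriv \<eta>) r \<noteq> 0})"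
 proof -
  have "{r. deriv (deriv \<eta>) r \<noteq> 0} \<subseteq> {-R..R}"
  proof
   fix r assume "r \<in> {r. deriv (deriv \<eta>) r \<noteq> 0}"
   then have "\<not> \<bar>r\<bar> > R" using supp[of r] e2 by auto
   then show "r \<in> {-R..R}" by auto
  qed
  then have "bounded {r. deriv (deriv \<eta>) r \<noteq> 0}" by (rule bounded_subset[rotated]) simp
  then show ?thesis by (simp add: compact_closure)
 qed
 ultimately show "\<eta> \<in> entropies" by (simp add: entropies_def)
qed

lemma entropy_id: "(\<lambda>r. r) \<in> entropies" "(\<lambda>r. - r) \<in> entropies"
 by (rule entropy_of_second_derivative(1)[where h="\<lambda>_. 0" and \<eta>'="\<lambda>_. 1" and R=0]; auto intro!: derivative_eq_intros)
  (rule entropy_of_second_derivative(1)[where h="\<lambda>_. 0" and \<eta>'="\<lambda>_. - 1" and R=0]; auto intro!: derivative_eq_intros)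

definition Phi :: "real \<Rightarrow> real \<Rightarrow> real" where "Phi m r = abs r powr (m + 1) / (m + 1)"

lemma Phi_deriv: assumes "m > 1" shows "(Phi m has_real_derivative pw (m - 1) r) (at r)"
proof -
 have e: "Phi m r = pw (m - 1) r * r / (m + 1)" for r
 proof -
  have "abs r powr (m + 1) = abs r powr (m - 1) * abs r powr 2" by (simp only: powr_add[symmetric]) (simp add: add.commute)
  then have "abs r powr (m + 1) = abs r powr (m - 1) * r\<^sup>2" by simp
  then show ?thesis by (simp add: Phi_def pw_def power2_eq_square mult.assoc)
 qed
 have "((\<lambda>r. pw (m - 1) r * r / (m + 1)) has_real_derivative ((m - 1 + 1) * abs r powr (m - 1) * r + 1 * pw (m - 1) r) / (m + 1)) (at r)"
  using assms by (intro DERIV_cdivide DERIV_mult DERIV_ident pw_deriv) simp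
 moreover have "((m - 1 + 1) * abs r powr (m - 1) * r + 1 * pw (m - 1) r) / (m + 1) = pw (m - 1) r"
  using assms by (simp add: pw_def field_simps)
 ultimately show ?thesis using e by (simp add: fun_eq_iff[symmetric] e[abs_def])
qed

text \<open>An entropy with second derivative \<open>h\<close> that agrees with \<open>Phi m\<close> on \<open>[- N, N]\<close> and is dominated by it, together with
 its derivatives, everywhere.\<close>

definition approx_entropy :: "real \<Rightarrow> real \<Rightarrow> (real \<Rightarrow> real) \<Rightarrow> (real \<Rightarrow> real) \<Rightarrow> bool" where
 "approx_entropy m N \<eta> h \<longleftrightarrow> \<eta> \<in> entropies \<and> deriv (deriv \<eta>) = h \<and>
  (\<forall>r. 0 \<le> \<eta> r \<and> \<eta> r \<le> Phi m r \<and> \<bar>deriv \<eta> r\<bar> \<le> abs r powr m \<and> 0 \<le> h r \<and> h r \<le> m * abs r powr (m - 1)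
   \<and> h r \<le> m * (N + 1) powr (m - 1)) \<and>
  (\<forall>r. abs r \<le> N \<longrightarrow> \<eta> r = Phi m r \<and> deriv \<eta> r = pw (m - 1) r \<and> h r = m * abs r powr (m - 1)) \<and>
  continuous_on UNIV h \<and> continuous_on UNIV \<eta> \<and> continuous_on UNIV (deriv \<eta>)"

text \<open>Multiply the second derivative of \<open>Phi m\<close> by a continuous cutoff and integrate twice.\<close>

lemma approx_entropy_exists:
 fixes m N :: real
 assumes m: "m > 1" and N: "N \<ge> 0"
 shows "\<exists>\<eta> h. approx_entropy m N \<eta> h"
proof -
 define h where "h r = m * abs r powr (m - 1) * max 0 (min 1 (N + 1 - abs r))" for r
 have hc: "continuous_on UNIV h" unfolding h_def[abs_def] using m by (intro continuous_intros continuous_abs_powr) simp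
 have h0: "0 \<le> h r" for r unfolding h_def using m by (intro mult_nonneg_nonneg) auto
 have hle: "h r \<le> m * abs r powr (m - 1)" for r
 proof -
  have "m * abs r powr (m - 1) * max 0 (min 1 (N + 1 - abs r)) \<le> m * abs r powr (m - 1) * 1"
   using m by (intro mult_left_mono) auto
  then show ?thesis by (simp add: h_def)
 qed
 have heq: "h r = m * abs r powr (m - 1)" if "abs r \<le> N" for r using that by (simp add: h_def)
 have hs: "h r = 0" if "abs r > N + 1" for r using that by (simp add: h_def)
 have hb: "h r \<le> m * (N + 1) powr (m - 1)" for r
 proof (cases "abs r > N + 1")
  case True then show ?thesis using hs[of r] m by simp
 next
  case False
  then have "m * abs r powr (m - 1) \<le> m * (N + 1) powr (m - 1)" using m by (intro mult_left_mono powr_mono2) auto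
  then show ?thesis using hle[of r] by linarith
 qed
 obtain \<eta>' where d2: "\<And>r. (\<eta>' has_real_derivative h r) (at r)" and \<eta>'0: "\<eta>' 0 = 0"
  using antiderivative_exists[OF hc, of 0] by blast
 have \<eta>'c: "continuous_on UNIV \<eta>'" using d2 by (intro DERIV_continuous_on) (auto intro: has_field_derivative_at_within)
 obtain \<eta> where d1: "\<And>r. (\<eta> has_real_derivative \<eta>' r) (at r)" and \<eta>0: "\<eta> 0 = 0"
  using antiderivative_exists[OF \<eta>'c, of 0] by blast
 have \<eta>c: "continuous_on UNIV \<eta>" using d1 by (intro DERIV_continuous_on) (auto intro: has_field_derivative_at_within)
 note ent = entropy_of_second_derivative[OF hc h0 hs d1 d2]
 have mono: "f a \<le> f b" if "a \<le> b" "\<And>x. a \<le> x \<Longrightarrow> x \<le> b \<Longrightarrow> (f has_real_derivative f' x) (at x)" "\<And>x. a \<le> x \<Longrightarrow> x \<le> b \<Longrightarrow> 0 \<le> f' x"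
  for f f' :: "real \<Rightarrow> real" and a b using that by (intro DERIV_nonneg_imp_nondecreasing[of a b f]) blast+
 have dpw: "(pw (m - 1) has_real_derivative m * abs r powr (m - 1)) (at r)" for r using pw_deriv[of "m - 1" r] m by simp
 have pw0: "pw (m - 1) 0 = 0" "Phi m 0 = 0" by (simp_all add: pw_def Phi_def)
 have dd: "((\<lambda>r. pw (m - 1) r - \<eta>' r) has_real_derivative m * abs r powr (m - 1) - h r) (at r)" for r
  by (intro DERIV_diff dpw d2)
 have dge: "0 \<le> m * abs r powr (m - 1) - h r" for r using hle[of r] by simp
 have s1: "0 \<le> \<eta>' r" "\<eta>' r \<le> pw (m - 1) r" if "0 \<le> r" for r using mono[OF that d2 h0] mono[OF that dd dge] \<eta>'0 pw0 by auto
 have s2: "\<eta>' r \<le> 0" "pw (m - 1) r \<le> \<eta>' r" if "r \<le> 0" for r using mono[OF that d2 h0] mono[OF that dd dge] \<eta>'0 pw0 by auto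
 have s3: "\<eta>' r = pw (m - 1) r" if "abs r \<le> N" for r
 proof -
  have dd': "((\<lambda>r. \<eta>' r - pw (m - 1) r) has_real_derivative h r - m * abs r powr (m - 1)) (at r)" for r
   by (intro DERIV_diff dpw d2)
  show ?thesis
  proof (cases "0 \<le> r")
   case True
   have "\<eta>' 0 - pw (m - 1) 0 \<le> \<eta>' r - pw (m - 1) r" using that True heq by (intro mono[OF True dd']) auto
   then show ?thesis using s1[OF True] \<eta>'0 pw0 by simp
  next
   case False
   then have r: "r \<le> 0" by simp
   have "\<eta>' r - pw (m - 1) r \<le> \<eta>' 0 - pw (m - 1) 0" using that False heq by (intro mono[OF r dd']) auto
   then show ?thesis using s2[OF r] \<eta>'0 pw0 by simp
  qed
 qed
 have s4: "\<bar>\<eta>' r\<bar> \<le> abs r powr m" for r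
 proof -
  have "\<bar>\<eta>' r\<bar> \<le> \<bar>pw (m - 1) r\<bar>" using s1[of r] s2[of r] by (cases "0 \<le> r") auto
  then show ?thesis by (simp add: pw_abs)
 qed
 have dP: "((\<lambda>r. Phi m r - \<eta> r) has_real_derivative pw (m - 1) r - \<eta>' r) (at r)" for r by (intro DERIV_diff Phi_deriv[OF m] d1)
 have neg: "f r \<ge> f 0" if "r \<le> 0" "\<And>x. (f has_real_derivative f' x) (at x)" "\<And>x. x \<le> 0 \<Longrightarrow> f' x \<le> 0" for f f' :: "real \<Rightarrow> real" and r
  using that by (intro DERIV_nonpos_imp_nonincreasing[of r 0 f]) blast+
 have t1: "0 \<le> \<eta> r" for r
 proof (cases "0 \<le> r")
  case True then show ?thesis using mono[OF True d1] s1(1) \<eta>0 by auto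
 next
  case False then show ?thesis using neg[of r, OF _ d1] s2(1) \<eta>0 by auto
 qed
 have t2: "\<eta> r \<le> Phi m r" for r
 proof (cases "0 \<le> r")
  case True then show ?thesis using mono[OF True dP] s1(2) \<eta>0 pw0 by auto
 next
  case False then show ?thesis using neg[of r, OF _ dP] s2(2) \<eta>0 pw0 by auto
 qed
 have t3: "\<eta> r = Phi m r" if "abs r \<le> N" for r
 proof -
  have dP': "((\<lambda>r. \<eta> r - Phi m r) has_real_derivative \<eta>' r - pw (m - 1) r) (at r)" for r by (intro DERIV_diff Phi_deriv[OF m] d1)
  have "Phi m r \<le> \<eta> r"
  proof (cases "0 \<le> r")
   case True
   have "\<eta> 0 - Phi m 0 \<le> \<eta> r - Phi m r" using that True s3 by (intro mono[OF True dP']) auto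
   then show ?thesis using \<eta>0 pw0 by simp
  next
   case False
   then have r: "r \<le> 0" by simp
   have "Phi m r - \<eta> r \<le> Phi m 0 - \<eta> 0" using that False s3 by (intro mono[OF r dP]) auto
   then show ?thesis using \<eta>0 pw0 by simp
  qed
  then show ?thesis using t2[of r] by simp
 qed
 have "approx_entropy m N \<eta> h"
  unfolding approx_entropy_def ent(2) using ent(1,3) h0 hle heq hb hc \<eta>c \<eta>'c s3 s4 t1 t2 t3 by (auto simp: ent(2))
 then show ?thesis by blast
qed

section \<open>Energy estimates for an entropy solution\<close>

lemma laplacian_const: "laplacian (\<lambda>_. c) (x :: real ^ 'd) = 0"
proof -
 have "dderiv e (\<lambda>_::real^'d. c) = (\<lambda>_. 0)" for e c using dderiv_eqI[OF has_derivative_const] by blast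
 then show ?thesis by (simp add: laplacian_def)
qed

lemma time_test_bounded:
 assumes "\<phi> \<in> time_tests T" "0 \<le> T"
 obtains B where "B \<ge> 0" "\<And>t. t \<in> {0..T} \<Longrightarrow> \<bar>\<phi> t\<bar> \<le> B" "\<And>t. t \<in> {0..T} \<Longrightarrow> \<bar>deriv \<phi> t\<bar> \<le> B"
proof -
 have sm: "smooth \<phi>" using assms by (auto simp: time_tests_def)
 have "compact (\<phi> ` {0..T})" "compact (deriv \<phi> ` {0..T})" using sm by (auto intro!: compact_continuous_image smooth_continuous smooth_deriv)
 then obtain A B where "\<forall>y\<in>\<phi> ` {0..T}. norm y \<le> A" "\<forall>y\<in>deriv \<phi> ` {0..T}. norm y \<le> B"
  using compact_imp_bounded bounded_iff by metis
 then show thesis using that[of "max 0 (max A B)"] by (force simp: le_max_iff_disj)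
qed

lemma time_test_deriv_borel [measurable]:
 assumes "\<phi> \<in> time_tests T" shows "\<phi> \<in> borel_measurable borel" "deriv \<phi> \<in> borel_measurable borel"
 using assms by (auto simp: time_tests_def intro!: borel_measurable_continuous_onI smooth_continuous smooth_deriv)

locale obstacle =
 fixes T m :: real and \<psi> u :: "real \<times> (real ^ 'd) \<Rightarrow> real" and \<xi> :: "real ^ 'd \<Rightarrow> real"
  and \<nu> :: "(real \<times> (real ^ 'd)) measure"
 assumes T: "0 < T" and m: "1 < m" and psi: "\<psi> \<in> C2x T"
  and xi: "\<xi> \<in> Lp (m + 1) TX"
  and ent: "entropy_solution T m \<psi> \<xi> u \<nu>"
begin

abbreviation Q :: "(real \<times> (real ^ 'd)) measure" where "Q \<equiv> QT_measure T"
abbreviation X :: "(real ^ 'd) measure" where "X \<equiv> TX"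

lemma T0: "0 \<le> T" using T by simp
lemma Qpair: "Q = TM T \<Otimes>\<^sub>M X" by (rule QT_pair[OF T0])

sublocale Qf: finite_measure Q by (rule QT_finite[OF T0])
sublocale QP: pair_sigma_finite "TM T" X by (rule pair_TM[OF T0])
sublocale TI: approx_identity "{0..<T}" "\<lambda>n t s. theta n (t - s)" by (rule approx_identity_theta[OF T])

lemma space_Q [simp]: "space Q = {0..<T} \<times> cell" by (simp add: QT_measure_def QT_def space_restrict_space)

lemma fst_meas [measurable]: "fst \<in> Q \<rightarrow>\<^sub>M (borel :: real measure)"
 unfolding QT_measure_def by (rule measurable_restrict_space1) (simp add: borel_measurable_continuous_onI continuous_on_fst)

lemma time_fun_meas [measurable]: "f \<in> borel_measurable (borel :: real measure) \<Longrightarrow> (\<lambda>z. f (fst z)) \<in> borel_measurable Q"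
 by (rule measurable_compose[OF fst_meas])

lemma nu: "finite_measure \<nu>" "sets \<nu> = sets (restrict_space borel (QT T))"
 using ent by (auto simp: entropy_solution_def)

sublocale nu: finite_measure \<nu> by (rule nu(1))

lemma space_nu [simp]: "space \<nu> = {0..<T} \<times> cell"
 using sets_eq_imp_space_eq[OF nu(2)] by (simp add: space_restrict_space QT_def)

lemma u_meas [measurable]: "u \<in> borel_measurable Q"
 and u_int: "integrable Q (\<lambda>z. abs (u z) powr (m + 1))" using ent by (auto simp: entropy_solution_def Lp_def)

lemma xi_meas [measurable]: "\<xi> \<in> borel_measurable X"
 and xi_int: "integrable X (\<lambda>x. \<bar>\<xi> x\<bar> powr (m + 1))" using xi by (auto simp: Lp_def)

lemma Phi_borel [measurable]: "Phi m \<in> borel_measurable borel" unfolding Phi_def[abs_def] by measurable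

lemma Phi_int: "integrable Q (\<lambda>z. Phi m (u z))" "integrable X (\<lambda>x. Phi m (\<xi> x))"
 using u_int xi_int unfolding Phi_def by auto

lemma Phi_nonneg: "0 \<le> Phi m r" using m by (simp add: Phi_def)

definition U where "U z = pw (m - 1) (u z)"
definition G where "G = wgrad T (\<lambda>z. pw ((m - 1) / 2) (u z))"
text \<open>The chain rule applied to \<open>U = pw a (pw ((m - 1) / 2) u)\<close> with \<open>a = (m - 1) / (m + 1)\<close> gives this formula for the gradient of \<open>U\<close>.
 The square of its norm is the dissipation \<open>\<eta>''(u) |\<nabla>(pw ((m - 1) / 2) u)|\<^sup>2\<close> for \<open>\<eta>'' = m |r|\<^sup>m\<^sup>-\<^sup>1\<close>.\<close>

definition H where "H z = (2 * m / (m + 1) * abs (u z) powr ((m - 1) / 2)) *\<^sub>R G z"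

lemma G_wgrad: "has_wgrad T (\<lambda>z. pw ((m - 1) / 2) (u z)) G"
 and G2: "integrable Q (\<lambda>z. (norm (G z))\<^sup>2)"
 and G_meas [measurable]: "G \<in> borel_measurable Q"
proof -
 have "(\<lambda>z. pw ((m - 1) / 2) (u z)) \<in> L2H1 T" using ent by (auto simp: entropy_solution_def)
 then obtain G0 where G0: "has_wgrad T (\<lambda>z. pw ((m - 1) / 2) (u z)) G0" "G0 \<in> Lp 2 Q" by (auto simp: L2H1_def)
 show w: "has_wgrad T (\<lambda>z. pw ((m - 1) / 2) (u z)) G" unfolding G_def by (rule has_wgrad_wgrad[OF G0(1)])
 then show gm: "G \<in> borel_measurable Q" by (simp add: has_wgrad_def)
 have "integrable Q (\<lambda>z. (norm (G0 z))\<^sup>2)" using G0(2) by (simp add: Lp_def)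
 moreover have "AE z in Q. (norm (G0 z))\<^sup>2 = (norm (G z))\<^sup>2" using has_wgrad_unique[OF T0 G0(1) w] by eventually_elim simp
 ultimately show "integrable Q (\<lambda>z. (norm (G z))\<^sup>2)" using gm by (elim integrable_cong_AE_imp) (auto elim: AE_mp)
qed

lemma H_meas [measurable]: "H \<in> borel_measurable Q" unfolding H_def[abs_def] by measurable
lemma U_meas [measurable]: "U \<in> borel_measurable Q" unfolding U_def[abs_def] by measurable

lemma norm_H: "(norm (H z))\<^sup>2 = 4 * m / (m + 1)\<^sup>2 * (m * abs (u z) powr (m - 1)) * (norm (G z))\<^sup>2"
proof -
 have "(abs (u z) powr ((m - 1) / 2))\<^sup>2 = abs (u z) powr (m - 1)" by (simp only: power2_eq_square powr_add[symmetric]) simp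
 then show ?thesis unfolding H_def by (simp add: power_mult_distrib power_divide power2_eq_square[of m])
qed

lemma psi_bound: obtains C where "C \<ge> 0" "\<And>t x. t \<in> {0..T} \<Longrightarrow> \<bar>\<psi> (t, x)\<bar> \<le> C"
proof -
 obtain C where C: "\<And>t x. t \<in> {0..T} \<Longrightarrow> \<bar>\<psi> (t, x)\<bar> \<le> C" using psi unfolding C2x_def by blast
 show thesis by (rule that[of C]) (use C[of 0 0] T in \<open>auto intro: C order_trans[OF abs_ge_zero]\<close>)
qed

lemma psi_cont: "continuous_on ({0..T} \<times> UNIV) \<psi>"
 and psi_periodic: "t \<in> {0..T} \<Longrightarrow> periodic (\<lambda>x. \<psi> (t, x))" using psi by (auto simp: C2x_def)

lemma nu_meas: assumes "continuous_on ({0..T} \<times> UNIV) f" shows "f \<in> borel_measurable \<nu>"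
proof -
 have "f \<in> borel_measurable (restrict_space borel (QT T))"
  by (rule borel_measurable_continuous_on_restrict, rule continuous_on_subset[OF assms]) (auto simp: QT_def)
 then show ?thesis using measurable_cong_sets[OF nu(2) refl] by blast
qed

lemma psi_nu_meas [measurable]: "\<psi> \<in> borel_measurable \<nu>" by (rule nu_meas[OF psi_cont])

lemma time_nu_meas [measurable]:
 assumes "\<phi> \<in> time_tests T" shows "(\<lambda>z. \<phi> (fst z)) \<in> borel_measurable \<nu>"
 by (rule nu_meas, rule continuous_on_compose2[of UNIV \<phi> _ fst])
  (use assms in \<open>auto simp: time_tests_def intro!: smooth_continuous continuous_intros\<close>)

lemma entropy_raw:
 assumes "\<eta> \<in> entropies" "\<phi> \<in> time_tests T" "smooth \<rho>" "periodic \<rho>" "\<And>t x. t \<in> {0..<T} \<Longrightarrow> 0 \<le> \<phi> t * \<rho> x"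
 shows "- (LINT z|Q. \<eta> (u z) * (deriv \<phi> (fst z) * \<rho> (snd z))) - (LINT z|\<nu>. deriv \<eta> (\<psi> z) * (\<phi> (fst z) * \<rho> (snd z)))
   \<le> (LINT x|X. \<eta> (\<xi> x) * (\<phi> 0 * \<rho> x))
    + m * (LINT z|Q. (LBINT r=0..u z. abs r powr (m - 1) * deriv \<eta> r) * (\<phi> (fst z) * laplacian \<rho> (snd z)))
    - 4 * m / (m + 1)\<^sup>2 * (LINT z|Q. deriv (deriv \<eta>) (u z) * (norm (G z))\<^sup>2 * (\<phi> (fst z) * \<rho> (snd z)))"
 using ent assms unfolding entropy_solution_def G_def by (auto simp: case_prod_unfold)

lemma entropy_time:
 assumes "\<eta> \<in> entropies" "\<phi> \<in> time_tests T" "\<And>t. t \<in> {0..<T} \<Longrightarrow> 0 \<le> \<phi> t"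
 shows "- (LINT z|Q. \<eta> (u z) * deriv \<phi> (fst z)) - (LINT z|\<nu>. deriv \<eta> (\<psi> z) * \<phi> (fst z))
   \<le> (LINT x|X. \<eta> (\<xi> x)) * \<phi> 0 - 4 * m / (m + 1)\<^sup>2 * (LINT z|Q. deriv (deriv \<eta>) (u z) * (norm (G z))\<^sup>2 * \<phi> (fst z))"
 using entropy_raw[OF assms(1,2) smooth_const, of 1] assms(3) by (simp add: laplacian_const periodic_def)

lemma bounded_mult_int:
 fixes f g :: "'z \<Rightarrow> real"
 assumes f: "integrable M f" and g: "g \<in> borel_measurable M" and B: "\<And>z. z \<in> space M \<Longrightarrow> abs (g z) \<le> B"
 shows "integrable M (\<lambda>z. f z * g z)"
proof (rule B_integrable_bound[of _ "\<lambda>z. B * f z"])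
 show "AE z in M. norm (f z * g z) \<le> norm (B * f z)"
 proof (rule AE_I2)
  fix z assume "z \<in> space M"
  then show "norm (f z * g z) \<le> norm (B * f z)"
   using mult_right_mono[OF order_trans[OF B abs_ge_self], of z "abs (f z)"] by (simp add: abs_mult mult.commute)
 qed
qed (use f g in auto)

lemma approx_int:
 assumes e: "approx_entropy m N \<eta> h" and N: "0 \<le> N"
 shows "integrable Q (\<lambda>z. \<eta> (u z))" "integrable X (\<lambda>x. \<eta> (\<xi> x))" "integrable Q (\<lambda>z. h (u z) * (norm (G z))\<^sup>2)"
  "(\<lambda>z. \<eta> (u z)) \<in> borel_measurable Q" "(\<lambda>x. \<eta> (\<xi> x)) \<in> borel_measurable X" "(\<lambda>z. h (u z)) \<in> borel_measurable Q"
  "(\<lambda>z. deriv \<eta> (\<psi> z)) \<in> borel_measurable \<nu>"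
proof -
 have [measurable]: "\<eta> \<in> borel_measurable borel" "h \<in> borel_measurable borel" "deriv \<eta> \<in> borel_measurable borel"
  using e by (auto simp: approx_entropy_def intro: borel_measurable_continuous_onI)
 show "(\<lambda>z. \<eta> (u z)) \<in> borel_measurable Q" "(\<lambda>x. \<eta> (\<xi> x)) \<in> borel_measurable X" "(\<lambda>z. h (u z)) \<in> borel_measurable Q"
  "(\<lambda>z. deriv \<eta> (\<psi> z)) \<in> borel_measurable \<nu>" by measurable
 have b: "\<bar>\<eta> r\<bar> \<le> abs (Phi m r)" "abs (h r) \<le> m * (N + 1) powr (m - 1)" for r
  using e Phi_nonneg[of r] by (auto simp: approx_entropy_def)
 show "integrable Q (\<lambda>z. \<eta> (u z))" by (rule B_integrable_bound[OF Phi_int(1)]) (use b in auto)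
 show "integrable X (\<lambda>x. \<eta> (\<xi> x))" by (rule B_integrable_bound[OF Phi_int(2)]) (use b in auto)
 show "integrable Q (\<lambda>z. h (u z) * (norm (G z))\<^sup>2)"
  using bounded_mult_int[OF G2 _ b(2), of u] \<open>(\<lambda>z. h (u z)) \<in> borel_measurable Q\<close> by (simp add: mult.commute)
qed

text \<open>For a nonincreasing weight both the dissipation and the energy term have a favourable sign; the data bound them uniformly
 over the approximating entropies.\<close>

lemma cutoff_bound:
 obtains C where "C \<ge> 0"
  "\<And>N \<eta> h \<phi>. \<lbrakk>approx_entropy m N \<eta> h; 0 \<le> N; \<phi> \<in> time_tests T; \<And>t. 0 \<le> \<phi> t; \<And>t. \<phi> t \<le> 1; \<And>t. deriv \<phi> t \<le> 0\<rbrakk> \<Longrightarrow>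
   4 * m / (m + 1)\<^sup>2 * (LINT z|Q. h (u z) * (norm (G z))\<^sup>2 * \<phi> (fst z)) \<le> C \<and> - (LINT z|Q. \<eta> (u z) * deriv \<phi> (fst z)) \<le> C"
proof -
 obtain A where A: "A \<ge> 0" "\<And>t x. t \<in> {0..T} \<Longrightarrow> \<bar>\<psi> (t, x)\<bar> \<le> A" using psi_bound by blast
 define C where "C = (LINT x|X. Phi m (\<xi> x)) + A powr m * measure \<nu> (space \<nu>)"
 show thesis
 proof (rule that)
  show "C \<ge> 0" unfolding C_def using Phi_nonneg by (intro add_nonneg_nonneg B_integral_nonneg) auto
  fix N \<eta> h \<phi>
  assume e: "approx_entropy m N \<eta> h" and N: "0 \<le> N" and \<phi>: "\<phi> \<in> time_tests T" "\<And>t. 0 \<le> \<phi> t" "\<And>t. \<phi> t \<le> 1" "\<And>t. deriv \<phi> t \<le> 0"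
  note i = approx_int[OF e N]
  have ee: "\<eta> \<in> entropies" "deriv (deriv \<eta>) = h" "\<And>r. 0 \<le> \<eta> r" "\<And>r. \<eta> r \<le> Phi m r" "\<And>r. \<bar>deriv \<eta> r\<bar> \<le> abs r powr m" "\<And>r. 0 \<le> h r"
   using e by (auto simp: approx_entropy_def)
  have 1: "(LINT x|X. \<eta> (\<xi> x)) * \<phi> 0 \<le> (LINT x|X. Phi m (\<xi> x))"
  proof -
   have "(LINT x|X. \<eta> (\<xi> x)) * \<phi> 0 \<le> (LINT x|X. \<eta> (\<xi> x)) * 1"
    using \<phi>(3) ee by (intro mult_left_mono B_integral_nonneg) auto
   also have "\<dots> \<le> (LINT x|X. Phi m (\<xi> x))" using i(2) Phi_int ee by (auto intro: integral_mono)
   finally show ?thesis .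
  qed
  have 2: "(LINT z|\<nu>. deriv \<eta> (\<psi> z) * \<phi> (fst z)) \<le> A powr m * measure \<nu> (space \<nu>)"
  proof -
   have b: "\<bar>deriv \<eta> (\<psi> z) * \<phi> (fst z)\<bar> \<le> A powr m" if "z \<in> space \<nu>" for z
   proof -
    have "\<bar>\<psi> z\<bar> powr m \<le> A powr m" using that A m by (cases z) (auto intro!: powr_mono2)
    then have "\<bar>deriv \<eta> (\<psi> z)\<bar> \<le> A powr m" using ee(5)[of "\<psi> z"] by linarith
    then have "\<bar>deriv \<eta> (\<psi> z)\<bar> * \<bar>\<phi> (fst z)\<bar> \<le> A powr m * 1" using \<phi>(2,3) by (intro mult_mono) auto
    then show ?thesis by (simp add: abs_mult)
   qed
   have ii: "integrable \<nu> (\<lambda>z. deriv \<eta> (\<psi> z) * \<phi> (fst z))" by (rule nu.integrable_const_bound[where B="A powr m"])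
     (use b in \<open>auto intro!: borel_measurable_times i(7) time_nu_meas[OF \<phi>(1)]\<close>)
   have "(LINT z|\<nu>. deriv \<eta> (\<psi> z) * \<phi> (fst z)) \<le> (LINT z|\<nu>. A powr m)"
    using b by (intro integral_mono ii) (auto simp: abs_le_iff)
   then show ?thesis by (simp add: mult.commute)
  qed
  have 3: "0 \<le> - (LINT z|Q. \<eta> (u z) * deriv \<phi> (fst z))"
  proof -
   have "0 \<le> (LINT z|Q. - (\<eta> (u z) * deriv \<phi> (fst z)))"
    using ee(3) \<phi>(4) by (intro B_integral_nonneg) (auto simp: mult_nonneg_nonpos)
   then show ?thesis by simp
  qed
  have 4: "0 \<le> 4 * m / (m + 1)\<^sup>2 * (LINT z|Q. h (u z) * (norm (G z))\<^sup>2 * \<phi> (fst z))"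
   using m ee(6) \<phi>(2) by (intro mult_nonneg_nonneg B_integral_nonneg) auto
  have "- (LINT z|Q. \<eta> (u z) * deriv \<phi> (fst z)) - (LINT z|\<nu>. deriv \<eta> (\<psi> z) * \<phi> (fst z))
   \<le> (LINT x|X. \<eta> (\<xi> x)) * \<phi> 0 - 4 * m / (m + 1)\<^sup>2 * (LINT z|Q. h (u z) * (norm (G z))\<^sup>2 * \<phi> (fst z))"
   using entropy_time[OF ee(1) \<phi>(1) \<phi>(2)] unfolding ee(2) .
  with 1 2 3 4 show "4 * m / (m + 1)\<^sup>2 * (LINT z|Q. h (u z) * (norm (G z))\<^sup>2 * \<phi> (fst z)) \<le> C \<and> - (LINT z|Q. \<eta> (u z) * deriv \<phi> (fst z)) \<le> C"
   unfolding C_def by linarith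
 qed
qed

lemma approx_sequence:
 obtains \<eta> h where "\<And>n::nat. approx_entropy m (real n) (\<eta> n) (h n)"
proof -
 have "\<forall>n::nat. \<exists>\<eta> h. approx_entropy m (real n) \<eta> h" using approx_entropy_exists[OF m] by simp
 then show thesis using that by metis
qed

lemma cutoff_props:
 "0 \<le> theta_prim n (c - t)" "theta_prim n (c - t) \<le> 1" "deriv (\<lambda>t. theta_prim n (c - t)) t \<le> 0"
 "deriv (\<lambda>t. theta_prim n (c - t)) t = - theta n (c - t)"
 using theta_prim_range theta_nonneg DERIV_imp_deriv[OF theta_prim_reflect_deriv] by auto

text \<open>Fatou's lemma along the uniform bounds, for approximating entropies and cutoffs that exhaust \<open>[0,T)\<close>.\<close>

lemma H2: "integrable Q (\<lambda>z. (norm (H z))\<^sup>2)"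
proof -
 obtain C where C: "C \<ge> 0" "\<And>N \<eta> h \<phi>. \<lbrakk>approx_entropy m N \<eta> h; 0 \<le> N; \<phi> \<in> time_tests T; \<And>t. 0 \<le> \<phi> t; \<And>t. \<phi> t \<le> 1; \<And>t. deriv \<phi> t \<le> 0\<rbrakk> \<Longrightarrow>
   4 * m / (m + 1)\<^sup>2 * (LINT z|Q. h (u z) * (norm (G z))\<^sup>2 * \<phi> (fst z)) \<le> C \<and> - (LINT z|Q. \<eta> (u z) * deriv \<phi> (fst z)) \<le> C"
  using cutoff_bound by blast
 obtain \<eta> h where e: "\<And>n::nat. approx_entropy m (real n) (\<eta> n) (h n)" using approx_sequence by blast
 \<comment> \<open>The cutoff is one up to \<open>T - 2 / (n + 1)\<close> and vanishes from \<open>T - 1 / (n + 1)\<close> on.\<close>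
 define c where "c n = T - 3 / real (Suc n)" for n
 define \<phi> where "\<phi> n t = theta_prim n (c n - t)" for n t
 have lt: "c n + 2 / real (Suc n) < T" for n
 proof -
  have "2 / real (Suc n) < 3 / real (Suc n)" by (intro divide_strict_right_mono) auto
  then show ?thesis unfolding c_def by linarith
 qed
 have tt: "\<phi> n \<in> time_tests T" for n unfolding \<phi>_def[abs_def] by (rule theta_prim_time_test[OF lt])
 let ?f = "\<lambda>n z. 4 * m / (m + 1)\<^sup>2 * (h n (u z) * (norm (G z))\<^sup>2 * \<phi> n (fst z))"
 have h0: "0 \<le> h n r" for n r using e[of n] by (simp add: approx_entropy_def)
 have f0: "0 \<le> ?f n z" for n z using m h0 cutoff_props(1) unfolding \<phi>_def by (intro mult_nonneg_nonneg) auto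
 have fi: "integrable Q (?f n)" for n
 proof -
  have "(\<lambda>z. \<phi> n (fst z)) \<in> borel_measurable Q" using time_test_deriv_borel(1)[OF tt[of n]] by measurable
  moreover have "\<bar>\<phi> n t\<bar> \<le> 1" for t unfolding \<phi>_def using cutoff_props(1,2)[of n "c n" t] by simp
  ultimately show ?thesis
   using approx_int(3)[OF e[of n]] by (intro integrable_mult_right bounded_mult_int[where B=1 and f="\<lambda>z. h n (u z) * (norm (G z))\<^sup>2"]) auto
 qed
 have lim: "(\<lambda>n. ?f n z) \<longlonglongrightarrow> (norm (H z))\<^sup>2" if z: "z \<in> space Q" for z
 proof (rule tendsto_eventually)
  have t: "fst z < T" using z by auto
  obtain N :: nat where N: "abs (u z) \<le> real N" using real_arch_simple by blast
  have "(\<lambda>n. 2 / real (Suc n)) \<longlonglongrightarrow> 0" by (rule LIMSEQ_Suc) (rule lim_const_over_n)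
  then have "eventually (\<lambda>n. 2 / real (Suc n) < T - fst z) sequentially" using t by (intro order_tendstoD) auto
  then show "eventually (\<lambda>n. ?f n z = (norm (H z))\<^sup>2) sequentially" using eventually_ge_at_top[of N]
  proof eventually_elim
   case (elim n)
   have "- 1 / real (Suc n) \<le> c n - fst z"
   proof -
    have "3 / real (Suc n) - 1 / real (Suc n) = 2 / real (Suc n)" by (simp add: diff_divide_distrib[symmetric] del: of_nat_Suc)
    then show ?thesis using elim(1) unfolding c_def minus_divide_left[symmetric] by linarith
   qed
   then have 1: "\<phi> n (fst z) = 1" unfolding \<phi>_def by (rule theta_prim_1)
   have "abs (u z) \<le> real n" using N elim(2) by linarith
   then have 2: "h n (u z) = m * abs (u z) powr (m - 1)" using e[of n] by (simp add: approx_entropy_def)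
   show ?case unfolding norm_H 1 2 by simp
  qed
 qed
 have "(\<integral>\<^sup>+z. ennreal ((norm (H z))\<^sup>2) \<partial>Q) = (\<integral>\<^sup>+z. liminf (\<lambda>n. ennreal (?f n z)) \<partial>Q)"
 proof (rule nn_integral_cong)
  fix z assume "z \<in> space Q"
  then have "(\<lambda>n. ennreal (?f n z)) \<longlonglongrightarrow> ennreal ((norm (H z))\<^sup>2)" by (intro tendsto_ennrealI lim)
  from lim_imp_Liminf[OF trivial_limit_sequentially this]
  show "ennreal ((norm (H z))\<^sup>2) = liminf (\<lambda>n. ennreal (?f n z))" by (rule sym)
 qed
 also have "\<dots> \<le> liminf (\<lambda>n. \<integral>\<^sup>+z. ennreal (?f n z) \<partial>Q)" using fi by (intro nn_integral_liminf) auto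
 also have "\<dots> \<le> liminf (\<lambda>n. ennreal C)"
 proof (intro Liminf_mono always_eventually allI)
  fix n
  have "(\<integral>\<^sup>+z. ennreal (?f n z) \<partial>Q) = ennreal (LINT z|Q. ?f n z)" using fi f0 by (intro nn_integral_eq_integral) auto
  also have "(LINT z|Q. ?f n z) = 4 * m / (m + 1)\<^sup>2 * (LINT z|Q. h n (u z) * (norm (G z))\<^sup>2 * \<phi> n (fst z))" by (rule integral_mult_right_zero)
  also have "ennreal \<dots> \<le> ennreal C" using C(2)[OF e[of n] _ tt[of n]] cutoff_props unfolding \<phi>_def[abs_def] by (intro ennreal_leI) auto
  finally show "(\<integral>\<^sup>+z. ennreal (?f n z) \<partial>Q) \<le> ennreal C" .
 qed
 also have "\<dots> = ennreal C" by (simp add: Liminf_const)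
 finally show ?thesis by (intro integrableI_bounded) (auto intro: le_less_trans)
qed

definition E where "E t = (LINT x|X. Phi m (u (t, x)))"

lemma E_int: "integrable (TM T) E"
 using QP.integrable_fst'[of "\<lambda>z. Phi m (u z)"] Phi_int(1) unfolding Qpair E_def[abs_def] by simp

text \<open>Cutoffs whose derivative is a mollifying kernel at \<open>a\<close> bound the mollified energy at \<open>a\<close>.\<close>

lemma E_bound: obtains C where "C \<ge> 0" "AE t in TM T. E t \<le> C"
proof -
 obtain C where C: "C \<ge> 0" "\<And>N \<eta> h \<phi>. \<lbrakk>approx_entropy m N \<eta> h; 0 \<le> N; \<phi> \<in> time_tests T; \<And>t. 0 \<le> \<phi> t; \<And>t. \<phi> t \<le> 1; \<And>t. deriv \<phi> t \<le> 0\<rbrakk> \<Longrightarrow>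
   4 * m / (m + 1)\<^sup>2 * (LINT z|Q. h (u z) * (norm (G z))\<^sup>2 * \<phi> (fst z)) \<le> C \<and> - (LINT z|Q. \<eta> (u z) * deriv \<phi> (fst z)) \<le> C"
  using cutoff_bound by blast
 obtain \<eta> h where e: "\<And>n::nat. approx_entropy m (real n) (\<eta> n) (h n)" using approx_sequence by blast
 have key: "TI.moll k E a \<le> C" if a: "a + 2 / real (Suc k) < T" for a k
 proof -
  obtain B where B: "\<And>t s. \<bar>theta k (t - s)\<bar> \<le> B" using TI.k_abs_bdd by blast
  have [measurable]: "theta k \<in> borel_measurable borel" by (intro borel_measurable_continuous_onI smooth_continuous smooth_theta)
  have thm0: "(\<lambda>z. theta k (a - fst z)) \<in> borel_measurable Q" by measurable
  have pi: "integrable Q (\<lambda>z. Phi m (u z) * theta k (a - fst z))" by (rule bounded_mult_int[OF Phi_int(1) thm0 B])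
  have "(\<lambda>n. (LINT z|Q. \<eta> n (u z) * theta k (a - fst z))) \<longlonglongrightarrow> (LINT z|Q. Phi m (u z) * theta k (a - fst z))"
  proof (rule integral_dominated_convergence[where w="\<lambda>z. Phi m (u z) * theta k (a - fst z)"])
   show "AE z in Q. (\<lambda>n. \<eta> n (u z) * theta k (a - fst z)) \<longlonglongrightarrow> Phi m (u z) * theta k (a - fst z)"
   proof (rule AE_I2, rule tendsto_eventually)
    fix z
    obtain N :: nat where N: "abs (u z) \<le> real N" using real_arch_simple by blast
    show "eventually (\<lambda>n. \<eta> n (u z) * theta k (a - fst z) = Phi m (u z) * theta k (a - fst z)) sequentially"
     using eventually_ge_at_top[of N]
    proof eventually_elim
     case (elim n)
     then have "abs (u z) \<le> real n" using N by linarith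
     then show ?case using e[of n] by (simp add: approx_entropy_def)
    qed
   qed
   show "AE z in Q. norm (\<eta> n (u z) * theta k (a - fst z)) \<le> Phi m (u z) * theta k (a - fst z)" for n
    using e[of n] theta_nonneg by (intro AE_I2) (auto simp: approx_entropy_def abs_mult intro!: mult_right_mono)
   show "(\<lambda>z. \<eta> n (u z) * theta k (a - fst z)) \<in> borel_measurable Q" for n
    using approx_int(4)[OF e[of n]] thm0 by (intro borel_measurable_times) auto
   show "(\<lambda>z. Phi m (u z) * theta k (a - fst z)) \<in> borel_measurable Q" using thm0 by measurable
  qed (rule pi)
  moreover have "(LINT z|Q. \<eta> n (u z) * theta k (a - fst z)) \<le> C" for n
  proof -
   have "- (LINT z|Q. \<eta> n (u z) * deriv (\<lambda>t. theta_prim k (a - t)) (fst z)) \<le> C"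
    using C(2)[OF e[of n] _ theta_prim_time_test[OF a]] cutoff_props by auto
   then show ?thesis by (simp add: cutoff_props(4))
  qed
  ultimately have "(LINT z|Q. Phi m (u z) * theta k (a - fst z)) \<le> C" by (intro LIMSEQ_le_const2) auto
  moreover have "(LINT z|Q. Phi m (u z) * theta k (a - fst z)) = TI.moll k E a"
  proof -
   have "(LINT z|Q. Phi m (u z) * theta k (a - fst z)) = (LINT t|TM T. (LINT x|X. Phi m (u (t, x)) * theta k (a - t)))"
    using QP.integral_fst'[OF pi[unfolded Qpair]] unfolding Qpair by simp
   then show ?thesis by (simp add: TI.moll_def E_def mult.commute)
  qed
  ultimately show ?thesis by simp
 qed
 have "AE t in TM T. E t \<in> {..C}"
 proof (rule TI.moll_AE_eventually_closed[OF E_int])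
  show "AE a in TM T. eventually (\<lambda>n. TI.moll n E a \<in> {..C}) sequentially"
  proof (rule AE_I2)
   fix a assume "a \<in> space (TM T)"
   then have a: "a < T" by (simp add: space_restrict_space)
   have "(\<lambda>n. 2 / real (Suc n)) \<longlonglongrightarrow> 0" by (rule LIMSEQ_Suc) (rule lim_const_over_n)
   then have "eventually (\<lambda>n. 2 / real (Suc n) < T - a) sequentially" using a by (intro order_tendstoD) auto
   then show "eventually (\<lambda>n. TI.moll n E a \<in> {..C}) sequentially" by eventually_elim (auto intro!: key)
  qed
 qed simp
 then show thesis by (intro that[OF C(1)]) simp
qed

end

lemma powr_le_one_plus: fixes r m :: real assumes "m \<ge> 0" shows "abs r powr m \<le> 1 + abs r powr (m + 1)"
proof (cases "abs r \<le> 1")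
 case True
 then have "abs r powr m \<le> 1" using assms by (intro powr_le1) auto
 then show ?thesis using powr_ge_zero[of "abs r" "m + 1"] by linarith
next
 case False
 then have "abs r powr m \<le> abs r powr (m + 1)" by (intro powr_mono) auto
 then show ?thesis by linarith
qed

context obstacle
begin

text \<open>The entropy inequality for \<open>\<eta> = Phi m\<close>, as a limit over the approximating entropies by dominated convergence. The
 dissipation term is the square of \<open>H\<close>, and \<open>Phi m\<close> has the derivative \<open>pw (m - 1)\<close>.\<close>

lemma energy_ineq:
 assumes \<phi>: "\<phi> \<in> time_tests T" "\<And>t. t \<in> {0..<T} \<Longrightarrow> 0 \<le> \<phi> t"
 shows "(LINT z|Q. (norm (H z))\<^sup>2 * \<phi> (fst z))
  \<le> (LINT z|Q. Phi m (u z) * deriv \<phi> (fst z)) + (LINT z|\<nu>. pw (m - 1) (\<psi> z) * \<phi> (fst z)) + (LINT x|X. Phi m (\<xi> x)) * \<phi> 0"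
proof -
 obtain \<eta> h where e: "\<And>n::nat. approx_entropy m (real n) (\<eta> n) (h n)" using approx_sequence by blast
 obtain B where B: "B \<ge> 0" "\<And>t. t \<in> {0..T} \<Longrightarrow> \<bar>\<phi> t\<bar> \<le> B" "\<And>t. t \<in> {0..T} \<Longrightarrow> \<bar>deriv \<phi> t\<bar> \<le> B"
  using time_test_bounded[OF \<phi>(1) T0] by blast
 obtain A where A: "A \<ge> 0" "\<And>t x. t \<in> {0..T} \<Longrightarrow> \<bar>\<psi> (t, x)\<bar> \<le> A" using psi_bound by blast
 have \<phi>Q [measurable]: "(\<lambda>z. \<phi> (fst z)) \<in> borel_measurable Q" "(\<lambda>z. deriv \<phi> (fst z)) \<in> borel_measurable Q"
  using time_test_deriv_borel[OF \<phi>(1)] by (auto intro: time_fun_meas)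
 have \<phi>\<nu> [measurable]: "(\<lambda>z. \<phi> (fst z)) \<in> borel_measurable \<nu>" by (rule time_nu_meas[OF \<phi>(1)])
 have bQ: "\<bar>\<phi> (fst z)\<bar> \<le> B" "\<bar>deriv \<phi> (fst z)\<bar> \<le> B" if "z \<in> {0..<T} \<times> cell" for z using that B by auto
 have ev: "\<exists>N. \<forall>n\<ge>N. abs r \<le> real n" for r :: real
 proof -
  obtain N :: nat where "abs r \<le> real N" using real_arch_simple by blast
  then show ?thesis by (intro exI[of _ N]) (auto intro: order_trans)
 qed
 have eqs: "eventually (\<lambda>n. \<eta> n r = Phi m r \<and> deriv (\<eta> n) r = pw (m - 1) r \<and> h n r = m * abs r powr (m - 1)) sequentially" for r
 proof -
  obtain N where "\<forall>n\<ge>N. abs r \<le> real n" using ev by blast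
  then show ?thesis unfolding eventually_sequentially using e by (intro exI[of _ N]) (auto simp: approx_entropy_def)
 qed
 have lim1: "(\<lambda>n. \<eta> n r) \<longlonglongrightarrow> Phi m r" and lim2: "(\<lambda>n. deriv (\<eta> n) r) \<longlonglongrightarrow> pw (m - 1) r" for r
  using eqs[of r] by (auto intro!: tendsto_eventually elim: eventually_mono)
 have L1: "(\<lambda>n. (LINT z|Q. \<eta> n (u z) * deriv \<phi> (fst z))) \<longlonglongrightarrow> (LINT z|Q. Phi m (u z) * deriv \<phi> (fst z))"
 proof (rule integral_dominated_convergence[where w="\<lambda>z. Phi m (u z) * B"])
  show "AE z in Q. (\<lambda>n. \<eta> n (u z) * deriv \<phi> (fst z)) \<longlonglongrightarrow> Phi m (u z) * deriv \<phi> (fst z)"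
   by (intro AE_I2 tendsto_mult lim1 lim2 tendsto_const)
  show "AE z in Q. norm (\<eta> n (u z) * deriv \<phi> (fst z)) \<le> Phi m (u z) * B" for n
  proof (rule AE_I2)
   fix z assume "z \<in> space Q"
   then have "\<bar>\<eta> n (u z)\<bar> * \<bar>deriv \<phi> (fst z)\<bar> \<le> Phi m (u z) * B"
    using e[of n] bQ Phi_nonneg by (intro mult_mono) (auto simp: approx_entropy_def)
   then show "norm (\<eta> n (u z) * deriv \<phi> (fst z)) \<le> Phi m (u z) * B" by (simp add: abs_mult)
  qed
  show "(\<lambda>z. \<eta> n (u z) * deriv \<phi> (fst z)) \<in> borel_measurable Q" for n
   using approx_int(4)[OF e[of n]] by (intro borel_measurable_times) auto
  show "integrable Q (\<lambda>z. Phi m (u z) * B)" using Phi_int by simp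
 qed measurable
 have L2: "(\<lambda>n. (LINT z|\<nu>. deriv (\<eta> n) (\<psi> z) * \<phi> (fst z))) \<longlonglongrightarrow> (LINT z|\<nu>. pw (m - 1) (\<psi> z) * \<phi> (fst z))"
 proof (rule integral_dominated_convergence[where w="\<lambda>z. A powr m * B"])
  show "AE z in \<nu>. (\<lambda>n. deriv (\<eta> n) (\<psi> z) * \<phi> (fst z)) \<longlonglongrightarrow> pw (m - 1) (\<psi> z) * \<phi> (fst z)"
   by (intro AE_I2 tendsto_mult lim1 lim2 tendsto_const)
  show "AE z in \<nu>. norm (deriv (\<eta> n) (\<psi> z) * \<phi> (fst z)) \<le> A powr m * B" for n
  proof (rule AE_I2)
   fix z assume z: "z \<in> space \<nu>"
   then have "\<bar>\<psi> z\<bar> powr m \<le> A powr m" using A m by (cases z) (auto intro!: powr_mono2)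
   moreover have "\<bar>deriv (\<eta> n) (\<psi> z)\<bar> \<le> \<bar>\<psi> z\<bar> powr m" using e[of n] by (simp add: approx_entropy_def)
   ultimately have "\<bar>deriv (\<eta> n) (\<psi> z)\<bar> * \<bar>\<phi> (fst z)\<bar> \<le> A powr m * B" using bQ z by (intro mult_mono) auto
   then show "norm (deriv (\<eta> n) (\<psi> z) * \<phi> (fst z)) \<le> A powr m * B" by (simp add: abs_mult)
  qed
  show "(\<lambda>z. deriv (\<eta> n) (\<psi> z) * \<phi> (fst z)) \<in> borel_measurable \<nu>" for n
   using approx_int(7)[OF e[of n]] by (intro borel_measurable_times) auto
 qed (auto, measurable)
 have L3: "(\<lambda>n. (LINT x|X. \<eta> n (\<xi> x))) \<longlonglongrightarrow> (LINT x|X. Phi m (\<xi> x))"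
 proof (rule integral_dominated_convergence[where w="\<lambda>x. Phi m (\<xi> x)"])
  show "AE x in X. (\<lambda>n. \<eta> n (\<xi> x)) \<longlonglongrightarrow> Phi m (\<xi> x)" by (intro AE_I2 tendsto_mult lim1 lim2 tendsto_const)
  show "AE x in X. norm (\<eta> n (\<xi> x)) \<le> Phi m (\<xi> x)" for n using e[of n] by (auto simp: approx_entropy_def)
  show "(\<lambda>x. \<eta> n (\<xi> x)) \<in> borel_measurable X" for n using approx_int(5)[OF e[of n]] by simp
 qed (use Phi_int in auto)
 have L4: "(\<lambda>n. (LINT z|Q. 4 * m / (m + 1)\<^sup>2 * (h n (u z) * (norm (G z))\<^sup>2 * \<phi> (fst z)))) \<longlonglongrightarrow> (LINT z|Q. (norm (H z))\<^sup>2 * \<phi> (fst z))"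
 proof (rule integral_dominated_convergence[where w="\<lambda>z. (norm (H z))\<^sup>2 * B"])
  show "AE z in Q. (\<lambda>n. 4 * m / (m + 1)\<^sup>2 * (h n (u z) * (norm (G z))\<^sup>2 * \<phi> (fst z))) \<longlonglongrightarrow> (norm (H z))\<^sup>2 * \<phi> (fst z)"
  proof (intro AE_I2 tendsto_eventually)
   fix z
   show "eventually (\<lambda>n. 4 * m / (m + 1)\<^sup>2 * (h n (u z) * (norm (G z))\<^sup>2 * \<phi> (fst z)) = (norm (H z))\<^sup>2 * \<phi> (fst z)) sequentially"
    using eqs[of "u z"] by eventually_elim (simp add: norm_H)
  qed
  show "AE z in Q. norm (4 * m / (m + 1)\<^sup>2 * (h n (u z) * (norm (G z))\<^sup>2 * \<phi> (fst z))) \<le> (norm (H z))\<^sup>2 * B" for n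
  proof (rule AE_I2)
   fix z assume z: "z \<in> space Q"
   have h: "0 \<le> h n (u z)" "h n (u z) \<le> m * abs (u z) powr (m - 1)" using e[of n] by (auto simp: approx_entropy_def)
   have "4 * m / (m + 1)\<^sup>2 * h n (u z) * (norm (G z))\<^sup>2 \<le> (norm (H z))\<^sup>2"
    unfolding norm_H using h m by (intro mult_right_mono mult_left_mono) auto
   then have "(4 * m / (m + 1)\<^sup>2 * h n (u z) * (norm (G z))\<^sup>2) * \<bar>\<phi> (fst z)\<bar> \<le> (norm (H z))\<^sup>2 * B"
    using bQ[of z] z by (intro mult_mono) auto
   then show "norm (4 * m / (m + 1)\<^sup>2 * (h n (u z) * (norm (G z))\<^sup>2 * \<phi> (fst z))) \<le> (norm (H z))\<^sup>2 * B"
    using h m by (simp add: abs_mult mult_ac)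
  qed
  show "(\<lambda>z. 4 * m / (m + 1)\<^sup>2 * (h n (u z) * (norm (G z))\<^sup>2 * \<phi> (fst z))) \<in> borel_measurable Q" for n
   using approx_int(6)[OF e[of n]] by (intro borel_measurable_times borel_measurable_power borel_measurable_norm) auto
  show "integrable Q (\<lambda>z. (norm (H z))\<^sup>2 * B)" using H2 by simp
 qed measurable
 have ineq: "- (LINT z|Q. \<eta> n (u z) * deriv \<phi> (fst z)) - (LINT z|\<nu>. deriv (\<eta> n) (\<psi> z) * \<phi> (fst z))
   \<le> (LINT x|X. \<eta> n (\<xi> x)) * \<phi> 0 - (LINT z|Q. 4 * m / (m + 1)\<^sup>2 * (h n (u z) * (norm (G z))\<^sup>2 * \<phi> (fst z)))" for n
 proof -
  have "\<eta> n \<in> entropies" "deriv (deriv (\<eta> n)) = h n" using e[of n] by (auto simp: approx_entropy_def)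
  then show ?thesis using entropy_time[of "\<eta> n" \<phi>, OF _ \<phi>] by (simp only: integral_mult_right_zero)
 qed
 have "- (LINT z|Q. Phi m (u z) * deriv \<phi> (fst z)) - (LINT z|\<nu>. pw (m - 1) (\<psi> z) * \<phi> (fst z))
   \<le> (LINT x|X. Phi m (\<xi> x)) * \<phi> 0 - (LINT z|Q. (norm (H z))\<^sup>2 * \<phi> (fst z))"
  by (rule LIMSEQ_le[OF tendsto_diff[OF tendsto_minus[OF L1] L2] tendsto_diff[OF tendsto_mult[OF L3 tendsto_const] L4]]) (use ineq in blast)
 then show ?thesis by linarith
qed

lemma slice_meas: "f \<in> borel_measurable Q \<Longrightarrow> t \<in> {0..<T} \<Longrightarrow> (\<lambda>x. f (t, x)) \<in> borel_measurable X"
 unfolding Qpair by (rule measurable_compose[OF measurable_Pair1']) (auto simp: space_restrict_space)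

lemma AE_slice_int: fixes f :: "_ \<Rightarrow> real" shows "integrable Q f \<Longrightarrow> AE t in TM T. integrable X (\<lambda>x. f (t, x))"
 unfolding Qpair by (rule QP.AE_integrable_fst')

lemma U_slice_int:
 assumes "t \<in> {0..<T}" and i: "integrable X (\<lambda>x. abs (u (t, x)) powr (m + 1))"
 shows "integrable X (\<lambda>x. U (t, x))" "(LINT x|X. abs (U (t, x))) \<le> 1 + (m + 1) * E t"
proof -
 have b: "abs (U (t, x)) \<le> 1 + abs (u (t, x)) powr (m + 1)" for x
  unfolding U_def pw_abs using powr_le_one_plus[of m "u (t, x)"] m by simp
 show ui: "integrable X (\<lambda>x. U (t, x))"
 proof (rule B_integrable_bound[of _ "\<lambda>x. 1 + abs (u (t, x)) powr (m + 1)"])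
  show "AE x in X. norm (U (t, x)) \<le> norm (1 + abs (u (t, x)) powr (m + 1))" using b by (auto simp: abs_of_nonneg)
  show "(\<lambda>x. U (t, x)) \<in> borel_measurable X" using assms(1) by (intro slice_meas) auto
 qed (use i in auto)
 have "(LINT x|X. abs (U (t, x))) \<le> (LINT x|X. 1 + abs (u (t, x)) powr (m + 1))" using b ui i by (intro integral_mono) auto
 also have "\<dots> = 1 + (LINT x|X. abs (u (t, x)) powr (m + 1))" using i by simp
 also have "(LINT x|X. abs (u (t, x)) powr (m + 1)) = (m + 1) * E t" unfolding E_def Phi_def using m by simp
 finally show "(LINT x|X. abs (U (t, x))) \<le> 1 + (m + 1) * E t" .
qed

lemma H_slice_int:
 assumes "t \<in> {0..<T}" and i: "integrable X (\<lambda>x. (norm (H (t, x)))\<^sup>2)"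
 shows "integrable X (\<lambda>x. H (t, x))"
proof -
 have hm: "(\<lambda>x. H (t, x)) \<in> borel_measurable X" using assms(1) unfolding Qpair by (intro measurable_compose[OF measurable_Pair1' H_meas[unfolded Qpair]]) (auto simp: space_restrict_space)
 have "integrable X (\<lambda>x. norm (H (t, x)))" by (rule torus.square_integrable_imp_integrable_real[OF _ i]) (use hm in measurable)
 then show ?thesis using hm by (simp add: integrable_norm_iff)
qed

text \<open>At almost every time the chain rule applies, because \<open>U(t)\<close> and \<open>H(t)\<close> are integrable.\<close>

lemma U_wgrad_slices: "AE t in TM T. has_torus_wgrad (\<lambda>x. U (t, x)) (\<lambda>x. H (t, x))"
proof -
 have w: "AE t in TM T. has_torus_wgrad (\<lambda>x. pw ((m - 1) / 2) (u (t, x))) (\<lambda>x. G (t, x))"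
  using G_wgrad unfolding has_wgrad_def AE_TM_time by auto
 from w AE_slice_int[OF u_int] AE_slice_int[OF H2] AE_space show ?thesis
 proof eventually_elim
  case (elim t)
  then have t: "t \<in> {0..<T}" by (simp add: space_restrict_space)
  let ?a = "(m - 1) / (m + 1)"
  have a: "?a > 0" "?a + 1 = 2 * m / (m + 1)" using m by (auto simp: field_simps)
  have Ueq: "pw ?a (pw ((m - 1) / 2) (u (t, x))) = U (t, x)" for x unfolding U_def by (rule pw_pw(1)[OF m])
  have Heq: "((?a + 1) * \<bar>pw ((m - 1) / 2) (u (t, x))\<bar> powr ?a) *\<^sub>R G (t, x) = H (t, x)" for x unfolding H_def pw_pw(2)[OF m] a(2) ..
  have "has_torus_wgrad (\<lambda>x. pw ?a (pw ((m - 1) / 2) (u (t, x)))) (\<lambda>x. ((?a + 1) * \<bar>pw ((m - 1) / 2) (u (t, x))\<bar> powr ?a) *\<^sub>R G (t, x))"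
  proof (rule chain_rule_pw[OF elim(1) a(1)])
   show "integrable X (\<lambda>x. pw ?a (pw ((m - 1) / 2) (u (t, x))))" unfolding Ueq by (rule U_slice_int(1)[OF t elim(2)])
   show "integrable X (\<lambda>x. ((?a + 1) * \<bar>pw ((m - 1) / 2) (u (t, x))\<bar> powr ?a) *\<^sub>R G (t, x))"
    unfolding Heq by (rule H_slice_int[OF t elim(3)])
  qed
  then show ?case unfolding Ueq Heq .
 qed
qed

lemma U_wgrad: "has_wgrad T U H"
 unfolding has_wgrad_def AE_TM_time using U_wgrad_slices by auto

text \<open>At almost every time Poincare's inequality bounds the \<open>L\<^sub>2\<close> norm by the gradient and the energy, which is bounded in time.\<close>

lemma U2: "integrable Q (\<lambda>z. (U z)\<^sup>2)"
proof -
 obtain C where C: "C \<ge> 0" "AE t in TM T. E t \<le> C" using E_bound by blast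
 define N where "N t = (LINT x|X. (norm (H (t, x)))\<^sup>2)" for t
 have N: "integrable (TM T) N" using QP.integrable_fst'[OF H2[unfolded Qpair]] unfolding N_def[abs_def] by simp
 have N0: "0 \<le> N t" for t unfolding N_def by simp
 let ?B = "\<lambda>t. 2 * (real CARD('d))\<^sup>2 * N t + 2 * (1 + (m + 1) * C)\<^sup>2"
 have "AE t in TM T. (\<integral>\<^sup>+x. ennreal ((U (t, x))\<^sup>2) \<partial>X) \<le> ennreal (?B t)"
  using U_wgrad_slices AE_slice_int[OF u_int] AE_slice_int[OF H2] C(2) AE_space
 proof eventually_elim
  case (elim t)
  then have t: "t \<in> {0..<T}" by (simp add: space_restrict_space)
  have "(LINT x|X. abs (U (t, x))) \<le> 1 + (m + 1) * E t" by (rule U_slice_int(2)[OF t elim(2)])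
  also have "\<dots> \<le> 1 + (m + 1) * C" using elim(4) m by simp
  finally have "(LINT x|X. abs (U (t, x)))\<^sup>2 \<le> (1 + (m + 1) * C)\<^sup>2" by (intro power_mono) auto
  then have "2 * (real CARD('d))\<^sup>2 * (LINT x|X. (norm (H (t, x)))\<^sup>2) + 2 * (LINT x|X. abs (U (t, x)))\<^sup>2 \<le> ?B t"
   unfolding N_def by simp
  then show ?case using poincare[OF elim(1) elim(3)] by (meson ennreal_leI order_trans)
 qed
 then have "(\<integral>\<^sup>+t. \<integral>\<^sup>+x. ennreal ((U (t, x))\<^sup>2) \<partial>X \<partial>TM T) \<le> (\<integral>\<^sup>+t. ennreal (?B t) \<partial>TM T)"
  by (rule nn_integral_mono_AE)
 also have "\<dots> = ennreal (LINT t|TM T. ?B t)" using N N0 by (intro nn_integral_eq_integral) auto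
 finally have fin: "(\<integral>\<^sup>+t. \<integral>\<^sup>+x. ennreal ((U (t, x))\<^sup>2) \<partial>X \<partial>TM T) < \<infinity>" by (auto intro: le_less_trans)
 have "(\<integral>\<^sup>+z. ennreal ((U z)\<^sup>2) \<partial>Q) = (\<integral>\<^sup>+t. \<integral>\<^sup>+x. ennreal ((U (t, x))\<^sup>2) \<partial>X \<partial>TM T)"
  unfolding Qpair by (rule torus.nn_integral_fst[symmetric]) (use U_meas[unfolded Qpair] in measurable)
 with fin show ?thesis by (intro integrableI_bounded) auto
qed

lemma U_L2H1: "U \<in> L2H1 T"
 unfolding L2H1_def Lp_def using U2 H2 U_wgrad U_meas H_meas by (auto intro!: exI[of _ H])

end

section \<open>The equation tested with a mollification\<close>

lemma power_interval_integral:
 assumes "m > 1" shows "(LBINT r=0..x. abs r powr (m - 1) * c) = c * pw (m - 1) x / m"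
proof -
 have d: "((\<lambda>r. c * pw (m - 1) r / m) has_real_derivative \<bar>r\<bar> powr (m - 1) * c) (at r)" for r
 proof -
  have "((\<lambda>r. c * pw (m - 1) r / m) has_real_derivative c * ((m - 1 + 1) * abs r powr (m - 1)) / m) (at r)"
   using assms by (intro DERIV_cdivide DERIV_cmult pw_deriv) simp
  then show ?thesis using assms by (simp add: mult.commute)
 qed
 have "(LBINT r=ereal 0..ereal x. abs r powr (m - 1) * c) = c * pw (m - 1) x / m - c * pw (m - 1) 0 / m"
  using assms by (intro interval_integral_FTC_finite)
   (auto intro!: continuous_intros continuous_abs_powr has_field_derivative_at_within d
    simp: has_real_derivative_iff_has_vector_derivative[symmetric])
 then show ?thesis by (simp add: zero_ereal_def[symmetric] pw_def)
qed

lemma theta_bounded: obtains B where "\<And>t. abs (theta n t) \<le> B" "\<And>t. \<bar>deriv (theta n) t\<bar> \<le> B"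
proof -
 let ?I = "{- 2 / real (Suc n) .. - 1 / real (Suc n)}"
 have "compact (theta n ` ?I)" "compact (deriv (theta n) ` ?I)" by (auto intro!: compact_continuous_image smooth_continuous smooth_deriv smooth_theta)
 then obtain A B where AB: "\<forall>y\<in>theta n ` ?I. norm y \<le> A" "\<forall>y\<in>deriv (theta n) ` ?I. norm y \<le> B"
  using compact_imp_bounded bounded_iff by metis
 have z: "deriv (theta n) t = 0" if "t \<notin> ?I" for t
 proof -
  have "((\<lambda>_. 0) has_real_derivative 0) (at t)" by simp
  then have "(theta n has_real_derivative 0) (at t)"
  proof (rule has_field_derivative_transform_within_open)
   show "open (- ?I)" by (simp add: open_Compl)
   show "t \<in> - ?I" using that by simp
   show "0 = theta n s" if "s \<in> - ?I" for s using that by (intro theta_zero[symmetric]) auto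
  qed
  then show ?thesis by (rule DERIV_imp_deriv)
 qed
 show thesis
 proof (rule that[of "max 0 (max A B)"])
  fix t
  show "abs (theta n t) \<le> max 0 (max A B)"
  proof (cases "t \<in> ?I")
   case True then have "abs (theta n t) \<le> A" using AB(1) by force
   then show ?thesis by simp
  next
   case False then have "theta n t = 0" by (intro theta_zero) auto
   then show ?thesis by simp
  qed
  show "\<bar>deriv (theta n) t\<bar> \<le> max 0 (max A B)"
  proof (cases "t \<in> ?I")
   case True then have "\<bar>deriv (theta n) t\<bar> \<le> B" using AB(2) by force
   then show ?thesis by simp
  next
   case False then show ?thesis using z by simp
  qed
 qed
qed

context obstacle
begin

lemma Q_id: "(\<lambda>z. z) \<in> Q \<rightarrow>\<^sub>M borel"
 unfolding QT_measure_def by (rule measurable_restrict_space1) simp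

lemma nu_id: "(\<lambda>z. z) \<in> \<nu> \<rightarrow>\<^sub>M borel"
proof -
 have "(\<lambda>z. z) \<in> restrict_space borel (QT T) \<rightarrow>\<^sub>M (borel :: (real \<times> (real ^ 'd)) measure)"
  by (rule measurable_restrict_space1) simp
 then show ?thesis using measurable_cong_sets[OF nu(2) refl] by blast
qed

lemma snd_fun_meas: "f \<in> borel_measurable (borel :: (real ^ 'd) measure) \<Longrightarrow> (\<lambda>z. f (snd z)) \<in> borel_measurable Q"
proof -
 assume f: "f \<in> borel_measurable (borel :: (real ^ 'd) measure)"
 have "snd \<in> Q \<rightarrow>\<^sub>M (borel :: (real ^ 'd) measure)"
  unfolding QT_measure_def by (rule measurable_restrict_space1) (simp add: borel_measurable_continuous_onI continuous_on_snd)
 then show ?thesis using f by (rule measurable_compose)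
qed

lemma convolution_swap:
 fixes F :: "real \<Rightarrow> real" and K :: "real ^ 'd \<Rightarrow> real" and A :: "(real \<times> (real ^ 'd)) measure"
 assumes A: "finite_measure A" "(\<lambda>z. z) \<in> A \<rightarrow>\<^sub>M borel"
  and f: "integrable A f" and g: "integrable Q g"
  and F: "F \<in> borel_measurable borel" "\<And>t. abs (F t) \<le> B" and K: "K \<in> borel_measurable borel" "\<And>x. abs (K x) \<le> B'"
 shows "(LINT z'|Q. g z' * (LINT z|A. f z * (F (fst z - fst z') * K (snd z - snd z'))))
   = (LINT z|A. f z * (LINT z'|Q. F (fst z - fst z') * K (snd z - snd z') * g z'))"
  and "integrable A (\<lambda>z. f z * (LINT z'|Q. F (fst z - fst z') * K (snd z - snd z') * g z'))"
  and "integrable Q (\<lambda>z'. g z' * (LINT z|A. f z * (F (fst z - fst z') * K (snd z - snd z'))))"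
proof -
 interpret A: finite_measure A by fact
 have m1: "(\<lambda>p. fst (fst p) - fst (snd p)) \<in> A \<Otimes>\<^sub>M Q \<rightarrow>\<^sub>M (borel :: real measure)"
  and m2: "(\<lambda>p. snd (fst p) - snd (snd p)) \<in> A \<Otimes>\<^sub>M Q \<rightarrow>\<^sub>M (borel :: (real ^ 'd) measure)"
 proof -
  have 1: "fst \<in> (borel :: (real \<times> (real ^ 'd)) measure) \<rightarrow>\<^sub>M borel" "snd \<in> (borel :: (real \<times> (real ^ 'd)) measure) \<rightarrow>\<^sub>M borel"
   by (auto intro!: borel_measurable_continuous_onI continuous_intros)
  have 2: "(\<lambda>p. fst p) \<in> A \<Otimes>\<^sub>M Q \<rightarrow>\<^sub>M borel" "(\<lambda>p. snd p) \<in> A \<Otimes>\<^sub>M Q \<rightarrow>\<^sub>M borel"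
   using measurable_compose[OF measurable_fst A(2)] measurable_compose[OF measurable_snd Q_id] by auto
  show "(\<lambda>p. fst (fst p) - fst (snd p)) \<in> A \<Otimes>\<^sub>M Q \<rightarrow>\<^sub>M (borel :: real measure)"
   by (intro borel_measurable_diff measurable_compose[OF 2(1) 1(1)] measurable_compose[OF 2(2) 1(1)])
  show "(\<lambda>p. snd (fst p) - snd (snd p)) \<in> A \<Otimes>\<^sub>M Q \<rightarrow>\<^sub>M (borel :: (real ^ 'd) measure)"
   by (intro borel_measurable_diff measurable_compose[OF 2(1) 1(2)] measurable_compose[OF 2(2) 1(2)])
 qed
 have m: "(\<lambda>p. F (fst (fst p) - fst (snd p)) * K (snd (fst p) - snd (snd p))) \<in> borel_measurable (A \<Otimes>\<^sub>M Q)"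
  by (intro borel_measurable_times measurable_compose[OF m1 F(1)] measurable_compose[OF m2 K(1)])
 have B0: "0 \<le> B" using F(2)[of 0] by linarith
 have b: "\<bar>F (fst z - fst z') * K (snd z - snd z')\<bar> \<le> B * B'" for z z' unfolding abs_mult using F K B0 by (intro mult_mono) auto
 note ks = kernel_swap[OF A.sigma_finite_measure_axioms Qf.sigma_finite_measure_axioms f g m b]
 show "(LINT z'|Q. g z' * (LINT z|A. f z * (F (fst z - fst z') * K (snd z - snd z'))))
   = (LINT z|A. f z * (LINT z'|Q. F (fst z - fst z') * K (snd z - snd z') * g z'))"
  "integrable A (\<lambda>z. f z * (LINT z'|Q. F (fst z - fst z') * K (snd z - snd z') * g z'))"
  "integrable Q (\<lambda>z'. g z' * (LINT z|A. f z * (F (fst z - fst z') * K (snd z - snd z'))))" using ks by simp_all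
qed

lemma wgrad_test:
 assumes w: "has_wgrad T f F" and f: "integrable Q f" and F: "integrable Q F"
  and a: "a \<in> borel_measurable borel" "\<And>t. t \<in> {0..<T} \<Longrightarrow> abs (a t) \<le> B" and \<rho>: "smooth \<rho>" "periodic \<rho>"
 shows "(LINT z|Q. f z * (a (fst z) * dderiv (axis i 1) \<rho> (snd z))) = - (LINT z|Q. F z $ i * (a (fst z) * \<rho> (snd z)))"
proof -
 obtain C where C: "\<And>x. \<bar>\<rho> x\<bar> \<le> C" "\<And>x. \<bar>dderiv (axis i 1) \<rho> x\<bar> \<le> C"
  using smooth_periodic_bounded[OF \<rho>, of "axis i 1"] by (metis axis_Basis)
 have B0: "0 \<le> B" using a(2)[of 0] T by auto
 have \<rho>m: "\<rho> \<in> borel_measurable borel" "dderiv (axis i 1) \<rho> \<in> borel_measurable borel"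
  using \<rho> by (auto intro!: borel_measurable_continuous_onI smooth_continuous smooth_dderiv)
 have i1: "integrable Q (\<lambda>z. f z * (a (fst z) * dderiv (axis i 1) \<rho> (snd z)))"
 proof (rule bounded_mult_int[OF f])
  show "(\<lambda>z. a (fst z) * dderiv (axis i 1) \<rho> (snd z)) \<in> borel_measurable Q"
   using a \<rho>m by (intro borel_measurable_times time_fun_meas snd_fun_meas)
  show "\<bar>a (fst z) * dderiv (axis i 1) \<rho> (snd z)\<bar> \<le> B * C" if "z \<in> space Q" for z
   unfolding abs_mult using that a C B0 by (intro mult_mono) auto
 qed
 have i2: "integrable Q (\<lambda>z. F z $ i * (a (fst z) * \<rho> (snd z)))"
 proof (rule bounded_mult_int[OF integrable_vec_nth[OF F]])
  show "(\<lambda>z. a (fst z) * \<rho> (snd z)) \<in> borel_measurable Q"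
   using a \<rho>m by (intro borel_measurable_times time_fun_meas snd_fun_meas)
  show "\<bar>a (fst z) * \<rho> (snd z)\<bar> \<le> B * C" if "z \<in> space Q" for z unfolding abs_mult using that a C B0 by (intro mult_mono) auto
 qed
 have "(LINT z|Q. f z * (a (fst z) * dderiv (axis i 1) \<rho> (snd z))) = (LINT t|TM T. (LINT x|X. f (t, x) * (a t * dderiv (axis i 1) \<rho> x)))"
  using QP.integral_fst'[OF i1[unfolded Qpair]] unfolding Qpair by simp
 also have "\<dots> = (LINT t|TM T. - (LINT x|X. F (t, x) $ i * (a t * \<rho> x)))"
 proof (rule integral_cong_AE)
  have m1: "(\<lambda>t. (LINT x|X. f (t, x) * (a t * dderiv (axis i 1) \<rho> x))) \<in> borel_measurable (TM T)"
   using borel_measurable_integrable[OF QP.integrable_fst'[OF i1[unfolded Qpair]]] by simp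
  then show "(\<lambda>t. (LINT x|X. f (t, x) * (a t * dderiv (axis i 1) \<rho> x))) \<in> borel_measurable (TM T)" .
  have m2: "(\<lambda>t. (LINT x|X. F (t, x) $ i * (a t * \<rho> x))) \<in> borel_measurable (TM T)"
   using borel_measurable_integrable[OF QP.integrable_fst'[OF i2[unfolded Qpair]]] by simp
  then show "(\<lambda>t. - (LINT x|X. F (t, x) $ i * (a t * \<rho> x))) \<in> borel_measurable (TM T)" by simp
  have "AE t in TM T. has_torus_wgrad (\<lambda>x. f (t, x)) (\<lambda>x. F (t, x))" using w unfolding has_wgrad_def AE_TM_time by simp
  then show "AE t in TM T. (LINT x|X. f (t, x) * (a t * dderiv (axis i 1) \<rho> x)) = - (LINT x|X. F (t, x) $ i * (a t * \<rho> x))"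
  proof eventually_elim
   case (elim t)
   have "(LINT x|X. f (t, x) * (a t * dderiv (axis i 1) \<rho> x)) = a t * (LINT x|X. f (t, x) * dderiv (axis i 1) \<rho> x)"
    by (subst integral_mult_right_zero[symmetric]) (simp add: mult_ac)
   also have "\<dots> = a t * - (LINT x|X. F (t, x) $ i * \<rho> x)" using elim \<rho> unfolding has_torus_wgrad_def by simp
   also have "\<dots> = - (LINT x|X. F (t, x) $ i * (a t * \<rho> x))"
    by (subst mult_minus_right, subst integral_mult_right_zero[symmetric]) (simp add: mult_ac)
   finally show ?case .
  qed
 qed
 also have "\<dots> = - (LINT t|TM T. (LINT x|X. F (t, x) $ i * (a t * \<rho> x)))" by simp
 also have "(LINT t|TM T. (LINT x|X. F (t, x) $ i * (a t * \<rho> x))) = (LINT z|Q. F z $ i * (a (fst z) * \<rho> (snd z)))"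
  using QP.integral_fst'[OF i2[unfolded Qpair]] unfolding Qpair by simp
 finally show ?thesis .
qed

text \<open>Both \<open>r\<close> and \<open>- r\<close> are entropies, and the dissipation vanishes for them.\<close>

lemma linear_equation:
 assumes \<phi>: "\<phi> \<in> time_tests T" and \<rho>: "smooth \<rho>" "periodic \<rho>" and nn: "\<And>t x. t \<in> {0..<T} \<Longrightarrow> 0 \<le> \<phi> t * \<rho> x"
 shows "- (LINT z|Q. u z * (deriv \<phi> (fst z) * \<rho> (snd z))) - (LINT z|\<nu>. \<phi> (fst z) * \<rho> (snd z))
   = (LINT x|X. \<xi> x * (\<phi> 0 * \<rho> x)) + (LINT z|Q. U z * (\<phi> (fst z) * laplacian \<rho> (snd z)))"
proof -
 have d: "deriv (\<lambda>r::real. r) = (\<lambda>_. 1)" "deriv (\<lambda>r::real. - r) = (\<lambda>_. - 1)" "deriv (\<lambda>r::real. c) = (\<lambda>_. 0)" for c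
  by (auto intro!: DERIV_imp_deriv derivative_eq_intros)
 have m0: "m \<noteq> 0" using m by simp
 have p: "m * (LINT z|Q. (c * pw (m - 1) (u z) / m) * f z) = c * (LINT z|Q. U z * f z)" for c f
 proof -
  have "m * (LINT z|Q. (c * pw (m - 1) (u z) / m) * f z) = (LINT z|Q. m * ((c * pw (m - 1) (u z) / m) * f z))" by (rule integral_mult_right_zero[symmetric])
  also have "\<dots> = (LINT z|Q. c * (U z * f z))" using m0 by (simp add: U_def mult.assoc)
  also have "\<dots> = c * (LINT z|Q. U z * f z)" by (rule integral_mult_right_zero)
  finally show ?thesis .
 qed
 have 1: "- (LINT z|Q. u z * (deriv \<phi> (fst z) * \<rho> (snd z))) - (LINT z|\<nu>. \<phi> (fst z) * \<rho> (snd z))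
   \<le> (LINT x|X. \<xi> x * (\<phi> 0 * \<rho> x)) + (LINT z|Q. U z * (\<phi> (fst z) * laplacian \<rho> (snd z)))"
  using entropy_raw[OF entropy_id(1) \<phi> \<rho> nn] unfolding d power_interval_integral[OF m] p by simp
 have 2: "(LINT z|Q. u z * (deriv \<phi> (fst z) * \<rho> (snd z))) + (LINT z|\<nu>. \<phi> (fst z) * \<rho> (snd z))
   \<le> - (LINT x|X. \<xi> x * (\<phi> 0 * \<rho> x)) - (LINT z|Q. U z * (\<phi> (fst z) * laplacian \<rho> (snd z)))"
  using entropy_raw[OF entropy_id(2) \<phi> \<rho> nn] unfolding d power_interval_integral[OF m] p by simp
 from 1 2 show ?thesis by linarith
qed

sublocale QI: approx_identity "{0..<T} \<times> (cell :: (real ^ 'd) set)" "\<lambda>n a b. theta n (fst a - fst b) * kappa n (snd a - snd b)"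
 by (rule approx_identity_Times[OF TI.approx_identity_axioms approx_identity_kappa])

lemma QI_M: "restrict_space lborel ({0..<T} \<times> (cell :: (real ^ 'd) set)) = Q"
 by (simp add: QT_measure_def QT_def)

lemma QI_moll: "QI.moll n f z = (LINT z'|Q. theta n (fst z - fst z') * kappa n (snd z - snd z') * f z')"
 by (simp add: QI.moll_def QI_M)

text \<open>The time kernel is supported in \<open>(t + 1 / (n + 1), t + 2 / (n + 1))\<close>, well inside the open time interval, so the space-time kernel
 is an admissible test function for the weak time derivative.\<close>

lemma has_wdt_kernel:
 assumes wd: "has_wdt T f g" and t: "0 \<le> t" "t + 2 / real (Suc n) < T"
 shows "(LINT z'|Q. deriv (theta n) (t - fst z') * kappa n (x - snd z') * f z') = QI.moll n g (t, x)"
proof -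
 define \<Phi> where "\<Phi> z' = theta n (t - fst z') * kappa n (x - snd z')" for z' :: "real \<times> (real ^ 'd)"
 have L1: "bounded_linear (\<lambda>z'::real \<times> (real ^ 'd). - fst z')" and L2: "bounded_linear (\<lambda>z'::real \<times> (real ^ 'd). - snd z')"
  by (intro bounded_linear_minus bounded_linear_fst bounded_linear_snd)+
 have sm: "smooth \<Phi>" using smooth_mult[OF smooth_affine[OF L1 smooth_theta[of n], of t] smooth_affine[OF L2 smooth_kappa[of n], of x]]
  unfolding \<Phi>_def[abs_def] by simp
 have per: "periodic (\<lambda>y. \<Phi> (s, y))" for s
  using periodic_reflect[OF periodic_kappa[of n], of x] unfolding \<Phi>_def periodic_def by simp
 have supp: "\<Phi> (s, y) = 0" if "s \<notin> {t + 1 / real (Suc n) .. t + 2 / real (Suc n)}" for s y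
 proof -
  have "t - s \<notin> {- 2 / real (Suc n)<..< - 1 / real (Suc n)}"
   using that unfolding greaterThanLessThan_iff atLeastAtMost_iff minus_divide_left[symmetric] by linarith
  then show ?thesis by (simp add: \<Phi>_def theta_zero del: of_nat_Suc)
 qed
 have pos: "0 < t + 1 / real (Suc n)" using t(1) by (intro add_nonneg_pos) auto
 have dd: "dderiv (1, 0) \<Phi> z' = - (deriv (theta n) (t - fst z') * kappa n (x - snd z'))" for z'
 proof -
  have e: "(1, 0) \<in> (Basis :: (real \<times> (real ^ 'd)) set)" by (simp add: Basis_prod_def)
  have 1: "((\<lambda>r. \<Phi> (z' + r *\<^sub>R (1, 0))) has_real_derivative dderiv (1, 0) \<Phi> (z' + 0 *\<^sub>R (1, 0))) (at 0)"
   by (rule smooth_directional_Basis[OF sm e])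
  have "((\<lambda>r. t - fst z' - r) has_real_derivative - 1) (at 0)" by (auto intro!: derivative_eq_intros)
  moreover have "(theta n has_real_derivative deriv (theta n) (t - fst z' - 0)) (at (t - fst z' - 0))" by (rule smooth_DERIV[OF smooth_theta])
  ultimately have "((\<lambda>r. theta n (t - fst z' - r)) has_real_derivative deriv (theta n) (t - fst z' - 0) * - 1) (at 0)"
   using DERIV_chain2[where f="theta n" and g="\<lambda>r. t - fst z' - r"] by blast
  then have "((\<lambda>r. theta n (t - fst z' - r) * kappa n (x - snd z')) has_real_derivative deriv (theta n) (t - fst z' - 0) * - 1 * kappa n (x - snd z')) (at 0)"
   by (rule DERIV_cmult_right)
  then have 2: "((\<lambda>r. \<Phi> (z' + r *\<^sub>R (1, 0))) has_real_derivative - (deriv (theta n) (t - fst z') * kappa n (x - snd z'))) (at 0)"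
   by (simp add: \<Phi>_def algebra_simps)
  show ?thesis using DERIV_unique[OF 1 2] by (simp only: scaleR_zero_left add_0_right)
 qed
 have "(LINT z|Q. f z * dderiv (1, 0) \<Phi> z) = - (LINT z|Q. g z * \<Phi> z)" using wd sm per supp pos t(2) unfolding has_wdt_def by blast
 then have "(LINT z|Q. f z * (deriv (theta n) (t - fst z) * kappa n (x - snd z))) = (LINT z|Q. g z * \<Phi> z)" unfolding dd by simp
 then show ?thesis unfolding QI_moll \<Phi>_def by (simp add: mult.commute)
qed

end

text \<open>A competitor \<open>v\<close> with representatives of the weak derivatives of its signed power.\<close>

locale obstacle_test = obstacle T m \<psi> u \<xi> \<nu>
 for T m :: real and \<psi> u :: "real \<times> (real ^ 'd) \<Rightarrow> real" and \<xi> :: "real ^ 'd \<Rightarrow> real"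
  and \<nu> :: "(real \<times> (real ^ 'd)) measure" +
 fixes v :: "real \<times> (real ^ 'd) \<Rightarrow> real" and Gw :: "real \<times> (real ^ 'd) \<Rightarrow> real ^ 'd" and wt :: "real \<times> (real ^ 'd) \<Rightarrow> real"
 assumes v: "v \<in> C_Lp T (m + 1)"
  and w_L2: "integrable Q (\<lambda>z. (pw (m - 1) (v z))\<^sup>2)"
  and Gw: "has_wgrad T (\<lambda>z. pw (m - 1) (v z)) Gw" and Gw_L2: "integrable Q (\<lambda>z. (norm (Gw z))\<^sup>2)"
  and wt: "has_wdt T (\<lambda>z. pw (m - 1) (v z)) wt" and wt_Lp: "integrable Q (\<lambda>z. abs (wt z) powr ((m + 1) / m))"
  and v_psi: "AE z in Q. \<psi> z \<le> v z"
begin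

definition w where "w z = pw (m - 1) (v z)"

lemma v_meas [measurable]: "v \<in> borel_measurable Q" using v by (simp add: C_Lp_def)
lemma w_meas [measurable]: "w \<in> borel_measurable Q" unfolding w_def[abs_def] by measurable
lemma w_int: "integrable Q w" using wt unfolding has_wdt_def w_def[abs_def] by simp
lemma wt_int: "integrable Q wt" using wt unfolding has_wdt_def by simp
lemma wt_meas [measurable]: "wt \<in> borel_measurable Q" using wt_int by simp
lemma Gw_meas [measurable]: "Gw \<in> borel_measurable Q" using Gw by (simp add: has_wgrad_def)
lemma L2_vec_int:
 fixes F :: "real \<times> (real ^ 'd) \<Rightarrow> real ^ 'd"
 assumes [measurable]: "F \<in> borel_measurable Q" and "integrable Q (\<lambda>z. (norm (F z))\<^sup>2)" shows "integrable Q F"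
proof -
 have "integrable Q (\<lambda>z. norm (F z))" by (rule Qf.square_integrable_imp_integrable_real) (use assms in measurable)
 then show ?thesis using assms(1) by (simp add: integrable_norm_iff)
qed
lemma Gw_int: "integrable Q Gw" using L2_vec_int[OF Gw_meas Gw_L2] .
lemma H_int: "integrable Q H" using L2_vec_int[OF H_meas H2] .
lemma U_int: "integrable Q U" by (rule Qf.square_integrable_imp_integrable_real[OF U_meas U2])
lemma u_int1: "integrable Q u" using m u_int by (intro Qf.integrable_powr_imp_integrable[of u "m + 1"]) auto

end

lemma periodic_continuous_bounded_ex:
 fixes f :: "real ^ 'd \<Rightarrow> real"
 assumes "continuous_on UNIV f" "periodic f" shows "\<exists>C. \<forall>x. abs (f x) \<le> C"
 using periodic_continuous_bounded[OF assms] by blast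

context obstacle_test
begin

lemma time_test_mult_int:
 assumes \<phi>: "\<phi> \<in> time_tests T" and f: "integrable Q f"
 shows "integrable Q (\<lambda>z. f z * \<phi> (fst z))" "integrable Q (\<lambda>z. f z * deriv \<phi> (fst z))"
proof -
 obtain B where B: "B \<ge> 0" "\<And>t. t \<in> {0..T} \<Longrightarrow> \<bar>\<phi> t\<bar> \<le> B" "\<And>t. t \<in> {0..T} \<Longrightarrow> \<bar>deriv \<phi> t\<bar> \<le> B"
  using time_test_bounded[OF \<phi> T0] by blast
 have "(\<lambda>z. \<phi> (fst z)) \<in> borel_measurable Q" "(\<lambda>z. deriv \<phi> (fst z)) \<in> borel_measurable Q"
  using time_test_deriv_borel[OF \<phi>] by (auto intro: time_fun_meas)
 then show "integrable Q (\<lambda>z. f z * \<phi> (fst z))" "integrable Q (\<lambda>z. f z * deriv \<phi> (fst z))"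
  using B by (auto intro!: bounded_mult_int[OF f, where B=B])
qed

text \<open>The product rule separates the derivative that falls on the kernel, which will act on \<open>w\<close>, from the one that falls on \<open>\<phi>\<close>.\<close>

lemma tested_equation:
 assumes \<phi>: "\<phi> \<in> time_tests T" "\<And>t. t \<in> {0..<T} \<Longrightarrow> 0 \<le> \<phi> t"
 shows "- (LINT z|Q. (u z * \<phi> (fst z)) * (deriv (theta n) (fst z - s) * kappa n (snd z - y)))
   - (LINT z|Q. (u z * deriv \<phi> (fst z)) * (theta n (fst z - s) * kappa n (snd z - y)))
   - (LINT z|\<nu>. \<phi> (fst z) * (theta n (fst z - s) * kappa n (snd z - y)))
   = (LINT x|X. (\<xi> x * \<phi> 0) * (theta n (0 - s) * kappa n (x - y)))
   + (\<Sum>i\<in>UNIV. (LINT z|Q. (U z * \<phi> (fst z)) * (theta n (fst z - s) * dderiv (axis i 1) (dderiv (axis i 1) (kappa n)) (snd z - y))))"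
proof -
 let ?\<kappa> = "kappa n :: real ^ 'd \<Rightarrow> real"
 let ?D = "\<lambda>i. dderiv (axis i 1) ?\<kappa>" let ?DD = "\<lambda>i. dderiv (axis i 1) (?D i)"
 define \<zeta> where "\<zeta> t = theta n (t - s) * \<phi> t" for t
 define \<rho> where "\<rho> x = ?\<kappa> (x - y)" for x
 have th: "smooth (\<lambda>t. theta n (t - s))" using smooth_translate(1)[OF smooth_theta[of n], of "- s"] by simp
 have \<phi>s: "smooth \<phi>" using \<phi> by (simp add: time_tests_def)
 have \<zeta>: "\<zeta> \<in> time_tests T" using smooth_mult[OF th \<phi>s] \<phi>(1) unfolding time_tests_def \<zeta>_def[abs_def] by auto
 have zd: "deriv \<zeta> t = deriv (theta n) (t - s) * \<phi> t + theta n (t - s) * deriv \<phi> t" for t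
 proof -
  have "((\<lambda>t. t - s) has_real_derivative 1) (at t)" by (auto intro!: derivative_eq_intros)
  from DERIV_chain2[where f="theta n" and g="\<lambda>t. t - s", OF smooth_DERIV[OF smooth_theta] this]
  have "((\<lambda>t. theta n (t - s)) has_real_derivative deriv (theta n) (t - s)) (at t)" by simp
  from DERIV_mult[OF this smooth_DERIV[OF \<phi>s]] have "(\<zeta> has_real_derivative deriv (theta n) (t - s) * \<phi> t + theta n (t - s) * deriv \<phi> t) (at t)"
   unfolding \<zeta>_def[abs_def] by (simp add: mult.commute)
  then show ?thesis by (rule DERIV_imp_deriv)
 qed
 have tr: "smooth f \<Longrightarrow> e \<in> Basis \<Longrightarrow> dderiv e (\<lambda>x. f (x - y)) x = dderiv e f (x - y)" for f e x
  using smooth_translate(2)[of f e "- y" x] by simp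
 have \<rho>: "smooth \<rho>" "periodic \<rho>"
 proof -
  show "smooth \<rho>" using smooth_translate(1)[OF smooth_kappa[of n], of "- y"] unfolding \<rho>_def[abs_def] by simp
  have "?\<kappa> (x + axis i 1 - y) = ?\<kappa> (x - y)" for x i using periodic_kappa[of n] unfolding periodic_def by (metis add_diff_eq diff_add_eq)
  then show "periodic \<rho>" by (simp add: periodic_def \<rho>_def)
 qed
 have lap: "laplacian \<rho> x = (\<Sum>i\<in>UNIV. ?DD i (x - y))" for x
 proof -
  have d1: "dderiv e \<rho> = (\<lambda>x. dderiv e ?\<kappa> (x - y))" if "e \<in> Basis" for e
   unfolding \<rho>_def[abs_def] using tr[OF smooth_kappa that] by auto
  have "laplacian \<rho> x = (\<Sum>i\<in>UNIV. dderiv (axis i 1) (dderiv (axis i 1) \<rho>) x)" unfolding laplacian_def sum_Basis_vec ..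
  also have "\<dots> = (\<Sum>i\<in>UNIV. ?DD i (x - y))"
  proof (rule sum.cong[OF refl])
   fix i
   show "dderiv (axis i 1) (dderiv (axis i 1) \<rho>) x = ?DD i (x - y)"
    unfolding d1[OF axis_Basis] by (rule tr[OF smooth_dderiv[OF smooth_kappa axis_Basis] axis_Basis])
  qed
  finally show ?thesis .
 qed
 have nn: "0 \<le> \<zeta> t * \<rho> x" if "t \<in> {0..<T}" for t x
  unfolding \<zeta>_def \<rho>_def using \<phi>(2)[OF that] theta_nonneg[of n "t - s"] kappa_nonneg[of n "x - y"] by (intro mult_nonneg_nonneg)
 have eq: "- (LINT z|Q. u z * (deriv \<zeta> (fst z) * \<rho> (snd z))) - (LINT z|\<nu>. \<zeta> (fst z) * \<rho> (snd z))
   = (LINT x|X. \<xi> x * (\<zeta> 0 * \<rho> x)) + (LINT z|Q. U z * (\<zeta> (fst z) * laplacian \<rho> (snd z)))"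
  by (rule linear_equation[OF \<zeta> \<rho> nn])
 obtain B where B: "\<And>t. abs (theta n t) \<le> B" "\<And>t. \<bar>deriv (theta n) t\<bar> \<le> B" using theta_bounded by blast
 have B0: "0 \<le> B" using B(1)[of 0] by linarith
 have Fm: "theta n \<in> borel_measurable borel" "deriv (theta n) \<in> borel_measurable borel"
  by (auto intro!: borel_measurable_continuous_onI smooth_continuous smooth_deriv smooth_theta)
 have km: "(\<lambda>z. F (fst z - s) * K (snd z - y)) \<in> borel_measurable Q" if "F \<in> borel_measurable borel" "K \<in> borel_measurable borel"
  for F :: "real \<Rightarrow> real" and K :: "real ^ 'd \<Rightarrow> real"
 proof (rule borel_measurable_times)
  have "(\<lambda>t. F (t - s)) \<in> borel_measurable borel" "(\<lambda>x. K (x - y)) \<in> borel_measurable borel" using that by measurable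
  then show "(\<lambda>z. F (fst z - s)) \<in> borel_measurable Q" "(\<lambda>z. K (snd z - y)) \<in> borel_measurable Q"
   by (auto intro: time_fun_meas snd_fun_meas)
 qed
 obtain B' where B': "\<And>x. \<bar>?\<kappa> x\<bar> \<le> B'" using kappa_bounded by blast
 have e1: "(LINT z|Q. u z * (deriv \<zeta> (fst z) * \<rho> (snd z))) =
   (LINT z|Q. (u z * \<phi> (fst z)) * (deriv (theta n) (fst z - s) * ?\<kappa> (snd z - y)))
   + (LINT z|Q. (u z * deriv \<phi> (fst z)) * (theta n (fst z - s) * ?\<kappa> (snd z - y)))"
 proof -
  have i1: "integrable Q (\<lambda>z. (u z * \<phi> (fst z)) * (deriv (theta n) (fst z - s) * ?\<kappa> (snd z - y)))"
   by (rule bounded_mult_int[OF time_test_mult_int(1)[OF \<phi>(1) u_int1] km[OF Fm(2) kappa_borel], where B="B * B'"])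
    (use B B' B0 in \<open>auto simp: abs_mult intro!: mult_mono\<close>)
  have i2: "integrable Q (\<lambda>z. (u z * deriv \<phi> (fst z)) * (theta n (fst z - s) * ?\<kappa> (snd z - y)))"
   by (rule bounded_mult_int[OF time_test_mult_int(2)[OF \<phi>(1) u_int1] km[OF Fm(1) kappa_borel], where B="B * B'"])
    (use B B' B0 in \<open>auto simp: abs_mult intro!: mult_mono\<close>)
  have "u z * (deriv \<zeta> (fst z) * \<rho> (snd z)) = (u z * \<phi> (fst z)) * (deriv (theta n) (fst z - s) * ?\<kappa> (snd z - y))
    + (u z * deriv \<phi> (fst z)) * (theta n (fst z - s) * ?\<kappa> (snd z - y))" for z unfolding zd \<rho>_def by (simp add: algebra_simps)
  then show ?thesis using B_integral_add[OF i1 i2] by simp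
 qed
 have e2: "(LINT z|Q. U z * (\<zeta> (fst z) * laplacian \<rho> (snd z)))
   = (\<Sum>i\<in>UNIV. (LINT z|Q. (U z * \<phi> (fst z)) * (theta n (fst z - s) * ?DD i (snd z - y))))"
 proof -
  have i: "integrable Q (\<lambda>z. (U z * \<phi> (fst z)) * (theta n (fst z - s) * ?DD i (snd z - y)))" for i
  proof -
   have sm: "smooth (?DD i)" by (intro smooth_dderiv smooth_kappa axis_Basis)
   obtain C where C: "\<And>x. \<bar>?DD i x\<bar> \<le> C"
    using periodic_continuous_bounded[OF smooth_continuous[OF sm] periodic_dderiv[OF smooth_dderiv[OF smooth_kappa axis_Basis] periodic_dderiv[OF smooth_kappa periodic_kappa axis_Basis] axis_Basis]] by blast
   show ?thesis
    by (rule bounded_mult_int[OF time_test_mult_int(1)[OF \<phi>(1) U_int] km[OF Fm(1) borel_measurable_continuous_onI[OF smooth_continuous[OF sm]]], where B="B * C"])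
     (use B C B0 in \<open>auto simp: abs_mult intro!: mult_mono\<close>)
  qed
  have "U z * (\<zeta> (fst z) * laplacian \<rho> (snd z)) = (\<Sum>i\<in>UNIV. (U z * \<phi> (fst z)) * (theta n (fst z - s) * ?DD i (snd z - y)))" for z
   unfolding lap \<zeta>_def sum_distrib_left by (intro sum.cong refl) (simp only: mult_ac)
  then show ?thesis using B_integral_sum[of UNIV Q "\<lambda>i z. (U z * \<phi> (fst z)) * (theta n (fst z - s) * ?DD i (snd z - y))"] i by simp
 qed
 have e3: "(LINT z|\<nu>. \<zeta> (fst z) * \<rho> (snd z)) = (LINT z|\<nu>. \<phi> (fst z) * (theta n (fst z - s) * ?\<kappa> (snd z - y)))"
  unfolding \<zeta>_def \<rho>_def by (intro B_integral_cong refl) (simp only: mult_ac)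
 have e4: "(LINT x|X. \<xi> x * (\<zeta> 0 * \<rho> x)) = (LINT x|X. (\<xi> x * \<phi> 0) * (theta n (0 - s) * ?\<kappa> (x - y)))"
  unfolding \<zeta>_def \<rho>_def by (intro B_integral_cong refl) (simp only: mult_ac)
 from eq show ?thesis unfolding e1 e2 e3 e4 minus_add_distrib diff_conv_add_uminus .
qed

text \<open>Multiply the equation tested with the kernel at \<open>(s, y)\<close> by \<open>w (s, y)\<close> and integrate. The time derivative moves from the kernel to
 \<open>w\<close>; one space derivative moves to \<open>w\<close> and the other to \<open>U\<close>. The condition on \<open>n\<close> keeps the kernel away from the final time wherever
 \<open>\<phi>\<close> does not vanish.\<close>

lemma moll_equation:
 assumes \<phi>: "\<phi> \<in> time_tests T" "\<And>t. t \<in> {0..<T} \<Longrightarrow> 0 \<le> \<phi> t"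
  and s0: "\<And>t. t \<ge> s0 \<Longrightarrow> \<phi> t = 0" and n: "2 / real (Suc n) < T - s0"
 shows "- (LINT z|Q. (u z * \<phi> (fst z)) * QI.moll n wt z) - (LINT z|Q. (u z * deriv \<phi> (fst z)) * QI.moll n w z)
   - (LINT z|\<nu>. \<phi> (fst z) * QI.moll n w z)
   = (LINT x|X. (\<xi> x * \<phi> 0) * QI.moll n w (0, x)) - (\<Sum>i\<in>UNIV. (LINT z|Q. (H z $ i * \<phi> (fst z)) * QI.moll n (\<lambda>z. Gw z $ i) z))"
  and "integrable \<nu> (\<lambda>z. \<phi> (fst z) * QI.moll n w z)"
  and "(LINT x|X. (\<xi> x * \<phi> 0) * QI.moll n w (0, x)) = (LINT z'|Q. w z' * (LINT x|X. (\<xi> x * \<phi> 0) * (theta n (0 - fst z') * kappa n (x - snd z'))))"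
  and "integrable Q (\<lambda>z'. w z' * (LINT x|X. (\<xi> x * \<phi> 0) * (theta n (0 - fst z') * kappa n (x - snd z'))))"
proof -
 let ?\<kappa> = "kappa n :: real ^ 'd \<Rightarrow> real" and ?\<theta> = "theta n"
 let ?D = "\<lambda>i. dderiv (axis i 1) ?\<kappa>" let ?DD = "\<lambda>i. dderiv (axis i 1) (?D i)"
 obtain B where B: "\<And>t. \<bar>?\<theta> t\<bar> \<le> B" "\<And>t. \<bar>deriv ?\<theta> t\<bar> \<le> B" using theta_bounded by blast
 have B0: "0 \<le> B" using B(1)[of 0] by linarith
 have Fm: "?\<theta> \<in> borel_measurable borel" "deriv ?\<theta> \<in> borel_measurable borel"
  by (auto intro!: borel_measurable_continuous_onI smooth_continuous smooth_deriv smooth_theta)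
 obtain B' where B': "\<And>x. \<bar>?\<kappa> x\<bar> \<le> B'" using kappa_bounded by blast
 have Ds: "smooth (?D i)" "periodic (?D i)" "smooth (?DD i)" "periodic (?DD i)" for i
  by (intro smooth_dderiv periodic_dderiv smooth_kappa periodic_kappa axis_Basis)+
 have Dm: "?D i \<in> borel_measurable borel" "?DD i \<in> borel_measurable borel" for i
  by (rule borel_measurable_continuous_onI, rule smooth_continuous, rule Ds)+
 have "\<forall>i. \<exists>C. \<forall>x. \<bar>?D i x\<bar> \<le> C" by (intro allI periodic_continuous_bounded_ex smooth_continuous Ds)
 from choice[OF this] obtain C where C1': "\<forall>i. \<forall>x. \<bar>?D i x\<bar> \<le> C i" ..
 have C1: "\<bar>?D i x\<bar> \<le> C i" for i x by (rule C1'[THEN spec, THEN spec])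
 have "\<forall>i. \<exists>C. \<forall>x. \<bar>?DD i x\<bar> \<le> C" by (intro allI periodic_continuous_bounded_ex smooth_continuous Ds)
 from choice[OF this] obtain C' where C2': "\<forall>i. \<forall>x. \<bar>?DD i x\<bar> \<le> C' i" ..
 have C2: "\<bar>?DD i x\<bar> \<le> C' i" for i x by (rule C2'[THEN spec, THEN spec])
 note uq = time_test_mult_int[OF \<phi>(1) u_int1] time_test_mult_int(1)[OF \<phi>(1) U_int]
 have Hi: "integrable Q (\<lambda>z. H z $ i)" "integrable Q (\<lambda>z. Gw z $ i)" for i
  by (rule integrable_vec_nth[OF H_int], rule integrable_vec_nth[OF Gw_int])
 have pnu: "integrable \<nu> (\<lambda>z. \<phi> (fst z))"
 proof -
  obtain A where "A \<ge> 0" "\<And>t. t \<in> {0..T} \<Longrightarrow> \<bar>\<phi> t\<bar> \<le> A" "\<And>t. t \<in> {0..T} \<Longrightarrow> \<bar>deriv \<phi> t\<bar> \<le> A" using time_test_bounded[OF \<phi>(1) T0] by blast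
  then have "AE z in \<nu>. norm (\<phi> (fst z)) \<le> A" by (intro AE_I2) auto
  then show ?thesis by (rule nu.integrable_const_bound[OF _ time_nu_meas[OF \<phi>(1)]])
 qed
 note sw1 = convolution_swap[OF Qf.finite_measure_axioms Q_id uq(1) w_int Fm(2) B(2) kappa_borel B']
 note sw2 = convolution_swap[OF Qf.finite_measure_axioms Q_id uq(2) w_int Fm(1) B(1) kappa_borel B']
 note sw3 = convolution_swap[OF nu.finite_measure_axioms nu_id pnu w_int Fm(1) B(1) kappa_borel B']
 note sw5 = convolution_swap[OF Qf.finite_measure_axioms Q_id uq(3) w_int Fm(1) B(1) Dm(2) C2]
 note sw5' = convolution_swap[OF Qf.finite_measure_axioms Q_id uq(3) Hi(2) Fm(1) B(1) Dm(1) C1]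
 note sw5'' = convolution_swap[OF Qf.finite_measure_axioms Q_id time_test_mult_int(1)[OF \<phi>(1) Hi(1)] Hi(2) Fm(1) B(1) kappa_borel B']
 have \<xi>i: "integrable X (\<lambda>x. \<xi> x * \<phi> 0)"
  using m xi_int by (intro integrable_mult_left torus.integrable_powr_imp_integrable[of \<xi> "m + 1"]) auto
 have m4: "(\<lambda>p. ?\<theta> (0 - fst (snd p)) * ?\<kappa> (fst p - snd (snd p))) \<in> borel_measurable (X \<Otimes>\<^sub>M Q)"
 proof -
  have 1: "fst \<in> (borel :: (real \<times> (real ^ 'd)) measure) \<rightarrow>\<^sub>M borel" "snd \<in> (borel :: (real \<times> (real ^ 'd)) measure) \<rightarrow>\<^sub>M borel"
   by (auto intro!: borel_measurable_continuous_onI continuous_intros)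
  have Xid: "(\<lambda>x. x) \<in> X \<rightarrow>\<^sub>M borel" by (rule measurable_torus) simp
  have 2: "(\<lambda>p. fst p) \<in> X \<Otimes>\<^sub>M Q \<rightarrow>\<^sub>M borel" "(\<lambda>p. snd p) \<in> X \<Otimes>\<^sub>M Q \<rightarrow>\<^sub>M borel"
   using measurable_compose[OF measurable_fst Xid] measurable_compose[OF measurable_snd Q_id] by auto
  have 3: "(\<lambda>p. 0 - fst (snd p)) \<in> X \<Otimes>\<^sub>M Q \<rightarrow>\<^sub>M (borel :: real measure)"
   by (intro borel_measurable_diff borel_measurable_const measurable_compose[OF 2(2) 1(1)])
  have 4: "(\<lambda>p. fst p - snd (snd p)) \<in> X \<Otimes>\<^sub>M Q \<rightarrow>\<^sub>M (borel :: (real ^ 'd) measure)"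
   by (intro borel_measurable_diff 2(1) measurable_compose[OF 2(2) 1(2)])
  show ?thesis by (intro borel_measurable_times measurable_compose[OF 3 Fm(1)] measurable_compose[OF 4 kappa_borel])
 qed
 have b4: "\<bar>?\<theta> (0 - fst z) * ?\<kappa> (x - snd z)\<bar> \<le> B * B'" for x z unfolding abs_mult using B B' B0 by (intro mult_mono) auto
 note sw4 = kernel_swap[OF torus.sigma_finite_measure_axioms Qf.sigma_finite_measure_axioms \<xi>i w_int m4 b4]
 show "integrable \<nu> (\<lambda>z. \<phi> (fst z) * QI.moll n w z)" unfolding QI_moll using sw3(2) by simp
 show "(LINT x|X. (\<xi> x * \<phi> 0) * QI.moll n w (0, x)) = (LINT z'|Q. w z' * (LINT x|X. (\<xi> x * \<phi> 0) * (theta n (0 - fst z') * kappa n (x - snd z'))))"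
  unfolding QI_moll using sw4(1) by simp
 show "integrable Q (\<lambda>z'. w z' * (LINT x|X. (\<xi> x * \<phi> 0) * (theta n (0 - fst z') * kappa n (x - snd z'))))" using sw4(3) by simp
 have T1: "(LINT z'|Q. w z' * (LINT z|Q. (u z * \<phi> (fst z)) * (deriv ?\<theta> (fst z - fst z') * ?\<kappa> (snd z - snd z'))))
  = (LINT z|Q. (u z * \<phi> (fst z)) * QI.moll n wt z)" unfolding sw1(1)
 proof (intro B_integral_cong refl)
  fix z assume z: "z \<in> space Q"
  show "(u z * \<phi> (fst z)) * (LINT z'|Q. deriv ?\<theta> (fst z - fst z') * ?\<kappa> (snd z - snd z') * w z') = (u z * \<phi> (fst z)) * QI.moll n wt z"
  proof (cases "fst z \<ge> s0")
   case True then show ?thesis using s0 by simp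
  next
   case False
   then have "fst z + 2 / real (Suc n) < T" using n by linarith
   then show ?thesis using has_wdt_kernel[OF wt[folded w_def], of "fst z" n "snd z"] z by auto
  qed
 qed
 have T5: "(LINT z'|Q. w z' * (LINT z|Q. (U z * \<phi> (fst z)) * (?\<theta> (fst z - fst z') * ?DD i (snd z - snd z'))))
  = - (LINT z|Q. (H z $ i * \<phi> (fst z)) * QI.moll n (\<lambda>z. Gw z $ i) z)" for i
 proof -
  have in1: "(LINT z'|Q. ?\<theta> (fst z - fst z') * ?DD i (snd z - snd z') * w z') = (LINT z'|Q. ?\<theta> (fst z - fst z') * ?D i (snd z - snd z') * (Gw z' $ i))" for z
  proof -
   have "(LINT z'|Q. w z' * (?\<theta> (fst z - fst z') * dderiv (axis i 1) (\<lambda>y. ?D i (snd z - y)) (snd z')))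
    = - (LINT z'|Q. Gw z' $ i * (?\<theta> (fst z - fst z') * ?D i (snd z - snd z')))"
   proof (rule wgrad_test[where a="\<lambda>s. ?\<theta> (fst z - s)" and B=B and \<rho>="\<lambda>y. ?D i (snd z - y)"])
    show "has_wgrad T w Gw" using Gw by (simp add: w_def[abs_def])
    show "(\<lambda>s. ?\<theta> (fst z - s)) \<in> borel_measurable borel" using Fm(1) by measurable
    show "smooth (\<lambda>y. ?D i (snd z - y))" "periodic (\<lambda>y. ?D i (snd z - y))"
     by (rule smooth_reflect(1)[OF Ds(1)], rule periodic_reflect[OF Ds(2)])
   qed (use w_int Gw_int B in auto)
   moreover have "(LINT z'|Q. ?\<theta> (fst z - fst z') * ?DD i (snd z - snd z') * w z')
    = (LINT z'|Q. - (w z' * (?\<theta> (fst z - fst z') * dderiv (axis i 1) (\<lambda>y. ?D i (snd z - y)) (snd z'))))"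
    unfolding smooth_reflect(2)[OF Ds(1) axis_Basis] by (intro B_integral_cong refl) simp
   moreover have "(LINT z'|Q. ?\<theta> (fst z - fst z') * ?D i (snd z - snd z') * (Gw z' $ i)) = (LINT z'|Q. Gw z' $ i * (?\<theta> (fst z - fst z') * ?D i (snd z - snd z')))"
    by (intro B_integral_cong refl) (simp only: mult_ac)
   ultimately show ?thesis by (simp only: B_integral_minus minus_minus)
  qed
  have in2: "(LINT z|Q. (U z * \<phi> (fst z)) * (?\<theta> (fst z - fst z') * ?D i (snd z - snd z')))
    = - (LINT z|Q. (H z $ i * \<phi> (fst z)) * (?\<theta> (fst z - fst z') * ?\<kappa> (snd z - snd z')))" for z'
  proof -
   obtain A where A: "A \<ge> 0" "\<And>t. t \<in> {0..T} \<Longrightarrow> \<bar>\<phi> t\<bar> \<le> A" "\<And>t. t \<in> {0..T} \<Longrightarrow> \<bar>deriv \<phi> t\<bar> \<le> A" using time_test_bounded[OF \<phi>(1) T0] by blast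
   have tr: "dderiv (axis i 1) (\<lambda>x. ?\<kappa> (x - y)) x = ?D i (x - y)" for x y
    using smooth_translate(2)[OF smooth_kappa[of n] axis_Basis[of i], of "- y" x] by simp
   have "(LINT z|Q. U z * ((\<phi> (fst z) * ?\<theta> (fst z - fst z')) * dderiv (axis i 1) (\<lambda>x. ?\<kappa> (x - snd z')) (snd z)))
    = - (LINT z|Q. H z $ i * ((\<phi> (fst z) * ?\<theta> (fst z - fst z')) * ?\<kappa> (snd z - snd z')))"
   proof (rule wgrad_test[where a="\<lambda>t. \<phi> t * ?\<theta> (t - fst z')" and B="A * B" and \<rho>="\<lambda>x. ?\<kappa> (x - snd z')"])
    show "(\<lambda>t. \<phi> t * ?\<theta> (t - fst z')) \<in> borel_measurable borel"
     using Fm(1) time_test_deriv_borel(1)[OF \<phi>(1)] by measurable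
    show "\<bar>\<phi> t * ?\<theta> (t - fst z')\<bar> \<le> A * B" if "t \<in> {0..<T}" for t
     unfolding abs_mult using that A B by (intro mult_mono) auto
    show "smooth (\<lambda>x. ?\<kappa> (x - snd z'))" using smooth_translate(1)[OF smooth_kappa[of n], of "- snd z'"] by simp
    have "?\<kappa> (x + axis j 1 - snd z') = ?\<kappa> (x - snd z')" for x j
     using periodic_kappa[of n] unfolding periodic_def by (metis add_diff_eq diff_add_eq)
    then show "periodic (\<lambda>x. ?\<kappa> (x - snd z'))" by (simp add: periodic_def)
   qed (rule U_wgrad U_int H_int)+
   moreover have "(LINT z|Q. (U z * \<phi> (fst z)) * (?\<theta> (fst z - fst z') * ?D i (snd z - snd z')))
    = (LINT z|Q. U z * ((\<phi> (fst z) * ?\<theta> (fst z - fst z')) * dderiv (axis i 1) (\<lambda>x. ?\<kappa> (x - snd z')) (snd z)))"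
    unfolding tr by (intro B_integral_cong refl) (simp only: mult_ac)
   moreover have "(LINT z|Q. (H z $ i * \<phi> (fst z)) * (?\<theta> (fst z - fst z') * ?\<kappa> (snd z - snd z')))
    = (LINT z|Q. H z $ i * ((\<phi> (fst z) * ?\<theta> (fst z - fst z')) * ?\<kappa> (snd z - snd z')))"
    by (intro B_integral_cong refl) (simp only: mult_ac)
   ultimately show ?thesis by (simp only:)
  qed
  have "(LINT z'|Q. w z' * (LINT z|Q. (U z * \<phi> (fst z)) * (?\<theta> (fst z - fst z') * ?DD i (snd z - snd z'))))
   = (LINT z|Q. (U z * \<phi> (fst z)) * (LINT z'|Q. ?\<theta> (fst z - fst z') * ?D i (snd z - snd z') * (Gw z' $ i)))" unfolding sw5(1) in1 ..
  also have "\<dots> = (LINT z'|Q. Gw z' $ i * (LINT z|Q. (U z * \<phi> (fst z)) * (?\<theta> (fst z - fst z') * ?D i (snd z - snd z'))))"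
   by (rule sw5'(1)[symmetric])
  also have "\<dots> = - (LINT z'|Q. Gw z' $ i * (LINT z|Q. (H z $ i * \<phi> (fst z)) * (?\<theta> (fst z - fst z') * ?\<kappa> (snd z - snd z'))))"
   unfolding in2 by simp
  also have "\<dots> = - (LINT z|Q. (H z $ i * \<phi> (fst z)) * QI.moll n (\<lambda>z. Gw z $ i) z)" unfolding sw5''(1) QI_moll ..
  finally show ?thesis .
 qed
 let ?a1 = "\<lambda>z'. (LINT z|Q. (u z * \<phi> (fst z)) * (deriv ?\<theta> (fst z - fst z') * ?\<kappa> (snd z - snd z')))"
 let ?a2 = "\<lambda>z'. (LINT z|Q. (u z * deriv \<phi> (fst z)) * (?\<theta> (fst z - fst z') * ?\<kappa> (snd z - snd z')))"
 let ?a3 = "\<lambda>z'. (LINT z|\<nu>. \<phi> (fst z) * (?\<theta> (fst z - fst z') * ?\<kappa> (snd z - snd z')))"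
 let ?a4 = "\<lambda>z'. (LINT x|X. (\<xi> x * \<phi> 0) * (?\<theta> (0 - fst z') * ?\<kappa> (x - snd z')))"
 let ?a5 = "\<lambda>i z'. (LINT z|Q. (U z * \<phi> (fst z)) * (?\<theta> (fst z - fst z') * ?DD i (snd z - snd z')))"
 have "- (w z' * ?a1 z') - w z' * ?a2 z' - w z' * ?a3 z' = w z' * ?a4 z' + (\<Sum>i\<in>UNIV. w z' * ?a5 i z')" for z'
 proof -
  have "w z' * (- ?a1 z' - ?a2 z' - ?a3 z') = w z' * (?a4 z' + (\<Sum>i\<in>UNIV. ?a5 i z'))"
   using tested_equation[OF \<phi>, of n "fst z'" "snd z'"] by (simp only:)
  then show ?thesis by (simp only: right_diff_distrib distrib_left sum_distrib_left mult_minus_right)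
 qed
 then have "(LINT z'|Q. - (w z' * ?a1 z') - w z' * ?a2 z' - w z' * ?a3 z') = (LINT z'|Q. w z' * ?a4 z' + (\<Sum>i\<in>UNIV. w z' * ?a5 i z'))" by simp
 moreover have "(LINT z'|Q. - (w z' * ?a1 z') - w z' * ?a2 z' - w z' * ?a3 z') = - (LINT z'|Q. w z' * ?a1 z') - (LINT z'|Q. w z' * ?a2 z') - (LINT z'|Q. w z' * ?a3 z')"
  using sw1(3) sw2(3) sw3(3) by simp
 moreover have "(LINT z'|Q. w z' * ?a4 z' + (\<Sum>i\<in>UNIV. w z' * ?a5 i z')) = (LINT z'|Q. w z' * ?a4 z') + (\<Sum>i\<in>UNIV. (LINT z'|Q. w z' * ?a5 i z'))"
  using sw4(3) sw5(3) by simp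
 ultimately have "- (LINT z'|Q. w z' * ?a1 z') - (LINT z'|Q. w z' * ?a2 z') - (LINT z'|Q. w z' * ?a3 z') = (LINT z'|Q. w z' * ?a4 z') + (\<Sum>i\<in>UNIV. (LINT z'|Q. w z' * ?a5 i z'))"
  by simp
 moreover have "(LINT z'|Q. w z' * ?a2 z') = (LINT z|Q. (u z * deriv \<phi> (fst z)) * QI.moll n w z)" unfolding sw2(1) QI_moll ..
 moreover have "(LINT z'|Q. w z' * ?a3 z') = (LINT z|\<nu>. \<phi> (fst z) * QI.moll n w z)" unfolding sw3(1) QI_moll ..
 moreover have "(LINT z'|Q. w z' * ?a4 z') = (LINT x|X. (\<xi> x * \<phi> 0) * QI.moll n w (0, x))" unfolding QI_moll using sw4(1) by simp
 ultimately show "- (LINT z|Q. (u z * \<phi> (fst z)) * QI.moll n wt z) - (LINT z|Q. (u z * deriv \<phi> (fst z)) * QI.moll n w z)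
   - (LINT z|\<nu>. \<phi> (fst z) * QI.moll n w z)
   = (LINT x|X. (\<xi> x * \<phi> 0) * QI.moll n w (0, x)) - (\<Sum>i\<in>UNIV. (LINT z|Q. (H z $ i * \<phi> (fst z)) * QI.moll n (\<lambda>z. Gw z $ i) z))"
  unfolding T1 T5 by (simp add: sum_negf)
qed

end

section \<open>Passage to the limit in the equation\<close>

lemma pw_lipschitz_on_bounded:
 assumes m: "m > 1" and ab: "abs a \<le> M" "abs b \<le> M"
 shows "\<bar>pw (m - 1) a - pw (m - 1) b\<bar> \<le> m * M powr (m - 1) * \<bar>a - b\<bar>"
proof -
 have "norm (pw (m - 1) a - pw (m - 1) b) \<le> (m * M powr (m - 1)) * norm (a - b)"
 proof (rule field_differentiable_bound[of "{- M..M}"])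
  show "(pw (m - 1) has_field_derivative (m * abs z powr (m - 1))) (at z within {- M..M})" for z
  proof (rule has_field_derivative_at_within)
   have "m - 1 > 0" "m - 1 + 1 = m" using m by simp_all
   then show "(pw (m - 1) has_field_derivative (m * abs z powr (m - 1))) (at z)" using pw_deriv[of "m - 1" z] by metis
  qed
  show "norm (m * abs z powr (m - 1)) \<le> m * M powr (m - 1)" if "z \<in> {- M..M}" for z
  proof -
   have "abs z powr (m - 1) \<le> M powr (m - 1)" using that m by (intro powr_mono2) auto
   moreover have "norm (m * abs z powr (m - 1)) = m * abs z powr (m - 1)" using m by (simp add: abs_mult)
   ultimately show ?thesis using m by simp
  qed
  show "convex {- M..M}" by (rule convex_real_interval)
  show "a \<in> {- M..M}" "b \<in> {- M..M}" using ab by (simp_all add: abs_le_iff)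
 qed
 then show ?thesis by (simp only: real_norm_def)
qed

text \<open>Quantitative continuity of \<open>v \<mapsto> |v|\<^sup>m\<^sup>-\<^sup>1 v\<close> from \<open>L\<^sub>m\<^sub>+\<^sub>1\<close> to \<open>L\<^sub>p\<close>: where the increment is small compared to \<open>b\<close> the local
 Lipschitz bound gives a small multiple of \<open>|b|\<^sup>m\<^sup>+\<^sup>1\<close>, and elsewhere the increment itself dominates.\<close>

lemma pw_power_continuity:
 fixes m e :: real
 assumes m: "m > 1" and e: "e > 0"
 obtains C where "C \<ge> 0" "\<And>a b. \<bar>pw (m - 1) a - pw (m - 1) b\<bar> powr ((m + 1) / m) \<le> e * abs b powr (m + 1) + C * \<bar>a - b\<bar> powr (m + 1)"
proof -
 define p where "p = (m + 1) / m"
 have p: "p > 0" "m * p = m + 1" using m by (auto simp: p_def)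
 obtain d0 :: real where d0: "d0 > 0" "d0 powr p * (m * 2 powr (m - 1)) powr p < e"
 proof (rule exists_small_powr[of p "(m * 2 powr (m - 1)) powr p" e])
  show "p > 0" "(m * 2 powr (m - 1)) powr p \<ge> 0" "e > 0" using p(1) e by simp_all
 qed (rule that; assumption)
 define d where "d = min d0 1"
 have d: "d > 0" "d \<le> 1" "d \<le> d0" using d0 by (auto simp: d_def)
 define k where "k = 1 + 1 / d"
 define C where "C = (2 * k powr m) powr p"
 show thesis
 proof (rule that[of C])
  show "C \<ge> 0" by (simp add: C_def)
  fix a b :: real
  have nn: "0 \<le> e * abs b powr (m + 1)" "0 \<le> C * \<bar>a - b\<bar> powr (m + 1)" using e by (auto simp: C_def)
  show "\<bar>pw (m - 1) a - pw (m - 1) b\<bar> powr ((m + 1) / m) \<le> e * abs b powr (m + 1) + C * \<bar>a - b\<bar> powr (m + 1)"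
  proof (cases "\<bar>a - b\<bar> \<le> d * abs b")
   case True
   have "d * abs b \<le> 1 * abs b" using d by (intro mult_right_mono) auto
   then have ab: "abs a \<le> 2 * abs b" using True by linarith
   have "\<bar>pw (m - 1) a - pw (m - 1) b\<bar> \<le> m * (2 * abs b) powr (m - 1) * \<bar>a - b\<bar>"
    by (rule pw_lipschitz_on_bounded[OF m ab]) simp
   also have "\<dots> \<le> m * (2 * abs b) powr (m - 1) * (d0 * abs b)"
    using m True d mult_right_mono[OF d(3), of "abs b"] by (intro mult_left_mono) auto
   also have "\<dots> = (m * 2 powr (m - 1)) * d0 * (abs b powr (m - 1) * abs b)" by (simp add: powr_mult)
   also have "abs b powr (m - 1) * abs b = abs b powr m" using powr_add[of "abs b" "m - 1" 1] by (cases "b = 0") auto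
   finally have "\<bar>pw (m - 1) a - pw (m - 1) b\<bar> powr p \<le> ((m * 2 powr (m - 1)) * d0 * abs b powr m) powr p"
    using p by (intro powr_mono2) auto
   also have "\<dots> = (d0 powr p * (m * 2 powr (m - 1)) powr p) * abs b powr (m + 1)"
    using m d0(1) by (simp only: powr_mult powr_powr p(2) mult.commute mult.left_commute mult.assoc)
   also have "\<dots> \<le> e * abs b powr (m + 1)" using d0(2) by (intro mult_right_mono) auto
   finally show ?thesis using nn(2) unfolding p_def by linarith
  next
   case False
   have k0: "0 \<le> k" using d by (simp add: k_def)
   have b: "abs b \<le> 1 / d * \<bar>a - b\<bar>" using d False by (simp add: field_simps)
   have kk: "k * \<bar>a - b\<bar> = \<bar>a - b\<bar> + 1 / d * \<bar>a - b\<bar>" by (simp only: k_def distrib_right mult_1)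
   have bb: "abs b \<le> k * \<bar>a - b\<bar>" unfolding kk using b abs_ge_zero[of "a - b"] by linarith
   have a: "abs a \<le> k * \<bar>a - b\<bar>" unfolding kk using b by linarith
   have "\<bar>pw (m - 1) a - pw (m - 1) b\<bar> \<le> abs a powr m + abs b powr m"
    using abs_triangle_ineq4[of "pw (m - 1) a" "pw (m - 1) b"] by (simp add: pw_abs)
   also have "\<dots> \<le> (k * \<bar>a - b\<bar>) powr m + (k * \<bar>a - b\<bar>) powr m" using a bb m by (intro add_mono powr_mono2) auto
   also have "\<dots> = (2 * k powr m) * \<bar>a - b\<bar> powr m" using k0 by (simp add: powr_mult)
   finally have "\<bar>pw (m - 1) a - pw (m - 1) b\<bar> powr p \<le> ((2 * k powr m) * \<bar>a - b\<bar> powr m) powr p"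
    using p by (intro powr_mono2) auto
   also have "\<dots> = (2 * k powr m) powr p * (\<bar>a - b\<bar> powr m) powr p" by (rule powr_mult)
   also have "\<dots> = C * \<bar>a - b\<bar> powr (m + 1)" unfolding C_def powr_powr p(2) ..
   finally show ?thesis using nn(1) unfolding p_def by linarith
  qed
 qed
qed

lemma abs_powr_self: "\<bar>abs x powr q\<bar> = abs x powr (q::real)" by simp

lemma powr_le_one_plus_sq: fixes x p :: real assumes "0 \<le> p" "p \<le> 2" shows "abs x powr p \<le> 1 + x\<^sup>2"
proof (cases "abs x \<le> 1")
 case True
 then have "abs x powr p \<le> 1" using assms by (intro powr_le1) auto
 then show ?thesis using zero_le_power2[of x] by linarith
next
 case False
 then have "abs x powr p \<le> abs x powr 2" using assms by (intro powr_mono) auto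
 then show ?thesis by simp
qed

context obstacle_test
begin

definition p where "p = (m + 1) / m"

lemma p_facts: "p > 1" "m + 1 > 1" "1 / p + 1 / (m + 1) = 1" "p \<le> 2" "m * p = m + 1"
proof -
 show "p > 1" "m + 1 > 1" "p \<le> 2" "m * p = m + 1" using m by (simp_all add: p_def field_simps)
 have "1 / p + 1 / (m + 1) = m / (m + 1) + 1 / (m + 1)" by (simp add: p_def)
 also have "\<dots> = (m + 1) / (m + 1)" by (simp only: add_divide_distrib)
 finally show "1 / p + 1 / (m + 1) = 1" using m by simp
qed

lemma w_Lp: "integrable Q (\<lambda>z. abs (w z) powr p)"
proof (rule B_integrable_bound[of _ "\<lambda>z. 1 + (w z)\<^sup>2"])
 show "integrable Q (\<lambda>z. 1 + (w z)\<^sup>2)" using w_L2 unfolding w_def[abs_def] by simp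
 show "AE z in Q. norm (abs (w z) powr p) \<le> norm (1 + (w z)\<^sup>2)"
  using powr_le_one_plus_sq[of p] p_facts by (intro AE_I2) (simp add: abs_of_nonneg add_nonneg_nonneg)
qed measurable

lemma time_test_powr_int:
 assumes \<phi>: "\<phi> \<in> time_tests T" and f: "f \<in> borel_measurable Q" "integrable Q (\<lambda>z. abs (f z) powr q)" and q: "0 \<le> q"
 shows "integrable Q (\<lambda>z. \<bar>f z * \<phi> (fst z)\<bar> powr q)" "integrable Q (\<lambda>z. \<bar>f z * deriv \<phi> (fst z)\<bar> powr q)"
  "(\<lambda>z. f z * \<phi> (fst z)) \<in> borel_measurable Q" "(\<lambda>z. f z * deriv \<phi> (fst z)) \<in> borel_measurable Q"
proof -
 obtain B where B: "B \<ge> 0" "\<And>t. t \<in> {0..T} \<Longrightarrow> \<bar>\<phi> t\<bar> \<le> B" "\<And>t. t \<in> {0..T} \<Longrightarrow> \<bar>deriv \<phi> t\<bar> \<le> B"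
  using time_test_bounded[OF \<phi> T0] by blast
 have m1: "(\<lambda>z. \<phi> (fst z)) \<in> borel_measurable Q" "(\<lambda>z. deriv \<phi> (fst z)) \<in> borel_measurable Q"
  using time_test_deriv_borel[OF \<phi>] by (auto intro: time_fun_meas)
 have *: "integrable Q (\<lambda>z. \<bar>f z * g z\<bar> powr q)" if gm: "g \<in> borel_measurable Q" and gB: "\<And>z. z \<in> space Q \<Longrightarrow> abs (g z) \<le> B" for g
 proof (rule B_integrable_bound[of _ "\<lambda>z. B powr q * abs (f z) powr q"])
  show "integrable Q (\<lambda>z. B powr q * abs (f z) powr q)" using f by simp
  show "(\<lambda>z. \<bar>f z * g z\<bar> powr q) \<in> borel_measurable Q" using gm f(1) by measurable
  show "AE z in Q. norm (\<bar>f z * g z\<bar> powr q) \<le> norm (B powr q * abs (f z) powr q)"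
  proof (rule AE_I2)
   fix z assume "z \<in> space Q"
   then have "abs (g z) powr q \<le> B powr q" using gB q by (intro powr_mono2) auto
   then show "norm (\<bar>f z * g z\<bar> powr q) \<le> norm (B powr q * abs (f z) powr q)"
    by (simp add: abs_mult powr_mult mult.commute[of "abs (f z) powr q"] mult_right_mono)
  qed
 qed
 show "integrable Q (\<lambda>z. \<bar>f z * \<phi> (fst z)\<bar> powr q)" using B by (intro * m1) auto
 show "integrable Q (\<lambda>z. \<bar>f z * deriv \<phi> (fst z)\<bar> powr q)" using B by (intro * m1) auto
 show "(\<lambda>z. f z * \<phi> (fst z)) \<in> borel_measurable Q" "(\<lambda>z. f z * deriv \<phi> (fst z)) \<in> borel_measurable Q"
  using m1 f(1) by (auto intro: borel_measurable_times)
qed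

lemma QI_pairing:
 assumes "p' > 1" "q > 1" "1/p' + 1/q = 1" "f \<in> borel_measurable Q" "g \<in> borel_measurable Q"
  "integrable Q (\<lambda>z. abs (f z) powr p')" "integrable Q (\<lambda>z. abs (g z) powr q)"
 shows "(\<lambda>n. (LINT z|Q. g z * QI.moll n f z)) \<longlonglongrightarrow> (LINT z|Q. g z * f z)"
 using QI.moll_pairing[of p' q f g] assms unfolding QI_M by blast

lemma pairing_limits:
 assumes \<phi>: "\<phi> \<in> time_tests T"
 shows "(\<lambda>n. (LINT z|Q. (u z * \<phi> (fst z)) * QI.moll n wt z)) \<longlonglongrightarrow> (LINT z|Q. (u z * \<phi> (fst z)) * wt z)"
  "(\<lambda>n. (LINT z|Q. (u z * deriv \<phi> (fst z)) * QI.moll n w z)) \<longlonglongrightarrow> (LINT z|Q. (u z * deriv \<phi> (fst z)) * w z)"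
  "(\<lambda>n. (LINT z|Q. (H z $ i * \<phi> (fst z)) * QI.moll n (\<lambda>z. Gw z $ i) z)) \<longlonglongrightarrow> (LINT z|Q. (H z $ i * \<phi> (fst z)) * Gw z $ i)"
proof -
 have m0: "0 \<le> m + 1" using m by simp
 note uu = time_test_powr_int[OF \<phi> u_meas u_int m0]
 show "(\<lambda>n. (LINT z|Q. (u z * \<phi> (fst z)) * QI.moll n wt z)) \<longlonglongrightarrow> (LINT z|Q. (u z * \<phi> (fst z)) * wt z)"
  by (rule QI_pairing[OF p_facts(1,2,3) wt_meas uu(3) wt_Lp[folded p_def] uu(1)])
 show "(\<lambda>n. (LINT z|Q. (u z * deriv \<phi> (fst z)) * QI.moll n w z)) \<longlonglongrightarrow> (LINT z|Q. (u z * deriv \<phi> (fst z)) * w z)"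
  by (rule QI_pairing[OF p_facts(1,2,3) w_meas uu(4) w_Lp uu(2)])
 have comp: "integrable Q (\<lambda>z. \<bar>F z $ i\<bar> powr 2)" "(\<lambda>z. F z $ i) \<in> borel_measurable Q"
  if F: "F \<in> borel_measurable Q" "integrable Q (\<lambda>z. (norm (F z))\<^sup>2)" for F :: "real \<times> (real ^ 'd) \<Rightarrow> real ^ 'd"
 proof -
  show fm: "(\<lambda>z. F z $ i) \<in> borel_measurable Q" using integrable_vec_nth[OF L2_vec_int[OF F]] by (rule borel_measurable_integrable)
  show "integrable Q (\<lambda>z. \<bar>F z $ i\<bar> powr 2)"
  proof (rule B_integrable_bound[OF F(2)])
   show "(\<lambda>z. \<bar>F z $ i\<bar> powr 2) \<in> borel_measurable Q" using fm by measurable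
   show "AE z in Q. norm (\<bar>F z $ i\<bar> powr 2) \<le> norm ((norm (F z))\<^sup>2)"
   proof (rule AE_I2)
    fix z
    have "\<bar>F z $ i\<bar>\<^sup>2 \<le> (norm (F z))\<^sup>2" using component_le_norm_cart[of "F z" i] by (intro power_mono) auto
    then show "norm (\<bar>F z $ i\<bar> powr 2) \<le> norm ((norm (F z))\<^sup>2)" by simp
   qed
  qed
 qed
 note Hc = comp[OF H_meas H2] note Gc = comp[OF Gw_meas Gw_L2]
 have two: "(0::real) \<le> 2" by simp
 note HH = time_test_powr_int[OF \<phi> Hc(2) Hc(1) two]
 have t: "(2::real) > 1" "1 / 2 + 1 / (2::real) = 1" by auto
 show "(\<lambda>n. (LINT z|Q. (H z $ i * \<phi> (fst z)) * QI.moll n (\<lambda>z. Gw z $ i) z)) \<longlonglongrightarrow> (LINT z|Q. (H z $ i * \<phi> (fst z)) * Gw z $ i)"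
  by (rule QI_pairing[OF t(1) t(1) t(2) Gc(2) HH(3) Gc(1) HH(1)])
qed

lemma v_slice: assumes "t \<in> {0..T}" shows "(\<lambda>x. v (t, x)) \<in> borel_measurable X" "integrable X (\<lambda>x. abs (v (t, x)) powr (m + 1))"
 using v assms unfolding C_Lp_def Lp_def by auto

lemma w_slice:
 assumes t: "t \<in> {0..T}"
 shows "(\<lambda>x. w (t, x)) \<in> borel_measurable X" "integrable X (\<lambda>x. abs (w (t, x)) powr p)" "integrable X (\<lambda>x. w (t, x))"
proof -
 have [measurable]: "(\<lambda>x. v (t, x)) \<in> borel_measurable X" by (rule v_slice(1)[OF t])
 show wm: "(\<lambda>x. w (t, x)) \<in> borel_measurable X" unfolding w_def by measurable
 have "abs (w (t, x)) powr p = abs (v (t, x)) powr (m + 1)" for x unfolding w_def pw_abs powr_powr using p_facts(5) by simp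
 then show wi: "integrable X (\<lambda>x. abs (w (t, x)) powr p)" using v_slice(2)[OF t] by simp
 show "integrable X (\<lambda>x. w (t, x))" using p_facts by (intro torus.integrable_powr_imp_integrable[OF wm _ wi]) auto
qed

end

section \<open>Averages near a point and the initial trace\<close>

text \<open>Convergence holds at every point, including the boundary of the cell, because the integral is taken over the
 cell centred at \<open>x\<close>; this matters for a measure that may charge the boundary.\<close>

lemma tmoll_pointwise:
 fixes f :: "real ^ 'd \<Rightarrow> real"
 assumes cont: "continuous_on UNIV f" and per: "periodic f"
 shows "(\<lambda>n. tmoll n f x) \<longlonglongrightarrow> f x"
proof (rule LIMSEQ_I)
 fix r :: real assume r: "r > 0"
 obtain C0 where C0: "\<And>x. abs (f x) \<le> C0" using periodic_continuous_bounded_ex[OF cont per] by blast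
 define C where "C = max C0 1"
 have C: "C > 0" "abs (f y) \<le> C" for y using C0[of y] by (auto simp: C_def)
 have fm [measurable]: "f \<in> borel_measurable borel" using cont by (rule borel_measurable_continuous_onI)
 have "isCont f x" using cont by (simp add: continuous_on_eq_continuous_at)
 then obtain d where d: "d > 0" "\<And>y. dist y x < d \<Longrightarrow> dist (f y) (f x) < r / 2"
  using r unfolding continuous_at_eps_delta by (meson half_gt_zero)
 have "eventually (\<lambda>n. (LINT z|(lborel :: (real ^ 'd) measure). indicator (ccell - ball 0 d) z * kappa n z) < r / (4 * C)) sequentially"
  using C r by (intro order_tendstoD(2)[OF kappa_tail_tendsto[OF d(1)]]) simp
 then obtain N where N: "\<And>n. n \<ge> N \<Longrightarrow> (LINT z|(lborel :: (real ^ 'd) measure). indicator (ccell - ball 0 d) z * kappa n z) < r / (4 * C)"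
  unfolding eventually_sequentially by blast
 have "norm (tmoll n f x - f x) < r" if n: "n \<ge> N" for n
 proof -
  let ?t = "\<lambda>z::real ^ 'd. indicator (ccell - ball 0 d) z * kappa n z"
  obtain B where B: "\<And>x :: real ^ 'd. abs (kappa n x) \<le> B" using kappa_bounded by blast
  have B0: "0 \<le> B" using B[of 0] by linarith
  have cc: "(ccell :: (real ^ 'd) set) \<in> sets borel" by simp
  have shift: "tmoll n f x = (LINT z|lborel. indicator ccell z * (kappa n z * f (x + z)))"
   unfolding tmoll_def by (rule kappa_shift_integral[OF fm per C(2)])
  have fs: "(\<lambda>z. f (x + z)) \<in> borel_measurable borel" by measurable
  have i1: "integrable lborel (\<lambda>z. indicator ccell z * (kappa n z * f (x + z)))"
   by (rule ccell_integrable[OF cc _ subset_refl, where C="B * C"]) (use B B0 C in \<open>auto simp: abs_mult intro!: mult_mono\<close>)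
  have i2: "integrable lborel (\<lambda>z::real ^ 'd. indicator ccell z * kappa n z)" by (rule ccell_integrable[OF cc _ subset_refl B]) simp
  have i3: "integrable lborel ?t" by (rule ccell_integrable[OF _ _ _ B]) auto
  have one: "(LINT z|(lborel :: (real ^ 'd) measure). indicator ccell z * kappa n z) = 1" by (rule kappa_row)
  have "tmoll n f x - f x = (LINT z|lborel. indicator ccell z * (kappa n z * f (x + z))) - (LINT z|(lborel :: (real ^ 'd) measure). f x * (indicator ccell z * kappa n z))"
   unfolding shift integral_mult_right_zero by (subst one) simp
  also have "\<dots> = (LINT z|lborel. indicator ccell z * (kappa n z * f (x + z)) - f x * (indicator ccell z * kappa n z))"
   using i1 i2 by (intro B_integral_diff[symmetric]) simp_all
  finally have "norm (tmoll n f x - f x) \<le> (LINT z|lborel. norm (indicator ccell z * (kappa n z * f (x + z)) - f x * (indicator ccell z * kappa n z)))"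
   by (simp only: integral_norm_bound)
  also have "\<dots> \<le> (LINT z|lborel. r / 2 * (indicator ccell z * kappa n z) + 2 * C * ?t z)"
  proof (rule integral_mono)
   fix z :: "real ^ 'd"
   have k: "0 \<le> kappa n z" by (rule kappa_nonneg)
   show "norm (indicator ccell z * (kappa n z * f (x + z)) - f x * (indicator ccell z * kappa n z)) \<le> r / 2 * (indicator ccell z * kappa n z) + 2 * C * ?t z"
   proof (cases "z \<in> ccell")
    case True
    have e: "norm (kappa n z * f (x + z) - f x * kappa n z) = \<bar>f (x + z) - f x\<bar> * kappa n z"
     using k by (simp only: real_norm_def mult.commute[of "kappa n z"] left_diff_distrib[symmetric] abs_mult abs_of_nonneg)
    show ?thesis
    proof (cases "z \<in> ball 0 d")
     case ball: True
     then have "\<bar>f (x + z) - f x\<bar> \<le> r / 2" using d(2)[of "x + z"] by (simp add: dist_norm)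
     then show ?thesis using True ball e mult_right_mono[OF _ k, of "\<bar>f (x + z) - f x\<bar>" "r / 2"] by simp
    next
     case False
     have "\<bar>f (x + z) - f x\<bar> \<le> 2 * C" using C(2)[of "x + z"] C(2)[of x] by linarith
     moreover have "0 \<le> r / 2 * kappa n z" using r k by simp
     ultimately show ?thesis using True False e mult_right_mono[OF _ k, of "\<bar>f (x + z) - f x\<bar>" "2 * C"] by simp
    qed
   qed simp
  qed (use i1 i2 i3 in \<open>auto intro!: B_integrable_diff B_integrable_add integrable_mult_right\<close>)
  also have "\<dots> = r / 2 + 2 * C * (LINT z|(lborel :: (real ^ 'd) measure). ?t z)"
   using i2 i3 one by (subst B_integral_add) simp_all
  also have "\<dots> < r / 2 + 2 * C * (r / (4 * C))" using N[OF n] C(1) by (intro add_strict_left_mono mult_strict_left_mono) auto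
  also have "\<dots> = r" using C(1) by (simp add: field_simps)
  finally show ?thesis .
 qed
 then show "\<exists>no. \<forall>n\<ge>no. norm (tmoll n f x - f x) < r" by blast
qed

context obstacle
begin

lemma forward_mass:
 assumes a: "0 \<le> a" "a + 2 / real (Suc n) \<le> T" shows "(LINT s|TM T. theta n (a - s)) = 1"
proof -
 have "(LINT s|TM T. theta n (a - s)) = (LINT s|lborel. indicator {0..<T} s *\<^sub>R theta n (a - s))" by (rule integral_restrict_space) simp
 also have "\<dots> = (LINT s|lborel. theta n (a + (- 1) * s))"
 proof (rule B_integral_cong[OF refl])
  fix s
  have "0 < 1 / real (Suc n)" by simp
  then have "theta n (a - s) = 0" if "s \<notin> {0..<T}"
   using that a by (intro theta_zero) (auto simp del: of_nat_Suc simp: minus_divide_left[symmetric])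
  then show "indicator {0..<T} s *\<^sub>R theta n (a - s) = theta n (a + (- 1) * s)" by (auto simp: indicator_def)
 qed
 also have "\<dots> = 1" using lborel_integral_real_affine[of "-1" "theta n" a] by (simp add: integral_theta)
 finally show ?thesis .
qed

text \<open>The kernel at \<open>a\<close> sees only the times directly after \<open>a\<close> and has full mass.\<close>

lemma forward_average:
 assumes a: "0 \<le> a" "a + 2 / real (Suc n) \<le> T"
  and f: "integrable (TM T) (\<lambda>s. theta n (a - s) * f s)"
  and e: "\<And>s. \<lbrakk>0 \<le> s; s < T; a < s; s < a + 2 / real (Suc n)\<rbrakk> \<Longrightarrow> \<bar>f s - c\<bar> \<le> e"
 shows "\<bar>(LINT s|TM T. theta n (a - s) * f s) - c\<bar> \<le> e"
proof -
 have aS: "a \<in> {0..<T}"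
 proof -
  have "0 < 2 / real (Suc n)" by simp
  then have "a < a + 2 / real (Suc n)" by (simp only: less_add_same_cancel1)
  then have "a < T" using a(2) by (rule less_le_trans)
  then show ?thesis using a(1) by (simp only: atLeastLessThan_iff)
 qed
 have i: "integrable (TM T) (\<lambda>s. theta n (a - s))" by (rule TI.k_row_int[OF aS])
 have "(LINT s|TM T. theta n (a - s) * f s) - c = (LINT s|TM T. theta n (a - s) * f s) - (LINT s|TM T. theta n (a - s) * c)"
  unfolding integral_mult_left_zero forward_mass[OF a] by simp
 also have "\<dots> = (LINT s|TM T. theta n (a - s) * f s - theta n (a - s) * c)"
  using i f by (intro B_integral_diff[symmetric]) simp_all
 finally have "\<bar>(LINT s|TM T. theta n (a - s) * f s) - c\<bar> \<le> (LINT s|TM T. \<bar>theta n (a - s) * f s - theta n (a - s) * c\<bar>)"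
  by (simp only: integral_abs_bound)
 also have "\<dots> \<le> (LINT s|TM T. theta n (a - s) * e)"
 proof (rule integral_mono)
  fix s assume "s \<in> space (TM T)"
  then have s: "0 \<le> s" "s < T" by (auto simp: space_restrict_space)
  show "\<bar>theta n (a - s) * f s - theta n (a - s) * c\<bar> \<le> theta n (a - s) * e"
  proof (cases "a < s \<and> s < a + 2 / real (Suc n)")
   case True
   then have "\<bar>f s - c\<bar> \<le> e" using s by (intro e) auto
   then have "theta n (a - s) * \<bar>f s - c\<bar> \<le> theta n (a - s) * e" by (intro mult_left_mono theta_nonneg)
   then show ?thesis using theta_nonneg[of n "a - s"] by (simp only: right_diff_distrib[symmetric] abs_mult abs_of_nonneg)
  next
   case False
   have "0 < 1 / real (Suc n)" by simp
   then have "theta n (a - s) = 0" using False by (intro theta_zero) (auto simp del: of_nat_Suc simp: minus_divide_left[symmetric])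
   then show ?thesis by simp
  qed
 qed (use i f in auto)
 also have "\<dots> = e" unfolding integral_mult_left_zero forward_mass[OF a] by simp
 finally show ?thesis .
qed

lemma eventually_small_window: assumes "a < b" shows "eventually (\<lambda>n. a + 2 / real (Suc n) < b) sequentially"
proof -
 have "(\<lambda>n. 2 / real (Suc n)) \<longlonglongrightarrow> 0" by (rule LIMSEQ_Suc) (rule lim_const_over_n)
 then have "eventually (\<lambda>n. 2 / real (Suc n) < b - a) sequentially" using assms by (intro order_tendstoD) auto
 then show ?thesis by eventually_elim linarith
qed

end

context obstacle_test
begin

lemma w_initial_continuity:
 assumes e: "e > 0"
 obtains d where "d > 0" "\<And>s. \<lbrakk>s \<in> {0..T}; s < d\<rbrakk> \<Longrightarrow> integrable X (\<lambda>x. \<bar>w (s, x) - w (0, x)\<bar> powr p) \<and> (LINT x|X. \<bar>w (s, x) - w (0, x)\<bar> powr p) < e"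
proof -
 have z: "0 \<in> {0..T}" using T by simp
 define A where "A = (LINT x|X. abs (v (0, x)) powr (m + 1))"
 have A0: "0 \<le> A" unfolding A_def by simp
 define e' where "e' = e / (2 * (A + 1))"
 have e': "e' > 0" "e' * A \<le> e / 2"
 proof -
  show "e' > 0" using e A0 by (simp add: e'_def)
  have "e' * A = e / 2 * (A / (A + 1))" using A0 by (simp add: e'_def)
  also have "\<dots> \<le> e / 2 * 1" using A0 e by (intro mult_left_mono) auto
  finally show "e' * A \<le> e / 2" by simp
 qed
 obtain C where C: "C \<ge> 0" "\<And>a b. \<bar>pw (m - 1) a - pw (m - 1) b\<bar> powr ((m + 1) / m) \<le> e' * abs b powr (m + 1) + C * \<bar>a - b\<bar> powr (m + 1)"
  by (rule pw_power_continuity[OF m e'(1)]) (rule that; assumption)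
 define r where "r = (e / (2 * (C + 1))) powr (1 / (m + 1))"
 have r: "r > 0" "C * r powr (m + 1) < e / 2"
 proof -
  show "r > 0" using e C by (simp add: r_def)
  have "C * r powr (m + 1) = e / 2 * (C / (C + 1))" using e C m by (simp add: r_def powr_powr)
  also have "\<dots> < e / 2 * 1" using e C by (intro mult_strict_left_mono) auto
  finally show "C * r powr (m + 1) < e / 2" by simp
 qed
 define I where "I s = (LINT x|X. \<bar>v (s, x) - v (0, x)\<bar> powr (m + 1))" for s
 have "((\<lambda>s. Lp_norm (m + 1) X (\<lambda>x. v (s, x) - v (0, x))) \<longlongrightarrow> 0) (at 0 within {0..T})"
  using v z unfolding C_Lp_def mem_Collect_eq by (elim conjE bspec)
 then have "eventually (\<lambda>s. Lp_norm (m + 1) X (\<lambda>x. v (s, x) - v (0, x)) < r) (at 0 within {0..T})" using r(1) by (rule order_tendstoD)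
 then obtain d where dd: "d > 0 \<and> (\<forall>s\<in>{0..T}. s \<noteq> 0 \<and> dist s 0 < d \<longrightarrow> Lp_norm (m + 1) X (\<lambda>x. v (s, x) - v (0, x)) < r)"
  unfolding eventually_at ..
 have d1: "d > 0" using dd by (rule conjunct1)
 have d2: "Lp_norm (m + 1) X (\<lambda>x. v (s, x) - v (0, x)) < r" if "s \<in> {0..T}" "s \<noteq> 0" "dist s 0 < d" for s
  using bspec[OF conjunct2[OF dd] that(1)] that(2,3) by (elim mp) (rule conjI)
 have I: "I s \<le> r powr (m + 1)" if s: "s \<in> {0..T}" "s < d" for s
 proof (cases "s = 0")
  case True then show ?thesis by (simp add: I_def)
 next
  case False
  have "Lp_norm (m + 1) X (\<lambda>x. v (s, x) - v (0, x)) < r" using s False by (intro d2) (simp_all add: dist_real_def)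
  then have "I s powr (1 / (m + 1)) < r" by (simp add: Lp_norm_def I_def)
  then have "(I s powr (1 / (m + 1))) powr (m + 1) \<le> r powr (m + 1)" using m by (intro powr_mono2) auto
  moreover have "0 \<le> I s" unfolding I_def by simp
  ultimately show ?thesis using m by (simp add: powr_powr)
 qed
 show thesis
 proof (rule that[OF d1])
  fix s assume s: "s \<in> {0..T}" "s < d"
  have [measurable]: "(\<lambda>x. v (s, x)) \<in> borel_measurable X" "(\<lambda>x. v (0, x)) \<in> borel_measurable X"
   "(\<lambda>x. w (s, x)) \<in> borel_measurable X" "(\<lambda>x. w (0, x)) \<in> borel_measurable X"
   using v_slice(1)[OF s(1)] v_slice(1)[OF z] w_slice(1)[OF s(1)] w_slice(1)[OF z] by auto
  have b: "\<bar>w (s, x) - w (0, x)\<bar> powr p \<le> e' * abs (v (0, x)) powr (m + 1) + C * \<bar>v (s, x) - v (0, x)\<bar> powr (m + 1)" for x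
   using C(2)[of "v (s, x)" "v (0, x)"] unfolding w_def p_def .
  have vd: "integrable X (\<lambda>x. \<bar>v (s, x) - v (0, x)\<bar> powr (m + 1))"
  proof (rule B_integrable_bound[of _ "\<lambda>x. 2 powr (m + 1) * (abs (v (s, x)) powr (m + 1) + abs (v (0, x)) powr (m + 1))"])
   show "integrable X (\<lambda>x. 2 powr (m + 1) * (abs (v (s, x)) powr (m + 1) + abs (v (0, x)) powr (m + 1)))"
    using v_slice(2)[OF s(1)] v_slice(2)[OF z] by simp
   have two: "\<bar>a - b\<bar> powr (m + 1) \<le> 2 powr (m + 1) * (abs a powr (m + 1) + abs b powr (m + 1))" for a b :: real
   proof -
    have "\<bar>a - b\<bar> powr (m + 1) \<le> (2 * max \<bar>a\<bar> \<bar>b\<bar>) powr (m + 1)" using m by (intro powr_mono2) auto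
    also have "\<dots> = 2 powr (m + 1) * max \<bar>a\<bar> \<bar>b\<bar> powr (m + 1)" by (simp add: powr_mult)
    also have "\<dots> \<le> 2 powr (m + 1) * (abs a powr (m + 1) + abs b powr (m + 1))"
     by (intro mult_left_mono) (simp_all add: max_def)
    finally show ?thesis .
   qed
   show "AE x in X. norm (\<bar>v (s, x) - v (0, x)\<bar> powr (m + 1)) \<le> norm (2 powr (m + 1) * (abs (v (s, x)) powr (m + 1) + abs (v (0, x)) powr (m + 1)))"
   proof (rule AE_I2)
    fix x
    show "norm (\<bar>v (s, x) - v (0, x)\<bar> powr (m + 1)) \<le> norm (2 powr (m + 1) * (abs (v (s, x)) powr (m + 1) + abs (v (0, x)) powr (m + 1)))"
     using order_trans[OF two[of "v (s, x)" "v (0, x)"] abs_ge_self] by (simp only: real_norm_def abs_powr_self)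
   qed
  qed measurable
  have dom: "integrable X (\<lambda>x. e' * abs (v (0, x)) powr (m + 1) + C * \<bar>v (s, x) - v (0, x)\<bar> powr (m + 1))"
   using vd v_slice(2)[OF z] by simp
  have wi: "integrable X (\<lambda>x. \<bar>w (s, x) - w (0, x)\<bar> powr p)"
  proof (rule B_integrable_bound[OF dom])
   show "AE x in X. norm (\<bar>w (s, x) - w (0, x)\<bar> powr p) \<le> norm (e' * abs (v (0, x)) powr (m + 1) + C * \<bar>v (s, x) - v (0, x)\<bar> powr (m + 1))"
    using order_trans[OF b abs_ge_self] by (intro AE_I2) (simp only: real_norm_def abs_powr_self)
  qed measurable
  have "(LINT x|X. \<bar>w (s, x) - w (0, x)\<bar> powr p) \<le> (LINT x|X. e' * abs (v (0, x)) powr (m + 1) + C * \<bar>v (s, x) - v (0, x)\<bar> powr (m + 1))"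
   using wi dom b by (rule integral_mono)
  also have "\<dots> = e' * A + C * I s" using vd v_slice(2)[OF z] by (simp add: A_def I_def)
  also have "\<dots> \<le> e / 2 + C * r powr (m + 1)" using e' C I[OF s] by (intro add_mono mult_left_mono) auto
  also have "\<dots> < e" using r by simp
  finally show "integrable X (\<lambda>x. \<bar>w (s, x) - w (0, x)\<bar> powr p) \<and> (LINT x|X. \<bar>w (s, x) - w (0, x)\<bar> powr p) < e"
   using wi by simp
 qed
qed

text \<open>By Fubini the integral is a forward average at time zero of pairings of \<open>\<xi>\<close> with spatial mollifications of \<open>w(s)\<close>. By the Young
 bound these are close to the pairing at time zero, uniformly in the spatial kernel.\<close>

lemma initial_limit:
 assumes \<phi>: "\<phi> \<in> time_tests T" "\<And>t. t \<in> {0..<T} \<Longrightarrow> 0 \<le> \<phi> t" and s0: "\<And>t. t \<ge> s0 \<Longrightarrow> \<phi> t = 0" "s0 < T"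
 shows "(\<lambda>n. (LINT x|X. (\<xi> x * \<phi> 0) * QI.moll n w (0, x))) \<longlonglongrightarrow> (LINT x|X. (\<xi> x * \<phi> 0) * w (0, x))"
proof -
 define h where "h x = \<xi> x * \<phi> 0" for x
 have h_meas: "h \<in> borel_measurable X" unfolding h_def[abs_def] by measurable
 have h_q: "integrable X (\<lambda>x. abs (h x) powr (m + 1))" using xi_int by (simp add: h_def abs_mult powr_mult)
 have h1: "integrable X h" using m by (intro torus.integrable_powr_imp_integrable[OF h_meas _ h_q]) simp
 define P where "P n s = (LINT x|X. h x * K.moll n (\<lambda>y. w (s, y)) x)" for n s
 define J where "J n = (LINT x|X. h x * QI.moll n w (0, x))" for n
 have z: "0 \<in> {0..T}" using T by simp
 have P0: "(\<lambda>n. P n 0) \<longlonglongrightarrow> (LINT x|X. h x * w (0, x))" unfolding P_def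
  by (rule K.moll_pairing[unfolded torus_fold, OF p_facts(1,2,3) w_slice(1)[OF z] h_meas w_slice(2)[OF z] h_q])
 have ev1: "eventually (\<lambda>n. s0 + 2 / real (Suc n) < T) sequentially" by (rule eventually_small_window[OF s0(2)])
 have ev2: "eventually (\<lambda>n. 0 + 2 / real (Suc n) < T) sequentially" by (rule eventually_small_window[OF T])
 have J_avg: "J n = (LINT s|TM T. theta n (0 - s) * P n s) \<and> integrable (TM T) (\<lambda>s. theta n (0 - s) * P n s)"
  if n: "s0 + 2 / real (Suc n) < T" for n
 proof -
  have n': "2 / real (Suc n) < T - s0" using n by linarith
  note me = moll_equation(3,4)[OF \<phi> s0(1) n']
  let ?f = "\<lambda>z'. w z' * (LINT x|X. (\<xi> x * \<phi> 0) * (theta n (0 - fst z') * kappa n (x - snd z')))"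
  have sl: "(LINT y|X. ?f (s, y)) = theta n (0 - s) * P n s" if s: "s \<in> {0..<T}" for s
  proof -
   have s': "s \<in> {0..T}" using s by simp
   have "?f (s, y) = theta n (0 - s) * (w (s, y) * (LINT x|X. h x * kappa n (x - y)))" for y
   proof -
    have "(LINT x|X. (\<xi> x * \<phi> 0) * (theta n (0 - s) * kappa n (x - y))) = theta n (0 - s) * (LINT x|X. h x * kappa n (x - y))"
     unfolding h_def by (subst integral_mult_right_zero[symmetric]) (rule B_integral_cong[OF refl], simp only: mult.left_commute)
    then show ?thesis by (simp only: fst_conv snd_conv mult.left_commute)
   qed
   then have "(LINT y|X. ?f (s, y)) = theta n (0 - s) * (LINT y|X. w (s, y) * (LINT x|X. h x * kappa n (x - y)))"
    by (simp only: integral_mult_right_zero)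
   also have "(LINT y|X. w (s, y) * (LINT x|X. h x * kappa n (x - y))) = P n s"
    unfolding P_def by (rule K.moll_swap[unfolded torus_fold, OF w_slice(3)[OF s'] h1, symmetric])
   finally show ?thesis .
  qed
  have J1: "J n = (LINT z'|Q. ?f z')" unfolding J_def h_def by (rule me(1))
  have J2: "(LINT z'|Q. ?f z') = (LINT s|TM T. (LINT y|X. ?f (s, y)))" using QP.integral_fst'[OF me(2)[unfolded Qpair]] unfolding Qpair by (rule sym)
  have J3: "(LINT s|TM T. (LINT y|X. ?f (s, y))) = (LINT s|TM T. theta n (0 - s) * P n s)"
   by (rule B_integral_cong[OF refl], rule sl) (simp add: space_restrict_space)
  have i: "integrable (TM T) (\<lambda>s. (LINT y|X. ?f (s, y)))" by (rule QP.integrable_fst'[OF me(2)[unfolded Qpair]])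
  have "integrable (TM T) (\<lambda>s. theta n (0 - s) * P n s)"
   by (rule B_integrable_cong[THEN iffD1, OF refl _ i], rule sl) (simp add: space_restrict_space)
  then show ?thesis using J1 J2 J3 by simp
 qed
 have close: "eventually (\<lambda>n. \<bar>J n - P n 0\<bar> \<le> r) sequentially" if r: "r > 0" for r
 proof -
  define A where "A = (LINT x|X. abs (h x) powr (m + 1))"
  have A0: "0 \<le> A" unfolding A_def by simp
  obtain c where c: "c > 0" "c powr (m + 1) * A < r / 2"
  proof (rule exists_small_powr[of "m + 1" A "r / 2"])
   show "m + 1 > 0" "A \<ge> 0" "r / 2 > 0" using m A0 r by simp_all
  qed (rule that; assumption)
  \<comment> \<open>The fixed \<open>L\<^sub>m\<^sub>+\<^sub>1\<close> part gets a small factor, the \<open>L\<^sub>p\<close> part a large one; the latter part is small near time zero.\<close>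
  define b where "b = 1 / c"
  have b0: "b > 0" using c by (simp add: b_def)
  have bA: "b powr (- (m + 1)) = c powr (m + 1)"
   using c(1) unfolding b_def by (simp add: powr_minus powr_divide inverse_eq_divide del: minus_add_distrib)
  have eb: "r / (2 * b powr p) > 0" using r b0 by simp
  obtain d where d: "d > 0" "\<And>s. \<lbrakk>s \<in> {0..T}; s < d\<rbrakk> \<Longrightarrow> integrable X (\<lambda>x. \<bar>w (s, x) - w (0, x)\<bar> powr p) \<and> (LINT x|X. \<bar>w (s, x) - w (0, x)\<bar> powr p) < r / (2 * b powr p)"
   by (rule w_initial_continuity[OF eb]) (rule that; assumption)
  have Pc: "\<bar>P n s - P n 0\<bar> \<le> r" if s: "s \<in> {0..T}" "s < d" for n s
  proof -
   let ?D = "\<lambda>x. w (s, x) - w (0, x)"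
   have D1: "integrable X ?D" using w_slice(3)[OF s(1)] w_slice(3)[OF z] by simp
   have Dp: "integrable X (\<lambda>x. \<bar>?D x\<bar> powr p)" using d(2)[OF s] by (rule conjunct1)
   have i: "integrable X (\<lambda>x. h x * K.moll n (\<lambda>y. w (t, y)) x)" if "t \<in> {0..T}" for t
    by (rule K.moll_mult_int[unfolded torus_fold, OF w_slice(3)[OF that] h1])
   have "P n s - P n 0 = (LINT x|X. h x * K.moll n (\<lambda>y. w (s, y)) x - h x * K.moll n (\<lambda>y. w (0, y)) x)"
    unfolding P_def by (rule B_integral_diff[symmetric, OF i[OF s(1)] i[OF z]])
   also have "\<dots> = (LINT x|X. h x * K.moll n ?D x)"
   proof (rule B_integral_cong[OF refl])
    fix x :: "real ^ 'd" assume "x \<in> space X"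
    then have x: "x \<in> cell" by (simp add: torus_measure_def space_restrict_space)
    show "h x * K.moll n (\<lambda>y. w (s, y)) x - h x * K.moll n (\<lambda>y. w (0, y)) x = h x * K.moll n ?D x"
     unfolding K.moll_diff[unfolded torus_fold, OF w_slice(3)[OF s(1)] w_slice(3)[OF z] x] by (simp only: right_diff_distrib)
   qed
   also have "\<bar>\<dots>\<bar> \<le> (LINT x|X. \<bar>h x * K.moll n ?D x\<bar>)" by (rule integral_abs_bound)
   also have "\<dots> \<le> b powr (- (m + 1)) * (LINT x|X. abs (h x) powr (m + 1)) + b powr p * (LINT x|X. \<bar>?D x\<bar> powr p)"
    by (rule K.pairing_young[unfolded torus_fold, OF p_facts(1,2,3) b0 D1 Dp h1 h_q])
   also have "\<dots> \<le> r / 2 + b powr p * (r / (2 * b powr p))"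
    unfolding bA A_def[symmetric] using c(2) conjunct2[OF d(2)[OF s]] by (intro add_mono mult_left_mono) simp_all
   also have "\<dots> = r" using b0 by simp
   finally show ?thesis .
  qed
  have "eventually (\<lambda>n. 0 + 2 / real (Suc n) < d) sequentially" by (rule eventually_small_window[OF d(1)])
  with ev1 ev2 show ?thesis
  proof eventually_elim
   case (elim n)
   note Jn = J_avg[OF elim(1)]
   have "\<bar>(LINT s|TM T. theta n (0 - s) * P n s) - P n 0\<bar> \<le> r"
   proof (rule forward_average)
    show "0 + 2 / real (Suc n) \<le> T" using elim(2) by (rule less_imp_le)
    show "integrable (TM T) (\<lambda>s. theta n (0 - s) * P n s)" using Jn by (rule conjunct2)
    fix s assume s: "0 \<le> s" "s < T" "s < 0 + 2 / real (Suc n)"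
    have "s \<in> {0..T}" using s by simp
    moreover have "s < d" using s(3) elim(3) by linarith
    ultimately show "\<bar>P n s - P n 0\<bar> \<le> r" by (rule Pc)
   qed simp
   then show ?case using Jn by simp
  qed
 qed
 have "(\<lambda>n. J n - P n 0) \<longlonglongrightarrow> 0"
 proof (rule tendstoI)
  fix e :: real assume "e > 0"
  then have "e / 2 > 0" by simp
  from close[OF this] show "eventually (\<lambda>n. dist (J n - P n 0) 0 < e) sequentially"
   by eventually_elim (use \<open>e > 0\<close> in \<open>simp add: dist_real_def\<close>)
 qed
 from tendsto_add[OF this P0] show ?thesis unfolding J_def h_def by simp
qed

section \<open>The obstacle term\<close>

definition Psi where "Psi z = pw (m - 1) (\<psi> z)"

lemma cell_cbox: "(cell :: (real ^ 'd) set) \<subseteq> cbox 0 1"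
 by (auto simp: cell_def mem_box_cart less_imp_le)

lemma Psi_cont: "continuous_on ({0..T} \<times> UNIV) Psi"
proof -
 have "continuous_on UNIV (pw (m - 1))" using m by (intro continuous_pw) simp
 from continuous_on_compose2[OF this psi_cont subset_UNIV] show ?thesis by (simp add: Psi_def[abs_def])
qed

lemma Psi_slice: assumes t: "t \<in> {0..T}" shows "continuous_on UNIV (\<lambda>x. Psi (t, x))" "periodic (\<lambda>x. Psi (t, x))"
proof -
 show "continuous_on UNIV (\<lambda>x. Psi (t, x))"
  by (rule continuous_on_compose2[OF Psi_cont]) (use t in \<open>auto intro!: continuous_intros\<close>)
 show "periodic (\<lambda>x. Psi (t, x))" using psi_periodic[OF t] unfolding periodic_def Psi_def by simp
qed

lemma Psi_bound: obtains C where "C \<ge> 0" "\<And>t x. t \<in> {0..T} \<Longrightarrow> abs (Psi (t, x)) \<le> C"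
proof -
 obtain A where A: "A \<ge> 0" "\<And>t x. t \<in> {0..T} \<Longrightarrow> \<bar>\<psi> (t, x)\<bar> \<le> A" by (rule psi_bound) (rule that; assumption)
 show thesis
 proof (rule that[of "A powr m"])
  show "abs (Psi (t, x)) \<le> A powr m" if "t \<in> {0..T}" for t x
  proof -
   have "abs (Psi (t, x)) = \<bar>\<psi> (t, x)\<bar> powr m" by (simp add: Psi_def pw_abs)
   also have "\<dots> \<le> A powr m" using A(2)[OF that] m by (intro powr_mono2) auto
   finally show ?thesis .
  qed
 qed simp
qed

lemma Psi_meas: "Psi \<in> borel_measurable Q"
proof -
 have "Psi \<in> borel_measurable (restrict_space borel (QT T))"
  by (rule borel_measurable_continuous_on_restrict, rule continuous_on_subset[OF Psi_cont]) (auto simp: QT_def)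
 moreover have "sets (restrict_space borel (QT T)) = sets Q" unfolding QT_measure_def by (intro sets_restrict_space_cong) simp
 ultimately show ?thesis by (simp cong: measurable_cong_sets)
qed

lemma Psi_int: "integrable Q Psi"
proof -
 obtain C where C: "C \<ge> 0" "\<And>t x. t \<in> {0..T} \<Longrightarrow> abs (Psi (t, x)) \<le> C" by (rule Psi_bound) (rule that; assumption)
 have "AE z in Q. norm (Psi z) \<le> C" using C(2) by (intro AE_I2) auto
 then show ?thesis by (rule Qf.integrable_const_bound[OF _ Psi_meas])
qed

lemma Psi_time_cont:
 assumes t: "t \<in> {0..T}" and r: "r > 0"
 obtains d where "d > 0" "\<And>s y. \<lbrakk>s \<in> {0..T}; \<bar>s - t\<bar> < d; y \<in> cell\<rbrakk> \<Longrightarrow> \<bar>Psi (s, y) - Psi (t, y)\<bar> < r"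
proof -
 let ?S = "{0..T} \<times> (cbox 0 1 :: (real ^ 'd) set)"
 have "compact ?S" by (intro compact_Times compact_Icc compact_cbox)
 moreover have "continuous_on ?S Psi" by (rule continuous_on_subset[OF Psi_cont]) auto
 ultimately have "uniformly_continuous_on ?S Psi" by (intro compact_uniformly_continuous)
 then have "\<exists>d>0. \<forall>z\<in>?S. \<forall>z'\<in>?S. dist z' z < d \<longrightarrow> dist (Psi z') (Psi z) < r"
  using r unfolding uniformly_continuous_on_def by (elim allE impE)
 then obtain d where d: "d > 0" "\<forall>z\<in>?S. \<forall>z'\<in>?S. dist z' z < d \<longrightarrow> dist (Psi z') (Psi z) < r" by (elim exE conjE)
 show thesis
 proof (rule that[OF d(1)])
  fix s y assume *: "s \<in> {0..T}" "\<bar>s - t\<bar> < d" "y \<in> (cell :: (real ^ 'd) set)"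
  have y: "y \<in> cbox 0 1" using *(3) cell_cbox by (rule set_mp[rotated])
  have ds: "dist (s, y) (t, y) < d" using *(2) by (simp add: dist_Pair_Pair dist_real_def)
  have S: "(t, y) \<in> ?S" "(s, y) \<in> ?S" using y t *(1) by (simp_all only: mem_Times_iff fst_conv snd_conv simp_thms)
  have "dist (Psi (s, y)) (Psi (t, y)) < r" by (rule mp[OF bspec[OF bspec[OF d(2) S(1)] S(2)] ds])
  then show "\<bar>Psi (s, y) - Psi (t, y)\<bar> < r" by (simp only: dist_real_def)
 qed
qed

text \<open>In time, uniform continuity on the compact closure of the cell; in space, pointwise convergence at the fixed time.\<close>

lemma Psi_moll:
 assumes z: "z \<in> space Q" shows "(\<lambda>n. QI.moll n Psi z) \<longlonglongrightarrow> Psi z"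
proof -
 obtain t x where zt: "z = (t, x)" by (cases z)
 have t: "t \<in> {0..<T}" "t \<in> {0..T}" and x: "x \<in> cell" using z zt by auto
 obtain C where C: "C \<ge> 0" "\<And>t x. t \<in> {0..T} \<Longrightarrow> abs (Psi (t, x)) \<le> C" by (rule Psi_bound) (rule that; assumption)
 have sli: "integrable X (\<lambda>y. Psi (s, y))" if "s \<in> {0..T}" for s
  by (rule torus_integrable_bounded[where C=C]) (use C(2)[OF that] Psi_slice(1)[OF that] in \<open>auto intro: borel_measurable_continuous_onI\<close>)
 define g where "g n s = K.moll n (\<lambda>y. Psi (s, y)) x" for n s
 have "(\<lambda>n. g n t) \<longlonglongrightarrow> Psi (t, x)" unfolding g_def K_moll by (rule tmoll_pointwise[OF Psi_slice[OF t(2)]])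
 moreover have "(\<lambda>n. QI.moll n Psi z - g n t) \<longlonglongrightarrow> 0"
 proof (rule tendstoI)
  fix r :: real assume r: "r > 0"
  then have r2: "r / 2 > 0" by simp
  obtain d where d: "d > 0" "\<And>s y. \<lbrakk>s \<in> {0..T}; \<bar>s - t\<bar> < d; y \<in> cell\<rbrakk> \<Longrightarrow> \<bar>Psi (s, y) - Psi (t, y)\<bar> < r / 2"
   by (rule Psi_time_cont[OF t(2) r2]) (rule that; assumption)
  have gc: "\<bar>g n s - g n t\<bar> \<le> r / 2" if s: "s \<in> {0..T}" "\<bar>s - t\<bar> < d" for n s
  proof -
   have "g n s - g n t = K.moll n (\<lambda>y. Psi (s, y) - Psi (t, y)) x"
    unfolding g_def by (rule K.moll_diff[unfolded torus_fold, OF sli[OF s(1)] sli[OF t(2)] x, symmetric])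
   also have "\<bar>\<dots>\<bar> \<le> r / 2" by (rule K.k_row_bound[OF x]) (use d(2)[OF s] r2 in \<open>auto intro: less_imp_le\<close>)
   finally show ?thesis .
  qed
  have "t < T" using t by simp
  have ev1: "eventually (\<lambda>n. t + 2 / real (Suc n) < T) sequentially" by (rule eventually_small_window[OF \<open>t < T\<close>])
  have "t < t + d" using d(1) by simp
  have ev2: "eventually (\<lambda>n. t + 2 / real (Suc n) < t + d) sequentially" by (rule eventually_small_window[OF \<open>t < t + d\<close>])
  from ev1 ev2 show "eventually (\<lambda>n. dist (QI.moll n Psi z - g n t) 0 < r) sequentially"
  proof eventually_elim
   case (elim n)
   let ?F = "\<lambda>z'. theta n (t - fst z') * kappa n (x - snd z') * Psi z'"
   have "z \<in> {0..<T} \<times> cell" using z by simp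
   from QI.k_row_int_mult[unfolded QI_M, OF this Psi_int, of n]
   have Fi: "integrable Q ?F" by (simp only: zt fst_conv snd_conv)
   have sl: "(LINT y|X. ?F (s, y)) = theta n (t - s) * g n s" for s
    unfolding g_def K_moll tmoll_def by (simp only: fst_conv snd_conv mult.assoc integral_mult_right_zero)
   have e: "QI.moll n Psi z = (LINT s|TM T. theta n (t - s) * g n s)"
   proof -
    have "QI.moll n Psi z = (LINT z'|Q. ?F z')" unfolding QI_moll zt fst_conv snd_conv ..
    also have "\<dots> = (LINT s|TM T. (LINT y|X. ?F (s, y)))" using QP.integral_fst'[OF Fi[unfolded Qpair]] unfolding Qpair by (rule sym)
    finally show ?thesis unfolding sl .
   qed
   have i: "integrable (TM T) (\<lambda>s. theta n (t - s) * g n s)" using QP.integrable_fst'[OF Fi[unfolded Qpair]] unfolding sl .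
   have "\<bar>(LINT s|TM T. theta n (t - s) * g n s) - g n t\<bar> \<le> r / 2"
   proof (rule forward_average[OF _ _ i])
    show "0 \<le> t" "t + 2 / real (Suc n) \<le> T" using t elim(1) by (simp_all only: atLeastLessThan_iff less_imp_le)
    fix s assume s: "0 \<le> s" "s < T" "t < s" "s < t + 2 / real (Suc n)"
    have "s \<in> {0..T}" using s by simp
    moreover have "\<bar>s - t\<bar> < d" using s(3,4) elim(2) by linarith
    ultimately show "\<bar>g n s - g n t\<bar> \<le> r / 2" by (rule gc)
   qed
   then show ?case unfolding e dist_real_def using r by linarith
  qed
 qed
 ultimately have "(\<lambda>n. g n t + (QI.moll n Psi z - g n t)) \<longlonglongrightarrow> Psi (t, x) + 0" by (rule tendsto_add)
 then show ?thesis unfolding zt by simp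
qed

lemma w_ge_Psi: "AE z in Q. Psi z \<le> w z"
 using v_psi by eventually_elim (use m in \<open>auto simp: Psi_def w_def intro!: pw_mono\<close>)

lemma moll_ge: assumes z: "z \<in> space Q" shows "QI.moll n Psi z \<le> QI.moll n w z"
proof -
 have z': "z \<in> {0..<T} \<times> cell" using z by simp
 note i = QI.k_row_int_mult[unfolded QI_M, OF z' Psi_int, of n] QI.k_row_int_mult[unfolded QI_M, OF z' w_int, of n]
 have "AE z' in Q. theta n (fst z - fst z') * kappa n (snd z - snd z') * Psi z' \<le> theta n (fst z - fst z') * kappa n (snd z - snd z') * w z'"
  using w_ge_Psi by eventually_elim (intro mult_left_mono mult_nonneg_nonneg theta_nonneg kappa_nonneg)
 then show ?thesis unfolding QI_moll by (rule integral_mono_AE[OF i])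
qed

lemma obstacle_limit:
 assumes \<phi>: "\<phi> \<in> time_tests T"
 shows "(\<lambda>n. (LINT z|\<nu>. \<phi> (fst z) * QI.moll n Psi z)) \<longlonglongrightarrow> (LINT z|\<nu>. \<phi> (fst z) * Psi z)"
  and "integrable \<nu> (\<lambda>z. \<phi> (fst z) * QI.moll n Psi z)"
proof -
 obtain A where A: "A \<ge> 0" "\<And>t. t \<in> {0..T} \<Longrightarrow> \<bar>\<phi> t\<bar> \<le> A" "\<And>t. t \<in> {0..T} \<Longrightarrow> \<bar>deriv \<phi> t\<bar> \<le> A"
  using time_test_bounded[OF \<phi> T0] by blast
 have pnu: "integrable \<nu> (\<lambda>z. \<phi> (fst z))"
 proof -
  have "AE z in \<nu>. norm (\<phi> (fst z)) \<le> A" using A by (intro AE_I2) auto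
  then show ?thesis by (rule nu.integrable_const_bound[OF _ time_nu_meas[OF \<phi>]])
 qed
 have int: "integrable \<nu> (\<lambda>z. \<phi> (fst z) * QI.moll n Psi z)" for n
 proof -
  obtain B where B: "\<And>t. abs (theta n t) \<le> B" "\<And>t. \<bar>deriv (theta n) t\<bar> \<le> B" using theta_bounded by blast
  obtain B' where B': "\<And>x :: real ^ 'd. abs (kappa n x) \<le> B'" using kappa_bounded by blast
  have Fm: "theta n \<in> borel_measurable borel" by (auto intro!: borel_measurable_continuous_onI smooth_continuous smooth_theta)
  show ?thesis unfolding QI_moll by (rule convolution_swap(2)[OF nu.finite_measure_axioms nu_id pnu Psi_int Fm B(1) kappa_borel B'])
 qed
 then show "integrable \<nu> (\<lambda>z. \<phi> (fst z) * QI.moll n Psi z)" .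
 obtain C where C: "C \<ge> 0" "\<And>t x. t \<in> {0..T} \<Longrightarrow> abs (Psi (t, x)) \<le> C" by (rule Psi_bound) (rule that; assumption)
 have Pm: "Psi \<in> borel_measurable \<nu>" by (rule nu_meas[OF Psi_cont])
 show "(\<lambda>n. (LINT z|\<nu>. \<phi> (fst z) * QI.moll n Psi z)) \<longlonglongrightarrow> (LINT z|\<nu>. \<phi> (fst z) * Psi z)"
 proof (rule integral_dominated_convergence[where w="\<lambda>_. A * C"])
  show "(\<lambda>z. \<phi> (fst z) * Psi z) \<in> borel_measurable \<nu>" using time_nu_meas[OF \<phi>] Pm by (rule borel_measurable_times)
  show "(\<lambda>z. \<phi> (fst z) * QI.moll n Psi z) \<in> borel_measurable \<nu>" for n using int by (rule borel_measurable_integrable)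
  show "AE z in \<nu>. (\<lambda>n. \<phi> (fst z) * QI.moll n Psi z) \<longlonglongrightarrow> \<phi> (fst z) * Psi z"
   by (intro AE_I2 tendsto_mult tendsto_const Psi_moll) simp
  show "AE z in \<nu>. norm (\<phi> (fst z) * QI.moll n Psi z) \<le> A * C" for n
  proof (rule AE_I2)
   fix z assume z: "z \<in> space \<nu>"
   then have z': "z \<in> {0..<T} \<times> cell" by simp
   have "\<bar>QI.moll n Psi z\<bar> \<le> C" by (rule QI.k_row_bound[OF z' _ C(1)]) (use C(2) in auto)
   moreover have "\<bar>\<phi> (fst z)\<bar> \<le> A" using z' A by auto
   ultimately show "norm (\<phi> (fst z) * QI.moll n Psi z) \<le> A * C" unfolding real_norm_def abs_mult using A(1) by (intro mult_mono) auto
  qed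
 qed simp
qed

text \<open>The measure sees the mollification of \<open>w\<close> only through the lower bound by that of \<open>Psi\<close>, which has a limit at every point.\<close>

lemma obstacle_inequality:
 assumes \<phi>: "\<phi> \<in> time_tests T" "\<And>t. t \<in> {0..<T} \<Longrightarrow> 0 \<le> \<phi> t"
 shows "(LINT z|\<nu>. \<phi> (fst z) * Psi z) \<le> - (LINT z|Q. (u z * \<phi> (fst z)) * wt z) - (LINT z|Q. (u z * deriv \<phi> (fst z)) * w z)
   - (LINT x|X. (\<xi> x * \<phi> 0) * w (0, x)) + (\<Sum>i\<in>UNIV. (LINT z|Q. (H z $ i * \<phi> (fst z)) * Gw z $ i))"
proof -
 obtain s0 where s0: "s0 < T" "\<And>t. t \<ge> s0 \<Longrightarrow> \<phi> t = 0" using \<phi>(1) unfolding time_tests_def by blast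
 let ?R = "\<lambda>n. - (LINT z|Q. (u z * \<phi> (fst z)) * QI.moll n wt z) - (LINT z|Q. (u z * deriv \<phi> (fst z)) * QI.moll n w z)
   - (LINT x|X. (\<xi> x * \<phi> 0) * QI.moll n w (0, x)) + (\<Sum>i\<in>UNIV. (LINT z|Q. (H z $ i * \<phi> (fst z)) * QI.moll n (\<lambda>z. Gw z $ i) z))"
 have lim: "?R \<longlonglongrightarrow> - (LINT z|Q. (u z * \<phi> (fst z)) * wt z) - (LINT z|Q. (u z * deriv \<phi> (fst z)) * w z)
   - (LINT x|X. (\<xi> x * \<phi> 0) * w (0, x)) + (\<Sum>i\<in>UNIV. (LINT z|Q. (H z $ i * \<phi> (fst z)) * Gw z $ i))"
  by (intro tendsto_add tendsto_diff tendsto_minus tendsto_sum pairing_limits[OF \<phi>(1)] initial_limit[OF \<phi> s0(2,1)])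
 have "eventually (\<lambda>n. s0 + 2 / real (Suc n) < T) sequentially" by (rule eventually_small_window[OF s0(1)])
 then have "eventually (\<lambda>n. (LINT z|\<nu>. \<phi> (fst z) * QI.moll n Psi z) \<le> ?R n) sequentially"
 proof eventually_elim
  case (elim n)
  then have n: "2 / real (Suc n) < T - s0" by linarith
  note me = moll_equation(1,2)[OF \<phi> s0(2) n]
  have "(LINT z|\<nu>. \<phi> (fst z) * QI.moll n Psi z) \<le> (LINT z|\<nu>. \<phi> (fst z) * QI.moll n w z)"
  proof (rule integral_mono[OF obstacle_limit(2)[OF \<phi>(1)] me(2)])
   fix z assume z: "z \<in> space \<nu>"
   show "\<phi> (fst z) * QI.moll n Psi z \<le> \<phi> (fst z) * QI.moll n w z"
   proof (rule mult_left_mono)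
    show "QI.moll n Psi z \<le> QI.moll n w z" by (rule moll_ge) (use z in simp)
    show "0 \<le> \<phi> (fst z)" by (rule \<phi>(2)) (use z in auto)
   qed
  qed
  with me(1) show ?case by linarith
 qed
 then have "\<exists>N. \<forall>n\<ge>N. (LINT z|\<nu>. \<phi> (fst z) * QI.moll n Psi z) \<le> ?R n" unfolding eventually_sequentially .
 then show ?thesis by (rule LIMSEQ_le[OF obstacle_limit(1)[OF \<phi>(1)] lim])
qed

end

section \<open>Weights of low regularity in time\<close>

lemma theta_time_test:
 assumes "s < T" shows "(\<lambda>t. theta n (t - s)) \<in> time_tests T"
proof -
 have "theta n (t - s) = 0" if "t \<ge> s" for t
 proof -
  have "0 < 1 / real (Suc n)" by simp
  then show ?thesis using that by (intro theta_zero) (auto simp del: of_nat_Suc simp: minus_divide_left[symmetric])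
 qed
 then show ?thesis using smooth_translate(1)[OF smooth_theta[of n], of "- s"] assms unfolding time_tests_def by auto
qed

lemma theta_shift_deriv: "deriv (\<lambda>t. theta n (t - s)) = (\<lambda>t. deriv (theta n) (t - s))"
proof
 fix t
 have "((\<lambda>t. t - s) has_real_derivative 1) (at t)" by (auto intro!: derivative_eq_intros)
 from DERIV_chain2[where f="theta n" and g="\<lambda>t. t - s", OF smooth_DERIV[OF smooth_theta] this]
 show "deriv (\<lambda>t. theta n (t - s)) t = deriv (theta n) (t - s)" by (intro DERIV_imp_deriv) simp
qed

context obstacle
begin

lemma moll_time_pointwise:
 assumes f: "continuous_on {0..T} f" and fi: "integrable (TM T) f" and a: "a \<in> {0..<T}"
 shows "(\<lambda>n. TI.moll n f a) \<longlonglongrightarrow> f a"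
proof (rule tendstoI)
 fix r :: real assume r: "r > 0"
 have aT: "a \<in> {0..T}" "a < T" using a by auto
 obtain d where d: "d > 0" "\<forall>s\<in>{0..T}. dist s a < d \<longrightarrow> dist (f s) (f a) < r / 2"
  using f aT(1) r unfolding continuous_on_iff by (meson half_gt_zero)
 have "a < a + d" using d(1) by simp
 from eventually_small_window[OF aT(2)] eventually_small_window[OF this]
 show "eventually (\<lambda>n. dist (TI.moll n f a) (f a) < r) sequentially"
 proof eventually_elim
  case (elim n)
  have "\<bar>(LINT s|TM T. theta n (a - s) * f s) - f a\<bar> \<le> r / 2"
  proof (rule forward_average)
   show "0 \<le> a" using a by simp
   show "a + 2 / real (Suc n) \<le> T" using elim(1) by (rule less_imp_le)
   show "integrable (TM T) (\<lambda>s. theta n (a - s) * f s)" by (rule TI.k_row_int_mult[OF a fi])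
   fix s assume s: "0 \<le> s" "s < T" "a < s" "s < a + 2 / real (Suc n)"
   have "s \<in> {0..T}" using s by simp
   from bspec[OF d(2) this] have "dist (f s) (f a) < r / 2" by (rule mp) (use s(3,4) elim(2) in \<open>unfold dist_real_def, linarith\<close>)
   then show "\<bar>f s - f a\<bar> \<le> r / 2" unfolding dist_real_def by (rule less_imp_le)
  qed
  then show ?case unfolding TI.moll_def dist_real_def using r by linarith
 qed
qed

text \<open>The kernel as a function of \<open>s\<close> need not vanish near the final time, so it is cut off there. The error is an average of \<open>ch\<close>
 over times close to \<open>T\<close> and tends to zero because \<open>ch T = 0\<close>.\<close>

lemma wderiv_kernel:
 assumes ch: "continuous_on {0..T} ch" "ch T = 0" and wd: "has_wderiv T ch g" and t: "t \<in> {0..<T}"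
 shows "(LINT s|TM T. deriv (theta n) (t - s) * ch s) = TI.moll n g t"
proof -
 have ci: "integrable (TM T) ch" and gi: "integrable (TM T) g" using wd unfolding has_wderiv_def TM_time_integrable by simp_all
 have cm: "ch \<in> borel_measurable (TM T)" and gm: "g \<in> borel_measurable (TM T)" using ci gi by (auto intro: borel_measurable_integrable)
 obtain B where B: "\<And>t. abs (theta n t) \<le> B" "\<And>t. \<bar>deriv (theta n) t\<bar> \<le> B" using theta_bounded by blast
 have B0: "0 \<le> B" using B(1)[of 0] by linarith
 have bm: "f \<in> borel_measurable borel \<Longrightarrow> (\<lambda>s. f (a - s)) \<in> borel_measurable (TM T)" for f :: "real \<Rightarrow> real" and a
  by (rule measurable_restrict_space1, rule measurable_compose[where g=f and N=borel]) simp_all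
 have thb: "theta k \<in> borel_measurable borel" "deriv (theta k) \<in> borel_measurable borel" for k
  by (auto intro!: borel_measurable_continuous_onI smooth_continuous smooth_deriv smooth_theta)
 note sp = smooth_theta_prim
 \<comment> \<open>The window of the cutoff then ends at \<open>T - 1 / (k + 1)\<close>, strictly before the final time.\<close>
 define b where "b k = T - 3 / real (Suc k)" for k
 define X where "X k s = theta_prim k (b k - s)" for k s
 have Xb: "0 \<le> X k s" "X k s \<le> 1" for k s unfolding X_def by (rule theta_prim_range)+
 have Xm: "X k \<in> borel_measurable (TM T)" for k
  unfolding X_def[abs_def] by (rule bm, rule borel_measurable_continuous_onI, rule smooth_continuous, rule sp)
 have Xlim: "(\<lambda>k. X k s) \<longlonglongrightarrow> 1" if s: "s < T" for s
 proof (rule tendsto_eventually)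
  have "(\<lambda>k. 2 / real (Suc k)) \<longlonglongrightarrow> 0" by (rule LIMSEQ_Suc) (rule lim_const_over_n)
  then have "eventually (\<lambda>k. 2 / real (Suc k) < T - s) sequentially" using s by (intro order_tendstoD) auto
  then show "eventually (\<lambda>k. X k s = 1) sequentially"
  proof eventually_elim
   case (elim k)
   have "3 / real (Suc k) = 2 / real (Suc k) + 1 / real (Suc k)" by (simp only: add_divide_distrib[symmetric]) simp
   then have "b k - s \<ge> - 1 / real (Suc k)" using elim unfolding b_def minus_divide_left[symmetric] by linarith
   then show ?case unfolding X_def by (rule theta_prim_1)
  qed
 qed
 have smt: "smooth (\<lambda>s. theta n (t - s))" using smooth_reflect(1)[OF smooth_theta[of n], of t] by simp
 have dt: "((\<lambda>s. theta n (t - s)) has_real_derivative - deriv (theta n) (t - s)) (at s)" for s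
 proof -
  have "((\<lambda>s. t - s) has_real_derivative - 1) (at s)" by (auto intro!: derivative_eq_intros)
  from DERIV_chain2[where f="theta n" and g="\<lambda>s. t - s", OF smooth_DERIV[OF smooth_theta] this] show ?thesis by simp
 qed
 have id: "integrable (TM T) (\<lambda>s. ch s * deriv (theta n) (t - s))" by (rule bounded_mult_int[OF ci bm[OF thb(2)] B(2)])
 have parts: "(LINT s|TM T. (ch s * deriv (theta n) (t - s)) * X k s) + (LINT s|TM T. theta k (b k - s) * (ch s * theta n (t - s)))
   = (LINT s|TM T. (g s * theta n (t - s)) * X k s)" for k
 proof -
  define F where "F s = theta n (t - s) * X k s" for s
  have smX: "smooth (X k)" unfolding X_def[abs_def] using smooth_reflect(1)[OF sp[of k], of "b k"] by simp
  have F: "smooth F" unfolding F_def[abs_def] by (rule smooth_mult[OF smt smX])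
  have dF: "deriv F s = - (deriv (theta n) (t - s) * X k s) - theta n (t - s) * theta k (b k - s)" for s
  proof (rule DERIV_imp_deriv)
   from DERIV_mult[OF dt theta_prim_reflect_deriv[of k "b k" s]]
   show "(F has_real_derivative - (deriv (theta n) (t - s) * X k s) - theta n (t - s) * theta k (b k - s)) (at s)"
    unfolding F_def[abs_def] X_def by (rule DERIV_cong) (simp add: mult.commute)
  qed
  have supp: "F s = 0" if "s \<notin> {t + 1 / real (Suc n) .. T - 1 / real (Suc k)}" for s
  proof (cases "s < t + 1 / real (Suc n)")
   case True
   then have "t - s \<notin> {- 2 / real (Suc n)<..< - 1 / real (Suc n)}" unfolding greaterThanLessThan_iff minus_divide_left[symmetric] by linarith
   then show ?thesis by (simp add: F_def theta_zero del: of_nat_Suc)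
  next
   case False
   have "3 / real (Suc k) = 2 / real (Suc k) + 1 / real (Suc k)" by (simp only: add_divide_distrib[symmetric]) simp
   then have "b k - s \<le> - 2 / real (Suc k)" using False that unfolding b_def minus_divide_left[symmetric] atLeastAtMost_iff by linarith
   then show ?thesis by (simp add: F_def X_def theta_prim_0 del: of_nat_Suc)
  qed
  have pos: "0 < t + 1 / real (Suc n)" "T - 1 / real (Suc k) < T" using t by (auto intro: add_nonneg_pos)
  have "(LINT s|TM T. ch s * deriv F s) = - (LINT s|TM T. g s * F s)" using wd F supp pos unfolding has_wderiv_def TM_time_integral by blast
  moreover have "(LINT s|TM T. ch s * deriv F s) = - (LINT s|TM T. (ch s * deriv (theta n) (t - s)) * X k s) - (LINT s|TM T. theta k (b k - s) * (ch s * theta n (t - s)))"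
  proof -
   have i1: "integrable (TM T) (\<lambda>s. (ch s * deriv (theta n) (t - s)) * X k s)"
    by (rule bounded_mult_int[OF id Xm, where B=1]) (use Xb in \<open>simp add: abs_of_nonneg\<close>)
   obtain B' where B': "\<And>t. abs (theta k t) \<le> B'" "\<And>t. \<bar>deriv (theta k) t\<bar> \<le> B'" using theta_bounded by blast
   have i2: "integrable (TM T) (\<lambda>s. theta k (b k - s) * (ch s * theta n (t - s)))"
    using bounded_mult_int[OF bounded_mult_int[OF ci bm[OF thb(1)] B(1)] bm[OF thb(1)] B'(1), of t "b k"] by (simp only: mult.commute)
   have "ch s * deriv F s = - ((ch s * deriv (theta n) (t - s)) * X k s) - theta k (b k - s) * (ch s * theta n (t - s))" for s
    unfolding dF by (simp add: algebra_simps)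
   then show ?thesis using i1 i2 by simp
  qed
  moreover have "(LINT s|TM T. g s * F s) = (LINT s|TM T. (g s * theta n (t - s)) * X k s)" unfolding F_def by (simp only: mult.assoc)
  ultimately show ?thesis by linarith
 qed
 have ti: "integrable (TM T) (\<lambda>s. g s * theta n (t - s))" by (rule bounded_mult_int[OF gi bm[OF thb(1)] B(1)])
 have dct: "(\<lambda>k. (LINT s|TM T. f s * X k s)) \<longlonglongrightarrow> (LINT s|TM T. f s)" if f: "integrable (TM T) f" for f
 proof (rule integral_dominated_convergence[where w="\<lambda>s. norm (f s)"])
  show "integrable (TM T) (\<lambda>s. norm (f s))" using f by (rule integrable_norm)
  show "f \<in> borel_measurable (TM T)" using f by (rule borel_measurable_integrable)
  then show "(\<lambda>s. f s * X k s) \<in> borel_measurable (TM T)" for k using Xm by (rule borel_measurable_times)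
  show "AE s in TM T. (\<lambda>k. f s * X k s) \<longlonglongrightarrow> f s"
  proof (rule AE_I2)
   fix s assume "s \<in> space (TM T)"
   then have "s < T" by (simp add: space_restrict_space)
   from tendsto_mult[OF tendsto_const Xlim[OF this], of "f s"] show "(\<lambda>k. f s * X k s) \<longlonglongrightarrow> f s" by simp
  qed
  show "AE s in TM T. norm (f s * X k s) \<le> norm (f s)" for k
  proof (rule AE_I2)
   fix s
   have "abs (f s) * abs (X k s) \<le> abs (f s) * 1" using Xb by (intro mult_left_mono) (simp_all add: abs_of_nonneg)
   then show "norm (f s * X k s) \<le> norm (f s)" by (simp add: abs_mult)
  qed
 qed
 have edge: "(\<lambda>k. (LINT s|TM T. theta k (b k - s) * (ch s * theta n (t - s)))) \<longlonglongrightarrow> 0"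
 proof (rule tendstoI)
  fix r :: real assume r: "r > 0"
  define r' where "r' = r / (2 * (B + 1))"
  have r': "r' > 0" using r B0 by (simp add: r'_def)
  have TT: "T \<in> {0..T}" using T by simp
  obtain d where d: "d > 0" "\<forall>s\<in>{0..T}. dist s T < d \<longrightarrow> dist (ch s) (ch T) < r'"
   using ch(1) TT r' unfolding continuous_on_iff by meson
  have "(\<lambda>n. 3 / real (Suc n)) \<longlonglongrightarrow> 0" by (rule LIMSEQ_Suc) (rule lim_const_over_n)
  then have "eventually (\<lambda>k. 3 / real (Suc k) < min d T) sequentially" using d(1) T by (intro order_tendstoD) auto
  then show "eventually (\<lambda>k. dist (LINT s|TM T. theta k (b k - s) * (ch s * theta n (t - s))) 0 < r) sequentially"
  proof eventually_elim
   case (elim k)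
   have k3: "3 / real (Suc k) = 2 / real (Suc k) + 1 / real (Suc k)" by (simp only: add_divide_distrib[symmetric]) simp
   have k1: "0 < 1 / real (Suc k)" by simp
   obtain B' where B': "\<And>t. abs (theta k t) \<le> B'" "\<And>t. \<bar>deriv (theta k) t\<bar> \<le> B'" using theta_bounded by blast
   have "\<bar>(LINT s|TM T. theta k (b k - s) * (ch s * theta n (t - s))) - 0\<bar> \<le> r / 2"
   proof (rule forward_average)
    show "0 \<le> b k" using elim unfolding b_def min_less_iff_conj by linarith
    show "b k + 2 / real (Suc k) \<le> T" using k3 k1 unfolding b_def by linarith
    show "integrable (TM T) (\<lambda>s. theta k (b k - s) * (ch s * theta n (t - s)))"
     using bounded_mult_int[OF bounded_mult_int[OF ci bm[OF thb(1)] B(1)] bm[OF thb(1)] B'(1), of t "b k"] by (simp only: mult.commute)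
    fix s assume s: "0 \<le> s" "s < T" "b k < s"
    have "s \<in> {0..T}" using s by simp
    from bspec[OF d(2) this] have "dist (ch s) (ch T) < r'"
     by (rule mp) (use s(2,3) elim in \<open>unfold b_def dist_real_def min_less_iff_conj, linarith\<close>)
    then have "abs (ch s) * \<bar>theta n (t - s)\<bar> \<le> r' * B" using B(1)[of "t - s"] ch(2) r' by (intro mult_mono) (simp_all add: dist_real_def)
    also have "\<dots> \<le> r / 2"
    proof -
     have "r' * B = r / 2 * (B / (B + 1))" using B0 by (simp add: r'_def)
     also have "\<dots> \<le> r / 2 * 1" using B0 r by (intro mult_left_mono) auto
     finally show ?thesis by simp
    qed
    finally show "\<bar>ch s * theta n (t - s) - 0\<bar> \<le> r / 2" by (simp add: abs_mult)
   qed
   then show ?case unfolding dist_real_def using r by linarith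
  qed
 qed
 have "(\<lambda>k. (LINT s|TM T. (g s * theta n (t - s)) * X k s)) \<longlonglongrightarrow> (LINT s|TM T. ch s * deriv (theta n) (t - s)) + 0"
  unfolding parts[symmetric] by (rule tendsto_add[OF dct[OF id] edge])
 from LIMSEQ_unique[OF this dct[OF ti]] show ?thesis unfolding TI.moll_def by (simp add: mult.commute)
qed

text \<open>Averaging the inequality for \<open>\<phi> = \<theta>(\<cdot> - s)\<close> with the weight \<open>ch s\<close> gives the inequality for the mollified weight, whose
 derivative is the mollification of \<open>g\<close>; both are bounded and converge almost everywhere along a subsequence.\<close>

lemma time_extension:
 assumes E: "integrable (TM T) e" and D: "integrable (TM T) f"
  and ineq: "\<And>\<phi>. \<lbrakk>\<phi> \<in> time_tests T; \<And>t. t \<in> {0..<T} \<Longrightarrow> 0 \<le> \<phi> t\<rbrakk> \<Longrightarrow> 0 \<le> (LINT t|TM T. e t * deriv \<phi> t) + (LINT t|TM T. f t * \<phi> t) + c * \<phi> 0"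
  and ch: "continuous_on {0..T} ch" "ch T = 0" "\<And>t. t \<in> {0..T} \<Longrightarrow> 0 \<le> ch t"
  and wd: "has_wderiv T ch g" and g: "\<And>t. abs (g t) \<le> C"
 shows "0 \<le> (LINT t|TM T. e t * g t) + (LINT t|TM T. f t * ch t) + c * ch 0"
proof -
 have ci: "integrable (TM T) ch" and gi: "integrable (TM T) g" using wd unfolding has_wderiv_def TM_time_integrable by simp_all
 have C0: "0 \<le> C" using g[of 0] by linarith
 have zero: "0 \<in> {0..<T}" using T by simp
 have sf: "sigma_finite_measure (TM T)" by (rule finite_measure.axioms(1)[OF TM_finite[OF T0]])
 have moll_ineq: "0 \<le> (LINT t|TM T. e t * TI.moll n g t) + (LINT t|TM T. f t * TI.moll n ch t) + c * TI.moll n ch 0" for n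
 proof -
  obtain B where B: "\<And>t. abs (theta n t) \<le> B" "\<And>t. \<bar>deriv (theta n) t\<bar> \<le> B" using theta_bounded by blast
  have km: "(\<lambda>p. F (fst p - snd p)) \<in> borel_measurable (TM T \<Otimes>\<^sub>M TM T)" if F: "F \<in> borel_measurable borel" for F :: "real \<Rightarrow> real"
  proof -
   have i: "(\<lambda>x. x) \<in> TM T \<rightarrow>\<^sub>M borel" by (rule measurable_restrict_space1) simp
   have "(\<lambda>p. fst p - snd p) \<in> TM T \<Otimes>\<^sub>M TM T \<rightarrow>\<^sub>M (borel :: real measure)"
    by (intro borel_measurable_diff measurable_compose[OF measurable_fst i] measurable_compose[OF measurable_snd i])
   then show ?thesis using F by (rule measurable_compose)
  qed
  have thb: "theta n \<in> borel_measurable borel" "deriv (theta n) \<in> borel_measurable borel"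
   by (auto intro!: borel_measurable_continuous_onI smooth_continuous smooth_deriv smooth_theta)
  note s1 = kernel_swap[OF sf sf E ci km[OF thb(2)] B(2)]
  note s2 = kernel_swap[OF sf sf D ci km[OF thb(1)] B(1)]
  have i3: "integrable (TM T) (\<lambda>s. ch s * (c * theta n (0 - s)))"
   using integrable_mult_right[OF TI.k_row_int_mult[OF zero ci, of n], of c] by (simp only: mult.left_commute mult.commute)
  let ?I = "\<lambda>s. ch s * (LINT t|TM T. e t * deriv (theta n) (t - s)) + ch s * (LINT t|TM T. f t * theta n (t - s)) + ch s * (c * theta n (0 - s))"
  have "0 \<le> (LINT s|TM T. ?I s)"
  proof (rule B_integral_nonneg)
   fix s assume "s \<in> space (TM T)"
   then have s: "0 \<le> s" "s < T" by (auto simp: space_restrict_space)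
   have "0 \<le> ch s" using s by (intro ch(3)) simp
   moreover have "0 \<le> (LINT t|TM T. e t * deriv (theta n) (t - s)) + (LINT t|TM T. f t * theta n (t - s)) + c * theta n (0 - s)"
    using ineq[OF theta_time_test[OF s(2)] theta_nonneg, of n] unfolding theta_shift_deriv .
   ultimately have "0 \<le> ch s * ((LINT t|TM T. e t * deriv (theta n) (t - s)) + (LINT t|TM T. f t * theta n (t - s)) + c * theta n (0 - s))"
    by (rule mult_nonneg_nonneg)
   then show "0 \<le> ?I s" by (simp only: distrib_left)
  qed
  also have "\<dots> = (LINT s|TM T. ch s * (LINT t|TM T. e t * deriv (theta n) (t - s))) + (LINT s|TM T. ch s * (LINT t|TM T. f t * theta n (t - s))) + (LINT s|TM T. ch s * (c * theta n (0 - s)))"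
   using s1(3) s2(3) i3 by simp
  also have "\<dots> = (LINT t|TM T. e t * (LINT s|TM T. deriv (theta n) (t - s) * ch s)) + (LINT t|TM T. f t * TI.moll n ch t) + c * TI.moll n ch 0"
  proof -
   have "(LINT s|TM T. ch s * (c * theta n (0 - s))) = c * TI.moll n ch 0"
    unfolding TI.moll_def by (subst integral_mult_right_zero[symmetric]) (simp only: mult.left_commute mult.commute)
   then show ?thesis unfolding s1(1)[symmetric] s2(1)[symmetric] TI.moll_def by simp
  qed
  also have "(LINT t|TM T. e t * (LINT s|TM T. deriv (theta n) (t - s) * ch s)) = (LINT t|TM T. e t * TI.moll n g t)"
  proof (rule B_integral_cong[OF refl])
   fix t assume "t \<in> space (TM T)"
   then have t: "t \<in> {0..<T}" by (auto simp: space_restrict_space)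
   show "e t * (LINT s|TM T. deriv (theta n) (t - s) * ch s) = e t * TI.moll n g t" unfolding wderiv_kernel[OF ch(1,2) wd t] ..
  qed
  finally show ?thesis .
 qed
 obtain r where r: "strict_mono r" "AE a in TM T. (\<lambda>n. TI.moll (r n) g a) \<longlonglongrightarrow> g a" by (rule TI.moll_AE_subseq[OF gi])
 obtain A where A: "A \<ge> 0" "\<And>t. t \<in> {0..T} \<Longrightarrow> abs (ch t) \<le> A"
 proof -
  have "compact (ch ` {0..T})" using ch(1) by (intro compact_continuous_image) auto
  then obtain A where "\<forall>y\<in>ch ` {0..T}. norm y \<le> A" using compact_imp_bounded bounded_iff by metis
  then have "abs (ch t) \<le> max 0 A" if "t \<in> {0..T}" for t using that by (auto simp: le_max_iff_disj)
  then show thesis by (intro that[of "max 0 A"]) auto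
 qed
 have lim: "(\<lambda>n. (LINT t|TM T. h t * TI.moll (r n) y t)) \<longlonglongrightarrow> (LINT t|TM T. h t * y t)"
  if h: "integrable (TM T) h" and y: "integrable (TM T) y" and yA: "\<And>t. t \<in> {0..<T} \<Longrightarrow> abs (y t) \<le> A'" "0 \<le> A'"
   and ae: "AE a in TM T. (\<lambda>n. TI.moll (r n) y a) \<longlonglongrightarrow> y a" for h y A'
 proof (rule integral_dominated_convergence[where w="\<lambda>t. abs (h t) * A'"])
  show "integrable (TM T) (\<lambda>t. abs (h t) * A')" using h by simp
  show "(\<lambda>t. h t * y t) \<in> borel_measurable (TM T)" "\<And>n. (\<lambda>t. h t * TI.moll (r n) y t) \<in> borel_measurable (TM T)"
   using h y TI.moll_int[OF y] by (auto intro!: borel_measurable_times borel_measurable_integrable)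
  show "AE t in TM T. (\<lambda>n. h t * TI.moll (r n) y t) \<longlonglongrightarrow> h t * y t"
   using ae by eventually_elim (rule tendsto_mult[OF tendsto_const])
  show "AE t in TM T. norm (h t * TI.moll (r n) y t) \<le> abs (h t) * A'" for n
  proof (rule AE_I2)
   fix t assume "t \<in> space (TM T)"
   then have t: "t \<in> {0..<T}" by (auto simp: space_restrict_space)
   show "norm (h t * TI.moll (r n) y t) \<le> abs (h t) * A'"
    unfolding real_norm_def abs_mult by (rule mult_left_mono[OF TI.k_row_bound[OF t yA] abs_ge_zero])
  qed
 qed
 have lch: "(\<lambda>n. TI.moll (r n) ch a) \<longlonglongrightarrow> ch a" if "a \<in> {0..<T}" for a
  using LIMSEQ_subseq_LIMSEQ[OF moll_time_pointwise[OF ch(1) ci that] r(1)] by (simp add: o_def)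
 have "(\<lambda>n. (LINT t|TM T. e t * TI.moll (r n) g t) + (LINT t|TM T. f t * TI.moll (r n) ch t) + c * TI.moll (r n) ch 0)
   \<longlonglongrightarrow> (LINT t|TM T. e t * g t) + (LINT t|TM T. f t * ch t) + c * ch 0"
 proof (intro tendsto_add tendsto_mult tendsto_const lch[OF zero])
  show "(\<lambda>n. (LINT t|TM T. e t * TI.moll (r n) g t)) \<longlonglongrightarrow> (LINT t|TM T. e t * g t)" by (rule lim[OF E gi g C0 r(2)])
  show "(\<lambda>n. (LINT t|TM T. f t * TI.moll (r n) ch t)) \<longlonglongrightarrow> (LINT t|TM T. f t * ch t)"
  proof (rule lim[OF D ci _ A(1)])
   show "abs (ch t) \<le> A" if "t \<in> {0..<T}" for t using that by (intro A(2)) simp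
   show "AE a in TM T. (\<lambda>n. TI.moll (r n) ch a) \<longlonglongrightarrow> ch a" by (rule AE_I2, rule lch) (simp add: space_restrict_space)
  qed
 qed
 then show ?thesis by (rule LIMSEQ_le_const) (use moll_ineq in blast)
qed

end

section \<open>The variational inequality\<close>

lemma integrable_mult_conjugate:
 fixes f g :: "'z \<Rightarrow> real"
 assumes pq: "p > 1" "q > 1" "1/p + 1/q = 1" and m: "f \<in> borel_measurable M" "g \<in> borel_measurable M"
  and i: "integrable M (\<lambda>x. abs (f x) powr q)" "integrable M (\<lambda>x. abs (g x) powr p)"
 shows "integrable M (\<lambda>x. f x * g x)"
proof (rule B_integrable_bound)
 show "integrable M (\<lambda>x. abs (f x) powr q + abs (g x) powr p)" using i by simp
 show "(\<lambda>x. f x * g x) \<in> borel_measurable M" using m by (rule borel_measurable_times)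
 show "AE x in M. norm (f x * g x) \<le> norm (abs (f x) powr q + abs (g x) powr p)"
 proof (rule AE_I2)
  fix x
  have "abs (f x) * abs (g x) \<le> abs (f x) powr q + abs (g x) powr p"
   using young_scaled[OF pq abs_ge_zero abs_ge_zero zero_less_one, of "f x" "g x"] by simp
  then show "norm (f x * g x) \<le> norm (abs (f x) powr q + abs (g x) powr p)"
   unfolding real_norm_def abs_mult by (rule order_trans[OF _ abs_ge_self])
 qed
qed

lemma has_torus_wgrad_diff_scaled:
 fixes f g :: "real ^ 'd \<Rightarrow> real"
 assumes f: "has_torus_wgrad f F" and g: "has_torus_wgrad g G"
 shows "has_torus_wgrad (\<lambda>x. (f x - g x) * c) (\<lambda>x. c *\<^sub>R (F x - G x))" unfolding has_torus_wgrad_def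
proof (intro conjI allI impI)
 have i: "integrable TX f" "integrable TX F" "integrable TX g" "integrable TX G" using f g unfolding has_torus_wgrad_def by simp_all
 show "integrable TX (\<lambda>x. (f x - g x) * c)" "integrable TX (\<lambda>x. c *\<^sub>R (F x - G x))" using i by simp_all
 fix \<rho> :: "real ^ 'd \<Rightarrow> real" and i' assume \<rho>: "smooth \<rho> \<and> periodic \<rho>"
 obtain B where B: "\<And>x. \<bar>\<rho> x\<bar> \<le> B" "\<And>x. \<bar>dderiv (axis i' 1) \<rho> x\<bar> \<le> B"
  using smooth_periodic_bounded[OF conjunct1[OF \<rho>] conjunct2[OF \<rho>], of "axis i' 1"] by (metis axis_Basis)
 have m: "\<rho> \<in> borel_measurable TX" "dderiv (axis i' 1) \<rho> \<in> borel_measurable TX"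
  using \<rho> by (auto intro!: measurable_torus borel_measurable_continuous_onI smooth_continuous smooth_dderiv)
 have bi: "integrable TX (\<lambda>x. h x * k x)"
  if "integrable TX h" "k \<in> borel_measurable TX" "\<And>x. abs (k x) \<le> B" for h k :: "real ^ 'd \<Rightarrow> real"
 proof (rule B_integrable_bound[of _ "\<lambda>x. B * h x"])
  show "AE x in TX. norm (h x * k x) \<le> norm (B * h x)"
  proof (rule AE_I2)
   fix x
   show "norm (h x * k x) \<le> norm (B * h x)"
    using mult_right_mono[OF order_trans[OF that(3)[of x] abs_ge_self], of "abs (h x)"] by (simp add: abs_mult mult.commute)
  qed
 qed (use that in auto)
 have l: "(LINT x|TX. (f x - g x) * c * dderiv (axis i' 1) \<rho> x)
   = c * ((LINT x|TX. f x * dderiv (axis i' 1) \<rho> x) - (LINT x|TX. g x * dderiv (axis i' 1) \<rho> x))"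
 proof -
  have "(f x - g x) * c * dderiv (axis i' 1) \<rho> x = c * (f x * dderiv (axis i' 1) \<rho> x - g x * dderiv (axis i' 1) \<rho> x)" for x
   by (simp add: algebra_simps)
  then show ?thesis by (simp only: integral_mult_right_zero B_integral_diff[OF bi[OF i(1) m(2) B(2)] bi[OF i(3) m(2) B(2)]])
 qed
 have r: "(LINT x|TX. (c *\<^sub>R (F x - G x)) $ i' * \<rho> x)
   = c * ((LINT x|TX. F x $ i' * \<rho> x) - (LINT x|TX. G x $ i' * \<rho> x))"
 proof -
  have "(c *\<^sub>R (F x - G x)) $ i' * \<rho> x = c * (F x $ i' * \<rho> x - G x $ i' * \<rho> x)" for x by (simp add: algebra_simps)
  then show ?thesis
   by (simp only: integral_mult_right_zero B_integral_diff[OF bi[OF integrable_vec_nth[OF i(2)] m(1) B(1)] bi[OF integrable_vec_nth[OF i(4)] m(1) B(1)]])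
 qed
 have "(LINT x|TX. f x * dderiv (axis i' 1) \<rho> x) = - (LINT x|TX. F x $ i' * \<rho> x)"
  "(LINT x|TX. g x * dderiv (axis i' 1) \<rho> x) = - (LINT x|TX. G x $ i' * \<rho> x)" using f g \<rho> unfolding has_torus_wgrad_def by simp_all
 then show "(LINT x|TX. (f x - g x) * c * dderiv (axis i' 1) \<rho> x) = - (LINT x|TX. (c *\<^sub>R (F x - G x)) $ i' * \<rho> x)"
  unfolding l r by (simp add: algebra_simps)
qed

context obstacle
begin

text \<open>The mollification of a weak time derivative depends on the function alone, by testing with the kernel.\<close>

lemma has_wdt_unique:
 assumes f: "has_wdt T f g" and f': "has_wdt T f g'"
 shows "AE z in Q. g z = g' z"
proof -
 have gi: "integrable Q g" "integrable Q g'" using f f' unfolding has_wdt_def by simp_all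
 have "AE z in Q. g z - g' z \<in> {0}"
 proof (rule QI.moll_AE_eventually_closed[unfolded QI_M])
  show "integrable Q (\<lambda>z. g z - g' z)" using gi by simp
  show "AE z in Q. eventually (\<lambda>n. QI.moll n (\<lambda>z. g z - g' z) z \<in> {0}) sequentially"
  proof (rule AE_I2)
   fix z assume z: "z \<in> space Q"
   obtain t x where zt: "z = (t, x)" by (cases z)
   have t: "0 \<le> t" "t < T" using z zt by auto
   from eventually_small_window[OF t(2)] show "eventually (\<lambda>n. QI.moll n (\<lambda>z. g z - g' z) z \<in> {0}) sequentially"
   proof eventually_elim
    case (elim n)
    have "QI.moll n (\<lambda>z. g z - g' z) z = QI.moll n g z - QI.moll n g' z" using z by (intro QI.moll_diff[unfolded QI_M] gi) simp
    also have "\<dots> = 0" unfolding zt has_wdt_kernel[OF f t(1) elim, symmetric] has_wdt_kernel[OF f' t(1) elim, symmetric] by simp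
    finally show ?case by simp
   qed
  qed
 qed simp
 then show ?thesis by eventually_elim simp
qed

lemma has_wderiv_unique:
 assumes ch: "continuous_on {0..T} ch" "ch T = 0" and wd: "has_wderiv T ch g" "has_wderiv T ch g'"
 shows "AE t in TM T. g t = g' t"
proof -
 have gi: "integrable (TM T) g" "integrable (TM T) g'" using wd unfolding has_wderiv_def TM_time_integrable by simp_all
 have "AE t in TM T. g t - g' t \<in> {0}"
 proof (rule TI.moll_AE_eventually_closed)
  show "integrable (TM T) (\<lambda>t. g t - g' t)" using gi by simp
  show "AE t in TM T. eventually (\<lambda>n. TI.moll n (\<lambda>t. g t - g' t) t \<in> {0}) sequentially"
  proof (rule AE_I2, rule always_eventually, rule allI)
   fix t n assume "t \<in> space (TM T)"
   then have t: "t \<in> {0..<T}" by (simp add: space_restrict_space)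
   show "TI.moll n (\<lambda>t. g t - g' t) t \<in> {0}"
    unfolding TI.moll_diff[OF gi t] wderiv_kernel[OF ch wd(1) t, symmetric] wderiv_kernel[OF ch wd(2) t, symmetric] by simp
  qed
 qed simp
 then show ?thesis by eventually_elim simp
qed

lemma time_weighted_integral:
 fixes h :: "real \<times> (real ^ 'd) \<Rightarrow> real" and a :: "real \<Rightarrow> real"
 assumes h: "integrable Q h" and a: "a \<in> borel_measurable (TM T)" and B: "\<And>t. t \<in> {0..<T} \<Longrightarrow> abs (a t) \<le> B"
 shows "integrable Q (\<lambda>z. h z * a (fst z))" "(LINT z|Q. h z * a (fst z)) = (LINT t|TM T. (LINT x|X. h (t, x)) * a t)"
  "integrable (TM T) (\<lambda>t. (LINT x|X. h (t, x)))"
proof -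
 have am: "(\<lambda>z. a (fst z)) \<in> borel_measurable Q" unfolding Qpair by (rule measurable_compose[OF measurable_fst a])
 show i: "integrable Q (\<lambda>z. h z * a (fst z))" by (rule bounded_mult_int[OF h am, where B=B]) (use B in auto)
 have "(LINT z|Q. h z * a (fst z)) = (LINT t|TM T. (LINT x|X. h (t, x) * a t))" using QP.integral_fst'[OF i[unfolded Qpair]] unfolding Qpair by simp
 then show "(LINT z|Q. h z * a (fst z)) = (LINT t|TM T. (LINT x|X. h (t, x)) * a t)" by simp
 show "integrable (TM T) (\<lambda>t. (LINT x|X. h (t, x)))" by (rule QP.integrable_fst'[OF h[unfolded Qpair]])
qed

end

context obstacle_test
begin

lemma uw_int: "integrable Q (\<lambda>z. u z * w z)"
 by (rule integrable_mult_conjugate[OF p_facts(1,2,3) u_meas w_meas u_int w_Lp])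

lemma uwt_int: "integrable Q (\<lambda>z. u z * wt z)"
 by (rule integrable_mult_conjugate[OF p_facts(1,2,3) u_meas wt_meas u_int wt_Lp[folded p_def]])

lemma xiw_int: "integrable X (\<lambda>x. \<xi> x * w (0, x))"
proof -
 have z: "0 \<in> {0..T}" using T by simp
 show ?thesis by (rule integrable_mult_conjugate[OF p_facts(1,2,3) xi_meas w_slice(1)[OF z] xi_int w_slice(2)[OF z]])
qed

lemma HG_int: "integrable Q (\<lambda>z. H z \<bullet> Gw z)"
proof (rule B_integrable_bound)
 show "integrable Q (\<lambda>z. (norm (H z))\<^sup>2 + (norm (Gw z))\<^sup>2)" using H2 Gw_L2 by simp
 show "AE z in Q. norm (H z \<bullet> Gw z) \<le> norm ((norm (H z))\<^sup>2 + (norm (Gw z))\<^sup>2)"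
 proof (rule AE_I2)
  fix z
  have "\<bar>H z \<bullet> Gw z\<bar> \<le> norm (H z) * norm (Gw z)" by (rule Cauchy_Schwarz_ineq2)
  also have "\<dots> \<le> (norm (H z))\<^sup>2 + (norm (Gw z))\<^sup>2"
  proof -
   have "2 * (norm (H z) * norm (Gw z)) \<le> (norm (H z))\<^sup>2 + (norm (Gw z))\<^sup>2"
    using sum_squares_bound[of "norm (H z)" "norm (Gw z)"] by (simp only: mult.assoc)
   moreover have "0 \<le> norm (H z) * norm (Gw z)" by simp
   ultimately show ?thesis by linarith
  qed
  finally show "norm (H z \<bullet> Gw z) \<le> norm ((norm (H z))\<^sup>2 + (norm (Gw z))\<^sup>2)"
   unfolding real_norm_def by (rule order_trans[OF _ abs_ge_self])
 qed
qed measurable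

text \<open>The integrands multiplying \<open>\<partial>\<^sub>t\<phi>\<close> and \<open>\<phi>\<close>, and the coefficient of \<open>\<phi>(0)\<close>, in the variational inequality.\<close>

definition energy_density where "energy_density z = Phi m (u z) - u z * w z"
definition flux_density where "flux_density z = H z \<bullet> Gw z - (norm (H z))\<^sup>2 - u z * wt z"
definition initial_energy where "initial_energy = (LINT x|X. Phi m (\<xi> x) - \<xi> x * w (0, x))"

lemma energy_density_int: "integrable Q energy_density" unfolding energy_density_def[abs_def] using Phi_int(1) uw_int by simp
lemma flux_density_int: "integrable Q flux_density" unfolding flux_density_def[abs_def] using HG_int H2 uwt_int by simp

text \<open>The sum of the energy inequality and the obstacle inequality; the integrals over \<open>\<nu>\<close> cancel.\<close>

lemma smooth_inequality:
 assumes \<phi>: "\<phi> \<in> time_tests T" "\<And>t. t \<in> {0..<T} \<Longrightarrow> 0 \<le> \<phi> t"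
 shows "0 \<le> (LINT z|Q. energy_density z * deriv \<phi> (fst z)) + (LINT z|Q. flux_density z * \<phi> (fst z)) + initial_energy * \<phi> 0"
proof -
 note i = time_test_mult_int[OF \<phi>(1)]
 have 1: "(LINT z|Q. energy_density z * deriv \<phi> (fst z)) = (LINT z|Q. Phi m (u z) * deriv \<phi> (fst z)) - (LINT z|Q. (u z * deriv \<phi> (fst z)) * w z)"
 proof -
  have "(LINT z|Q. (u z * deriv \<phi> (fst z)) * w z) = (LINT z|Q. u z * w z * deriv \<phi> (fst z))"
   by (rule B_integral_cong[OF refl]) (simp only: mult.assoc mult.commute mult.left_commute)
  then show ?thesis
   unfolding energy_density_def left_diff_distrib using B_integral_diff[OF i(2)[OF Phi_int(1)] i(2)[OF uw_int]] by simp
 qed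
 have HG: "integrable Q (\<lambda>z. (H z $ i * \<phi> (fst z)) * Gw z $ i)" for i
 proof -
  have "integrable Q (\<lambda>z. H z $ i * Gw z $ i)"
  proof (rule B_integrable_bound)
   show "integrable Q (\<lambda>z. (norm (H z))\<^sup>2 + (norm (Gw z))\<^sup>2)" using H2 Gw_L2 by simp
   show "(\<lambda>z. H z $ i * Gw z $ i) \<in> borel_measurable Q"
    using borel_measurable_integrable[OF integrable_vec_nth[OF H_int]] borel_measurable_integrable[OF integrable_vec_nth[OF Gw_int]] by (rule borel_measurable_times)
   show "AE z in Q. norm (H z $ i * Gw z $ i) \<le> norm ((norm (H z))\<^sup>2 + (norm (Gw z))\<^sup>2)"
   proof (rule AE_I2)
    fix z
    have "\<bar>H z $ i\<bar> * \<bar>Gw z $ i\<bar> \<le> norm (H z) * norm (Gw z)" by (intro mult_mono component_le_norm_cart) auto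
    also have "\<dots> \<le> (norm (H z))\<^sup>2 + (norm (Gw z))\<^sup>2"
    proof -
     have "2 * (norm (H z) * norm (Gw z)) \<le> (norm (H z))\<^sup>2 + (norm (Gw z))\<^sup>2"
      using sum_squares_bound[of "norm (H z)" "norm (Gw z)"] by (simp only: mult.assoc)
     moreover have "0 \<le> norm (H z) * norm (Gw z)" by simp
     ultimately show ?thesis by linarith
    qed
    finally show "norm (H z $ i * Gw z $ i) \<le> norm ((norm (H z))\<^sup>2 + (norm (Gw z))\<^sup>2)"
     unfolding real_norm_def abs_mult by (rule order_trans[OF _ abs_ge_self])
   qed
  qed
  from i(1)[OF this] show ?thesis by (simp only: mult.assoc mult.commute[of "\<phi> _"])
 qed
 have 2: "(\<Sum>i\<in>UNIV. (LINT z|Q. (H z $ i * \<phi> (fst z)) * Gw z $ i)) = (LINT z|Q. (H z \<bullet> Gw z) * \<phi> (fst z))"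
 proof -
  have "(H z \<bullet> Gw z) * \<phi> (fst z) = (\<Sum>i\<in>UNIV. (H z $ i * \<phi> (fst z)) * Gw z $ i)" for z
   unfolding inner_vec_def sum_distrib_right by (intro sum.cong refl) (simp only: inner_real_def mult.assoc mult.commute[of "\<phi> _"])
  then show ?thesis using HG by (simp add: B_integral_sum)
 qed
 have 3: "(LINT z|Q. flux_density z * \<phi> (fst z)) = (LINT z|Q. (H z \<bullet> Gw z) * \<phi> (fst z)) - (LINT z|Q. (norm (H z))\<^sup>2 * \<phi> (fst z)) - (LINT z|Q. (u z * \<phi> (fst z)) * wt z)"
 proof -
  have "(LINT z|Q. (u z * \<phi> (fst z)) * wt z) = (LINT z|Q. u z * wt z * \<phi> (fst z))"
   by (rule B_integral_cong[OF refl]) (simp only: mult.assoc mult.commute mult.left_commute)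
  then show ?thesis unfolding flux_density_def left_diff_distrib using i(1)[OF HG_int] i(1)[OF H2] i(1)[OF uwt_int] by simp
 qed
 have 4: "initial_energy * \<phi> 0 = (LINT x|X. Phi m (\<xi> x)) * \<phi> 0 - (LINT x|X. (\<xi> x * \<phi> 0) * w (0, x))"
 proof -
  have "(LINT x|X. (\<xi> x * \<phi> 0) * w (0, x)) = (LINT x|X. \<xi> x * w (0, x) * \<phi> 0)"
   by (rule B_integral_cong[OF refl]) (simp only: mult.assoc mult.commute mult.left_commute)
  also have "\<dots> = (LINT x|X. \<xi> x * w (0, x)) * \<phi> 0" by (rule integral_mult_left_zero)
  finally show ?thesis unfolding initial_energy_def B_integral_diff[OF Phi_int(2) xiw_int] by (simp only: left_diff_distrib)
 qed
 have 5: "(LINT z|\<nu>. pw (m - 1) (\<psi> z) * \<phi> (fst z)) = (LINT z|\<nu>. \<phi> (fst z) * Psi z)" unfolding Psi_def by (simp only: mult.commute)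
 show ?thesis using energy_ineq[OF \<phi>] obstacle_inequality[OF \<phi>] unfolding 1 2 3 4 5 by linarith
qed

lemma weighted_inequality:
 assumes ch: "continuous_on {0..T} ch" "ch T = 0" "\<And>t. t \<in> {0..T} \<Longrightarrow> 0 \<le> ch t"
  and wd: "has_wderiv T ch g" and g: "\<And>t. abs (g t) \<le> C"
 shows "0 \<le> (LINT z|Q. energy_density z * g (fst z)) + (LINT z|Q. flux_density z * ch (fst z)) + initial_energy * ch 0"
  and "integrable Q (\<lambda>z. energy_density z * g (fst z))" "\<And>h. integrable Q h \<Longrightarrow> integrable Q (\<lambda>z. h z * ch (fst z))"
proof -
 have ci: "integrable (TM T) ch" and gi: "integrable (TM T) g" using wd unfolding has_wderiv_def TM_time_integrable by simp_all
 have cm: "ch \<in> borel_measurable (TM T)" and gm: "g \<in> borel_measurable (TM T)" using ci gi by (auto intro: borel_measurable_integrable)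
 obtain A where A: "\<And>t. t \<in> {0..<T} \<Longrightarrow> abs (ch t) \<le> A"
 proof -
  have "compact (ch ` {0..T})" using ch(1) by (intro compact_continuous_image) auto
  then obtain A where "\<forall>y\<in>ch ` {0..T}. norm y \<le> A" using compact_imp_bounded bounded_iff by metis
  then show thesis by (intro that[of A]) auto
 qed
 note E = time_weighted_integral[OF energy_density_int] and D = time_weighted_integral[OF flux_density_int]
 have e1: "(LINT z|Q. energy_density z * g (fst z)) = (LINT t|TM T. (LINT x|X. energy_density (t, x)) * g t)" by (rule E(2)[OF gm g])
 have e2: "(LINT z|Q. flux_density z * ch (fst z)) = (LINT t|TM T. (LINT x|X. flux_density (t, x)) * ch t)" by (rule D(2)[OF cm A])
 show "0 \<le> (LINT z|Q. energy_density z * g (fst z)) + (LINT z|Q. flux_density z * ch (fst z)) + initial_energy * ch 0" unfolding e1 e2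
 proof (rule time_extension[OF E(3)[OF gm g] D(3)[OF cm A] _ ch wd g])
  fix \<phi> assume \<phi>: "\<phi> \<in> time_tests T" "\<And>t. t \<in> {0..<T} \<Longrightarrow> 0 \<le> \<phi> t"
  obtain B where B: "B \<ge> 0" "\<And>t. t \<in> {0..T} \<Longrightarrow> \<bar>\<phi> t\<bar> \<le> B" "\<And>t. t \<in> {0..T} \<Longrightarrow> \<bar>deriv \<phi> t\<bar> \<le> B"
   using time_test_bounded[OF \<phi>(1) T0] by blast
  have m: "\<phi> \<in> borel_measurable (TM T)" "deriv \<phi> \<in> borel_measurable (TM T)"
   using time_test_deriv_borel[OF \<phi>(1)] by (auto intro: measurable_restrict_space1)
  have B': "\<bar>\<phi> t\<bar> \<le> B" "\<bar>deriv \<phi> t\<bar> \<le> B" if "t \<in> {0..<T}" for t using B that by simp_all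
  show "0 \<le> (LINT t|TM T. (LINT x|X. energy_density (t, x)) * deriv \<phi> t) + (LINT t|TM T. (LINT x|X. flux_density (t, x)) * \<phi> t) + initial_energy * \<phi> 0"
  proof -
   have "(LINT z|Q. energy_density z * deriv \<phi> (fst z)) = (LINT t|TM T. (LINT x|X. energy_density (t, x)) * deriv \<phi> t)" by (rule E(2)[OF m(2) B'(2)])
   moreover have "(LINT z|Q. flux_density z * \<phi> (fst z)) = (LINT t|TM T. (LINT x|X. flux_density (t, x)) * \<phi> t)" by (rule D(2)[OF m(1) B'(1)])
   moreover have "0 \<le> (LINT z|Q. energy_density z * deriv \<phi> (fst z)) + (LINT z|Q. flux_density z * \<phi> (fst z)) + initial_energy * \<phi> 0"
    by (rule smooth_inequality[OF \<phi>(1)], rule \<phi>(2))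
   ultimately show ?thesis by (simp only:)
  qed
 qed
 show "integrable Q (\<lambda>z. energy_density z * g (fst z))" by (rule E(1)[OF gm g])
 show "integrable Q (\<lambda>z. h z * ch (fst z))" if "integrable Q h" for h by (rule time_weighted_integral(1)[OF that cm A])
qed

end

theorem proposition7p3:
  fixes T m :: real
    and \<psi> u :: "real \<times> (real ^ 'd) \<Rightarrow> real"
    and \<xi> :: "real ^ 'd \<Rightarrow> real"
    and \<nu> :: "(real \<times> (real ^ 'd)) measure"
  assumes "0 < T" and "1 < m"
    and "\<psi> \<in> C2x T"
    and "\<xi> \<in> Lp (m + 1) torus_measure"
    and "AE x in torus_measure. \<psi> (0, x) \<le> \<xi> x"
    and "entropy_solution T m \<psi> \<xi> u \<nu>"
  shows "(\<lambda>z. pw (m - 1) (u z)) \<in> L2H1 T \<and>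
    (\<forall>v \<in> K' T m \<psi>. \<forall>\<phi> \<in> H1inf_nonneg T. \<phi> T = 0 \<longrightarrow>
      dt_pairing T m \<xi> u v \<phi>
      + (\<integral>z. wgrad T (\<lambda>z. pw (m - 1) (u z)) z
              \<bullet> wgrad T (\<lambda>(t, x). (pw (m - 1) (v (t, x)) - pw (m - 1) (u (t, x))) * \<phi> t) z
           \<partial>QT_measure T) \<ge> 0)"
proof -
 interpret obstacle T m \<psi> u \<xi> \<nu> using assms by unfold_locales
 have U_eq: "(\<lambda>z. pw (m - 1) (u z)) = U" by (simp add: U_def[abs_def])
 have ineq: "0 \<le> dt_pairing T m \<xi> u v \<phi>
   + (LINT z|Q. wgrad T U z \<bullet> wgrad T (\<lambda>(t, x). (pw (m - 1) (v (t, x)) - pw (m - 1) (u (t, x))) * \<phi> t) z)"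
  if vK: "v \<in> K' T m \<psi>" and \<phi>H: "\<phi> \<in> H1inf_nonneg T" and \<phi>T: "\<phi> T = 0" for v \<phi>
 proof -
  obtain Gw where Gw: "has_wgrad T (\<lambda>z. pw (m - 1) (v z)) Gw" "Gw \<in> Lp 2 Q" using vK unfolding K'_def L2H1_def by blast
  obtain wt where wt: "has_wdt T (\<lambda>z. pw (m - 1) (v z)) wt" "wt \<in> Lp ((m + 1) / m) Q" using vK unfolding K'_def by blast
  have w2: "(\<lambda>z. pw (m - 1) (v z)) \<in> Lp 2 Q" using vK unfolding K'_def L2H1_def by blast
  interpret V: obstacle_test T m \<psi> u \<xi> \<nu> v Gw wt
  proof
   show "v \<in> C_Lp T (m + 1)" "AE z in Q. \<psi> z \<le> v z" using vK unfolding K'_def by blast+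
   show "integrable Q (\<lambda>z. (pw (m - 1) (v z))\<^sup>2)" using w2 by (simp add: Lp_def)
   show "integrable Q (\<lambda>z. (norm (Gw z))\<^sup>2)" using Gw(2) by (simp add: Lp_def)
   show "integrable Q (\<lambda>z. abs (wt z) powr ((m + 1) / m))" using wt(2) by (simp add: Lp_def)
  qed (fact Gw(1) wt(1))+
  have \<phi>c: "continuous_on {0..T} \<phi>" and \<phi>nn: "\<And>t. t \<in> {0..T} \<Longrightarrow> 0 \<le> \<phi> t"
   using \<phi>H unfolding H1inf_nonneg_def by blast+
  obtain g0 C where g0: "has_wderiv T \<phi> g0" "AE t in time_measure T. abs (g0 t) \<le> C" using \<phi>H unfolding H1inf_nonneg_def by blast
  \<comment> \<open>A representative of the weak derivative that is bounded everywhere.\<close>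
  define g where "g t = max (- abs C) (min \<bar>C\<bar> (g0 t))" for t
  have gb: "abs (g t) \<le> abs C" for t
  proof -
   have "- abs C \<le> abs C" by linarith
   then have "- abs C \<le> g t" "g t \<le> abs C" unfolding g_def by simp_all
   then show ?thesis by linarith
  qed
  have gg0: "AE t in TM T. g t = g0 t" using g0(2) unfolding AE_TM_time 
  proof eventually_elim
   case (elim t)
   have "- abs C \<le> g0 t" "g0 t \<le> abs C" using elim by linarith+
   then show ?case unfolding g_def by (simp only: min_absorb2 max_absorb2)
  qed
  have g0m: "g0 \<in> borel_measurable (TM T)"
   using g0(1) unfolding has_wderiv_def TM_time_integrable by (elim conjE) (rule borel_measurable_integrable)
  then have gm: "g \<in> borel_measurable (TM T)" unfolding g_def[abs_def] by measurable
  have g: "has_wderiv T \<phi> g" unfolding has_wderiv_def TM_time_integrable TM_time_integral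
  proof (intro conjI allI impI)
   show "integrable (TM T) \<phi>" using g0(1) unfolding has_wderiv_def TM_time_integrable by simp
   show "integrable (TM T) g"
   proof (rule integrable_cong_AE_imp[of _ g0])
    show "integrable (TM T) g0" using g0(1) unfolding has_wderiv_def TM_time_integrable by simp
    show "AE t in TM T. g0 t = g t" using gg0 by eventually_elim simp
   qed (rule gm)
   fix y :: "real \<Rightarrow> real" assume y: "smooth y \<and> (\<exists>a b. 0 < a \<and> b < T \<and> (\<forall>t. t \<notin> {a..b} \<longrightarrow> y t = 0))"
   then have ym: "y \<in> borel_measurable (TM T)" by (intro measurable_restrict_space1) (simp add: borel_measurable_continuous_onI smooth_continuous)
   have "(LINT t|TM T. \<phi> t * deriv y t) = - (LINT t|TM T. g0 t * y t)" using g0(1) y unfolding has_wderiv_def TM_time_integral by blast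
   also have "(LINT t|TM T. g0 t * y t) = (LINT t|TM T. g t * y t)"
   proof (rule integral_cong_AE)
    show "(\<lambda>t. g0 t * y t) \<in> borel_measurable (TM T)" "(\<lambda>t. g t * y t) \<in> borel_measurable (TM T)"
     using g0m gm ym by (auto intro: borel_measurable_times)
    show "AE t in TM T. g0 t * y t = g t * y t" using gg0 by eventually_elim simp
   qed
   finally show "(LINT t|TM T. \<phi> t * deriv y t) = - (LINT t|TM T. g t * y t)" .
  qed
  have \<phi>m: "\<phi> \<in> borel_measurable (TM T)"
   using g unfolding has_wderiv_def TM_time_integrable by (elim conjE) (rule borel_measurable_integrable)
  have main: "0 \<le> (LINT z|Q. V.energy_density z * g (fst z)) + (LINT z|Q. V.flux_density z * \<phi> (fst z)) + V.initial_energy * \<phi> 0"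
   and gi: "integrable Q (\<lambda>z. V.energy_density z * g (fst z))" and \<phi>i: "\<And>h. integrable Q h \<Longrightarrow> integrable Q (\<lambda>z. h z * \<phi> (fst z))"
   by (rule V.weighted_inequality[OF \<phi>c \<phi>T \<phi>nn g gb]; assumption)+
  have ae_t: "AE z in Q. wderiv T \<phi> (fst z) = g (fst z)"
  proof -
   have "has_wderiv T \<phi> (wderiv T \<phi>)" unfolding wderiv_def by (rule someI[of "has_wderiv T \<phi>", OF g])
   from has_wderiv_unique[OF \<phi>c \<phi>T this g] show ?thesis unfolding Qpair by (rule AE_fst) (rule torus.sigma_finite_measure_axioms)
  qed
  have ae_w: "AE z in Q. wdt T (\<lambda>z. pw (m - 1) (v z)) z = wt z"
  proof -
   have "has_wdt T (\<lambda>z. pw (m - 1) (v z)) (wdt T (\<lambda>z. pw (m - 1) (v z)))"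
    unfolding wdt_def by (rule someI[of "has_wdt T (\<lambda>z. pw (m - 1) (v z))", OF wt(1)])
   from has_wdt_unique[OF this wt(1)] show ?thesis .
  qed
  have wderiv_m: "(\<lambda>z. wderiv T \<phi> (fst z)) \<in> borel_measurable Q"
  proof -
   have "has_wderiv T \<phi> (wderiv T \<phi>)" unfolding wderiv_def by (rule someI[of "has_wderiv T \<phi>", OF g])
   then have "wderiv T \<phi> \<in> borel_measurable (TM T)"
    unfolding has_wderiv_def TM_time_integrable by (elim conjE) (rule borel_measurable_integrable)
   then show ?thesis unfolding Qpair by (rule measurable_compose[OF measurable_fst])
  qed
  have \<phi>Q: "(\<lambda>z. \<phi> (fst z)) \<in> borel_measurable Q" unfolding Qpair by (rule measurable_compose[OF measurable_fst \<phi>m])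
  have wdt_m: "wdt T (\<lambda>z. pw (m - 1) (v z)) \<in> borel_measurable Q"
  proof -
   have "has_wdt T (\<lambda>z. pw (m - 1) (v z)) (wdt T (\<lambda>z. pw (m - 1) (v z)))"
    unfolding wdt_def by (rule someI[of "has_wdt T (\<lambda>z. pw (m - 1) (v z))", OF wt(1)])
   then show ?thesis unfolding has_wdt_def by (elim conjE) (rule borel_measurable_integrable)
  qed
  have pairing: "dt_pairing T m \<xi> u v \<phi> = (LINT z|Q. V.energy_density z * g (fst z)) - (LINT z|Q. (u z * wt z) * \<phi> (fst z)) + V.initial_energy * \<phi> 0"
  proof -
   let ?F = "\<lambda>z. wderiv T \<phi> (fst z) * (1 / (m + 1) * abs (u z) powr (m + 1) - u z * pw (m - 1) (v z)) - \<phi> (fst z) * u z * wdt T (\<lambda>z. pw (m - 1) (v z)) z"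
   have "(LINT z|Q. ?F z) = (LINT z|Q. V.energy_density z * g (fst z) - (u z * wt z) * \<phi> (fst z))"
   proof (rule integral_cong_AE)
    show "?F \<in> borel_measurable Q" using wderiv_m \<phi>Q wdt_m V.w_meas[unfolded V.w_def[abs_def]] u_meas by measurable
    show "(\<lambda>z. V.energy_density z * g (fst z) - (u z * wt z) * \<phi> (fst z)) \<in> borel_measurable Q"
     using gi \<phi>i[OF V.uwt_int] by simp
    show "AE z in Q. ?F z = V.energy_density z * g (fst z) - (u z * wt z) * \<phi> (fst z)"
     using ae_t ae_w by eventually_elim (simp add: V.energy_density_def V.w_def Phi_def mult.commute)
   qed
   also have "\<dots> = (LINT z|Q. V.energy_density z * g (fst z)) - (LINT z|Q. (u z * wt z) * \<phi> (fst z))"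
    by (rule B_integral_diff[OF gi \<phi>i[OF V.uwt_int]])
   finally have 1: "(LINT z|Q. ?F z) = (LINT z|Q. V.energy_density z * g (fst z)) - (LINT z|Q. (u z * wt z) * \<phi> (fst z))" .
   have 2: "(LINT x|X. \<phi> 0 * (1 / (m + 1) * \<bar>\<xi> x\<bar> powr (m + 1) - \<xi> x * pw (m - 1) (v (0, x)))) = V.initial_energy * \<phi> 0"
    unfolding V.initial_energy_def V.w_def Phi_def integral_mult_right_zero by (simp add: mult.commute)
   have 3: "(\<lambda>(t, x). wderiv T \<phi> t * (1 / (m + 1) * abs (u (t, x)) powr (m + 1) - u (t, x) * pw (m - 1) (v (t, x)))
     - \<phi> t * u (t, x) * wdt T (\<lambda>z. pw (m - 1) (v z)) (t, x)) = ?F" by (auto simp: fun_eq_iff)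
   show ?thesis unfolding dt_pairing_def 2 3 1 ..
  qed
  define D where "D z = \<phi> (fst z) *\<^sub>R (Gw z - H z)" for z
  have D_wgrad: "has_wgrad T (\<lambda>(t, x). (pw (m - 1) (v (t, x)) - pw (m - 1) (u (t, x))) * \<phi> t) D" unfolding has_wgrad_def
  proof (intro conjI)
   show "D \<in> borel_measurable Q" unfolding D_def[abs_def] using \<phi>Q by measurable
   have "AE t in time_measure T. has_torus_wgrad (\<lambda>x. pw (m - 1) (v (t, x))) (\<lambda>x. Gw (t, x))"
    "AE t in time_measure T. has_torus_wgrad (\<lambda>x. U (t, x)) (\<lambda>x. H (t, x))" using Gw(1) U_wgrad unfolding has_wgrad_def by simp_all
   then show "AE t in time_measure T. has_torus_wgrad (\<lambda>x. (\<lambda>(t, x). (pw (m - 1) (v (t, x)) - pw (m - 1) (u (t, x))) * \<phi> t) (t, x)) (\<lambda>x. D (t, x))"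
   proof eventually_elim
    case (elim t)
    then show ?case unfolding D_def case_prod_conv fst_conv U_def by (rule has_torus_wgrad_diff_scaled)
   qed
  qed
  have flux: "(LINT z|Q. wgrad T U z \<bullet> wgrad T (\<lambda>(t, x). (pw (m - 1) (v (t, x)) - pw (m - 1) (u (t, x))) * \<phi> t) z)
    = (LINT z|Q. V.flux_density z * \<phi> (fst z)) + (LINT z|Q. (u z * wt z) * \<phi> (fst z))"
  proof -
   let ?L = "\<lambda>z. wgrad T U z \<bullet> wgrad T (\<lambda>(t, x). (pw (m - 1) (v (t, x)) - pw (m - 1) (u (t, x))) * \<phi> t) z"
   have gm': "wgrad T U \<in> borel_measurable Q" using has_wgrad_wgrad[OF U_wgrad] unfolding has_wgrad_def by simp
   have dm': "wgrad T (\<lambda>(t, x). (pw (m - 1) (v (t, x)) - pw (m - 1) (u (t, x))) * \<phi> t) \<in> borel_measurable Q"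
    using has_wgrad_wgrad[OF D_wgrad] unfolding has_wgrad_def by simp
   have "(LINT z|Q. ?L z) = (LINT z|Q. V.flux_density z * \<phi> (fst z) + (u z * wt z) * \<phi> (fst z))"
   proof (rule integral_cong_AE)
    show "?L \<in> borel_measurable Q" using gm' dm' by (rule borel_measurable_inner)
    show "(\<lambda>z. V.flux_density z * \<phi> (fst z) + (u z * wt z) * \<phi> (fst z)) \<in> borel_measurable Q"
     using \<phi>i[OF V.flux_density_int] \<phi>i[OF V.uwt_int] by simp
    show "AE z in Q. ?L z = V.flux_density z * \<phi> (fst z) + (u z * wt z) * \<phi> (fst z)" using wgrad_AE[OF T0 U_wgrad] wgrad_AE[OF T0 D_wgrad]
    proof eventually_elim
     case (elim z)
     have "H z \<bullet> D z = (H z \<bullet> Gw z - (norm (H z))\<^sup>2) * \<phi> (fst z)"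
      by (simp add: D_def inner_diff_right power2_norm_eq_inner mult.commute)
     also have "\<dots> = V.flux_density z * \<phi> (fst z) + (u z * wt z) * \<phi> (fst z)"
      unfolding distrib_right[symmetric] by (simp add: V.flux_density_def)
     finally show ?case unfolding elim(1) elim(2) .
    qed
   qed
   also have "\<dots> = (LINT z|Q. V.flux_density z * \<phi> (fst z)) + (LINT z|Q. (u z * wt z) * \<phi> (fst z))"
    by (rule B_integral_add[OF \<phi>i[OF V.flux_density_int] \<phi>i[OF V.uwt_int]])
   finally show ?thesis .
  qed
  show ?thesis unfolding pairing flux using main by linarith
 qed
 show ?thesis unfolding U_eq using U_L2H1 ineq by blast
qed

end
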